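(* Let $C_1,\dots,C_m$ be open convex cones of $\mathbb{R}^n$ such that $\mathbb{R}^n=\bigcup_{j=1}^m C_j^\ast$. Then every $f\in\mathcal{D}'_{E'_\ast}$ admits the boundary value representation $$f=\sum_{j=1}^m\ \lim_{y\to0,\ y\in C_j}F_j(\,\cdot\,+iy)\qquad\text{strongly in }\mathcal{D}'_{E'_\ast},$$ where each $F_j$ is holomorphic in the tube $T^{C_j}$.
   Context: Throughout, $E$ is a translation-invariant Banach space of tempered distributions on $\mathbb{R}^n$, i.e. a Banach space such that: (a) $\mathcal{S}(\mathbb{R}^n)\hookrightarrow E\hookrightarrow\mathcal{S}'(\mathbb{R}^n)$ with continuous dense inclusions; (b) $T_h(E)=E$ for all $h\in\mathbb{R}^n$, where $(T_hg)(x)=g(x+h)$; (c) there are $M'>0$, $\tau\ge0$ with $\omega(h):=\|T_{-h}\|_{L(E)}\le M'(1+|h|)^{\tau}$ for all $h\in\mathbb{R}^n$. $\mathcal{D}_E$ is the Fréchet space of all $\varphi\in E$ with $\varphi^{(\alpha)}\in E$ for all $\alpha\in\mathbb{N}^n$, topologized by the norms $\max_{|\alpha|\le N}\|\varphi^{(\alpha)}\|_E$, $N\in\mathbb{N}$. $\mathcal{D}'_{E'_\ast}$ denotes the strong dual of $\mathcal{D}_E$; since $\mathcal{S}(\mathbb{R}^n)$ is dense in $\mathcal{D}_E$, it is continuously included in $\mathcal{S}'(\mathbb{R}^n)$. Cones have vertex at the origin. For an open cone $C$, $T^C=\mathbb{R}^n+iC\subseteq\mathbb{C}^n$ and $C^\ast=\{\xi\in\mathbb{R}^n: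 y\cdot\xi\ge0\ \forall y\in C\}$. *)

theory Defs
  imports "HOL-Analysis.Analysis"
begin

section \<open>Locally convex spaces of complex-valued functions\<close>

text \<open>
  All vector spaces below (test functions, distributions, functionals on spaces of distributions)
  are sets \<open>V\<close> of complex-valued functions with the pointwise operations, topologized by a set
  \<open>P\<close> of seminorms. Functionals on \<open>V\<close> are taken to be \<open>0\<close> outside \<open>V\<close>, so that
  equality of functionals is equality of functions.
\<close>

definition complex_subspace :: "('a \<Rightarrow> complex) set \<Rightarrow> bool" where
  "complex_subspace V \<longleftrightarrow>
     (\<lambda>x. 0) \<in> V \<and>
     (\<forall>u\<in>V. \<forall>v\<in>V. (\<lambda>x. u x + v x) \<in> V) \<and>
     (\<forall>c. \<forall>u\<in>V. (\<lambda>x. c * u x) \<in> V)"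

definition seminorm_topology ::
    "('a \<Rightarrow> complex) set \<Rightarrow> (('a \<Rightarrow> complex) \<Rightarrow> real) set \<Rightarrow> ('a \<Rightarrow> complex) topology" where
  "seminorm_topology V P = topology (\<lambda>U. U \<subseteq> V \<and>
     (\<forall>u\<in>U. \<exists>Q e. finite Q \<and> Q \<subseteq> P \<and> 0 < e \<and> {v\<in>V. \<forall>q\<in>Q. q (\<lambda>x. v x - u x) < e} \<subseteq> U))"

lemma openin_seminorm_topology:
  "openin (seminorm_topology V P) U \<longleftrightarrow> U \<subseteq> V \<and>
     (\<forall>u\<in>U. \<exists>Q e. finite Q \<and> Q \<subseteq> P \<and> 0 < e \<and> {v\<in>V. \<forall>q\<in>Q. q (\<lambda>x. v x - u x) < e} \<subseteq> U)"
proof -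
  let ?N = "\<lambda>u Q e. {v\<in>V. \<forall>q\<in>Q. q (\<lambda>x. v x - u x) < (e::real)}"
  define L where "L = (\<lambda>U. U \<subseteq> V \<and>
     (\<forall>u\<in>U. \<exists>Q e. finite Q \<and> Q \<subseteq> P \<and> 0 < e \<and> ?N u Q e \<subseteq> U))"
  have sub: "U \<subseteq> V" if "L U" for U
    using that unfolding L_def by (rule conjunct1)
  have nbhd: "\<exists>Q e. finite Q \<and> Q \<subseteq> P \<and> 0 < e \<and> ?N u Q e \<subseteq> U" if "L U" "u \<in> U" for U u
    using that(1) unfolding L_def by (rule conjunct2[THEN bspec, OF _ that(2)])
  have LI: "L U" if "U \<subseteq> V"
      "\<And>u. u \<in> U \<Longrightarrow> \<exists>Q e. finite Q \<and> Q \<subseteq> P \<and> 0 < e \<and> ?N u Q e \<subseteq> U" for U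
    unfolding L_def by (rule conjI, fact that(1), rule ballI, rule that(2))
  have inter: "L (S \<inter> T)" if S: "L S" and T: "L T" for S T
  proof (rule LI)
    show "S \<inter> T \<subseteq> V" using sub[OF S] by blast
    fix u assume u: "u \<in> S \<inter> T"
    obtain Q e where Q: "finite Q" "Q \<subseteq> P" "0 < e" "?N u Q e \<subseteq> S"
      using nbhd[OF S IntD1[OF u]] by (elim exE conjE)
    obtain R d where R: "finite R" "R \<subseteq> P" "0 < d" "?N u R d \<subseteq> T"
      using nbhd[OF T IntD2[OF u]] by (elim exE conjE)
    have "?N u (Q \<union> R) (min e d) \<subseteq> ?N u Q e"
      by (intro Collect_mono impI conjI ballI) (elim conjE, assumption, simp)
    moreover have "?N u (Q \<union> R) (min e d) \<subseteq> ?N u R d"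
      by (intro Collect_mono impI conjI ballI) (elim conjE, assumption, simp)
    ultimately have "?N u (Q \<union> R) (min e d) \<subseteq> S \<inter> T"
      by (intro Int_greatest subset_trans[OF _ Q(4)] subset_trans[OF _ R(4)])
    moreover have "finite (Q \<union> R)" "Q \<union> R \<subseteq> P" "0 < min e d"
      using Q(1-3) R(1-3) by simp_all
    ultimately show "\<exists>Q e. finite Q \<and> Q \<subseteq> P \<and> 0 < e \<and> ?N u Q e \<subseteq> S \<inter> T"
      by (intro exI conjI)
  qed
  have union: "L (\<Union>K)" if K: "\<forall>S\<in>K. L S" for K
  proof (rule LI)
    show "\<Union>K \<subseteq> V" using K sub by blast
    fix u assume "u \<in> \<Union>K"
    then obtain S where S: "S \<in> K" "u \<in> S" by blast
    obtain Q e where Q: "finite Q" "Q \<subseteq> P" "0 < e" "?N u Q e \<subseteq> S"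
      using nbhd[OF bspec[OF K S(1)] S(2)] by (elim exE conjE)
    then show "\<exists>Q e. finite Q \<and> Q \<subseteq> P \<and> 0 < e \<and> ?N u Q e \<subseteq> \<Union>K"
      by (intro exI conjI) (assumption+, rule subset_trans[OF Q(4) Union_upper[OF S(1)]])
  qed
  have "istopology L"
    unfolding istopology_def using inter union by blast
  then have "openin (topology L) = L"
    by (rule topology_inverse')
  then have "openin (topology L) U \<longleftrightarrow> L U"
    by (rule fun_cong)
  then show ?thesis
    unfolding seminorm_topology_def L_def .
qed

lemma topspace_seminorm_topology [simp]: "topspace (seminorm_topology V P) = V"
proof -
  have "openin (seminorm_topology V P) V"
    unfolding openin_seminorm_topology
  proof (intro conjI ballI)
    fix u assume "u \<in> V"
    show "\<exists>Q e. finite Q \<and> Q \<subseteq> P \<and> (0::real) < e \<and> {v\<in>V. \<forall>q\<in>Q. q (\<lambda>x. v x - u x) < e} \<subseteq> V"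
      by (rule exI[of _ "{}"], rule exI[of _ 1]) simp
  qed simp
  then have "V \<subseteq> topspace (seminorm_topology V P)"
    by (rule openin_subset)
  moreover have "topspace (seminorm_topology V P) \<subseteq> V"
    by (rule iffD1[OF openin_seminorm_topology openin_topspace, THEN conjunct1])
  ultimately show ?thesis
    by (rule subset_antisym[rotated])
qed

definition bounded_sets ::
    "('a \<Rightarrow> complex) set \<Rightarrow> (('a \<Rightarrow> complex) \<Rightarrow> real) set \<Rightarrow> ('a \<Rightarrow> complex) set set" where
  "bounded_sets V P = {B. B \<subseteq> V \<and> (\<forall>p\<in>P. bdd_above (p ` B))}"

definition continuous_dual ::
    "('a \<Rightarrow> complex) set \<Rightarrow> (('a \<Rightarrow> complex) \<Rightarrow> real) set \<Rightarrow> (('a \<Rightarrow> complex) \<Rightarrow> complex) set" where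
  "continuous_dual V P = {f.
     (\<forall>u\<in>V. \<forall>v\<in>V. f (\<lambda>x. u x + v x) = f u + f v) \<and>
     (\<forall>c. \<forall>u\<in>V. f (\<lambda>x. c * u x) = c * f u) \<and>
     continuous_map (seminorm_topology V P) euclidean f \<and>
     (\<forall>u. u \<notin> V \<longrightarrow> f u = 0)}"

definition strong_seminorms ::
    "('a \<Rightarrow> complex) set \<Rightarrow> (('a \<Rightarrow> complex) \<Rightarrow> real) set \<Rightarrow> ((('a \<Rightarrow> complex) \<Rightarrow> complex) \<Rightarrow> real) set" where
  "strong_seminorms V P =
     {(\<lambda>f. SUP u\<in>B. cmod (f u)) | B. B \<in> bounded_sets V P \<and> B \<noteq> {}}"

definition strong_dual_topology ::
    "('a \<Rightarrow> complex) set \<Rightarrow> (('a \<Rightarrow> complex) \<Rightarrow> real) set \<Rightarrow> (('a \<Rightarrow> complex) \<Rightarrow> complex) topology" where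
  "strong_dual_topology V P = seminorm_topology (continuous_dual V P) (strong_seminorms V P)"


section \<open>Rapidly decreasing functions and tempered distributions\<close>

definition partial :: "'n::finite \<Rightarrow> (real^'n \<Rightarrow> complex) \<Rightarrow> (real^'n \<Rightarrow> complex)" where
  "partial i \<phi> = (\<lambda>x. frechet_derivative \<phi> (at x) (axis i 1))"

text \<open>
  A multi-index \<open>\<alpha>\<close> is represented by a list of coordinate directions in which each \<open>i\<close>
  occurs \<open>\<alpha> i\<close> times; its length is the order of the derivative. Mixed partial derivatives of smooth
  functions commute, so the order of the list is immaterial. In the definition of smoothness,
  differentiability of all iterated partial derivatives also gives their continuity.
\<close>

definition partials :: "'n::finite list \<Rightarrow> (real^'n \<Rightarrow> complex) \<Rightarrow> (real^'n \<Rightarrow> complex)" where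
  "partials is \<phi> = foldr partial is \<phi>"

definition smooth :: "(real^'n::finite \<Rightarrow> complex) \<Rightarrow> bool" where
  "smooth \<phi> \<longleftrightarrow> (\<forall>is x. partials is \<phi> differentiable (at x))"

definition schwartz_space :: "(real^'n::finite \<Rightarrow> complex) set" where
  "schwartz_space = {\<phi>. smooth \<phi> \<and>
     (\<forall>k is. bdd_above (range (\<lambda>x. (1 + norm x) ^ k * cmod (partials is \<phi> x))))}"

definition schwartz_seminorms :: "((real^'n::finite \<Rightarrow> complex) \<Rightarrow> real) set" where
  "schwartz_seminorms =
     {(\<lambda>\<phi>. SUP x. (1 + norm x) ^ k * cmod (partials is \<phi> x)) | k is. True}"

definition tempered_distributions :: "((real^'n::finite \<Rightarrow> complex) \<Rightarrow> complex) set" where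
  "tempered_distributions = continuous_dual schwartz_space schwartz_seminorms"

abbreviation schwartz_topology :: "(real^'n::finite \<Rightarrow> complex) topology" where
  "schwartz_topology \<equiv> seminorm_topology schwartz_space schwartz_seminorms"

abbreviation tempered_topology :: "((real^'n::finite \<Rightarrow> complex) \<Rightarrow> complex) topology" where
  "tempered_topology \<equiv> strong_dual_topology schwartz_space schwartz_seminorms"

text \<open>The distribution given by a function; for a rapidly decreasing \<open>u\<close> all integrals converge.\<close>

definition regular_distribution ::
    "(real^'n::finite \<Rightarrow> complex) \<Rightarrow> (real^'n \<Rightarrow> complex) \<Rightarrow> complex" where
  "regular_distribution u =
     (\<lambda>\<phi>. if \<phi> \<in> schwartz_space then (LINT x|lborel. u x * \<phi> x) else 0)"

definition dist_partial ::
    "'n::finite \<Rightarrow> ((real^'n \<Rightarrow> complex) \<Rightarrow> complex) \<Rightarrow> ((real^'n \<Rightarrow> complex) \<Rightarrow> complex)" where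
  "dist_partial i u = (\<lambda>\<phi>. if \<phi> \<in> schwartz_space then - u (partial i \<phi>) else 0)"

definition dist_partials ::
    "'n::finite list \<Rightarrow> ((real^'n \<Rightarrow> complex) \<Rightarrow> complex) \<Rightarrow> ((real^'n \<Rightarrow> complex) \<Rightarrow> complex)" where
  "dist_partials is u = foldr dist_partial is u"

text \<open>\<open>(T\<^sub>h g)(x) = g(x + h)\<close>, extended to distributions by duality.\<close>

definition dist_translate ::
    "real^'n::finite \<Rightarrow> ((real^'n \<Rightarrow> complex) \<Rightarrow> complex) \<Rightarrow> ((real^'n \<Rightarrow> complex) \<Rightarrow> complex)" where
  "dist_translate h u = (\<lambda>\<phi>. u (\<lambda>x. \<phi> (x - h)))"


section \<open>Translation-invariant Banach spaces of tempered distributions\<close>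

definition bounded_operator :: "'b set \<Rightarrow> ('b \<Rightarrow> real) \<Rightarrow> ('b \<Rightarrow> 'b) \<Rightarrow> bool" where
  "bounded_operator E nE A \<longleftrightarrow> A ` E \<subseteq> E \<and> (\<exists>K\<ge>0. \<forall>u\<in>E. nE (A u) \<le> K * nE u)"

definition operator_norm :: "'b set \<Rightarrow> ('b \<Rightarrow> real) \<Rightarrow> ('b \<Rightarrow> 'b) \<Rightarrow> real" where
  "operator_norm E nE A = Inf {K. 0 \<le> K \<and> (\<forall>u\<in>E. nE (A u) \<le> K * nE u)}"

locale translation_invariant_banach_space =
  fixes E :: "((real^'n::finite \<Rightarrow> complex) \<Rightarrow> complex) set"
    and nE :: "((real^'n \<Rightarrow> complex) \<Rightarrow> complex) \<Rightarrow> real"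
  assumes subset_tempered: "E \<subseteq> tempered_distributions"
    and subspace: "complex_subspace E"
    and norm_nonneg: "u \<in> E \<Longrightarrow> 0 \<le> nE u"
    and norm_eq_0_iff: "u \<in> E \<Longrightarrow> nE u = 0 \<longleftrightarrow> u = (\<lambda>\<phi>. 0)"
    and norm_scale: "u \<in> E \<Longrightarrow> nE (\<lambda>\<phi>. c * u \<phi>) = cmod c * nE u"
    and norm_triangle: "u \<in> E \<Longrightarrow> v \<in> E \<Longrightarrow> nE (\<lambda>\<phi>. u \<phi> + v \<phi>) \<le> nE u + nE v"
    and complete:
      "(\<And>k::nat. X k \<in> E) \<Longrightarrow>
       (\<And>e. 0 < e \<Longrightarrow> \<exists>N. \<forall>k\<ge>N. \<forall>l\<ge>N. nE (\<lambda>\<phi>. X k \<phi> - X l \<phi>) < e) \<Longrightarrow>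
       \<exists>u\<in>E. (\<lambda>k. nE (\<lambda>\<phi>. X k \<phi> - u \<phi>)) \<longlonglongrightarrow> 0"
    and schwartz_continuous:
      "continuous_map schwartz_topology (seminorm_topology E {nE}) regular_distribution"
    and schwartz_dense:
      "seminorm_topology E {nE} closure_of (regular_distribution ` schwartz_space) = E"
    and tempered_continuous:
      "continuous_map (seminorm_topology E {nE}) tempered_topology id"
    and tempered_dense: "tempered_topology closure_of E = tempered_distributions"
    and translation_invariant: "dist_translate h ` E = E"
    and translation_growth:
      "\<exists>M>0. \<exists>\<tau>\<ge>0. \<forall>h. bounded_operator E nE (dist_translate (- h)) \<and>
         operator_norm E nE (dist_translate (- h)) \<le> M * (1 + norm h) powr \<tau>"

definition DE_space ::
    "((real^'n::finite \<Rightarrow> complex) \<Rightarrow> complex) set \<Rightarrow> ((real^'n \<Rightarrow> complex) \<Rightarrow> complex) set" where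
  "DE_space E = {u \<in> E. \<forall>is. dist_partials is u \<in> E}"

definition DE_seminorms ::
    "(((real^'n::finite \<Rightarrow> complex) \<Rightarrow> complex) \<Rightarrow> real) \<Rightarrow>
     (((real^'n \<Rightarrow> complex) \<Rightarrow> complex) \<Rightarrow> real) set" where
  "DE_seminorms nE = {(\<lambda>u. MAX is\<in>{is. length is \<le> N}. nE (dist_partials is u)) | N. True}"

definition DE_dual ::
    "((real^'n::finite \<Rightarrow> complex) \<Rightarrow> complex) set \<Rightarrow> (((real^'n \<Rightarrow> complex) \<Rightarrow> complex) \<Rightarrow> real) \<Rightarrow>
     (((real^'n \<Rightarrow> complex) \<Rightarrow> complex) \<Rightarrow> complex) set" where
  "DE_dual E nE = continuous_dual (DE_space E) (DE_seminorms nE)"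

definition DE_dual_topology ::
    "((real^'n::finite \<Rightarrow> complex) \<Rightarrow> complex) set \<Rightarrow> (((real^'n \<Rightarrow> complex) \<Rightarrow> complex) \<Rightarrow> real) \<Rightarrow>
     (((real^'n \<Rightarrow> complex) \<Rightarrow> complex) \<Rightarrow> complex) topology" where
  "DE_dual_topology E nE = strong_dual_topology (DE_space E) (DE_seminorms nE)"

text \<open>
  Since the rapidly decreasing functions are dense in \<open>DE_space E\<close>, an element \<open>g\<close> of the dual is
  determined by the tempered distribution \<open>\<phi> \<mapsto> g \<phi>\<close>. The function \<open>u\<close> is identified with
  \<open>g\<close> if it defines that distribution.
\<close>

definition represents ::
    "(real^'n::finite \<Rightarrow> complex) \<Rightarrow> (((real^'n \<Rightarrow> complex) \<Rightarrow> complex) \<Rightarrow> complex) \<Rightarrow> bool" where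
  "represents u g \<longleftrightarrow> (\<forall>\<phi>\<in>schwartz_space.
     integrable lborel (\<lambda>x. u x * \<phi> x) \<and>
     g (regular_distribution \<phi>) = (LINT x|lborel. u x * \<phi> x))"


section \<open>Tubes over cones and boundary values\<close>

text \<open>
  The library predicates \<open>cone\<close> and \<open>conic\<close> force a nonempty cone to contain its vertex, which
  an open cone does only if it is the whole space.
\<close>

definition open_convex_cone :: "(real^'n::finite) set \<Rightarrow> bool" where
  "open_convex_cone C \<longleftrightarrow>
     C \<noteq> {} \<and> open C \<and> convex C \<and> (\<forall>y\<in>C. \<forall>t>0. t *\<^sub>R y \<in> C)"

definition dual_cone :: "(real^'n::finite) set \<Rightarrow> (real^'n) set" where
  "dual_cone C = {\<xi>. \<forall>y\<in>C. 0 \<le> y \<bullet> \<xi>}"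

definition complex_vec :: "real^'n::finite \<Rightarrow> real^'n \<Rightarrow> complex^'n" where
  "complex_vec x y = (\<chi> k. Complex (x $ k) (y $ k))"

definition tube :: "(real^'n::finite) set \<Rightarrow> (complex^'n) set" where
  "tube C = {complex_vec x y | x y. y \<in> C}"

definition holomorphic_in :: "(complex^'n::finite \<Rightarrow> complex) \<Rightarrow> (complex^'n) set \<Rightarrow> bool" where
  "holomorphic_in F U \<longleftrightarrow>
     (\<forall>z\<in>U. \<exists>D. (F has_derivative D) (at z) \<and> (\<forall>c v. D (c *s v) = c * D v))"

text \<open>The functions \<open>F(\<cdot> + iy)\<close>, \<open>y \<in> C\<close>, lie in the dual and converge strongly to \<open>L\<close>.\<close>

definition boundary_value ::
    "((real^'n::finite \<Rightarrow> complex) \<Rightarrow> complex) set \<Rightarrow> (((real^'n \<Rightarrow> complex) \<Rightarrow> complex) \<Rightarrow> real) \<Rightarrow>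
     (real^'n) set \<Rightarrow> (complex^'n \<Rightarrow> complex) \<Rightarrow>
     (((real^'n \<Rightarrow> complex) \<Rightarrow> complex) \<Rightarrow> complex) \<Rightarrow> bool" where
  "boundary_value E nE C F L \<longleftrightarrow>
     (\<exists>G. (\<forall>y\<in>C. G y \<in> DE_dual E nE \<and> represents (\<lambda>x. F (complex_vec x y)) (G y)) \<and>
          limitin (DE_dual_topology E nE) G L (at 0 within C))"

end

(*
Let psi(z) = exp(-z.z/2) and let T_s denote translation. The Gaussian transform
Phi(z) = <f, psi(z - .)> of f is entire and grows like exp(|Im z|^2/2) in imaginary directions.
Partition R^n into Borel sets A_j contained in the dual cones of the C_j and put
  F_j(z) = (2 pi)^-n * integral over A_j of exp(-|xi|^2/2) Phi(z - i xi) dxi.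
For z = x + iy the integrand is the Fourier transform of psi(s + iy) <f, T_s .> damped by
exp(-y.xi), where y.xi >= 0 on A_j. In other words, f is convolved with the kernel whose symbol is the
indicator of A_j mollified by a Gaussian: the kernel decays rapidly, which is what makes polynomially
growing translations harmless, and no regularity of the partition is needed.
Since s |-> <f, T_s u> is smooth with polynomially bounded derivatives for u in D_E, integration by
parts makes the integrand O((1 + |xi|)^-N) uniformly for y near 0 and for u in bounded sets, so the
limits y -> 0 exist strongly by dominated convergence. Their sum is the integral over all of R^n, and
Fourier inversion at s = 0 gives psi(0) <f, u> = <f, u>.
*)

theory Submission
  imports Defs "HOL-Probability.Characteristic_Functions" "HOL-Probability.Sinc_Integral"
    "HOL-Computational_Algebra.Polynomial"
begin

section \<open>Integration over Euclidean space\<close>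

text \<open>The integral over \<xi> has to converge in two regimes, by different mechanisms. For y
  inside C_j the bound y.\<xi> \<ge> \<rho> |\<xi>| on A_j gives exponential damping and hence
  holomorphy, but \<rho> shrinks to 0 at the boundary. As y -> 0 only integration by parts in s
  remains. It trades 2n powers of |\<xi>| for 2n further derivatives of u, so every boundary
  estimate ends in one seminorm of D_E, and a bound by one such seminorm is uniform on bounded sets.
  This is why limits are taken of functionals acting on u and not of the functions F_j(. + iy). Two
  facts carry the analytic weight. First, differentiability of s -> <f, T_s u> rests on convergence
  of difference quotients in the norm of E, whereas the derivatives of u are given only in the sense
  of distributions; completeness of E closes this gap through Riemann sums. Second, F_j(. + iy) is
  built from f acting on Gaussians, and to recognise it as a functional on D_E, f must commute with
  a convolution integral; there Riemann sums converge in Schwartz seminorms.\<close>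

lemma
  fixes f :: "'a::euclidean_space \<Rightarrow> 'b::{banach, second_countable_topology}"
  assumes c: "c \<noteq> 0"
  shows integrable_lborel_affine: "integrable lborel f \<Longrightarrow> integrable lborel (\<lambda>x. f (t + c *\<^sub>R x))"
    and integral_lborel_affine: "f \<in> borel_measurable borel \<Longrightarrow>
      (LINT x|lborel. f x) = \<bar>c\<bar> ^ DIM('a) *\<^sub>R (LINT x|lborel. f (t + c *\<^sub>R x))"
proof -
  have eq: "lborel = density (distr lborel borel (\<lambda>x. t + c *\<^sub>R x)) (\<lambda>_. ennreal (\<bar>c\<bar> ^ DIM('a)))"
    using lborel_affine[OF c, of t] by (simp add: ennreal_power)
  show "integrable lborel (\<lambda>x. f (t + c *\<^sub>R x))" if f: "integrable lborel f"
  proof -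
    have [measurable]: "f \<in> borel_measurable borel"
      using f borel_measurable_integrable by fastforce
    have "integrable (density (distr lborel borel (\<lambda>x. t + c *\<^sub>R x)) (\<lambda>_. ennreal (\<bar>c\<bar> ^ DIM('a)))) f"
      using f eq by simp
    then have "integrable lborel (\<lambda>x. \<bar>c\<bar> ^ DIM('a) *\<^sub>R f (t + c *\<^sub>R x))"
      by (subst (asm) integrable_density) (auto simp: integrable_distr_eq)
    then have "integrable lborel (\<lambda>x. inverse (\<bar>c\<bar> ^ DIM('a)) *\<^sub>R \<bar>c\<bar> ^ DIM('a) *\<^sub>R f (t + c *\<^sub>R x))"
      by (rule integrable_scaleR_right)
    then show ?thesis
      using c by simp
  qed
  show "(LINT x|lborel. f x) = \<bar>c\<bar> ^ DIM('a) *\<^sub>R (LINT x|lborel. f (t + c *\<^sub>R x))"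
    if [measurable]: "f \<in> borel_measurable borel"
    by (subst eq, subst integral_density) (auto simp: integral_distr)
qed

lemma
  fixes f :: "'n::finite \<Rightarrow> real \<Rightarrow> 'b::{real_normed_field,banach,second_countable_topology}"
  assumes f: "\<And>k. integrable lborel (f k)"
  shows integrable_lborel_vec_prod: "integrable lborel (\<lambda>x::real^'n. \<Prod>k\<in>UNIV. f k (x $ k))"
    and integral_lborel_vec_prod:
      "(LINT x|lborel. (\<Prod>k\<in>UNIV. f k ((x::real^'n) $ k))) = (\<Prod>k\<in>UNIV. (LINT t|lborel. f k t))"
proof -
  \<comment> \<open>The product measure is indexed by basis vectors, the factors \<open>f\<close> by
    coordinates; \<open>ix\<close> inverts the map from \<open>k\<close> to \<open>axis k 1\<close>
    so that both index the same product.\<close>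
  define ix where "ix b = (THE k. b = axis k (1::real))" for b :: "real^'n"
  have ix: "ix (axis k 1) = k" for k
    by (auto simp: ix_def axis_eq_axis)
  have B: "(Basis::(real^'n) set) = (\<lambda>k. axis k 1) ` UNIV"
    by (auto simp: Basis_vec_def)
  have inj: "inj (\<lambda>k::'n. axis k (1::real))"
    by (auto simp: inj_def axis_eq_axis)
  interpret product_sigma_finite "\<lambda>b::real^'n. lborel::real measure" by standard
  let ?T = "\<lambda>g::real^'n\<Rightarrow>real. \<Sum>b\<in>Basis. g b *\<^sub>R b"
  let ?P = "(\<Pi>\<^sub>M b\<in>(Basis::(real^'n) set). (lborel::real measure))"
  have comp: "?T g $ k = g (axis k 1)" for g k
  proof -
    have "?T g $ k = (\<Sum>j\<in>UNIV. g (axis j 1) * axis j 1 $ k)"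
      by (simp add: B sum.reindex[OF inj])
    also have "\<dots> = (\<Sum>j\<in>UNIV. if j = k then g (axis j 1) else 0)"
      by (intro sum.cong) (auto simp: axis_def)
    finally show ?thesis by simp
  qed
  have prod_eq: "(\<Prod>k\<in>UNIV. f k (?T g $ k)) = (\<Prod>b\<in>Basis. f (ix b) (g b))" for g
    unfolding comp by (simp add: B prod.reindex[OF inj] ix)
  have 1: "integrable ?P (\<lambda>g. \<Prod>b\<in>Basis. f (ix b) (g b))"
    by (rule product_integrable_prod) (auto intro: f)
  have 2: "(LINT g|?P. (\<Prod>b\<in>Basis. f (ix b) (g b))) = (\<Prod>b\<in>Basis. (LINT t|lborel. f (ix b) t))"
    by (rule product_integral_prod) (auto intro: f)
  have T[measurable]: "?T \<in> measurable ?P borel"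
    by measurable
  have [measurable]: "f k \<in> borel_measurable borel" for k
    using f[of k] borel_measurable_integrable by fastforce
  have m: "(\<lambda>x::real^'n. \<Prod>k\<in>UNIV. f k (x $ k)) \<in> borel_measurable borel"
    by measurable
  show "integrable lborel (\<lambda>x::real^'n. \<Prod>k\<in>UNIV. f k (x $ k))"
    apply (subst lborel_eq, subst integrable_distr_eq[OF T m])
    unfolding prod_eq by (rule 1)
  show "(LINT x|lborel. (\<Prod>k\<in>UNIV. f k ((x::real^'n) $ k))) = (\<Prod>k\<in>UNIV. (LINT t|lborel. f k t))"
    apply (subst lborel_eq, subst integral_distr[OF T m])
    unfolding prod_eq 2 by (simp add: B prod.reindex[OF inj] ix)
qed

section \<open>An integrable polynomial weight\<close>

lemma integrable_lborel_inverse_1_plus_square: "integrable lborel (\<lambda>x::real. inverse (1 + x\<^sup>2))"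
  using integrable_inverse_1_plus_square
  by (simp add: set_integrable_def einterval_def)

text \<open>The integrable majorant behind the later domination arguments. The exponent is twice the
  dimension because each factor 1 + x_k^2 of an integrable product is at most (1 + |x|)^2.\<close>

definition weight :: "real^'n::finite \<Rightarrow> real" where
  "weight x = inverse ((1 + norm x) ^ (2 * CARD('n)))"

lemma weight_pos: "0 < weight x"
  unfolding weight_def by (simp add: add_pos_nonneg)

lemma weight_measurable [measurable]: "weight \<in> borel_measurable borel"
  unfolding weight_def[abs_def] by measurable

lemma integrable_weight: "integrable lborel (weight :: real^'n::finite \<Rightarrow> real)"
proof (rule Bochner_Integration.integrable_bound)
  show "integrable lborel (\<lambda>x::real^'n. \<Prod>k\<in>UNIV. inverse (1 + (x $ k)\<^sup>2))"
    by (rule integrable_lborel_vec_prod) (rule integrable_lborel_inverse_1_plus_square)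
  have "(\<Prod>k\<in>(UNIV::'n set). 1 + (x $ k)\<^sup>2) \<le> (\<Prod>k\<in>(UNIV::'n set). (1 + norm x)\<^sup>2)" for x :: "real^'n"
  proof (rule prod_mono)
    fix k
    have "\<bar>x $ k\<bar> \<le> norm x" by (rule component_le_norm_cart)
    then have "(x $ k)\<^sup>2 \<le> (norm x)\<^sup>2" using abs_le_square_iff by fastforce
    then show "0 \<le> 1 + (x $ k)\<^sup>2 \<and> 1 + (x $ k)\<^sup>2 \<le> (1 + norm x)\<^sup>2"
      by (simp add: power2_sum) (smt (verit) norm_ge_zero)
  qed
  then have "(\<Prod>k\<in>(UNIV::'n set). 1 + (x $ k)\<^sup>2) \<le> (1 + norm x) ^ (2 * CARD('n))" for x :: "real^'n"
    by (simp add: power_mult)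
  moreover have "0 < (\<Prod>k\<in>(UNIV::'n set). 1 + (x $ k)\<^sup>2)" for x :: "real^'n"
    by (intro prod_pos) (simp add: add_pos_nonneg)
  ultimately have "inverse ((1 + norm x) ^ (2 * CARD('n))) \<le> inverse (\<Prod>k\<in>(UNIV::'n set). 1 + (x $ k)\<^sup>2)" for x :: "real^'n"
    by (intro le_imp_inverse_le)
  moreover have "inverse (\<Prod>k\<in>(UNIV::'n set). 1 + (x $ k)\<^sup>2) = (\<Prod>k\<in>(UNIV::'n set). inverse (1 + (x $ k)\<^sup>2))" for x :: "real^'n"
    using prod_inversef[of "\<lambda>k. 1 + (x $ k)\<^sup>2" "UNIV::'n set"] by (simp add: o_def)
  ultimately show "AE x in lborel. norm (weight x) \<le> norm (\<Prod>k\<in>(UNIV::'n set). inverse (1 + ((x::real^'n) $ k)\<^sup>2))"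
    by (intro AE_I2) (auto simp: weight_def intro: order_trans[OF _ abs_ge_self])
qed simp

text \<open>Trades \<open>2 * CARD('n')\<close> powers of decay for an integrable factor; this is
  the origin of that summand in the orders of decay required later.\<close>

lemma weight_power: "(1 + norm x) ^ (k + 2 * CARD('n)) * y \<le> c \<Longrightarrow> (1 + norm x) ^ k * y \<le> c * weight x"
  for x :: "real^'n::finite"
  unfolding weight_def
  by (simp add: power_add field_simps add_pos_nonneg)

text \<open>The difference quotients of \<open>h\<close> in direction \<open>e\<close> have integral
  0 by translation invariance and converge pointwise to \<open>h'\<close>. The bound on whole unit
  segments dominates them through the mean value theorem. With a product inserted as
  \<open>h\<close> this is integration by parts.\<close>

lemma integral_directional_derivative_eq_0:
  fixes h h' :: "'a::euclidean_space \<Rightarrow> complex"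
  assumes h: "integrable lborel h" and [measurable]: "h' \<in> borel_measurable borel"
    and W: "integrable lborel W"
    and der: "\<And>s. ((\<lambda>r. h (s + r *\<^sub>R e)) has_vector_derivative h' s) (at 0)"
    and bnd: "\<And>s r. \<bar>r\<bar> \<le> 1 \<Longrightarrow> norm (h' (s + r *\<^sub>R e)) \<le> W s"
  shows "(LINT s|lborel. h' s) = 0"
proof -
  have [measurable]: "h \<in> borel_measurable borel"
    using h borel_measurable_integrable by fastforce
  define \<epsilon> where "\<epsilon> j = 1 / real (Suc j)" for j
  define D where "D j s = real (Suc j) *\<^sub>R (h (s + \<epsilon> j *\<^sub>R e) - h s)" for j s
  have eps: "0 < \<epsilon> j" "\<epsilon> j \<le> 1" for j
    by (auto simp: \<epsilon>_def divide_simps)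
  have ht: "integrable lborel (\<lambda>s. h (s + \<epsilon> j *\<^sub>R e))" for j
    using integrable_lborel_affine[of 1 h "\<epsilon> j *\<^sub>R e"] h by (simp add: add.commute)
  have "(\<lambda>j. LINT s|lborel. D j s) \<longlonglongrightarrow> (LINT s|lborel. h' s)"
  proof (rule integral_dominated_convergence)
    show "AE s in lborel. (\<lambda>j. D j s) \<longlonglongrightarrow> h' s"
    proof (rule AE_I2)
      fix s
      have e0: "filterlim \<epsilon> (at 0) sequentially"
        unfolding filterlim_at
      proof
        show "\<epsilon> \<longlonglongrightarrow> 0" unfolding \<epsilon>_def[abs_def]
          using LIMSEQ_inverse_real_of_nat by (simp add: inverse_eq_divide)
        show "\<forall>\<^sub>F j in sequentially. \<epsilon> j \<in> UNIV \<and> \<epsilon> j \<noteq> 0"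
          using eps(1) by (intro always_eventually) (metis UNIV_I less_irrefl)
      qed
      have "((\<lambda>r. (1/r) *\<^sub>R (h (s + r *\<^sub>R e) - h s)) \<longlongrightarrow> h' s) (at 0)"
      proof -
        have "((\<lambda>y. norm (h (s + y *\<^sub>R e) - h s - y *\<^sub>R h' s) / \<bar>y\<bar>) \<longlongrightarrow> 0) (at 0)"
          using der[of s] by (simp add: has_vector_derivative_def has_derivative_iff_norm)
        moreover have "\<forall>\<^sub>F y in at 0. norm (h (s + y *\<^sub>R e) - h s - y *\<^sub>R h' s) / \<bar>y\<bar>
            = norm ((1/y) *\<^sub>R (h (s + y *\<^sub>R e) - h s) - h' s)"
        proof -
          have "norm (h (s + y *\<^sub>R e) - h s - y *\<^sub>R h' s) / \<bar>y\<bar>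
            = norm ((1/y) *\<^sub>R (h (s + y *\<^sub>R e) - h s) - h' s)" if "y \<noteq> 0" for y
          proof -
            have "(1/y) *\<^sub>R (h (s + y *\<^sub>R e) - h s) - h' s = (1/y) *\<^sub>R (h (s + y *\<^sub>R e) - h s - y *\<^sub>R h' s)"
              using that by (simp add: scaleR_diff_right)
            then show ?thesis by (simp add: divide_inverse)
          qed
          then show ?thesis by (simp add: eventually_at_filter)
        qed
        ultimately have "((\<lambda>y. norm ((1/y) *\<^sub>R (h (s + y *\<^sub>R e) - h s) - h' s)) \<longlongrightarrow> 0) (at 0)"
          using tendsto_cong by fast
        from LIM_zero_cancel[OF tendsto_norm_zero_cancel[OF this]] show ?thesis .
      qed
      then have "(\<lambda>j. (1 / \<epsilon> j) *\<^sub>R (h (s + \<epsilon> j *\<^sub>R e) - h s)) \<longlonglongrightarrow> h' s"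
        using e0 by (rule filterlim_compose)
      moreover have "1 / \<epsilon> j = real (Suc j)" for j by (simp add: \<epsilon>_def)
      ultimately show "(\<lambda>j. D j s) \<longlonglongrightarrow> h' s"
        by (simp add: D_def)
    qed
    show "AE s in lborel. norm (D j s) \<le> W s" for j
    proof (rule AE_I2)
      fix s
      have "norm (h (s + \<epsilon> j *\<^sub>R e) - h (s + 0 *\<^sub>R e)) \<le> W s * norm (\<epsilon> j - 0)"
      proof (rule differentiable_bound[where f' = "\<lambda>r v. v *\<^sub>R h' (s + r *\<^sub>R e)"])
        show "convex {0..\<epsilon> j}" by simp
        show "((\<lambda>r. h (s + r *\<^sub>R e)) has_derivative (\<lambda>v. v *\<^sub>R h' (s + r *\<^sub>R e))) (at r within {0..\<epsilon> j})" for r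
        proof -
          have "((\<lambda>q. h (s + r *\<^sub>R e + q *\<^sub>R e)) has_vector_derivative h' (s + r *\<^sub>R e)) (at (r - r))"
            using der[of "s + r *\<^sub>R e"] by simp
          moreover have "((\<lambda>q. q - r) has_vector_derivative 1) (at r)"
            by (auto intro!: derivative_eq_intros)
          ultimately have "(((\<lambda>q. h (s + r *\<^sub>R e + q *\<^sub>R e)) \<circ> (\<lambda>q. q - r)) has_vector_derivative 1 *\<^sub>R h' (s + r *\<^sub>R e)) (at r)"
            by (intro vector_diff_chain_at)
          moreover have "s + r *\<^sub>R e + (q - r) *\<^sub>R e = s + q *\<^sub>R e" for q
            by (simp add: scaleR_left_diff_distrib)
          ultimately have "((\<lambda>q. h (s + q *\<^sub>R e)) has_vector_derivative h' (s + r *\<^sub>R e)) (at r)"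
            unfolding o_def by simp
          then show ?thesis
            unfolding has_vector_derivative_def by (rule has_derivative_at_withinI)
        qed
        show "onorm (\<lambda>v. v *\<^sub>R h' (s + r *\<^sub>R e)) \<le> W s" if "r \<in> {0..\<epsilon> j}" for r
          by (rule onorm_le) (use bnd[of r s] that eps(2)[of j] in \<open>auto simp: mult.commute mult_left_mono\<close>)
      qed (use eps[of j] in auto)
      then have "real (Suc j) * norm (h (s + \<epsilon> j *\<^sub>R e) - h s) \<le> real (Suc j) * (W s * \<epsilon> j)"
        using eps(1)[of j] by (intro mult_left_mono) auto
      also have "\<dots> = W s" by (simp add: \<epsilon>_def)
      finally show "norm (D j s) \<le> W s"
        by (simp add: D_def)
    qed
  qed (use W in \<open>auto simp: D_def[abs_def]\<close>)
  moreover have "(LINT s|lborel. D j s) = 0" for j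
    using integral_lborel_affine[of 1 h "\<epsilon> j *\<^sub>R e"] h ht[of j]
    by (simp add: D_def add.commute del: of_nat_Suc)
  ultimately show ?thesis
    using LIMSEQ_unique[of "\<lambda>j. 0" "LINT s|lborel. h' s" 0] by simp
qed

section \<open>Gaussian integrals and Fourier inversion\<close>

lemma cis_measurable [measurable]: "cis \<in> borel_measurable borel"
  by (intro borel_measurable_continuous_onI continuous_intros)

text \<open>This is the characteristic function of the standard normal law, freed of its
  normalisation.\<close>

lemma gaussian_fourier_real:
  shows "integrable lborel (\<lambda>x::real. complex_of_real (exp (- x\<^sup>2 / 2)) * cis (s * x))"
    and "(LINT x|lborel. complex_of_real (exp (- x\<^sup>2 / 2)) * cis (s * x)) = complex_of_real (sqrt (2 * pi) * exp (- s\<^sup>2 / 2))"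
proof -
  have "integrable lborel std_normal_density" by simp
  then have "integrable lborel (\<lambda>x. sqrt (2 * pi) * std_normal_density x)"
    by simp
  also have "(\<lambda>x. sqrt (2 * pi) * std_normal_density x) = (\<lambda>x::real. exp (- x\<^sup>2 / 2))"
    by (simp add: std_normal_density_def fun_eq_iff)
  finally have i: "integrable lborel (\<lambda>x::real. exp (- x\<^sup>2 / 2))" .
  show "integrable lborel (\<lambda>x::real. complex_of_real (exp (- x\<^sup>2 / 2)) * cis (s * x))"
    by (rule Bochner_Integration.integrable_bound[OF i]) (auto simp: norm_mult)
  have "char std_normal_distribution s = (LINT x|lborel. std_normal_density x *\<^sub>R iexp (s * x))"
    unfolding char_def by (subst integral_density) (auto simp: normal_density_nonneg)
  also have "\<dots> = (LINT x|lborel. complex_of_real (1 / sqrt (2 * pi)) * (complex_of_real (exp (- x\<^sup>2 / 2)) * cis (s * x)))"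
    by (intro Bochner_Integration.integral_cong)
      (auto simp: std_normal_density_def scaleR_conv_of_real cis_conv_exp)
  also have "\<dots> = complex_of_real (1 / sqrt (2 * pi)) * (LINT x|lborel. complex_of_real (exp (- x\<^sup>2 / 2)) * cis (s * x))"
    by simp
  finally show "(LINT x|lborel. complex_of_real (exp (- x\<^sup>2 / 2)) * cis (s * x)) = complex_of_real (sqrt (2 * pi) * exp (- s\<^sup>2 / 2))"
    by (simp add: char_std_normal_distribution field_simps)
qed

lemma gaussian_fourier:
  fixes s :: "real^'n::finite"
  shows "integrable lborel (\<lambda>x::real^'n. complex_of_real (exp (- (x \<bullet> x) / 2)) * cis (s \<bullet> x))" (is ?I)
    and "(LINT x|lborel. complex_of_real (exp (- (x \<bullet> x) / 2)) * cis (s \<bullet> x))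
      = complex_of_real (sqrt (2 * pi) ^ CARD('n) * exp (- (s \<bullet> s) / 2))" (is ?E)
proof -
  have eq: "complex_of_real (exp (- (x \<bullet> x) / 2)) * cis (s \<bullet> x)
     = (\<Prod>k\<in>UNIV. complex_of_real (exp (- (x $ k)\<^sup>2 / 2)) * cis (s $ k * x $ k))" for x :: "real^'n"
    by (simp add: inner_vec_def prod.distrib power2_eq_square exp_sum[symmetric] sum_negf sum_divide_distrib
       cis_conv_exp sum_distrib_left flip: of_real_prod)
  show ?I
    unfolding eq by (rule integrable_lborel_vec_prod) (rule gaussian_fourier_real)
  have eq2: "exp (- (s \<bullet> s) / 2) = (\<Prod>k\<in>UNIV. exp (- (s $ k)\<^sup>2 / 2))"
    by (simp add: inner_vec_def power2_eq_square exp_sum[symmetric] sum_negf sum_divide_distrib)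
  show ?E
    unfolding eq integral_lborel_vec_prod[OF gaussian_fourier_real(1)] gaussian_fourier_real(2) eq2
    by (simp add: prod.distrib)
qed

lemma integrable_gaussian: "integrable lborel (\<lambda>x::real^'n::finite. exp (- (x \<bullet> x) / 2))"
  using integrable_norm[OF gaussian_fourier(1)[of "0::real^'n"]] by simp

text \<open>The double integral does not converge absolutely, so a Gaussian factor in \<xi> is
  inserted to permit Fubini. Its Fourier transform concentrates at s = 0 as the factor tends to 1,
  and continuity of \<open>a\<close> there produces \<open>a 0\<close>. Integrability of the
  transform removes the factor in the limit.\<close>

lemma fourier_inversion_at_0:
  fixes a :: "real^'n::finite \<Rightarrow> complex"
  assumes cont: "continuous_on UNIV a" and bnd: "\<And>s. norm (a s) \<le> K" and int: "integrable lborel a"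
    and inth: "integrable lborel (\<lambda>\<xi>. LINT s|lborel. cis (s \<bullet> \<xi>) * a s)"
  shows "(LINT \<xi>|lborel. LINT s|lborel. cis (s \<bullet> \<xi>) * a s) = complex_of_real ((2 * pi) ^ CARD('n)) * a 0"
proof -
  define \<epsilon> where "\<epsilon> j = 1 / real (Suc j)" for j
  define ah where "ah = (\<lambda>\<xi>. LINT s|lborel. cis (s \<bullet> \<xi>) * a s)"
  define w where "w j \<xi> = complex_of_real (exp (- (\<epsilon> j)\<^sup>2 * (\<xi> \<bullet> \<xi>) / 2))" for j and \<xi> :: "real^'n"
  have eps: "0 < \<epsilon> j" for j by (auto simp: \<epsilon>_def)
  have eps0: "\<epsilon> \<longlonglongrightarrow> 0" unfolding \<epsilon>_def[abs_def]
    using LIMSEQ_inverse_real_of_nat by (simp add: inverse_eq_divide)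
  have [measurable]: "a \<in> borel_measurable borel"
    using cont by (rule borel_measurable_continuous_onI)
  have [measurable]: "ah \<in> borel_measurable borel"
    using borel_measurable_integrable[OF inth] by (simp add: ah_def)
  have [measurable]: "w j \<in> borel_measurable borel" for j
    unfolding w_def[abs_def] by measurable
  have w_aff: "w j (0 + (1 / \<epsilon> j) *\<^sub>R x) = complex_of_real (exp (- (x \<bullet> x) / 2))" for j x
    using eps[of j] by (simp add: w_def power2_eq_square field_simps)
  have w_int: "integrable lborel (w j)" for j
  proof -
    have "integrable lborel (\<lambda>x::real^'n. complex_of_real (exp (- (x \<bullet> x) / 2)))"
      using gaussian_fourier(1)[of "0::real^'n"] by simp
    from integrable_lborel_affine[OF _ this, of "\<epsilon> j" 0]
    show ?thesis using eps[of j] by (simp add: w_def[abs_def] power2_eq_square mult.assoc)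
  qed
  have wF: "(LINT \<xi>|lborel. w j \<xi> * cis (s \<bullet> \<xi>)) =
     complex_of_real ((1 / \<epsilon> j) ^ CARD('n)) * complex_of_real (sqrt (2 * pi) ^ CARD('n) * exp (- ((1 / \<epsilon> j) *\<^sub>R s \<bullet> (1 / \<epsilon> j) *\<^sub>R s) / 2))" for j s
  proof -
    have "(LINT \<xi>|lborel. w j \<xi> * cis (s \<bullet> \<xi>)) = \<bar>1 / \<epsilon> j\<bar> ^ DIM(real^'n) *\<^sub>R
       (LINT x|lborel. w j (0 + (1 / \<epsilon> j) *\<^sub>R x) * cis (s \<bullet> (0 + (1 / \<epsilon> j) *\<^sub>R x)))"
      by (rule integral_lborel_affine) (use eps[of j] in auto)
    also have "\<dots> = \<bar>1 / \<epsilon> j\<bar> ^ DIM(real^'n) *\<^sub>R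
       (LINT x|lborel. complex_of_real (exp (- (x \<bullet> x) / 2)) * cis (((1 / \<epsilon> j) *\<^sub>R s) \<bullet> x))"
      unfolding w_aff by simp
    finally show ?thesis
      unfolding gaussian_fourier(2) using eps[of j] by (simp add: scaleR_conv_of_real)
  qed
  have I: "(LINT \<xi>|lborel. w j \<xi> * ah \<xi>) =
     complex_of_real (sqrt (2 * pi) ^ CARD('n)) * (LINT r|lborel. a (\<epsilon> j *\<^sub>R r) * complex_of_real (exp (- (r \<bullet> r) / 2)))" for j
  proof -
    have P: "integrable (lborel \<Otimes>\<^sub>M lborel) (\<lambda>(\<xi>, s). w j \<xi> * (cis (s \<bullet> \<xi>) * a s))"
    proof (rule Bochner_Integration.integrable_bound)
      show "integrable (lborel \<Otimes>\<^sub>M lborel) (\<lambda>(\<xi>, s). w j \<xi> * a s)"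
        by (intro lborel_pair.Fubini_integrable) (auto simp: norm_mult w_int int integrable_norm)
    qed (auto simp: norm_mult)
    have "(LINT \<xi>|lborel. w j \<xi> * ah \<xi>) = (LINT \<xi>|lborel. LINT s|lborel. w j \<xi> * (cis (s \<bullet> \<xi>) * a s))"
      by (simp add: ah_def)
    also have "\<dots> = (LINT s|lborel. LINT \<xi>|lborel. w j \<xi> * (cis (s \<bullet> \<xi>) * a s))"
      by (rule lborel_pair.Fubini_integral[symmetric]) (use P in \<open>simp add: case_prod_beta\<close>)
    also have "\<dots> = (LINT s|lborel. (LINT \<xi>|lborel. w j \<xi> * cis (s \<bullet> \<xi>)) * a s)"
      by (simp add: mult.assoc[symmetric])
    \<comment> \<open>The substitution s = \<epsilon> r cancels the factor (1 / \<epsilon>)^n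
      carried by the transform of the cutoff.\<close>
    also have "\<dots> = \<bar>\<epsilon> j\<bar> ^ DIM(real^'n) *\<^sub>R (LINT r|lborel. (LINT \<xi>|lborel. w j \<xi> * cis ((0 + \<epsilon> j *\<^sub>R r) \<bullet> \<xi>)) * a (0 + \<epsilon> j *\<^sub>R r))"
      by (rule integral_lborel_affine) (use eps[of j] in \<open>auto simp: wF\<close>)
    also have "\<dots> = \<bar>\<epsilon> j\<bar> ^ DIM(real^'n) *\<^sub>R (LINT r|lborel. complex_of_real ((1 / \<epsilon> j) ^ CARD('n) * sqrt (2 * pi) ^ CARD('n)) *
           (a (\<epsilon> j *\<^sub>R r) * complex_of_real (exp (- (r \<bullet> r) / 2))))"
      unfolding wF using eps[of j] by (simp add: mult_ac)
    also have "\<dots> = (\<bar>\<epsilon> j\<bar> ^ DIM(real^'n) * ((1 / \<epsilon> j) ^ CARD('n) * sqrt (2 * pi) ^ CARD('n))) *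
         (LINT r|lborel. a (\<epsilon> j *\<^sub>R r) * complex_of_real (exp (- (r \<bullet> r) / 2)))"
      by (simp add: scaleR_conv_of_real)
    also have "\<bar>\<epsilon> j\<bar> ^ DIM(real^'n) * ((1 / \<epsilon> j) ^ CARD('n) * sqrt (2 * pi) ^ CARD('n)) = sqrt (2 * pi) ^ CARD('n)"
      using eps[of j] by (simp add: field_simps)
    finally show ?thesis .
  qed
  have "(\<lambda>j. LINT \<xi>|lborel. w j \<xi> * ah \<xi>) \<longlonglongrightarrow> (LINT \<xi>|lborel. ah \<xi>)"
  proof (rule integral_dominated_convergence[where w="\<lambda>\<xi>. norm (ah \<xi>)"])
    show "AE \<xi> in lborel. (\<lambda>j. w j \<xi> * ah \<xi>) \<longlonglongrightarrow> ah \<xi>"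
    proof (rule AE_I2)
      fix \<xi>
      have "(\<lambda>j. w j \<xi>) \<longlonglongrightarrow> complex_of_real (exp (- 0\<^sup>2 * (\<xi> \<bullet> \<xi>) / 2))"
        unfolding w_def by (intro tendsto_intros eps0) simp
      from tendsto_mult[OF this tendsto_const[of "ah \<xi>"]]
      show "(\<lambda>j. w j \<xi> * ah \<xi>) \<longlonglongrightarrow> ah \<xi>" by simp
    qed
    show "AE \<xi> in lborel. norm (w j \<xi> * ah \<xi>) \<le> norm (ah \<xi>)" for j
      by (intro AE_I2) (auto simp: norm_mult w_def intro!: mult_left_le_one_le)
  qed (use inth in \<open>auto simp: ah_def[symmetric]\<close>)
  moreover have "(\<lambda>j. LINT r|lborel. a (\<epsilon> j *\<^sub>R r) * complex_of_real (exp (- (r \<bullet> r) / 2)))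
     \<longlonglongrightarrow> (LINT r|lborel. a 0 * complex_of_real (exp (- ((r::real^'n) \<bullet> r) / 2)))"
  proof (rule integral_dominated_convergence[where w="\<lambda>r::real^'n. K * exp (- (r \<bullet> r) / 2)"])
    show "AE r::real^'n in lborel. (\<lambda>j. a (\<epsilon> j *\<^sub>R r) * complex_of_real (exp (- (r \<bullet> r) / 2))) \<longlonglongrightarrow> a 0 * complex_of_real (exp (- (r \<bullet> r) / 2))"
    proof (rule AE_I2)
      fix r :: "real^'n"
      have "(\<lambda>j. \<epsilon> j *\<^sub>R r) \<longlonglongrightarrow> 0 *\<^sub>R r" by (intro tendsto_intros eps0)
      moreover have "isCont a 0" using cont by (simp add: continuous_on_eq_continuous_at)
      ultimately have "(\<lambda>j. a (\<epsilon> j *\<^sub>R r)) \<longlonglongrightarrow> a 0"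
        using isCont_tendsto_compose[of 0 a "\<lambda>j. \<epsilon> j *\<^sub>R r" sequentially] by simp
      then show "(\<lambda>j. a (\<epsilon> j *\<^sub>R r) * complex_of_real (exp (- (r \<bullet> r) / 2))) \<longlonglongrightarrow> a 0 * complex_of_real (exp (- (r \<bullet> r) / 2))"
        by (intro tendsto_intros)
    qed
    show "AE r::real^'n in lborel. norm (a (\<epsilon> j *\<^sub>R r) * complex_of_real (exp (- (r \<bullet> r) / 2))) \<le> K * exp (- (r \<bullet> r) / 2)" for j
      by (intro AE_I2) (auto simp: norm_mult bnd)
  qed (use integrable_gaussian in auto)
  ultimately have "(LINT \<xi>|lborel. ah \<xi>) = complex_of_real (sqrt (2 * pi) ^ CARD('n)) * (LINT r|lborel. a 0 * complex_of_real (exp (- ((r::real^'n) \<bullet> r) / 2)))"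
    unfolding I by (rule LIMSEQ_unique[OF _ tendsto_mult_left])
  also have "(LINT r|lborel. a 0 * complex_of_real (exp (- ((r::real^'n) \<bullet> r) / 2))) = a 0 * complex_of_real (sqrt (2 * pi) ^ CARD('n))"
    using gaussian_fourier(2)[of "0::real^'n"] by simp
  also have "complex_of_real (sqrt (2 * pi) ^ CARD('n)) * (a 0 * complex_of_real (sqrt (2 * pi) ^ CARD('n)))
      = complex_of_real (sqrt (2 * pi) ^ CARD('n) * sqrt (2 * pi) ^ CARD('n)) * a 0"
    by (simp only: of_real_mult mult_ac)
  also have "sqrt (2 * pi) ^ CARD('n) * sqrt (2 * pi) ^ CARD('n) = (2 * pi) ^ CARD('n)"
    by (subst power_mult_distrib[symmetric]) simp
  finally show ?thesis
    unfolding ah_def .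
qed

text \<open>The free constant \<open>c\<close> lets one lemma serve twice: \<open>c\<close> = 0 is
  the mean value inequality, and taking for \<open>c\<close> the derivative at \<open>x\<close>
  applied to \<open>v\<close> gives a Taylor remainder. Two nested uses give quadratic
  remainders.\<close>

lemma derivative_line_bound:
  fixes f :: "'a::real_normed_vector \<Rightarrow> complex"
  assumes der: "\<And>t. 0 \<le> t \<Longrightarrow> t \<le> 1 \<Longrightarrow> (f has_derivative f' (x + t *\<^sub>R v)) (at (x + t *\<^sub>R v))"
    and bnd: "\<And>t. 0 \<le> t \<Longrightarrow> t \<le> 1 \<Longrightarrow> norm (f' (x + t *\<^sub>R v) v - c) \<le> K"
  shows "norm (f (x + v) - f x - c) \<le> K"
proof -
  let ?h = "\<lambda>t. f (x + t *\<^sub>R v) - t *\<^sub>R c"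
  have "norm (?h 1 - ?h 0) \<le> K * norm (1 - 0 :: real)"
  proof (rule differentiable_bound[where f' = "\<lambda>t s. s *\<^sub>R (f' (x + t *\<^sub>R v) v - c)"])
    show "convex {0..1::real}" by simp
    fix t :: real assume t: "t \<in> {0..1}"
    have lin: "linear (f' (x + t *\<^sub>R v))"
      using der[of t] t by (simp add: has_derivative_linear)
    have "((\<lambda>t. x + t *\<^sub>R v) has_derivative (\<lambda>s. s *\<^sub>R v)) (at t)"
      by (auto intro!: derivative_eq_intros)
    from has_derivative_compose[OF this, of f "f' (x + t *\<^sub>R v)"]
    have "((\<lambda>t. f (x + t *\<^sub>R v)) has_derivative (\<lambda>s. f' (x + t *\<^sub>R v) (s *\<^sub>R v))) (at t)"
      using der[of t] t by simp
    moreover have "((\<lambda>t. t *\<^sub>R c) has_derivative (\<lambda>s. s *\<^sub>R c)) (at t)"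
      by (auto intro!: derivative_eq_intros)
    ultimately have "(?h has_derivative (\<lambda>s. f' (x + t *\<^sub>R v) (s *\<^sub>R v) - s *\<^sub>R c)) (at t)"
      by (rule has_derivative_diff)
    then have "(?h has_derivative (\<lambda>s. s *\<^sub>R (f' (x + t *\<^sub>R v) v - c))) (at t)"
      by (simp add: linear_scale[OF lin] scaleR_diff_right)
    then show "(?h has_derivative (\<lambda>s. s *\<^sub>R (f' (x + t *\<^sub>R v) v - c))) (at t within {0..1})"
      by (rule has_derivative_at_withinI)
    show "onorm (\<lambda>s. s *\<^sub>R (f' (x + t *\<^sub>R v) v - c)) \<le> K"
    proof (rule onorm_le)
      fix s :: real
      show "norm (s *\<^sub>R (f' (x + t *\<^sub>R v) v - c)) \<le> K * norm s"
        using mult_right_mono[OF bnd[of t], of "\<bar>s\<bar>"] t by (simp add: mult.commute)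
    qed
  qed auto
  then show ?thesis by (simp add: algebra_simps)
qed

section \<open>Iterated partial derivatives\<close>

text \<open>The total derivative with prescribed partial derivatives; in this form derivatives are
  compared through their coefficients.\<close>

definition grad_form :: "('n::finite \<Rightarrow> complex) \<Rightarrow> real^'n \<Rightarrow> complex" where
  "grad_form g v = (\<Sum>i\<in>UNIV. complex_of_real (v $ i) * g i)"

lemma grad_form_axis [simp]: "grad_form g (axis i 1) = g i"
proof -
  have "grad_form g (axis i 1) = (\<Sum>j\<in>UNIV. if j = i then g j else 0)"
    unfolding grad_form_def by (intro sum.cong) (auto simp: axis_def)
  then show ?thesis by simp
qed

lemma grad_form_scaleR_axis: "grad_form g (h *\<^sub>R axis k 1) = complex_of_real h * g k"
proof -
  have "grad_form g (h *\<^sub>R axis k 1) = complex_of_real h * grad_form g (axis k 1)"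
    by (simp add: grad_form_def sum_distrib_left mult_ac)
  then show ?thesis by simp
qed

lemma norm_grad_form_le:
  fixes v :: "real^'n::finite"
  assumes "\<And>i. cmod (g i) \<le> K"
  shows "cmod (grad_form g v) \<le> real CARD('n) * K * norm v"
proof -
  have "cmod (grad_form g v) \<le> (\<Sum>i\<in>(UNIV::'n set). norm v * K)"
    unfolding grad_form_def
    by (intro sum_norm_le) (auto simp: norm_mult intro!: mult_mono assms component_le_norm_cart)
  then show ?thesis by (simp add: mult_ac)
qed

lemma grad_form_diff: "grad_form (\<lambda>i. g i - h i) v = grad_form g v - grad_form h v"
  by (simp add: grad_form_def right_diff_distrib sum_subtractf)

lemma partial_eq: "(\<phi> has_derivative D) (at x) \<Longrightarrow> partial i \<phi> x = D (axis i 1)"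
  unfolding partial_def using frechet_derivative_at by metis

lemma partials_Nil [simp]: "partials [] \<phi> = \<phi>"
  and partials_Cons [simp]: "partials (i # is) \<phi> = partial i (partials is \<phi>)"
  by (simp_all add: partials_def)

lemma partials_append: "partials (is @ js) \<phi> = partials is (partials js \<phi>)"
  by (simp add: partials_def)

lemma differentiable_grad_form:
  fixes \<phi> :: "real^'n::finite \<Rightarrow> complex"
  assumes "\<phi> differentiable (at x)"
  shows "(\<phi> has_derivative grad_form (\<lambda>i. partial i \<phi> x)) (at x)"
proof -
  obtain D where D: "(\<phi> has_derivative D) (at x)"
    using assms by (auto simp: differentiable_def)
  then have lin: "linear D" by (rule has_derivative_linear)
  have "D v = grad_form (\<lambda>i. partial i \<phi> x) v" for v
  proof -
    have "D v = D (\<Sum>i\<in>UNIV. (v $ i) *\<^sub>R axis i 1)"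
      using basis_expansion[of v] by (simp add: scalar_mult_eq_scaleR)
    also have "\<dots> = (\<Sum>i\<in>UNIV. (v $ i) *\<^sub>R D (axis i 1))"
      by (simp add: linear_sum[OF lin] linear_scale[OF lin])
    finally show ?thesis
      by (simp add: grad_form_def partial_eq[OF D] scaleR_conv_of_real)
  qed
  then have "D = grad_form (\<lambda>i. partial i \<phi> x)" by (rule ext)
  with D show ?thesis by simp
qed

text \<open>By induction, a family indexed by direction lists whose derivative at \<open>is\<close>
  has the coefficients \<open>G (i # is)\<close> consists of the iterated partials of its head.
  Smoothness of sums, affine images, Gaussians and superpositions is always shown by exhibiting such
  a family.\<close>

lemma
  fixes G :: "'n::finite list \<Rightarrow> real^'n \<Rightarrow> complex"
  assumes G: "\<And>is x. (G is has_derivative grad_form (\<lambda>i. G (i # is) x)) (at x)"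
  shows partials_eqI: "partials is (G []) = G is"
    and smoothI: "smooth (G [])"
proof -
  have *: "partials is (G []) = G is" for "is"
  proof (induction "is")
    case (Cons i "is")
    have "partial i (G is) x = G (i # is) x" for x
      using partial_eq[OF G[of "is" x]] by simp
    then have "partial i (G is) = G (i # is)" by (rule ext)
    with Cons.IH show ?case by simp
  qed simp
  then show "partials is (G []) = G is" .
  show "smooth (G [])"
    unfolding smooth_def * using G by (auto simp: differentiable_def)
qed

lemma smooth_partials: "smooth \<phi> \<Longrightarrow> smooth (partials js \<phi>)"
  unfolding smooth_def by (metis partials_append)

lemma smooth_derivative:
  "smooth \<phi> \<Longrightarrow> (partials is \<phi> has_derivative grad_form (\<lambda>i. partials (i # is) \<phi> x)) (at x)"
  using differentiable_grad_form[of "partials is \<phi>" x] by (auto simp: smooth_def)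

lemma grad_form_derivative_compose_affine:
  assumes "(g has_derivative grad_form d) (at (h + \<sigma> *\<^sub>R x))"
  shows "((\<lambda>x. g (h + \<sigma> *\<^sub>R x)) has_derivative grad_form (\<lambda>i. complex_of_real \<sigma> * d i)) (at x)"
proof -
  have "((\<lambda>x. h + \<sigma> *\<^sub>R x) has_derivative (\<lambda>v. \<sigma> *\<^sub>R v)) (at x)"
    by (auto intro!: derivative_eq_intros)
  from has_derivative_compose[OF this assms]
  show ?thesis
    by (rule has_derivative_eq_rhs) (auto simp: grad_form_def fun_eq_iff mult_ac)
qed

lemma
  assumes "smooth \<phi>"
  shows smooth_affine: "smooth (\<lambda>x. \<phi> (h + \<sigma> *\<^sub>R x))"
    and partials_affine:
      "partials is (\<lambda>x. \<phi> (h + \<sigma> *\<^sub>R x)) = (\<lambda>x. complex_of_real \<sigma> ^ length is * partials is \<phi> (h + \<sigma> *\<^sub>R x))"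
proof -
  let ?G = "\<lambda>is x. complex_of_real \<sigma> ^ length is * partials is \<phi> (h + \<sigma> *\<^sub>R x)"
  have G: "(?G is has_derivative grad_form (\<lambda>i. ?G (i # is) x)) (at x)" for "is" x
  proof -
    have "(?G is has_derivative (\<lambda>v. complex_of_real \<sigma> ^ length is * grad_form (\<lambda>i. complex_of_real \<sigma> * partials (i # is) \<phi> (h + \<sigma> *\<^sub>R x)) v)) (at x)"
      by (intro has_derivative_mult_right grad_form_derivative_compose_affine smooth_derivative assms)
    then show ?thesis
      by (rule has_derivative_eq_rhs) (simp add: grad_form_def fun_eq_iff sum_distrib_left mult_ac)
  qed
  from smoothI[of ?G, OF G] show "smooth (\<lambda>x. \<phi> (h + \<sigma> *\<^sub>R x))" by simp
  from partials_eqI[of ?G, OF G] show "partials is (\<lambda>x. \<phi> (h + \<sigma> *\<^sub>R x)) = ?G is" by simp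
qed

lemma
  assumes "smooth \<phi>" "smooth \<theta>"
  shows smooth_lincomb: "smooth (\<lambda>x. a * \<phi> x + b * \<theta> x)"
    and partials_lincomb:
      "partials is (\<lambda>x. a * \<phi> x + b * \<theta> x) = (\<lambda>x. a * partials is \<phi> x + b * partials is \<theta> x)"
proof -
  let ?G = "\<lambda>is x. a * partials is \<phi> x + b * partials is \<theta> x"
  have G: "(?G is has_derivative grad_form (\<lambda>i. ?G (i # is) x)) (at x)" for "is" x
  proof -
    have "(?G is has_derivative (\<lambda>v. a * grad_form (\<lambda>i. partials (i # is) \<phi> x) v + b * grad_form (\<lambda>i. partials (i # is) \<theta> x) v)) (at x)"
      by (intro has_derivative_add has_derivative_mult_right smooth_derivative assms)
    then show ?thesis
      by (rule has_derivative_eq_rhs)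
        (simp add: grad_form_def fun_eq_iff sum_distrib_left sum.distrib algebra_simps)
  qed
  from smoothI[of ?G, OF G] show "smooth (\<lambda>x. a * \<phi> x + b * \<theta> x)" by simp
  from partials_eqI[of ?G, OF G] show "partials is (\<lambda>x. a * \<phi> x + b * \<theta> x) = ?G is" by simp
qed

section \<open>Schwartz functions\<close>

text \<open>A bound on a Schwartz norm stated as a relation, so that no supremum has to be handled;
  a single index limits both the order of derivation and the power of the weight.\<close>

definition sbound :: "nat \<Rightarrow> (real^'n::finite \<Rightarrow> complex) \<Rightarrow> real \<Rightarrow> bool" where
  "sbound N \<phi> c \<longleftrightarrow> (\<forall>is x. length is \<le> N \<longrightarrow> (1 + norm x) ^ N * cmod (partials is \<phi> x) \<le> c)"

lemma sboundD: "sbound N \<phi> c \<Longrightarrow> length is \<le> N \<Longrightarrow> (1 + norm x) ^ N * cmod (partials is \<phi> x) \<le> c"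
  by (simp add: sbound_def)

lemma sbound_nonneg: "sbound N \<phi> c \<Longrightarrow> 0 \<le> c"
  using sboundD[of N \<phi> c "[]" 0] by (simp add: order_trans[OF norm_ge_zero])

lemma sboundD':
  assumes "sbound N \<phi> c" "length is \<le> N" "k \<le> N"
  shows "(1 + norm x) ^ k * cmod (partials is \<phi> x) \<le> c"
proof -
  have "(1 + norm x) ^ k * cmod (partials is \<phi> x) \<le> (1 + norm x) ^ N * cmod (partials is \<phi> x)"
    by (intro mult_right_mono power_increasing assms) auto
  with sboundD[OF assms(1,2), of x] show ?thesis by simp
qed

lemma sbound_mono: "sbound N \<phi> c \<Longrightarrow> M \<le> N \<Longrightarrow> c \<le> d \<Longrightarrow> sbound M \<phi> d"
  unfolding sbound_def[of M] by (meson sboundD' order_trans le_trans)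

lemma sbound_partial:
  fixes \<phi> :: "real^'n::finite \<Rightarrow> complex"
  shows "sbound (Suc N) \<phi> c \<Longrightarrow> sbound N (partial i \<phi>) c"
  unfolding sbound_def[of N]
proof (intro allI impI)
  fix "is" :: "'n list" and x assume *: "sbound (Suc N) \<phi> c" "length is \<le> N"
  show "(1 + norm x) ^ N * cmod (partials is (partial i \<phi>) x) \<le> c"
    using sboundD'[OF *(1), of "is @ [i]" N x] *(2) by (simp add: partials_append)
qed

lemma finite_short_lists: "finite {is::'n::finite list. length is \<le> N}"
  using finite_lists_length_le[of "UNIV::'n set" N] by simp

lemma schwartz_smooth: "\<phi> \<in> schwartz_space \<Longrightarrow> smooth \<phi>"
  by (simp add: schwartz_space_def)

lemma schwartz_sbound:
  assumes "\<phi> \<in> schwartz_space"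
  shows "\<exists>c. sbound N \<phi> c"
proof -
  have "\<exists>c. \<forall>x. (1 + norm x) ^ N * cmod (partials is \<phi> x) \<le> c" for "is"
    using assms by (fastforce simp: schwartz_space_def bdd_above_def)
  then obtain c where c: "\<And>is x. (1 + norm x) ^ N * cmod (partials is \<phi> x) \<le> c is" by metis
  have "sbound N \<phi> (\<Sum>is\<in>{is. length is \<le> N}. \<bar>c is\<bar>)"
    unfolding sbound_def
  proof (intro allI impI)
    fix "is" x assume "length (is::'a list) \<le> N"
    then have "\<bar>c is\<bar> \<le> (\<Sum>is\<in>{is. length is \<le> N}. \<bar>c is\<bar>)"
      by (intro member_le_sum) (auto simp: finite_short_lists)
    with c[of x "is"] show "(1 + norm x) ^ N * cmod (partials is \<phi> x) \<le> (\<Sum>is\<in>{is. length is \<le> N}. \<bar>c is\<bar>)"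
      by linarith
  qed
  then show ?thesis ..
qed

lemma schwartzI:
  fixes \<phi> :: "real^'n::finite \<Rightarrow> complex"
  assumes "smooth \<phi>" "\<And>N. \<exists>c. sbound N \<phi> c"
  shows "\<phi> \<in> schwartz_space"
  unfolding schwartz_space_def
proof (intro CollectI conjI assms(1) allI)
  fix k and "is" :: "'n list"
  obtain c where "sbound (max k (length is)) \<phi> c" using assms(2) by blast
  then show "bdd_above (range (\<lambda>x. (1 + norm x) ^ k * cmod (partials is \<phi> x)))"
    by (intro bdd_aboveI2[of _ _ c] sboundD') auto
qed

lemma schwartz_partials: "\<phi> \<in> schwartz_space \<Longrightarrow> partials js \<phi> \<in> schwartz_space"
  by (auto simp: schwartz_space_def smooth_partials simp flip: partials_append)

lemma schwartz_partial: "\<phi> \<in> schwartz_space \<Longrightarrow> partial i \<phi> \<in> schwartz_space"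
  using schwartz_partials[of \<phi> "[i]"] by simp

lemma schwartz_lincomb:
  fixes \<phi> :: "real^'n::finite \<Rightarrow> complex"
  assumes "\<phi> \<in> schwartz_space" "\<theta> \<in> schwartz_space"
  shows "(\<lambda>x. a * \<phi> x + b * \<theta> x) \<in> schwartz_space"
proof (rule schwartzI)
  note sm = schwartz_smooth[OF assms(1)] schwartz_smooth[OF assms(2)]
  show "smooth (\<lambda>x. a * \<phi> x + b * \<theta> x)" by (intro smooth_lincomb sm)
  fix N
  obtain c d where c: "sbound N \<phi> c" and d: "sbound N \<theta> d" using schwartz_sbound assms by blast
  have "sbound N (\<lambda>x. a * \<phi> x + b * \<theta> x) (cmod a * c + cmod b * d)"
    unfolding sbound_def partials_lincomb[OF sm]
  proof (intro allI impI)
    fix "is" :: "'n list" and x assume l: "length is \<le> N"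
    have "(1 + norm x) ^ N * cmod (a * partials is \<phi> x + b * partials is \<theta> x)
       \<le> (1 + norm x) ^ N * (cmod a * cmod (partials is \<phi> x) + cmod b * cmod (partials is \<theta> x))"
      by (intro mult_left_mono) (auto simp: norm_mult intro: order_trans[OF norm_triangle_ineq])
    also have "\<dots> = cmod a * ((1 + norm x) ^ N * cmod (partials is \<phi> x)) + cmod b * ((1 + norm x) ^ N * cmod (partials is \<theta> x))"
      by (simp add: algebra_simps)
    also have "\<dots> \<le> cmod a * c + cmod b * d"
      by (intro add_mono mult_left_mono sboundD[OF c l] sboundD[OF d l]) auto
    finally show "(1 + norm x) ^ N * cmod (a * partials is \<phi> x + b * partials is \<theta> x) \<le> cmod a * c + cmod b * d" .
  qed
  then show "\<exists>c. sbound N (\<lambda>x. a * \<phi> x + b * \<theta> x) c" ..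
qed

lemma schwartz_scale: "\<phi> \<in> schwartz_space \<Longrightarrow> (\<lambda>x. a * \<phi> x) \<in> schwartz_space"
  using schwartz_lincomb[of \<phi> \<phi> a 0] by simp

lemma schwartz_add: "\<phi> \<in> schwartz_space \<Longrightarrow> \<theta> \<in> schwartz_space \<Longrightarrow> (\<lambda>x. \<phi> x + \<theta> x) \<in> schwartz_space"
  using schwartz_lincomb[of \<phi> \<theta> 1 1] by simp

lemma schwartz_diff: "\<phi> \<in> schwartz_space \<Longrightarrow> \<theta> \<in> schwartz_space \<Longrightarrow> (\<lambda>x. \<phi> x - \<theta> x) \<in> schwartz_space"
  using schwartz_lincomb[of \<phi> \<theta> 1 "-1"] by simp

lemma schwartz_zero [simp]: "(\<lambda>x::real^'n::finite. 0) \<in> schwartz_space"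
proof (rule schwartzI)
  let ?G = "\<lambda>(is::'n list) (x::real^'n). 0 :: complex"
  have G: "(?G is has_derivative grad_form (\<lambda>i. ?G (i # is) x)) (at x)" for "is" x
    by (simp add: grad_form_def[abs_def])
  show "smooth (\<lambda>x::real^'n. 0)" using smoothI[of ?G, OF G] by simp
  show "\<exists>c. sbound N (\<lambda>x::real^'n. 0) c" for N
    using partials_eqI[of ?G, OF G] by (auto simp: sbound_def)
qed

text \<open>Peetre's inequality in its simplest form: it is why Schwartz bounds of translates grow
  only polynomially with the translation.\<close>

lemma one_plus_norm_add: "1 + norm (x + y) \<le> (1 + norm x) * (1 + norm (y::'a::real_normed_vector))"
proof -
  have "0 \<le> norm x * norm y" by simp
  moreover have "(1 + norm x) * (1 + norm y) = 1 + norm x + norm y + norm x * norm y"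
    by (simp add: algebra_simps)
  ultimately show ?thesis using norm_triangle_ineq[of x y] by linarith
qed

text \<open>\<sigma> = 1 is translation and \<sigma> = -1 reflection. The factors from the chain
  rule have modulus 1, and \<open>one_plus_norm_add\<close> moves the weight from x to the image
  point.\<close>

lemma sbound_affine:
  assumes "smooth \<phi>" "sbound N \<phi> c" "\<bar>\<sigma>\<bar> = 1"
  shows "sbound N (\<lambda>x. \<phi> (h + \<sigma> *\<^sub>R x)) ((1 + norm h) ^ N * c)"
  unfolding sbound_def partials_affine[OF assms(1)]
proof (intro allI impI)
  fix "is" :: "'a list" and x assume l: "length is \<le> N"
  have "1 + norm x \<le> (1 + norm h) * (1 + norm (h + \<sigma> *\<^sub>R x))"
    using one_plus_norm_add[of "-h" "h + \<sigma> *\<^sub>R x"] assms(3) by simp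
  then have "(1 + norm x) ^ N \<le> (1 + norm h) ^ N * (1 + norm (h + \<sigma> *\<^sub>R x)) ^ N"
    by (metis power_mono power_mult_distrib add_nonneg_nonneg norm_ge_zero zero_le_one)
  then have "(1 + norm x) ^ N * cmod (partials is \<phi> (h + \<sigma> *\<^sub>R x)) \<le>
     (1 + norm h) ^ N * (1 + norm (h + \<sigma> *\<^sub>R x)) ^ N * cmod (partials is \<phi> (h + \<sigma> *\<^sub>R x))"
    by (intro mult_right_mono) auto
  also have "\<dots> \<le> (1 + norm h) ^ N * c"
    using sboundD[OF assms(2) l, of "h + \<sigma> *\<^sub>R x"] by (simp add: mult.assoc mult_left_mono)
  finally show "(1 + norm x) ^ N * cmod (complex_of_real \<sigma> ^ length is * partials is \<phi> (h + \<sigma> *\<^sub>R x)) \<le> (1 + norm h) ^ N * c"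
    using assms(3) by (simp add: norm_mult norm_power)
qed

lemma schwartz_affine:
  assumes "\<phi> \<in> schwartz_space" "\<bar>\<sigma>\<bar> = 1"
  shows "(\<lambda>x. \<phi> (h + \<sigma> *\<^sub>R x)) \<in> schwartz_space"
proof (rule schwartzI)
  show "smooth (\<lambda>x. \<phi> (h + \<sigma> *\<^sub>R x))"
    using assms(1) by (intro smooth_affine schwartz_smooth)
  show "\<exists>c. sbound N (\<lambda>x. \<phi> (h + \<sigma> *\<^sub>R x)) c" for N
    using schwartz_sbound[OF assms(1), of N] sbound_affine[OF schwartz_smooth[OF assms(1)] _ assms(2)]
    by blast
qed

lemma schwartz_translate: "\<phi> \<in> schwartz_space \<Longrightarrow> (\<lambda>x. \<phi> (x + h)) \<in> schwartz_space"
  using schwartz_affine[of \<phi> 1 h] by (simp add: add.commute)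

lemma schwartz_translate_iff: "(\<lambda>x. \<phi> (x - h)) \<in> schwartz_space \<longleftrightarrow> \<phi> \<in> schwartz_space"
  using schwartz_translate[of "\<lambda>x. \<phi> (x - h)" h] schwartz_translate[of \<phi> "-h"] by auto

lemma partials_translate: "smooth \<phi> \<Longrightarrow> partials is (\<lambda>x. \<phi> (x + h)) = (\<lambda>x. partials is \<phi> (x + h))"
  using partials_affine[of \<phi> "is" h 1] by (simp add: add.commute)

text \<open>One order is lost to the mean value inequality along the segment from x to x + h. As |h|
  \<le> 1, the weight at x is at most 2^N times the weight at any point of the segment, which
  explains the constant.\<close>

lemma sbound_translate_diff:
  fixes \<phi> :: "real^'n::finite \<Rightarrow> complex"
  assumes sm: "smooth \<phi>" and c: "sbound (Suc N) \<phi> c" and h: "norm h \<le> 1"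
  shows "sbound N (\<lambda>x. \<phi> (x + h) - \<phi> x) (2 ^ N * real CARD('n) * c * norm h)"
proof -
  have eq: "partials is (\<lambda>x. \<phi> (x + h) - \<phi> x) = (\<lambda>x. partials is \<phi> (x + h) - partials is \<phi> x)" for "is"
    using partials_lincomb[of "\<lambda>x. \<phi> (x + h)" \<phi> "is" 1 "-1"] smooth_affine[of \<phi> h 1] sm
    by (simp add: add.commute partials_translate)
  show ?thesis
    unfolding sbound_def eq
  proof (intro allI impI)
    fix "is" :: "'n list" and x assume l: "length is \<le> N"
    have K: "cmod (partials (i # is) \<phi> (x + t *\<^sub>R h)) \<le> 2 ^ N * c / (1 + norm x) ^ N" if "0 \<le> t" "t \<le> 1" for t i
    proof -
      have "norm (t *\<^sub>R h) \<le> 1" using that h by (simp add: mult_le_one)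
      moreover have "norm x \<le> norm (x + t *\<^sub>R h) + norm (t *\<^sub>R h)"
        using norm_triangle_ineq4[of "x + t *\<^sub>R h" "t *\<^sub>R h"] by (simp only: add_diff_cancel_right')
      moreover have "1 + a \<le> 2 * (1 + b)" if "d \<le> 1" "a \<le> b + d" "0 \<le> b" for a b d :: real
        using that by argo
      ultimately have "1 + norm x \<le> 2 * (1 + norm (x + t *\<^sub>R h))"
        using norm_ge_zero by blast
      then have "(1 + norm x) ^ N \<le> 2 ^ N * (1 + norm (x + t *\<^sub>R h)) ^ N"
        by (metis power_mono power_mult_distrib add_nonneg_nonneg norm_ge_zero zero_le_one)
      then have "(1 + norm x) ^ N * cmod (partials (i # is) \<phi> (x + t *\<^sub>R h)) \<le>
         2 ^ N * (1 + norm (x + t *\<^sub>R h)) ^ N * cmod (partials (i # is) \<phi> (x + t *\<^sub>R h))"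
        by (intro mult_right_mono) auto
      also have "\<dots> \<le> 2 ^ N * c"
        using sboundD'[OF c, of "i # is" N "x + t *\<^sub>R h"] l by (simp add: mult.assoc)
      finally show ?thesis
        by (simp add: pos_le_divide_eq add_pos_nonneg mult.commute)
    qed
    have "cmod (partials is \<phi> (x + h) - partials is \<phi> x - 0) \<le> real CARD('n) * (2 ^ N * c / (1 + norm x) ^ N) * norm h"
    proof (rule derivative_line_bound[where f' = "\<lambda>y. grad_form (\<lambda>i. partials (i # is) \<phi> y)"])
      fix t :: real assume t: "0 \<le> t" "t \<le> 1"
      show "(partials is \<phi> has_derivative grad_form (\<lambda>i. partials (i # is) \<phi> (x + t *\<^sub>R h))) (at (x + t *\<^sub>R h))"
        by (rule smooth_derivative[OF sm])
      show "cmod (grad_form (\<lambda>i. partials (i # is) \<phi> (x + t *\<^sub>R h)) h - 0)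
          \<le> real CARD('n) * (2 ^ N * c / (1 + norm x) ^ N) * norm h"
        unfolding diff_zero using K[OF t] by (rule norm_grad_form_le)
    qed
    then show "(1 + norm x) ^ N * cmod (partials is \<phi> (x + h) - partials is \<phi> x) \<le> 2 ^ N * real CARD('n) * c * norm h"
      by (simp add: field_simps add_pos_nonneg)
  qed
qed

lemma schwartz_continuous_on: "\<phi> \<in> schwartz_space \<Longrightarrow> continuous_on S \<phi>"
  by (intro continuous_at_imp_continuous_on ballI differentiable_imp_continuous_within)
    (auto dest!: schwartz_smooth spec[of _ "[]"] simp: smooth_def)

lemma schwartz_measurable: "\<phi> \<in> schwartz_space \<Longrightarrow> \<phi> \<in> borel_measurable borel"
  by (intro borel_measurable_continuous_onI schwartz_continuous_on)

lemma sbound_weight: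
  fixes \<phi> :: "real^'n::finite \<Rightarrow> complex"
  assumes "sbound (k + 2 * CARD('n)) \<phi> c"
  shows "(1 + norm x) ^ k * cmod (\<phi> x) \<le> c * weight x"
  using sboundD[OF assms, of "[]" x] by (intro weight_power) simp

lemma integrable_poly_growth_schwartz:
  fixes \<phi> :: "real^'n::finite \<Rightarrow> complex"
  assumes \<phi>: "\<phi> \<in> schwartz_space" and m: "m \<in> borel_measurable borel"
    and b: "\<And>x. cmod (m x) \<le> K * (1 + norm x) ^ k"
  shows "integrable lborel (\<lambda>x. m x * \<phi> x)"
proof -
  obtain c where c: "sbound (k + 2 * CARD('n)) \<phi> c" using schwartz_sbound[OF \<phi>] by blast
  have [measurable]: "\<phi> \<in> borel_measurable borel" "m \<in> borel_measurable borel"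
    using \<phi> m by (auto intro: schwartz_measurable)
  have "cmod (m 0) \<le> K" using b[of 0] by simp
  then have K: "0 \<le> K" using norm_ge_zero order_trans by blast
  show ?thesis
  proof (rule Bochner_Integration.integrable_bound)
    show "integrable lborel (\<lambda>x::real^'n. K * c * weight x)"
      by (simp add: integrable_weight)
    show "AE x in lborel. norm (m x * \<phi> x) \<le> norm (K * c * weight x)"
    proof (rule AE_I2)
      fix x
      have "norm (m x * \<phi> x) \<le> K * (1 + norm x) ^ k * cmod (\<phi> x)"
        by (simp add: norm_mult b mult_right_mono)
      also have "\<dots> \<le> K * (c * weight x)"
        using sbound_weight[OF c, of x] K by (simp add: mult.assoc mult_left_mono)
      finally show "norm (m x * \<phi> x) \<le> norm (K * c * weight x)"
        by (simp add: mult.assoc)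
    qed
  qed simp
qed

section \<open>Seminorm topologies\<close>

text \<open>By homogeneity: a small multiple of \<open>u\<close> lies in the neighbourhood
  \<open>U\<close> of 0, where \<rho> is below 1. An arbitrary homogeneous \<rho> is allowed, so
  that the lemma covers functionals as well as the norm of an embedded function.\<close>

lemma seminorm_bound_of_open:
  assumes op: "openin (seminorm_topology V P) U" and zero: "(\<lambda>x. 0) \<in> U"
    and U: "\<And>u. u \<in> U \<Longrightarrow> \<rho> u < (1::real)"
    and V: "\<And>c u. u \<in> V \<Longrightarrow> (\<lambda>x. c * u x) \<in> V"
    and P: "\<And>q u c. q \<in> P \<Longrightarrow> u \<in> V \<Longrightarrow> q (\<lambda>x. c * u x) \<le> cmod c * q u"
    and P0: "\<And>q u. q \<in> P \<Longrightarrow> u \<in> V \<Longrightarrow> 0 \<le> q u"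
    and \<rho>: "\<And>u c. u \<in> V \<Longrightarrow> \<rho> (\<lambda>x. c * u x) = cmod c * \<rho> u"
  shows "\<exists>Q C. finite Q \<and> Q \<subseteq> P \<and> 0 \<le> C \<and> (\<forall>u\<in>V. \<rho> u \<le> C * (\<Sum>q\<in>Q. q u))"
proof -
  obtain Q e where Q: "finite Q" "Q \<subseteq> P" "0 < e"
    and sub: "{v\<in>V. \<forall>q\<in>Q. q (\<lambda>x. v x - 0) < e} \<subseteq> U"
    using iffD1[OF openin_seminorm_topology op, THEN conjunct2, THEN bspec, OF zero]
    by (elim exE conjE)
  have small: "\<rho> v < 1" if "v \<in> V" "\<And>q. q \<in> Q \<Longrightarrow> q v < e" for v
    using that sub U by auto
  \<comment> \<open>Scaling \<open>u\<close> by e / (2 s), with s the sum of the seminorms, keeps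
    each of them strictly below e; this is where the 2 comes from.\<close>
  have "\<rho> u \<le> (2 / e) * (\<Sum>q\<in>Q. q u)" if u: "u \<in> V" for u
  proof -
    let ?s = "\<Sum>q\<in>Q. q u"
    have qs: "q u \<le> ?s" if "q \<in> Q" for q
      using that Q P0 u by (intro member_le_sum) auto
    have s0: "0 \<le> ?s" using P0 u Q by (intro sum_nonneg) auto
    have bd: "t * \<rho> u < 1" if t: "0 \<le> t" "t * ?s < e" for t
    proof -
      have "\<rho> (\<lambda>x. complex_of_real t * u x) < 1"
      proof (rule small)
        show "(\<lambda>x. complex_of_real t * u x) \<in> V" using V u by blast
        fix q assume q: "q \<in> Q"
        have "q (\<lambda>x. complex_of_real t * u x) \<le> t * q u"
          using P[of q u "complex_of_real t"] q Q u t by auto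
        also have "\<dots> \<le> t * ?s" using qs[OF q] t by (intro mult_left_mono)
        finally show "q (\<lambda>x. complex_of_real t * u x) < e" using t by linarith
      qed
      then show ?thesis using \<rho>[OF u, of "complex_of_real t"] t by simp
    qed
    show ?thesis
    proof (cases "?s = 0")
      \<comment> \<open>All nonnegative multiples of \<open>u\<close> now lie in \<open>U\<close>,
        so a positive \<open>\<rho> u\<close> could be scaled to exactly 1.\<close>
      case True
      have "\<rho> u \<le> 0"
      proof (rule ccontr)
        assume "\<not> \<rho> u \<le> 0"
        then show False using bd[of "1 / \<rho> u"] True Q(3) by simp
      qed
      with True show ?thesis by simp
    next
      case False
      with s0 have s: "0 < ?s" by linarith
      have "(e / (2 * ?s)) * \<rho> u < 1"
        by (rule bd) (use s Q(3) in auto)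
      then have "\<rho> u < 2 * ?s / e"
        using s Q(3) by (simp add: field_simps)
      then show ?thesis by simp
    qed
  qed
  then show ?thesis
    using Q by (intro exI[of _ Q] exI[of _ "2 / e"]) auto
qed

lemma
  assumes V: "complex_subspace V" and u: "u \<in> V"
  shows subspace_scale: "(\<lambda>x. c * u x) \<in> V"
    and subspace_add: "v \<in> V \<Longrightarrow> (\<lambda>x. u x + v x) \<in> V"
    and subspace_diff: "v \<in> V \<Longrightarrow> (\<lambda>x. u x - v x) \<in> V"
proof -
  have a: "(\<lambda>x. u x + v x) \<in> V" if "u \<in> V" "v \<in> V" for u v
    by (rule V[unfolded complex_subspace_def, THEN conjunct2, THEN conjunct1, THEN bspec, OF that(1), THEN bspec, OF that(2)])
  have s: "(\<lambda>x. c * u x) \<in> V" if "u \<in> V" for c u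
    by (rule V[unfolded complex_subspace_def, THEN conjunct2, THEN conjunct2, THEN spec, THEN bspec, OF that])
  show "(\<lambda>x. c * u x) \<in> V" using u by (rule s)
  show "(\<lambda>x. u x + v x) \<in> V" if "v \<in> V" using u that by (rule a)
  show "(\<lambda>x. u x - v x) \<in> V" if "v \<in> V"
    using a[OF u s[OF that, of "-1"]] by simp
qed

lemma subspace_zero: "complex_subspace V \<Longrightarrow> (\<lambda>x. 0) \<in> V"
  by (simp add: complex_subspace_def)

lemma continuous_dualI:
  assumes V: "complex_subspace V" and p: "p \<in> P" and C: "\<And>u. u \<in> V \<Longrightarrow> cmod (f u) \<le> C * p u"
    and add: "\<And>u v. u \<in> V \<Longrightarrow> v \<in> V \<Longrightarrow> f (\<lambda>x. u x + v x) = f u + f v"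
    and scale: "\<And>c u. u \<in> V \<Longrightarrow> f (\<lambda>x. c * u x) = c * f u"
    and out: "\<And>u. u \<notin> V \<Longrightarrow> f u = 0"
    and p0: "\<And>u. u \<in> V \<Longrightarrow> 0 \<le> p u"
  shows "f \<in> continuous_dual V P"
proof -
  have diff: "(\<lambda>x. u x - v x) \<in> V \<and> f (\<lambda>x. u x - v x) = f u - f v" if uv: "u \<in> V" "v \<in> V" for u v
  proof -
    have m: "(\<lambda>x. (-1) * v x) \<in> V" by (rule subspace_scale[OF V uv(2)])
    have "f (\<lambda>x. u x + (-1) * v x) = f u - f v"
      using add[OF uv(1) m] scale[OF uv(2), of "-1"] by simp
    then show ?thesis using subspace_diff[OF V uv] by simp
  qed
  have "openin (seminorm_topology V P) {u \<in> V. f u \<in> W}" if W: "open W" for W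
    unfolding openin_seminorm_topology
  proof (intro conjI ballI)
    fix u assume u: "u \<in> {u \<in> V. f u \<in> W}"
    then obtain r where r: "0 < r" "ball (f u) r \<subseteq> W"
      using W open_contains_ball by blast
    \<comment> \<open>\<open>C\<close> may be 0 or negative, hence the division by \<bar>C\<bar> +
      1.\<close>
    let ?e = "r / (\<bar>C\<bar> + 1)"
    have "f v \<in> W" if v: "v \<in> V" "p (\<lambda>x. v x - u x) < ?e" for v
    proof -
      let ?w = "\<lambda>x. v x - u x"
      have w: "?w \<in> V" "f ?w = f v - f u" using diff[of v u] u v by auto
      have "cmod (f v - f u) \<le> C * p ?w" using C[OF w(1)] w(2) by simp
      also have "\<dots> \<le> (\<bar>C\<bar> + 1) * p ?w"
        using p0[OF w(1)] by (intro mult_right_mono) auto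
      also have "\<dots> < r" using v(2) by (simp add: field_simps)
      finally show ?thesis using r by (auto simp: dist_norm norm_minus_commute)
    qed
    then show "\<exists>Q e. finite Q \<and> Q \<subseteq> P \<and> 0 < e \<and> {v\<in>V. \<forall>q\<in>Q. q (\<lambda>x. v x - u x) < e} \<subseteq> {u \<in> V. f u \<in> W}"
      using r p by (intro exI[of _ "{p}"] exI[of _ ?e]) auto
  qed blast
  then have "continuous_map (seminorm_topology V P) euclidean f"
    by (simp add: continuous_map_def)
  with add scale out show ?thesis
    by (simp add: continuous_dual_def)
qed

text \<open>A singleton is a bounded set, so evaluation at \<open>u\<close> is controlled by one of
  the strong seminorms.\<close>

lemma open_pointwise_strong_dual:
  assumes u: "u \<in> V"
  shows "openin (strong_dual_topology V P) {f \<in> continuous_dual V P. cmod (f u) < 1}"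
  unfolding strong_dual_topology_def openin_seminorm_topology
proof (intro conjI ballI)
  fix f assume f: "f \<in> {f \<in> continuous_dual V P. cmod (f u) < 1}"
  let ?q = "\<lambda>f. SUP v\<in>{u}. cmod (f v)"
  have "?q \<in> strong_seminorms V P"
    unfolding strong_seminorms_def using u by (auto simp: bounded_sets_def intro!: exI[of _ "{u}"])
  moreover have "cmod (g u) < 1" if "cmod (g u - f u) < 1 - cmod (f u)" for g
    using that norm_triangle_ineq2[of "g u" "f u"] by linarith
  ultimately show "\<exists>Q e. finite Q \<and> Q \<subseteq> strong_seminorms V P \<and> 0 < e \<and>
     {v \<in> continuous_dual V P. \<forall>q\<in>Q. q (\<lambda>x. v x - f x) < e} \<subseteq> {f \<in> continuous_dual V P. cmod (f u) < 1}"
    using f by (intro exI[of _ "{?q}"] exI[of _ "1 - cmod (f u)"]) auto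
qed blast

text \<open>Every strong seminorm is a supremum over a set on which \<open>p\<close> is bounded; an
  error of size \<open>e y * p u\<close> with \<open>e\<close> tending to 0 is therefore uniformly
  small there.\<close>

lemma limitin_strong_dual:
  assumes L: "L \<in> continuous_dual V P" and G: "\<forall>\<^sub>F y in F. G y \<in> continuous_dual V P"
    and p: "p \<in> P" and e: "(e \<longlongrightarrow> 0) F"
    and bnd: "\<forall>\<^sub>F y in F. \<forall>u\<in>V. cmod (G y u - L u) \<le> e y * p u"
    and p0: "\<And>u. u \<in> V \<Longrightarrow> 0 \<le> p u"
  shows "limitin (strong_dual_topology V P) G L F"
  unfolding limitin_def
proof (intro conjI allI impI)
  show "L \<in> topspace (strong_dual_topology V P)"
    using L by (simp add: strong_dual_topology_def)
  fix U assume "openin (strong_dual_topology V P) U \<and> L \<in> U"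
  then obtain Q d where Q: "finite Q" "Q \<subseteq> strong_seminorms V P" "0 < d"
    and sub: "{v\<in>continuous_dual V P. \<forall>q\<in>Q. q (\<lambda>x. v x - L x) < d} \<subseteq> U"
    unfolding strong_dual_topology_def openin_seminorm_topology by blast
  have "\<forall>\<^sub>F y in F. q (\<lambda>x. G y x - L x) < d" if q: "q \<in> Q" for q
  proof -
    obtain B where B: "B \<in> bounded_sets V P" "B \<noteq> {}" and qB: "q = (\<lambda>f. SUP u\<in>B. cmod (f u))"
      using q Q(2) unfolding strong_seminorms_def by blast
    obtain M where M: "\<And>u. u \<in> B \<Longrightarrow> p u \<le> M"
      using B(1) p unfolding bounded_sets_def bdd_above_def by blast
    have BV: "B \<subseteq> V" using B(1) by (simp add: bounded_sets_def)
    have "((\<lambda>y. \<bar>e y\<bar> * \<bar>M\<bar>) \<longlongrightarrow> \<bar>0\<bar> * \<bar>M\<bar>) F"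
      by (intro tendsto_intros e)
    then have "\<forall>\<^sub>F y in F. \<bar>e y\<bar> * \<bar>M\<bar> < d"
      using Q(3) by (intro order_tendstoD(2)) auto
    with bnd show ?thesis
    proof eventually_elim
      case (elim y)
      have "cmod (G y u - L u) \<le> \<bar>e y\<bar> * \<bar>M\<bar>" if u: "u \<in> B" for u
      proof -
        have "cmod (G y u - L u) \<le> e y * p u" using elim u BV by blast
        also have "\<dots> \<le> \<bar>e y\<bar> * \<bar>M\<bar>"
          using M[OF u] p0[of u] u BV by (intro mult_mono) auto
        finally show ?thesis .
      qed
      then have "q (\<lambda>x. G y x - L x) \<le> \<bar>e y\<bar> * \<bar>M\<bar>"
        unfolding qB using B(2) by (intro cSUP_least) auto
      with elim show ?case by linarith
    qed
  qed
  then have "\<forall>\<^sub>F y in F. \<forall>q\<in>Q. q (\<lambda>x. G y x - L x) < d"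
    using Q(1) by (simp add: eventually_ball_finite)
  with G show "\<forall>\<^sub>F y in F. G y \<in> U"
    by eventually_elim (use sub in auto)
qed

lemma schwartz_seminorm_scale:
  assumes q: "q \<in> schwartz_seminorms" and u: "u \<in> schwartz_space"
  shows "q (\<lambda>x. c * u x) \<le> cmod c * q u" "0 \<le> q u"
proof -
  obtain k "is" where qe: "q = (\<lambda>\<phi>. SUP x. (1 + norm x) ^ k * cmod (partials is \<phi> x))"
    using q unfolding schwartz_seminorms_def by blast
  have bdd: "bdd_above (range (\<lambda>x. (1 + norm x) ^ k * cmod (partials is u x)))"
    using u by (simp add: schwartz_space_def)
  have le: "(1 + norm x) ^ k * cmod (partials is u x) \<le> q u" for x
    unfolding qe by (rule cSUP_upper[OF _ bdd]) simp
  have eq: "partials is (\<lambda>x. c * u x) = (\<lambda>x. c * partials is u x)"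
    using partials_lincomb[of u u "is" c 0] schwartz_smooth[OF u] by simp
  show "q (\<lambda>x. c * u x) \<le> cmod c * q u"
    unfolding qe[THEN fun_cong, of "\<lambda>x. c * u x"] eq
  proof (rule cSUP_least)
    fix x
    show "(1 + norm x) ^ k * cmod (c * partials is u x) \<le> cmod c * q u"
      using mult_left_mono[OF le[of x], of "cmod c"] by (simp add: norm_mult mult_ac)
  qed simp
  show "0 \<le> q u"
    using order_trans[OF _ le[of 0]] by simp
qed

lemma sum_schwartz_seminorms_le_sbound:
  fixes Q :: "((real^'n::finite \<Rightarrow> complex) \<Rightarrow> real) set"
  assumes "finite Q" "Q \<subseteq> schwartz_seminorms"
  shows "\<exists>N. \<forall>\<phi>\<in>schwartz_space. \<forall>c. sbound N \<phi> c \<longrightarrow> (\<Sum>q\<in>Q. q \<phi>) \<le> real (card Q) * c"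
proof -
  have "\<forall>q\<in>Q. \<exists>N. \<forall>\<phi> c. sbound N \<phi> c \<longrightarrow> q \<phi> \<le> c"
  proof
    fix q assume "q \<in> Q"
    then obtain k "is" where qe: "q = (\<lambda>\<phi>. SUP x. (1 + norm x) ^ k * cmod (partials is \<phi> x))"
      using assms unfolding schwartz_seminorms_def by blast
    have "q \<phi> \<le> c" if "sbound (max k (length is)) \<phi> c" for \<phi> c
      unfolding qe by (rule cSUP_least) (auto intro!: sboundD'[OF that])
    then show "\<exists>N. \<forall>\<phi> c. sbound N \<phi> c \<longrightarrow> q \<phi> \<le> c" by blast
  qed
  then obtain N where N: "\<And>q \<phi> c. q \<in> Q \<Longrightarrow> sbound (N q) \<phi> c \<Longrightarrow> q \<phi> \<le> c" by metis
  have "(\<Sum>q\<in>Q. q \<phi>) \<le> real (card Q) * c" if "sbound (\<Sum>q\<in>Q. N q) \<phi> c" for \<phi> c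
  proof (rule sum_bounded_above)
    fix q assume q: "q \<in> Q"
    have "N q \<le> (\<Sum>q\<in>Q. N q)" using q assms(1) by (intro member_le_sum) auto
    then show "q \<phi> \<le> c" using N[OF q] sbound_mono[OF that] by blast
  qed
  then show ?thesis by blast
qed

lemma
  assumes f: "f \<in> continuous_dual V P"
  shows continuous_dual_add: "u \<in> V \<Longrightarrow> v \<in> V \<Longrightarrow> f (\<lambda>x. u x + v x) = f u + f v"
    and continuous_dual_scale: "u \<in> V \<Longrightarrow> f (\<lambda>x. c * u x) = c * f u"
    and continuous_dual_continuous: "continuous_map (seminorm_topology V P) euclidean f"
    and continuous_dual_outside: "u \<notin> V \<Longrightarrow> f u = 0"
proof -
  note f' = f[unfolded continuous_dual_def, THEN CollectD]
  show "f (\<lambda>x. u x + v x) = f u + f v" if "u \<in> V" "v \<in> V"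
    by (rule f'[THEN conjunct1, THEN bspec, OF that(1), THEN bspec, OF that(2)])
  show "f (\<lambda>x. c * u x) = c * f u" if "u \<in> V"
    by (rule f'[THEN conjunct2, THEN conjunct1, THEN spec, THEN bspec, OF that])
  show "continuous_map (seminorm_topology V P) euclidean f"
    by (rule f'[THEN conjunct2, THEN conjunct2, THEN conjunct1])
  show "f u = 0" if "u \<notin> V"
    by (rule f'[THEN conjunct2, THEN conjunct2, THEN conjunct2, THEN spec, THEN mp, OF that])
qed

text \<open>The second difference is an increment of an increment: the mean value inequality is
  applied along i to the increment in direction j, and then along j to
  \<open>partial i \<phi>\<close>. Continuity of the mixed derivative at x controls the
  rest.\<close>

lemma mixed_difference:
  fixes \<phi> :: "real^'n::finite \<Rightarrow> complex"
  assumes sm: "smooth \<phi>" and \<epsilon>: "0 < \<epsilon>"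
  shows "\<exists>\<delta>>0. \<forall>h. 0 < h \<longrightarrow> h < \<delta> \<longrightarrow>
    cmod (\<phi> (x + h *\<^sub>R axis i 1 + h *\<^sub>R axis j 1) - \<phi> (x + h *\<^sub>R axis i 1) - \<phi> (x + h *\<^sub>R axis j 1) + \<phi> x
       - complex_of_real (h * h) * partial j (partial i \<phi>) x) \<le> \<epsilon> * (h * h)"
proof -
  let ?ei = "axis i (1::real)" and ?ej = "axis j (1::real)"
  let ?c = "partial j (partial i \<phi>)"
  have d0: "(\<phi> has_derivative grad_form (\<lambda>i. partial i \<phi> y)) (at y)" for y
    using smooth_derivative[OF sm, of "[]"] by simp
  have d1: "(partial i \<phi> has_derivative grad_form (\<lambda>j. partial j (partial i \<phi>) y)) (at y)" for y
    using smooth_derivative[OF sm, of "[i]"] by simp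
  have "isCont ?c x"
    using smooth_derivative[OF sm, of "[j, i]" x] by (intro has_derivative_continuous) simp
  then obtain \<delta> where \<delta>: "0 < \<delta>" "\<And>y. dist y x < \<delta> \<Longrightarrow> dist (?c y) (?c x) < \<epsilon>"
    using \<epsilon> unfolding continuous_at_eps_delta by (metis dist_commute)
  \<comment> \<open>The intermediate points are reached from x by two legs of length at most h, so h
    < \<delta> / 2 keeps them within \<delta> of x.\<close>
  have "cmod (\<phi> (x + h *\<^sub>R ?ei + h *\<^sub>R ?ej) - \<phi> (x + h *\<^sub>R ?ei) - \<phi> (x + h *\<^sub>R ?ej) + \<phi> x
       - complex_of_real (h * h) * ?c x) \<le> \<epsilon> * (h * h)" if h: "0 < h" "h < \<delta> / 2" for h
  proof -
    let ?F = "\<lambda>y. \<phi> (y + h *\<^sub>R ?ej) - \<phi> y"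
    have "cmod (?F (x + h *\<^sub>R ?ei) - ?F x - complex_of_real (h * h) * ?c x) \<le> \<epsilon> * (h * h)"
    proof (rule derivative_line_bound[where f' = "\<lambda>y v. grad_form (\<lambda>i. partial i \<phi> (y + h *\<^sub>R ?ej)) v - grad_form (\<lambda>i. partial i \<phi> y) v"])
      fix t :: real assume t: "0 \<le> t" "t \<le> 1"
      let ?y = "x + t *\<^sub>R h *\<^sub>R ?ei"
      have "((\<lambda>y. \<phi> (h *\<^sub>R ?ej + 1 *\<^sub>R y)) has_derivative grad_form (\<lambda>i. complex_of_real 1 * partial i \<phi> (h *\<^sub>R ?ej + 1 *\<^sub>R ?y))) (at ?y)"
        by (rule grad_form_derivative_compose_affine) (rule d0)
      then have "((\<lambda>y. \<phi> (y + h *\<^sub>R ?ej)) has_derivative grad_form (\<lambda>i. partial i \<phi> (?y + h *\<^sub>R ?ej))) (at ?y)"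
        by (simp add: add.commute)
      from has_derivative_diff[OF this d0]
      show "(?F has_derivative (\<lambda>v. grad_form (\<lambda>i. partial i \<phi> (?y + h *\<^sub>R ?ej)) v - grad_form (\<lambda>i. partial i \<phi> ?y) v)) (at ?y)" .
            have "cmod (partial i \<phi> (?y + h *\<^sub>R ?ej) - partial i \<phi> ?y - complex_of_real h * ?c x) \<le> h * \<epsilon>"
      proof (rule derivative_line_bound[where f' = "\<lambda>z. grad_form (\<lambda>j. partial j (partial i \<phi>) z)"])
        fix s :: real assume s: "0 \<le> s" "s \<le> 1"
        let ?z = "?y + s *\<^sub>R h *\<^sub>R ?ej"
        show "(partial i \<phi> has_derivative grad_form (\<lambda>j. partial j (partial i \<phi>) ?z)) (at ?z)" by (rule d1)
        have "norm (t *\<^sub>R h *\<^sub>R ?ei) \<le> h" "norm (s *\<^sub>R h *\<^sub>R ?ej) \<le> h"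
          using t s h by (simp_all add: mult_left_le_one_le)
        then have "norm (t *\<^sub>R h *\<^sub>R ?ei + s *\<^sub>R h *\<^sub>R ?ej) < \<delta>"
          using norm_triangle_ineq[of "t *\<^sub>R h *\<^sub>R ?ei" "s *\<^sub>R h *\<^sub>R ?ej"] h(2) by argo
        then have "dist ?z x < \<delta>" by (simp add: dist_norm add.assoc)
        then have "cmod (?c ?z - ?c x) \<le> \<epsilon>" using \<delta>(2)[of ?z] by (simp add: dist_norm)
        then have "h * cmod (?c ?z - ?c x) \<le> h * \<epsilon>" using h by (intro mult_left_mono) auto
        moreover have "complex_of_real h * ?c ?z - complex_of_real h * ?c x = complex_of_real h * (?c ?z - ?c x)"
          by (simp add: right_diff_distrib)
        ultimately show "cmod (grad_form (\<lambda>j. partial j (partial i \<phi>) ?z) (h *\<^sub>R ?ej) - complex_of_real h * ?c x) \<le> h * \<epsilon>"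
          using h unfolding grad_form_scaleR_axis by (simp add: norm_mult)
      qed
      then have "h * cmod (partial i \<phi> (?y + h *\<^sub>R ?ej) - partial i \<phi> ?y - complex_of_real h * ?c x) \<le> h * (h * \<epsilon>)"
        using h by (intro mult_left_mono) auto
      moreover have "complex_of_real h * partial i \<phi> (?y + h *\<^sub>R ?ej) - complex_of_real h * partial i \<phi> ?y - complex_of_real (h * h) * ?c x
         = complex_of_real h * (partial i \<phi> (?y + h *\<^sub>R ?ej) - partial i \<phi> ?y - complex_of_real h * ?c x)"
        by (simp add: algebra_simps)
      ultimately show "cmod (grad_form (\<lambda>i. partial i \<phi> (?y + h *\<^sub>R ?ej)) (h *\<^sub>R ?ei) - grad_form (\<lambda>i. partial i \<phi> ?y) (h *\<^sub>R ?ei)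
          - complex_of_real (h * h) * ?c x) \<le> \<epsilon> * (h * h)"
        using h unfolding grad_form_scaleR_axis by (simp add: norm_mult mult_ac)
    qed
    then show ?thesis by (simp add: algebra_simps)
  qed
  with \<delta>(1) show ?thesis by (intro exI[of _ "\<delta> / 2"]) auto
qed

text \<open>Both mixed partial derivatives are limits of one second difference quotient, which is symmetric.\<close>

lemma partial_commute:
  fixes \<phi> :: "real^'n::finite \<Rightarrow> complex"
  assumes sm: "smooth \<phi>"
  shows "partial i (partial j \<phi>) = partial j (partial i \<phi>)"
proof (rule ext, rule ccontr)
  fix x assume ne: "partial i (partial j \<phi>) x \<noteq> partial j (partial i \<phi>) x"
  let ?a = "partial i (partial j \<phi>) x" and ?b = "partial j (partial i \<phi>) x"
  \<comment> \<open>With a quarter of the gap, the two errors together fill at most half of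
    it.\<close>
  define \<epsilon> where "\<epsilon> = cmod (?a - ?b) / 4"
  have \<epsilon>: "0 < \<epsilon>" using ne by (simp add: \<epsilon>_def)
  let ?D = "\<lambda>i j h. \<phi> (x + h *\<^sub>R axis i 1 + h *\<^sub>R axis j 1) - \<phi> (x + h *\<^sub>R axis i 1) - \<phi> (x + h *\<^sub>R axis j 1) + \<phi> x"
  obtain d1 where d1: "0 < d1" "\<And>h. 0 < h \<Longrightarrow> h < d1 \<Longrightarrow> cmod (?D i j h - complex_of_real (h * h) * ?b) \<le> \<epsilon> * (h * h)"
    using mixed_difference[OF sm \<epsilon>, of x i j] by blast
  obtain d2 where d2: "0 < d2" "\<And>h. 0 < h \<Longrightarrow> h < d2 \<Longrightarrow> cmod (?D j i h - complex_of_real (h * h) * ?a) \<le> \<epsilon> * (h * h)"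
    using mixed_difference[OF sm \<epsilon>, of x j i] by blast
  define h where "h = min d1 d2 / 2"
  have h: "0 < h" "h < d1" "h < d2" using d1(1) d2(1) by (auto simp: h_def)
  have sym: "?D i j h = ?D j i h" by (simp add: algebra_simps)
  have "complex_of_real (h * h) * (?a - ?b) = (?D i j h - complex_of_real (h * h) * ?b) - (?D j i h - complex_of_real (h * h) * ?a)"
    unfolding sym by (simp add: algebra_simps)
  then have "cmod (complex_of_real (h * h) * (?a - ?b)) \<le> \<epsilon> * (h * h) + \<epsilon> * (h * h)"
    using order_trans[OF norm_triangle_ineq4 add_mono[OF d1(2)[OF h(1,2)] d2(2)[OF h(1,3)]]]
    by (simp only:)
  then have "(h * h) * cmod (?a - ?b) \<le> (h * h) * (2 * \<epsilon>)"
    using h(1) by (simp add: norm_mult mult_ac)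
  then have "cmod (?a - ?b) \<le> 2 * \<epsilon>"
    using h(1) by (simp add: mult_le_cancel_left)
  then show False using \<epsilon> by (simp add: \<epsilon>_def)
qed

lemma partials_partial:
  assumes "smooth \<phi>"
  shows "partials is (partial i \<phi>) = partial i (partials is \<phi>)"
proof (induction "is")
  case (Cons j "is")
  then show ?case using partial_commute[OF smooth_partials[OF assms], of j i "is"] by simp
qed simp

text \<open>The Taylor inequality needs the increment of \<open>partial i \<phi>\<close>, which
  \<open>sbound_translate_diff\<close> estimates; hence two orders are lost. Since partial
  derivatives commute, the derivatives of the remainder are the remainders of the
  derivatives.\<close>

lemma sbound_translate_taylor:
  fixes \<phi> :: "real^'n::finite \<Rightarrow> complex"
  assumes sm: "smooth \<phi>" and c: "sbound (Suc (Suc N)) \<phi> c" and t: "\<bar>t\<bar> \<le> 1"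
  shows "sbound N (\<lambda>x. \<phi> (x + t *\<^sub>R axis i 1) - \<phi> x - complex_of_real t * partial i \<phi> x)
     (2 ^ Suc N * real CARD('n) * c * (t * t))"
proof -
  let ?e = "axis i (1::real)"
  have sm1: "smooth (partial i \<phi>)" using smooth_partials[OF sm, of "[i]"] by simp
  have sm2: "smooth (\<lambda>x. \<phi> (x + h))" for h
    using smooth_affine[of \<phi> h 1] sm by (simp add: add.commute)
  have smd: "smooth (\<lambda>x. \<phi> (x + h) - \<phi> x)" and
    eqd: "partials is (\<lambda>x. \<phi> (x + h) - \<phi> x) = (\<lambda>x. partials is \<phi> (x + h) - partials is \<phi> x)" for h "is"
    using smooth_lincomb[OF sm2[of h] sm, of 1 "-1"] partials_lincomb[OF sm2[of h] sm, of "is" 1 "-1"]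
    by (simp_all add: partials_translate[OF sm])
  have eq: "partials is (\<lambda>x. \<phi> (x + t *\<^sub>R ?e) - \<phi> x - complex_of_real t * partial i \<phi> x)
     = (\<lambda>x. partials is \<phi> (x + t *\<^sub>R ?e) - partials is \<phi> x - complex_of_real t * partial i (partials is \<phi>) x)" for "is"
    using partials_lincomb[OF smd[of "t *\<^sub>R ?e"] sm1, of "is" 1 "- complex_of_real t"]
    by (simp add: eqd partials_partial[OF sm])
  show ?thesis
    unfolding sbound_def eq
  proof (intro allI impI)
    fix "is" :: "'n list" and x assume l: "length is \<le> N"
    let ?\<theta> = "partials is \<phi>"
    let ?K = "2 ^ Suc N * real CARD('n) * c * \<bar>t\<bar>"
    have K: "cmod (partial i ?\<theta> (x + s *\<^sub>R t *\<^sub>R ?e) - partial i ?\<theta> x) \<le> ?K / (1 + norm x) ^ N"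
      if s: "0 \<le> s" "s \<le> 1" for s
    proof -
      let ?h = "s *\<^sub>R t *\<^sub>R ?e"
      have n: "norm ?h \<le> \<bar>t\<bar>" using s by (simp add: abs_mult mult_left_le_one_le)
      have "sbound (Suc N) (\<lambda>x. \<phi> (x + ?h) - \<phi> x) (2 ^ Suc N * real CARD('n) * c * norm ?h)"
        by (rule sbound_translate_diff[OF sm c]) (use n t in linarith)
      from sboundD'[OF this, of "i # is" N x] l
      have "(1 + norm x) ^ N * cmod (partial i ?\<theta> (x + ?h) - partial i ?\<theta> x) \<le> 2 ^ Suc N * real CARD('n) * c * norm ?h"
        unfolding eqd by simp
      also have "\<dots> \<le> ?K"
        using n sbound_nonneg[OF c] by (intro mult_left_mono) auto
      finally show ?thesis
        by (simp add: pos_le_divide_eq add_pos_nonneg mult.commute)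
    qed
        have "cmod (?\<theta> (x + t *\<^sub>R ?e) - ?\<theta> x - complex_of_real t * partial i ?\<theta> x) \<le> \<bar>t\<bar> * (?K / (1 + norm x) ^ N)"
    proof (rule derivative_line_bound[where f' = "\<lambda>y. grad_form (\<lambda>i. partial i ?\<theta> y)"])
      fix s :: real assume s: "0 \<le> s" "s \<le> 1"
      show "(?\<theta> has_derivative grad_form (\<lambda>k. partial k ?\<theta> (x + s *\<^sub>R t *\<^sub>R ?e))) (at (x + s *\<^sub>R t *\<^sub>R ?e))"
        using smooth_derivative[OF sm, of "is"] by simp
      have "cmod (complex_of_real t * (partial i ?\<theta> (x + s *\<^sub>R t *\<^sub>R ?e) - partial i ?\<theta> x)) \<le> \<bar>t\<bar> * (?K / (1 + norm x) ^ N)"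
        unfolding norm_mult norm_of_real by (rule mult_left_mono[OF K[OF s] abs_ge_zero])
      then show "cmod (grad_form (\<lambda>k. partial k ?\<theta> (x + s *\<^sub>R t *\<^sub>R ?e)) (t *\<^sub>R ?e) - complex_of_real t * partial i ?\<theta> x)
         \<le> \<bar>t\<bar> * (?K / (1 + norm x) ^ N)"
        unfolding grad_form_scaleR_axis by (simp add: right_diff_distrib)
    qed
    then have "(1 + norm x) ^ N * cmod (?\<theta> (x + t *\<^sub>R ?e) - ?\<theta> x - complex_of_real t * partial i ?\<theta> x) \<le> \<bar>t\<bar> * ?K"
      by (simp add: pos_le_divide_eq add_pos_nonneg mult.commute)
    also have "\<bar>t\<bar> * ?K = 2 ^ Suc N * real CARD('n) * c * (t * t)"
      using abs_mult_self_eq[of t] by (simp add: mult_ac del: abs_mult_self_eq)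
    finally show "(1 + norm x) ^ N * cmod (?\<theta> (x + t *\<^sub>R ?e) - ?\<theta> x - complex_of_real t * partial i ?\<theta> x)
        \<le> 2 ^ Suc N * real CARD('n) * c * (t * t)" .
  qed
qed

text \<open>Continuity in quantitative form: a tempered distribution has finite order.\<close>

lemma tempered_bound:
  assumes "u \<in> tempered_distributions"
  shows "\<exists>N C. 0 \<le> C \<and> (\<forall>\<phi>\<in>schwartz_space. \<forall>c. sbound N \<phi> c \<longrightarrow> cmod (u \<phi>) \<le> C * c)"
proof -
  let ?T = "schwartz_topology :: (real^'a \<Rightarrow> complex) topology"
  have sc: "u (\<lambda>x. c * \<phi> x) = c * u \<phi>" if "\<phi> \<in> schwartz_space" for c \<phi>
    using assms that unfolding tempered_distributions_def by (rule continuous_dual_scale)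
  have "continuous_map ?T euclidean u"
    using assms unfolding tempered_distributions_def by (rule continuous_dual_continuous)
  then have "openin ?T {\<phi> \<in> schwartz_space. u \<phi> \<in> ball 0 1}"
    using openin_continuous_map_preimage[of ?T euclidean u "ball 0 1"] by simp
  then have "\<exists>Q C. finite Q \<and> Q \<subseteq> schwartz_seminorms \<and> 0 \<le> C \<and> (\<forall>\<phi>\<in>schwartz_space. cmod (u \<phi>) \<le> C * (\<Sum>q\<in>Q. q \<phi>))"
  proof (rule seminorm_bound_of_open)
    have "u (\<lambda>x. 0) = 0" using sc[of "\<lambda>x. 0" 0] by simp
    then show "(\<lambda>x. 0) \<in> {\<phi> \<in> schwartz_space. u \<phi> \<in> ball 0 1}" by simp
  qed (auto simp: sc norm_mult schwartz_scale schwartz_seminorm_scale)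
  then obtain Q C where Q: "finite Q" "Q \<subseteq> schwartz_seminorms" "0 \<le> C"
    "\<And>\<phi>. \<phi>\<in>schwartz_space \<Longrightarrow> cmod (u \<phi>) \<le> C * (\<Sum>q\<in>Q. q \<phi>)" by blast
  obtain N where N: "\<And>\<phi> c. \<phi>\<in>schwartz_space \<Longrightarrow> sbound N \<phi> c \<Longrightarrow> (\<Sum>q\<in>Q. q \<phi>) \<le> real (card Q) * c"
    using sum_schwartz_seminorms_le_sbound[OF Q(1,2)] by blast
  have "cmod (u \<phi>) \<le> (C * real (card Q)) * c" if "\<phi>\<in>schwartz_space" "sbound N \<phi> c" for \<phi> c
    using Q(4)[OF that(1)] mult_left_mono[OF N[OF that] Q(3)] by (simp add: mult.assoc)
  then show ?thesis using Q(3) by (intro exI[of _ N] exI[of _ "C * real (card Q)"]) auto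
qed

section \<open>Regular distributions and translations\<close>

lemma regular_distribution_scale:
  "\<phi> \<in> schwartz_space \<Longrightarrow> regular_distribution (\<lambda>x. c * \<phi> x) = (\<lambda>\<theta>. c * regular_distribution \<phi> \<theta>)"
  by (simp add: regular_distribution_def fun_eq_iff mult.assoc)

lemma regular_distribution_zero: "regular_distribution (\<lambda>x. 0) = (\<lambda>\<theta>. 0)"
  by (simp add: regular_distribution_def fun_eq_iff)

lemma schwartz_product_integrable:
  fixes \<phi> :: "real^'n::finite \<Rightarrow> complex"
  assumes "\<phi> \<in> schwartz_space" "\<theta> \<in> schwartz_space"
  shows "integrable lborel (\<lambda>x. \<phi> x * \<theta> x)"
proof -
  obtain c where c: "sbound 0 \<phi> c" using schwartz_sbound assms by blast
  show ?thesis
    using sboundD[OF c, of "[]"] schwartz_measurable[OF assms(1)]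
    by (intro integrable_poly_growth_schwartz[OF assms(2), where K=c and k=0]) auto
qed

lemma regular_distribution_lincomb:
  fixes \<phi> :: "real^'n::finite \<Rightarrow> complex"
  assumes "\<phi> \<in> schwartz_space" "\<theta> \<in> schwartz_space"
  shows "regular_distribution (\<lambda>x. a * \<phi> x + b * \<theta> x) = (\<lambda>\<psi>. a * regular_distribution \<phi> \<psi> + b * regular_distribution \<theta> \<psi>)"
proof (rule ext)
  fix \<psi> :: "real^'n \<Rightarrow> complex"
  show "regular_distribution (\<lambda>x. a * \<phi> x + b * \<theta> x) \<psi> = a * regular_distribution \<phi> \<psi> + b * regular_distribution \<theta> \<psi>"
  proof (cases "\<psi> \<in> schwartz_space")
    case True
    have "(LINT x|lborel. (a * \<phi> x + b * \<theta> x) * \<psi> x) = (LINT x|lborel. a * (\<phi> x * \<psi> x) + b * (\<theta> x * \<psi> x))"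
      by (simp add: algebra_simps)
    also have "\<dots> = a * (LINT x|lborel. \<phi> x * \<psi> x) + b * (LINT x|lborel. \<theta> x * \<psi> x)"
      using True assms by (simp add: schwartz_product_integrable)
    finally show ?thesis using True by (simp add: regular_distribution_def)
  qed (simp add: regular_distribution_def)
qed

lemma regular_distribution_diff:
  fixes \<phi> :: "real^'n::finite \<Rightarrow> complex"
  assumes "\<phi> \<in> schwartz_space" "\<theta> \<in> schwartz_space"
  shows "regular_distribution (\<lambda>x. \<phi> x - \<theta> x) = (\<lambda>\<psi>. regular_distribution \<phi> \<psi> - regular_distribution \<theta> \<psi>)"
  using regular_distribution_lincomb[OF assms, of 1 "-1"] by simp

lemma dist_translate_regular:
  fixes \<phi> :: "real^'n::finite \<Rightarrow> complex"
  assumes "\<phi> \<in> schwartz_space"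
  shows "dist_translate h (regular_distribution \<phi>) = regular_distribution (\<lambda>x. \<phi> (x + h))"
proof (rule ext)
  fix \<theta> :: "real^'n \<Rightarrow> complex"
  show "dist_translate h (regular_distribution \<phi>) \<theta> = regular_distribution (\<lambda>x. \<phi> (x + h)) \<theta>"
  proof (cases "\<theta> \<in> schwartz_space")
    case True
    have [measurable]: "\<phi> \<in> borel_measurable borel" "\<theta> \<in> borel_measurable borel"
      using True assms by (auto intro: schwartz_measurable)
    have "(LINT x|lborel. \<phi> x * \<theta> (x - h)) = \<bar>1\<bar> ^ DIM(real^'n) *\<^sub>R (LINT x|lborel. \<phi> (h + 1 *\<^sub>R x) * \<theta> (h + 1 *\<^sub>R x - h))"
      by (rule integral_lborel_affine) auto
    then show ?thesis
      using True by (simp add: dist_translate_def regular_distribution_def schwartz_translate_iff add.commute)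
  qed (simp add: dist_translate_def regular_distribution_def schwartz_translate_iff)
qed

lemma partial_directional:
  assumes "smooth \<phi>"
  shows "((\<lambda>r. \<phi> (s + r *\<^sub>R axis i 1)) has_vector_derivative partial i \<phi> s) (at 0)"
proof -
  have "((\<lambda>r::real. s + r *\<^sub>R axis i 1) has_derivative (\<lambda>r. r *\<^sub>R axis i 1)) (at 0)"
    by (auto intro!: derivative_eq_intros)
  moreover have "(\<phi> has_derivative grad_form (\<lambda>i. partial i \<phi> s)) (at (s + 0 *\<^sub>R axis i 1))"
    using smooth_derivative[OF assms, of "[]" s] by simp
  ultimately have "((\<lambda>r. \<phi> (s + r *\<^sub>R axis i 1)) has_derivative (\<lambda>r. grad_form (\<lambda>i. partial i \<phi> s) (r *\<^sub>R axis i 1))) (at 0)"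
    by (rule has_derivative_compose)
  moreover have "grad_form (\<lambda>i. partial i \<phi> s) (r *\<^sub>R axis i 1) = r *\<^sub>R partial i \<phi> s" for r
    unfolding grad_form_scaleR_axis by (simp add: scaleR_conv_of_real)
  ultimately show ?thesis by (simp add: has_vector_derivative_def)
qed

text \<open>Provides the majorant, uniform on unit segments, that
  \<open>integral_directional_derivative_eq_0\<close> demands.\<close>

lemma weight_shift:
  fixes x :: "real^'n::finite"
  assumes "norm h \<le> 1"
  shows "weight (x + h) \<le> 2 ^ (2 * CARD('n)) * weight x"
proof -
  have "norm x \<le> norm (x + h) + norm h"
    using norm_triangle_ineq4[of "x + h" h] by (simp only: add_diff_cancel_right')
  then have "1 + norm x \<le> 2 * (1 + norm (x + h))"
    using assms norm_ge_zero[of "x + h"] by argo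
  then have "(1 + norm x) ^ (2 * CARD('n)) \<le> 2 ^ (2 * CARD('n)) * (1 + norm (x + h)) ^ (2 * CARD('n))"
    by (metis power_mono power_mult_distrib add_nonneg_nonneg norm_ge_zero zero_le_one)
  then show ?thesis
    unfolding weight_def by (simp add: field_simps add_pos_nonneg)
qed

text \<open>Integration by parts: the derivative of the product \<phi> \<theta> in direction i
  integrates to 0, and the resulting minus sign is that of \<open>dist_partial\<close>.\<close>

lemma dist_partial_regular:
  fixes \<phi> :: "real^'n::finite \<Rightarrow> complex"
  assumes \<phi>: "\<phi> \<in> schwartz_space"
  shows "dist_partial i (regular_distribution \<phi>) = regular_distribution (partial i \<phi>)"
proof (rule ext)
  fix \<theta> :: "real^'n \<Rightarrow> complex"
  show "dist_partial i (regular_distribution \<phi>) \<theta> = regular_distribution (partial i \<phi>) \<theta>"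
  proof (cases "\<theta> \<in> schwartz_space")
    case True
    note \<theta> = True
    note S = \<phi> \<theta> schwartz_partial[OF \<phi>, of i] schwartz_partial[OF \<theta>, of i]
    note M = S[THEN schwartz_measurable]
    let ?d = "\<lambda>x. \<phi> x * partial i \<theta> x + partial i \<phi> x * \<theta> x"
    obtain c where c: "sbound 1 \<phi> c" using schwartz_sbound[OF \<phi>] by blast
    obtain d where d: "sbound (Suc (2 * CARD('n))) \<theta> d" using schwartz_sbound[OF \<theta>] by blast
    have c0: "0 \<le> c" "0 \<le> d" using sbound_nonneg[OF c] sbound_nonneg[OF d] .
    have b1: "cmod (\<phi> x) \<le> c" "cmod (partial i \<phi> x) \<le> c" for x
      using sboundD'[OF c, of "[]" 0] sboundD'[OF c, of "[i]" 0] by auto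
    have d1: "sbound (0 + 2 * CARD('n)) (partial i \<theta>) d" "sbound (0 + 2 * CARD('n)) \<theta> d"
      using sbound_partial[OF d] sbound_mono[OF d] by auto
    have b2: "cmod (partial i \<theta> x) \<le> d * weight x" "cmod (\<theta> x) \<le> d * weight x" for x
      using sbound_weight[OF d1(1), of x] sbound_weight[OF d1(2), of x] by auto
    have "(LINT x|lborel. ?d x) = 0"
    proof (rule integral_directional_derivative_eq_0[where h="\<lambda>x. \<phi> x * \<theta> x" and e="axis i 1"
          and W = "\<lambda>x. 2 * c * d * 2 ^ (2 * CARD('n)) * weight x"])
      show "integrable lborel (\<lambda>x. \<phi> x * \<theta> x)" using \<phi> \<theta> by (rule schwartz_product_integrable)
      show "?d \<in> borel_measurable borel" using M by measurable
      show "integrable lborel (\<lambda>x::real^'n. 2 * c * d * 2 ^ (2 * CARD('n)) * weight x)"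
        by (simp add: integrable_weight)
      show "((\<lambda>r. \<phi> (s + r *\<^sub>R axis i 1) * \<theta> (s + r *\<^sub>R axis i 1)) has_vector_derivative ?d s) (at 0)" for s
        using has_vector_derivative_mult[OF partial_directional[OF schwartz_smooth[OF \<phi>]] partial_directional[OF schwartz_smooth[OF \<theta>]], of s i s i]
        by simp
      show "cmod (?d (s + r *\<^sub>R axis i 1)) \<le> 2 * c * d * 2 ^ (2 * CARD('n)) * weight s" if r: "\<bar>r\<bar> \<le> 1" for s r
      proof -
        let ?s = "s + r *\<^sub>R axis i 1"
        have "cmod (?d ?s) \<le> c * (d * weight ?s) + c * (d * weight ?s)"
          by (rule order_trans[OF norm_triangle_ineq], unfold norm_mult, intro add_mono mult_mono b1 b2)
            (use c0 weight_pos[of ?s] in auto)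
        also have "\<dots> = 2 * c * d * weight ?s" by simp
        also have "\<dots> \<le> 2 * c * d * (2 ^ (2 * CARD('n)) * weight s)"
          using c0 r by (intro mult_left_mono weight_shift) auto
        finally show ?thesis by (simp add: mult_ac)
      qed
    qed
    moreover have "(LINT x|lborel. ?d x) = (LINT x|lborel. \<phi> x * partial i \<theta> x) + (LINT x|lborel. partial i \<phi> x * \<theta> x)"
      using S by (intro Bochner_Integration.integral_add schwartz_product_integrable)
    ultimately show ?thesis
      using S by (simp add: dist_partial_def regular_distribution_def) (simp add: add_eq_0_iff)
  qed (simp add: dist_partial_def regular_distribution_def)
qed

lemma dist_translate_zero [simp]: "dist_translate 0 u = u"
  by (simp add: dist_translate_def)

lemma dist_translate_add: "dist_translate h (dist_translate s u) = dist_translate (s + h) u"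
  by (simp add: dist_translate_def algebra_simps)

lemma dist_translate_partial:
  "dist_partial i (dist_translate h u) = dist_translate h (dist_partial i u)"
proof (rule ext)
  fix \<theta> :: "real^'a \<Rightarrow> complex"
  have "partial i (\<lambda>x. \<theta> (x - h)) = (\<lambda>x. partial i \<theta> (x - h))" if "\<theta> \<in> schwartz_space"
    using partials_translate[OF schwartz_smooth[OF that], of "[i]" "-h"] by simp
  then show "dist_partial i (dist_translate h u) \<theta> = dist_translate h (dist_partial i u) \<theta>"
    by (simp add: dist_partial_def dist_translate_def schwartz_translate_iff)
qed

lemma dist_partials_simps [simp]:
  "dist_partials [] u = u" "dist_partials (i # is) u = dist_partial i (dist_partials is u)"
  by (simp_all add: dist_partials_def)

lemma dist_partials_append: "dist_partials (is @ js) u = dist_partials is (dist_partials js u)"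
  by (simp add: dist_partials_def)

lemma dist_translate_partials:
  "dist_partials is (dist_translate h u) = dist_translate h (dist_partials is u)"
  by (induction "is") (auto simp: dist_translate_partial)

lemma dist_partial_lincomb:
  "dist_partial i (\<lambda>\<phi>. a * u \<phi> + b * v \<phi>) = (\<lambda>\<phi>. a * dist_partial i u \<phi> + b * dist_partial i v \<phi>)"
  by (simp add: dist_partial_def fun_eq_iff)

lemma dist_partials_lincomb:
  "dist_partials is (\<lambda>\<phi>. a * u \<phi> + b * v \<phi>) = (\<lambda>\<phi>. a * dist_partials is u \<phi> + b * dist_partials is v \<phi>)"
  by (induction "is") (auto simp: dist_partial_lincomb)

lemma dist_partial_commute: "dist_partial i (dist_partial j u) = dist_partial j (dist_partial i u)"
  by (auto simp: dist_partial_def fun_eq_iff schwartz_partial partial_commute[OF schwartz_smooth])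

lemma dist_partials_partial: "dist_partials is (dist_partial i u) = dist_partial i (dist_partials is u)"
proof (induction "is")
  case (Cons j "is")
  then show ?case using dist_partial_commute by simp
qed simp

lemma dist_partials_regular:
  "\<phi> \<in> schwartz_space \<Longrightarrow> dist_partials is (regular_distribution \<phi>) = regular_distribution (partials is \<phi>)"
  by (induction "is") (auto simp: dist_partial_regular schwartz_partials)

section \<open>Norm estimates and continuity of translations in the Banach space\<close>

context translation_invariant_banach_space
begin

lemma norm_zero: "nE (\<lambda>\<phi>. 0) = 0"
  using norm_eq_0_iff[OF subspace_zero[OF subspace]] by simp

lemma norm_sum:
  assumes "finite I" "\<And>i. i \<in> I \<Longrightarrow> X i \<in> E"
  shows "(\<lambda>\<phi>. \<Sum>i\<in>I. X i \<phi>) \<in> E \<and> nE (\<lambda>\<phi>. \<Sum>i\<in>I. X i \<phi>) \<le> (\<Sum>i\<in>I. nE (X i))"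
  using assms
proof (induction I rule: finite_induct)
  case empty
  then show ?case using subspace_zero[OF subspace] norm_zero by simp
next
  case (insert i I)
  have X: "X i \<in> E" "(\<lambda>\<phi>. \<Sum>i\<in>I. X i \<phi>) \<in> E" using insert by auto
  show ?case
    using subspace_add[OF subspace X] norm_triangle[OF X] insert by simp
qed

lemma norm_diff_le:
  assumes "u \<in> E" "v \<in> E" "w \<in> E"
  shows "nE (\<lambda>\<phi>. u \<phi> - w \<phi>) \<le> nE (\<lambda>\<phi>. u \<phi> - v \<phi>) + nE (\<lambda>\<phi>. v \<phi> - w \<phi>)"
  using norm_triangle[OF subspace_diff[OF subspace assms(1,2)] subspace_diff[OF subspace assms(2,3)]] by simp

lemma norm_minus_commute_E:
  assumes "u \<in> E" "v \<in> E"
  shows "nE (\<lambda>\<phi>. u \<phi> - v \<phi>) = nE (\<lambda>\<phi>. v \<phi> - u \<phi>)"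
  using norm_scale[OF subspace_diff[OF subspace assms], of "-1"] by simp

lemma translate_in [simp]: "u \<in> E \<Longrightarrow> dist_translate h u \<in> E"
  using translation_invariant[of h] by blast

text \<open>The infimum in \<open>operator_norm\<close> is itself an admissible constant, and \<tau>
  is rounded up so that only natural powers of 1 + |h| occur later.\<close>

lemma translation_bound:
  "\<exists>M k. 0 < M \<and> (\<forall>h. \<forall>u\<in>E. nE (dist_translate h u) \<le> M * (1 + norm h) ^ k * nE u)"
proof -
  obtain M \<tau> where M: "0 < M" "0 \<le> \<tau>"
    and bo: "\<And>h. bounded_operator E nE (dist_translate (- h))"
    and on: "\<And>h. operator_norm E nE (dist_translate (- h)) \<le> M * (1 + norm h) powr \<tau>"
    using translation_growth by blast
  have "nE (dist_translate h u) \<le> M * (1 + norm h) ^ nat \<lceil>\<tau>\<rceil> * nE u" if u: "u \<in> E" for h u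
  proof -
    let ?A = "dist_translate h"
    let ?S = "{K. 0 \<le> K \<and> (\<forall>u\<in>E. nE (?A u) \<le> K * nE u)}"
    have ne: "?S \<noteq> {}" using bo[of "-h"] by (auto simp: bounded_operator_def)
    have "nE (?A u) \<le> operator_norm E nE ?A * nE u"
    proof (cases "nE u = 0")
      \<comment> \<open>Division by \<open>nE u\<close> is impossible here, but any admissible
        constant bounds the norm of the translate by 0.\<close>
      case True
      then show ?thesis using ne u by auto
    next
      case False
      then have pos: "0 < nE u" using norm_nonneg[OF u] by simp
      have "nE (?A u) / nE u \<le> operator_norm E nE ?A"
        unfolding operator_norm_def
        by (rule cInf_greatest[OF ne]) (use u pos in \<open>auto simp: pos_divide_le_eq\<close>)
      then show ?thesis using pos by (simp add: pos_divide_le_eq)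
    qed
    also have "\<dots> \<le> M * (1 + norm h) ^ nat \<lceil>\<tau>\<rceil> * nE u"
    proof (rule mult_right_mono)
      have "(1 + norm h) powr \<tau> \<le> (1 + norm h) powr real (nat \<lceil>\<tau>\<rceil>)"
        using M(2) by (intro powr_mono) (auto simp: of_nat_ceiling)
      also have "\<dots> = (1 + norm h) ^ nat \<lceil>\<tau>\<rceil>"
        by (rule powr_realpow) (simp add: add_pos_nonneg)
      finally have "M * (1 + norm h) powr \<tau> \<le> M * (1 + norm h) ^ nat \<lceil>\<tau>\<rceil>" using M(1) by simp
      then show "operator_norm E nE ?A \<le> M * (1 + norm h) ^ nat \<lceil>\<tau>\<rceil>"
        using on[of "-h"] by simp
    qed (rule norm_nonneg[OF u])
    finally show ?thesis .
  qed
  with M(1) show ?thesis by blast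
qed

lemma openin_norm_ball:
  assumes "v \<in> E"
  shows "openin (seminorm_topology E {nE}) {u \<in> E. nE (\<lambda>\<phi>. u \<phi> - v \<phi>) < r}"
  unfolding openin_seminorm_topology
proof (intro conjI ballI)
  fix u assume u: "u \<in> {u \<in> E. nE (\<lambda>\<phi>. u \<phi> - v \<phi>) < r}"
  have "nE (\<lambda>\<phi>. w \<phi> - v \<phi>) < r" if "w \<in> E" "nE (\<lambda>\<phi>. w \<phi> - u \<phi>) < r - nE (\<lambda>\<phi>. u \<phi> - v \<phi>)" for w
    using norm_diff_le[of w u v] that u assms by simp
  then show "\<exists>Q e. finite Q \<and> Q \<subseteq> {nE} \<and> 0 < e \<and>
      {w \<in> E. \<forall>q\<in>Q. q (\<lambda>x. w x - u x) < e} \<subseteq> {u \<in> E. nE (\<lambda>\<phi>. u \<phi> - v \<phi>) < r}"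
    using u by (intro exI[of _ "{nE}"] exI[of _ "r - nE (\<lambda>\<phi>. u \<phi> - v \<phi>)"]) auto
qed blast

lemma regular_in: "\<phi> \<in> schwartz_space \<Longrightarrow> regular_distribution \<phi> \<in> E"
  using continuous_map_image_subset_topspace[OF schwartz_continuous] by auto

lemma regular_bound:
  "\<exists>N C. 0 \<le> C \<and> (\<forall>\<phi>\<in>schwartz_space. \<forall>c. sbound N \<phi> c \<longrightarrow> nE (regular_distribution \<phi>) \<le> C * c)"
proof -
  let ?U = "{\<phi> \<in> schwartz_space. regular_distribution \<phi> \<in> {u \<in> E. nE (\<lambda>\<phi>. u \<phi> - 0) < 1}}"
  have op: "openin schwartz_topology ?U"
    using openin_continuous_map_preimage[OF schwartz_continuous openin_norm_ball[OF subspace_zero[OF subspace], of 1]] by simp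
  have "\<exists>Q C. finite Q \<and> Q \<subseteq> schwartz_seminorms \<and> 0 \<le> C \<and> (\<forall>\<phi>\<in>schwartz_space. nE (regular_distribution \<phi>) \<le> C * (\<Sum>q\<in>Q. q \<phi>))"
    using op
  proof (rule seminorm_bound_of_open)
    show "(\<lambda>x. 0) \<in> ?U"
      by (simp add: regular_distribution_zero norm_zero subspace_zero[OF subspace])
    show "nE (regular_distribution (\<lambda>x. c * u x)) = cmod c * nE (regular_distribution u)" if "u \<in> schwartz_space" for u c
      using that by (simp add: regular_distribution_scale norm_scale regular_in)
  qed (auto simp: schwartz_scale schwartz_seminorm_scale)
  then obtain Q C where Q: "finite Q" "Q \<subseteq> schwartz_seminorms" "0 \<le> C"
    "\<And>\<phi>. \<phi>\<in>schwartz_space \<Longrightarrow> nE (regular_distribution \<phi>) \<le> C * (\<Sum>q\<in>Q. q \<phi>)" by blast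
  obtain N where N: "\<And>\<phi> c. \<phi>\<in>schwartz_space \<Longrightarrow> sbound N \<phi> c \<Longrightarrow> (\<Sum>q\<in>Q. q \<phi>) \<le> real (card Q) * c"
    using sum_schwartz_seminorms_le_sbound[OF Q(1,2)] by blast
  have "nE (regular_distribution \<phi>) \<le> (C * real (card Q)) * c" if "\<phi>\<in>schwartz_space" "sbound N \<phi> c" for \<phi> c
    using Q(4)[OF that(1)] mult_left_mono[OF N[OF that] Q(3)] by (simp add: mult.assoc)
  then show ?thesis using Q(3) by (intro exI[of _ N] exI[of _ "C * real (card Q)"]) auto
qed

text \<open>Continuity of the inclusion into the strong dual, tested on a singleton. Outside
  \<open>schwartz_space\<close> distributions vanish by convention.\<close>

lemma evaluation_bound: "\<exists>C\<ge>0. \<forall>u\<in>E. cmod (u \<phi>) \<le> C * nE u"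
proof (cases "\<phi> \<in> schwartz_space")
  case False
  then have "u \<phi> = 0" if "u \<in> E" for u
    using that subset_tempered continuous_dual_outside unfolding tempered_distributions_def by blast
  then show ?thesis by (intro exI[of _ 0]) auto
next
  case True
  have z: "(\<lambda>x::real^'n \<Rightarrow> complex. 0) \<in> continuous_dual schwartz_space schwartz_seminorms"
    using subsetD[OF subset_tempered subspace_zero[OF subspace]] unfolding tempered_distributions_def .
  let ?U = "{u \<in> E. id u \<in> {f \<in> continuous_dual schwartz_space schwartz_seminorms. cmod (f \<phi>) < 1}}"
  have op: "openin (seminorm_topology E {nE}) ?U"
    using openin_continuous_map_preimage[OF tempered_continuous open_pointwise_strong_dual[OF True]] by simp
  have "\<exists>Q C. finite Q \<and> Q \<subseteq> {nE} \<and> 0 \<le> C \<and> (\<forall>u\<in>E. cmod (u \<phi>) \<le> C * (\<Sum>q\<in>Q. q u))"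
    using op
  proof (rule seminorm_bound_of_open)
    show "(\<lambda>x. 0) \<in> ?U" using z subspace_zero[OF subspace] by simp
  qed (auto simp: norm_scale norm_nonneg norm_mult subspace_scale[OF subspace])
  then obtain Q C where Q: "finite Q" "Q \<subseteq> {nE}" "0 \<le> C" "\<And>u. u\<in>E \<Longrightarrow> cmod (u \<phi>) \<le> C * (\<Sum>q\<in>Q. q u)" by blast
  have "(\<Sum>q\<in>Q. q u) \<le> nE u" if "u \<in> E" for u
    using Q(2) norm_nonneg[OF that] by (auto simp: subset_singleton_iff)
  then have "cmod (u \<phi>) \<le> C * nE u" if "u \<in> E" for u
    using Q(4)[OF that] mult_left_mono[OF _ Q(3)] that order_trans by blast
  with Q(3) show ?thesis by blast
qed

text \<open>On Schwartz functions this follows from \<open>sbound_translate_diff\<close>; it passes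
  to all of \<open>E\<close> by density, because the translations with |h| \<le> 1 are uniformly
  bounded.\<close>

lemma translation_continuous:
  assumes u: "u \<in> E" and \<epsilon>: "0 < \<epsilon>"
  shows "\<exists>\<delta>>0. \<forall>h. norm h < \<delta> \<longrightarrow> nE (\<lambda>\<phi>. dist_translate h u \<phi> - u \<phi>) < \<epsilon>"
proof -
  obtain M k where M: "0 < M" "\<And>h u. u \<in> E \<Longrightarrow> nE (dist_translate h u) \<le> M * (1 + norm h) ^ k * nE u"
    using translation_bound by blast
  obtain N C where C: "0 \<le> C" "\<And>\<phi> c. \<phi> \<in> schwartz_space \<Longrightarrow> sbound N \<phi> c \<Longrightarrow> nE (regular_distribution \<phi>) \<le> C * c"
    using regular_bound by blast
  \<comment> \<open>The approximation error enters once as it stands and once amplified by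
    \<open>M * 2 ^ k\<close>; together the two use up \<epsilon> / 2.\<close>
  define \<epsilon>1 where "\<epsilon>1 = \<epsilon> / (2 * (M * 2 ^ k + 1))"
  have M2: "0 < M * 2 ^ k + 1" using M(1) by (simp add: add_pos_nonneg)
  then have \<epsilon>1: "0 < \<epsilon>1" using \<epsilon> by (simp add: \<epsilon>1_def)
  have "u \<in> seminorm_topology E {nE} closure_of (regular_distribution ` schwartz_space)"
    using schwartz_dense u by simp
  then have cl: "u \<in> T \<and> openin (seminorm_topology E {nE}) T \<Longrightarrow> \<exists>v. v \<in> regular_distribution ` schwartz_space \<and> v \<in> T" for T
    unfolding in_closure_of by blast
  have "u \<in> {v \<in> E. nE (\<lambda>\<phi>. v \<phi> - u \<phi>) < \<epsilon>1}" using u \<epsilon>1 norm_zero by simp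
  then obtain v where "v \<in> regular_distribution ` schwartz_space" "v \<in> {v \<in> E. nE (\<lambda>\<phi>. v \<phi> - u \<phi>) < \<epsilon>1}"
    using cl openin_norm_ball[OF u] by meson
  then obtain \<phi> where \<phi>: "\<phi> \<in> schwartz_space" and close: "nE (\<lambda>\<theta>. regular_distribution \<phi> \<theta> - u \<theta>) < \<epsilon>1" by blast
  let ?r = "regular_distribution \<phi>"
  have r: "?r \<in> E" using \<phi> by (rule regular_in)
  obtain c where c: "sbound (Suc N) \<phi> c" using schwartz_sbound[OF \<phi>] by blast
  define D where "D = C * (2 ^ N * real CARD('n) * c)"
  have D: "0 \<le> D" using C(1) sbound_nonneg[OF c] by (simp add: D_def)
  define \<delta> where "\<delta> = min 1 (\<epsilon> / (2 * (D + 1)))"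
  have \<delta>: "0 < \<delta>" using \<epsilon> D by (simp add: \<delta>_def)
  have "nE (\<lambda>\<phi>. dist_translate h u \<phi> - u \<phi>) < \<epsilon>" if h: "norm h < \<delta>" for h
  proof -
    have h1: "norm h \<le> 1" using h by (simp add: \<delta>_def)
    have "nE (\<lambda>\<theta>. dist_translate h u \<theta> - dist_translate h ?r \<theta>) = nE (dist_translate h (\<lambda>\<theta>. u \<theta> - ?r \<theta>))"
      by (simp add: dist_translate_def)
    also have "\<dots> \<le> M * (1 + norm h) ^ k * nE (\<lambda>\<theta>. u \<theta> - ?r \<theta>)"
      by (intro M subspace_diff subspace u r)
    also have "\<dots> \<le> M * 2 ^ k * nE (\<lambda>\<theta>. u \<theta> - ?r \<theta>)"
      using h1 M(1) norm_nonneg[OF subspace_diff[OF subspace u r]]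
      by (intro mult_right_mono mult_left_mono power_mono) auto
    also have "\<dots> \<le> M * 2 ^ k * \<epsilon>1"
      using close M(1) unfolding norm_minus_commute_E[OF u r] by (intro mult_left_mono) auto
    finally have 1: "nE (\<lambda>\<theta>. dist_translate h u \<theta> - dist_translate h ?r \<theta>) \<le> M * 2 ^ k * \<epsilon>1" .
    have "nE (\<lambda>\<theta>. dist_translate h ?r \<theta> - ?r \<theta>) = nE (regular_distribution (\<lambda>x. \<phi> (x + h) - \<phi> x))"
      using \<phi> by (simp add: dist_translate_regular regular_distribution_diff schwartz_translate)
    also have "\<dots> \<le> C * (2 ^ N * real CARD('n) * c * norm h)"
      by (intro C schwartz_diff schwartz_translate \<phi> sbound_translate_diff c h1 schwartz_smooth)
    also have "\<dots> = D * norm h" by (simp add: D_def)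
    also have "\<dots> \<le> D * (\<epsilon> / (2 * (D + 1)))"
      using h D by (intro mult_left_mono) (auto simp: \<delta>_def)
    also have "\<dots> < \<epsilon> / 2" using D \<epsilon> by (simp add: field_simps)
    finally have 2: "nE (\<lambda>\<theta>. dist_translate h ?r \<theta> - ?r \<theta>) < \<epsilon> / 2" .
    have "nE (\<lambda>\<phi>. dist_translate h u \<phi> - u \<phi>) \<le> nE (\<lambda>\<theta>. dist_translate h u \<theta> - dist_translate h ?r \<theta>) +
       (nE (\<lambda>\<theta>. dist_translate h ?r \<theta> - ?r \<theta>) + nE (\<lambda>\<theta>. ?r \<theta> - u \<theta>))"
      using norm_diff_le[of "dist_translate h u" "dist_translate h ?r" u]
        norm_diff_le[of "dist_translate h ?r" ?r u] u r by simp
    also have "\<dots> < (M * 2 ^ k + 1) * \<epsilon>1 + \<epsilon> / 2" using 1 2 close by (simp add: algebra_simps)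
    also have "(M * 2 ^ k + 1) * \<epsilon>1 = \<epsilon> / 2" using M2 by (simp add: \<epsilon>1_def field_simps)
    finally show ?thesis by simp
  qed
  with \<delta> show ?thesis by blast
qed

end

section \<open>Derivatives of the Gaussian\<close>

text \<open>Up to the sign (-1)^a these are the probabilists' Hermite polynomials; the recursion is
  the product rule for a polynomial times exp (-w^2 / 2).\<close>

fun gauss_poly :: "nat \<Rightarrow> complex poly" where
  "gauss_poly 0 = 1"
| "gauss_poly (Suc a) = pderiv (gauss_poly a) - [:0, 1:] * gauss_poly a"

definition gauss_deriv :: "nat \<Rightarrow> complex \<Rightarrow> complex" where
  "gauss_deriv a w = poly (gauss_poly a) w * exp (- (w\<^sup>2 / 2))"

lemma gauss_deriv_derivative: "(gauss_deriv a has_field_derivative gauss_deriv (Suc a) w) (at w)"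
  unfolding gauss_deriv_def[abs_def]
  by (auto intro!: derivative_eq_intros poly_DERIV simp: field_simps power2_eq_square)

lemma poly_growth:
  fixes p :: "complex poly"
  shows "\<exists>C m. 0 \<le> C \<and> (\<forall>w. cmod (poly p w) \<le> C * (1 + cmod w) ^ m)"
proof (induction p)
  case 0
  show ?case by (intro exI[of _ 0]) simp
next
  case (pCons a p)
  then obtain C m where C: "0 \<le> C" "\<And>w. cmod (poly p w) \<le> C * (1 + cmod w) ^ m" by blast
  have "cmod (poly (pCons a p) w) \<le> (cmod a + C) * (1 + cmod w) ^ Suc m" for w
  proof -
    have "cmod (poly (pCons a p) w) \<le> cmod a + cmod w * cmod (poly p w)"
      by (simp add: norm_triangle_le norm_mult)
    also have "\<dots> \<le> cmod a * (1 + cmod w) ^ Suc m + (1 + cmod w) * (C * (1 + cmod w) ^ m)"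
    proof (rule add_mono)
      have "1 \<le> (1 + cmod w) ^ Suc m" by (rule one_le_power) simp
      from mult_left_mono[OF this, of "cmod a"]
      show "cmod a \<le> cmod a * (1 + cmod w) ^ Suc m" by simp
      show "cmod w * cmod (poly p w) \<le> (1 + cmod w) * (C * (1 + cmod w) ^ m)"
        using C by (intro mult_mono) auto
    qed
    finally show ?thesis by (simp add: algebra_simps)
  qed
  with C(1) show ?case
    by (intro exI[of _ "cmod a + C"] exI[of _ "Suc m"]) auto
qed

lemma gauss_deriv_bound:
  "\<exists>C m. 0 \<le> C \<and> (\<forall>w. cmod (gauss_deriv a w) \<le> C * (1 + cmod w) ^ m * exp ((Im w)\<^sup>2 / 2 - (Re w)\<^sup>2 / 2))"
proof -
  obtain C m where C: "0 \<le> C" "\<And>w. cmod (poly (gauss_poly a) w) \<le> C * (1 + cmod w) ^ m"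
    using poly_growth by blast
  have "cmod (exp (- (w\<^sup>2 / 2))) = exp ((Im w)\<^sup>2 / 2 - (Re w)\<^sup>2 / 2)" for w
    by (simp add: power2_eq_square diff_divide_distrib)
  then show ?thesis
    using C by (intro exI[of _ C] exI[of _ m]) (auto simp: gauss_deriv_def norm_mult intro!: mult_right_mono)
qed

text \<open>Gaussian derivatives are indexed by exponent functions instead of direction lists, since
  then \<open>incr_commute\<close> makes mixed derivatives literally equal.\<close>

definition incr :: "'n \<Rightarrow> ('n \<Rightarrow> nat) \<Rightarrow> ('n \<Rightarrow> nat)" where
  "incr i \<alpha> = \<alpha>(i := Suc (\<alpha> i))"

definition incrs :: "'n list \<Rightarrow> ('n \<Rightarrow> nat) \<Rightarrow> ('n \<Rightarrow> nat)" where
  "incrs is \<alpha> = foldr incr is \<alpha>"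

lemma incrs_simps [simp]: "incrs [] \<alpha> = \<alpha>" "incrs (i # is) \<alpha> = incr i (incrs is \<alpha>)"
  by (simp_all add: incrs_def)

lemma incr_commute: "incr i (incr j \<alpha>) = incr j (incr i \<alpha>)"
  by (auto simp: incr_def fun_eq_iff)

definition gau :: "('n::finite \<Rightarrow> nat) \<Rightarrow> complex^'n \<Rightarrow> complex" where
  "gau \<alpha> z = (\<Prod>k\<in>UNIV. gauss_deriv (\<alpha> k) (z $ k))"

text \<open>Complex linear counterpart of \<open>grad_form\<close>; a derivative of this form
  encodes the Cauchy-Riemann equations.\<close>

definition gform :: "('n::finite \<Rightarrow> complex) \<Rightarrow> complex^'n \<Rightarrow> complex" where
  "gform g v = (\<Sum>k\<in>UNIV. v $ k * g k)"

lemma gform_diff: "gform (\<lambda>i. g i - h i) v = gform g v - gform h v"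
  by (simp add: gform_def right_diff_distrib sum_subtractf)

lemma norm_gform_le:
  fixes v :: "complex^'n::finite"
  assumes "\<And>i. cmod (g i) \<le> K"
  shows "cmod (gform g v) \<le> real CARD('n) * K * norm v"
proof -
  have "cmod (gform g v) \<le> (\<Sum>i\<in>(UNIV::'n set). norm v * K)"
    unfolding gform_def
    by (intro sum_norm_le) (auto simp: norm_mult intro!: mult_mono assms Finite_Cartesian_Product.norm_nth_le)
  then show ?thesis by (simp add: mult_ac)
qed

lemma gau_derivative: "(gau \<alpha> has_derivative gform (\<lambda>k. gau (incr k \<alpha>) z)) (at z)"
proof -
  have "((\<lambda>z. gauss_deriv (\<alpha> k) (z $ k)) has_derivative (\<lambda>v. v $ k * gauss_deriv (Suc (\<alpha> k)) (z $ k))) (at z)" for k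
  proof -
    have "((\<lambda>z::complex^'a. z $ k) has_derivative (\<lambda>v. v $ k)) (at z)"
      by (rule bounded_linear_imp_has_derivative[OF bounded_linear_vec_nth])
    from has_derivative_compose[OF this gauss_deriv_derivative[unfolded has_field_derivative_def]]
    show ?thesis by (simp add: mult.commute)
  qed
  then have "((\<lambda>z. \<Prod>k\<in>UNIV. gauss_deriv (\<alpha> k) (z $ k)) has_derivative
     (\<lambda>v. \<Sum>k\<in>UNIV. (v $ k * gauss_deriv (Suc (\<alpha> k)) (z $ k)) * (\<Prod>j\<in>UNIV-{k}. gauss_deriv (\<alpha> j) (z $ j)))) (at z)"
    by (rule has_derivative_prod)
  moreover have "gau (incr k \<alpha>) z = gauss_deriv (Suc (\<alpha> k)) (z $ k) * (\<Prod>j\<in>UNIV-{k}. gauss_deriv (\<alpha> j) (z $ j))" for k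
  proof -
    have "(\<Prod>j\<in>UNIV-{k}. gauss_deriv (incr k \<alpha> j) (z $ j)) = (\<Prod>j\<in>UNIV-{k}. gauss_deriv (\<alpha> j) (z $ j))"
      by (intro prod.cong) (auto simp: incr_def)
    then show ?thesis
      unfolding gau_def by (subst prod.remove[of _ k]) (auto simp: incr_def)
  qed
  moreover have "gau \<alpha> = (\<lambda>z. \<Prod>k\<in>UNIV. gauss_deriv (\<alpha> k) (z $ k))"
    by (rule ext) (simp add: gau_def)
  ultimately show ?thesis
    by (simp add: gform_def[abs_def] mult.assoc)
qed

section \<open>Real and imaginary parts of complex vectors\<close>

definition re_vec :: "complex^'n \<Rightarrow> real^'n" where "re_vec z = (\<chi> k. Re (z $ k))"
definition im_vec :: "complex^'n \<Rightarrow> real^'n" where "im_vec z = (\<chi> k. Im (z $ k))"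

lemma re_im_simps [simp]:
  "re_vec (complex_vec x y) = x" "im_vec (complex_vec x y) = y"
  "re_vec (z + w) = re_vec z + re_vec w" "im_vec (z + w) = im_vec z + im_vec w"
  "re_vec (t *\<^sub>R z) = t *\<^sub>R re_vec z" "im_vec (t *\<^sub>R z) = t *\<^sub>R im_vec z"
  "complex_vec (re_vec z) (im_vec z) = z" "re_vec 0 = 0" "im_vec 0 = 0"
  by (simp_all add: re_vec_def im_vec_def complex_vec_def vec_eq_iff)

lemma complex_vec_add: "complex_vec x y + complex_vec x' y' = complex_vec (x + x') (y + y')"
  by (simp add: complex_vec_def vec_eq_iff complex_eq_iff)

lemma complex_vec_scaleR: "t *\<^sub>R complex_vec x y = complex_vec (t *\<^sub>R x) (t *\<^sub>R y)"
  by (simp add: complex_vec_def vec_eq_iff complex_eq_iff)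

lemma complex_vec_zero [simp]: "complex_vec 0 0 = 0"
  by (simp add: complex_vec_def vec_eq_iff complex_eq_iff)

lemma norm_re_im_le: "norm (re_vec z) \<le> norm z" "norm (im_vec z) \<le> norm z"
  unfolding norm_vec_def by (intro L2_set_mono; simp add: re_vec_def im_vec_def abs_Re_le_cmod abs_Im_le_cmod)+

lemma norm_complex_vec_le: "norm (complex_vec x y) \<le> norm x + norm y"
proof -
  have "norm (complex_vec x y) \<le> L2_set (\<lambda>k. norm (x $ k) + norm (y $ k)) UNIV"
    unfolding norm_vec_def by (intro L2_set_mono) (simp_all add: complex_vec_def complex_norm sqrt_sum_squares_le_sum_abs)
  also have "\<dots> \<le> norm x + norm y"
    unfolding norm_vec_def by (rule L2_set_triangle_ineq)
  finally show ?thesis .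
qed

lemma bounded_linear_complex_vec: "bounded_linear (\<lambda>x. complex_vec x 0)"
proof (rule bounded_linear_intro[where K=1])
  show "complex_vec (x + y) 0 = complex_vec x 0 + complex_vec y 0" for x y :: "real^'a"
    by (simp add: complex_vec_add)
  show "complex_vec (r *\<^sub>R x) 0 = r *\<^sub>R complex_vec x 0" for r and x :: "real^'a"
    by (simp add: complex_vec_scaleR)
  show "norm (complex_vec x 0) \<le> norm x * 1" for x :: "real^'a"
    using norm_complex_vec_le[of x 0] by simp
qed

lemma gaussian_beats_power: "\<exists>C\<ge>0. \<forall>x::real^'n::finite. (1 + norm x) ^ p * exp (- (x \<bullet> x) / 2) \<le> C"
\<comment> \<open>With t = 1 + |x| and q = p + 1, the inequality t / q \<le> exp (t / q) is raised
  to the power q; \<open>Suc p\<close> keeps q nonzero. The factor exp 2 bounds exp (1 + r - r^2 /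
  2) for every real r, applied at r = |x|.\<close>
proof (intro exI[of _ "real (Suc p) ^ Suc p * exp 2"] conjI allI)
  fix x :: "real^'n"
  let ?t = "norm x"
  let ?q = "real (Suc p)"
  have "(1 + ?t) / ?q \<le> exp ((1 + ?t) / ?q)"
    using exp_ge_add_one_self[of "(1 + ?t) / ?q"] by linarith
  then have "((1 + ?t) / ?q) ^ Suc p \<le> exp ((1 + ?t) / ?q) ^ Suc p"
    by (intro power_mono) auto
  also have "\<dots> = exp (1 + ?t)"
    by (subst exp_of_nat_mult[symmetric]) simp
  finally have "(1 + ?t) ^ Suc p \<le> ?q ^ Suc p * exp (1 + ?t)"
    by (simp only: power_divide pos_divide_le_eq zero_less_power of_nat_0_less_iff zero_less_Suc mult.commute)
  moreover have "(1 + ?t) ^ p \<le> (1 + ?t) ^ Suc p" by (intro power_increasing) auto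
  ultimately have "(1 + ?t) ^ p \<le> ?q ^ Suc p * exp (1 + ?t)" by linarith
  then have "(1 + ?t) ^ p * exp (- (x \<bullet> x) / 2) \<le> ?q ^ Suc p * exp (1 + ?t) * exp (- (x \<bullet> x) / 2)"
    by (intro mult_right_mono) auto
  also have "\<dots> = ?q ^ Suc p * exp (1 + ?t - ?t\<^sup>2 / 2)"
    by (simp add: power2_norm_eq_inner mult.assoc flip: exp_add)
  also have "\<dots> \<le> ?q ^ Suc p * exp 2"
  proof (intro mult_left_mono)
    have "0 \<le> (?t - 1)\<^sup>2" by simp
    then have "1 + ?t - ?t\<^sup>2 / 2 \<le> 2" by (simp add: power2_eq_square algebra_simps)
    then show "exp (1 + ?t - ?t\<^sup>2 / 2) \<le> exp 2" by simp
  qed simp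
  finally show "(1 + ?t) ^ p * exp (- (x \<bullet> x) / 2) \<le> ?q ^ Suc p * exp 2" .
qed simp

lemma gau_bound:
  fixes \<alpha> :: "'n::finite \<Rightarrow> nat"
  shows "\<exists>C m. 0 \<le> C \<and> (\<forall>x \<eta>. cmod (gau \<alpha> (complex_vec x \<eta>))
    \<le> C * ((1 + norm x) * (1 + norm \<eta>)) ^ m * (exp ((\<eta> \<bullet> \<eta>) / 2) * exp (- (x \<bullet> x) / 2)))"
proof -
  have "\<forall>k. \<exists>C m. 0 \<le> C \<and> (\<forall>w. cmod (gauss_deriv (\<alpha> k) w) \<le> C * (1 + cmod w) ^ m * exp ((Im w)\<^sup>2 / 2 - (Re w)\<^sup>2 / 2))"
    using gauss_deriv_bound by blast
  then obtain C m where C: "\<And>k. 0 \<le> C k"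
    "\<And>k w. cmod (gauss_deriv (\<alpha> k) w) \<le> C k * (1 + cmod w) ^ m k * exp ((Im w)\<^sup>2 / 2 - (Re w)\<^sup>2 / 2)"
    by metis
  have "cmod (gau \<alpha> (complex_vec x \<eta>)) \<le> (\<Prod>k\<in>UNIV. C k) * ((1 + norm x) * (1 + norm \<eta>)) ^ (\<Sum>k\<in>UNIV. m k)
     * (exp ((\<eta> \<bullet> \<eta>) / 2) * exp (- (x \<bullet> x) / 2))" for x \<eta> :: "real^'n"
  proof -
    have "cmod (gau \<alpha> (complex_vec x \<eta>)) = (\<Prod>k\<in>UNIV. cmod (gauss_deriv (\<alpha> k) (complex_vec x \<eta> $ k)))"
      by (simp add: gau_def prod_norm)
    also have "\<dots> \<le> (\<Prod>k\<in>UNIV. C k * ((1 + norm x) * (1 + norm \<eta>)) ^ m k * exp ((\<eta> $ k)\<^sup>2 / 2 - (x $ k)\<^sup>2 / 2))"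
    proof (rule prod_mono, intro conjI)
      fix k
      have "1 + cmod (complex_vec x \<eta> $ k) \<le> 1 + (norm x + norm \<eta>)"
        using Finite_Cartesian_Product.norm_nth_le[of "complex_vec x \<eta>" k] norm_complex_vec_le[of x \<eta>] by linarith
      also have "\<dots> \<le> (1 + norm x) * (1 + norm \<eta>)"
        by (simp add: algebra_simps)
      finally have "(1 + cmod (complex_vec x \<eta> $ k)) ^ m k \<le> ((1 + norm x) * (1 + norm \<eta>)) ^ m k"
        by (intro power_mono) auto
      then have "C k * (1 + cmod (complex_vec x \<eta> $ k)) ^ m k * exp ((Im (complex_vec x \<eta> $ k))\<^sup>2 / 2 - (Re (complex_vec x \<eta> $ k))\<^sup>2 / 2)
         \<le> C k * ((1 + norm x) * (1 + norm \<eta>)) ^ m k * exp ((Im (complex_vec x \<eta> $ k))\<^sup>2 / 2 - (Re (complex_vec x \<eta> $ k))\<^sup>2 / 2)"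
        by (intro mult_right_mono mult_left_mono C) auto
      with C(2)[of k "complex_vec x \<eta> $ k"]
      show "cmod (gauss_deriv (\<alpha> k) (complex_vec x \<eta> $ k)) \<le> C k * ((1 + norm x) * (1 + norm \<eta>)) ^ m k * exp ((\<eta> $ k)\<^sup>2 / 2 - (x $ k)\<^sup>2 / 2)"
        by (simp add: complex_vec_def)
    qed simp
    also have "\<dots> = (\<Prod>k\<in>UNIV. C k) * ((1 + norm x) * (1 + norm \<eta>)) ^ (\<Sum>k\<in>UNIV. m k)
     * (\<Prod>k\<in>UNIV. exp ((\<eta> $ k)\<^sup>2 / 2 - (x $ k)\<^sup>2 / 2))"
      by (simp add: prod.distrib power_sum)
    also have "(\<Prod>k\<in>UNIV. exp ((\<eta> $ k)\<^sup>2 / 2 - (x $ k)\<^sup>2 / 2)) = exp ((\<eta> \<bullet> \<eta>) / 2 - (x \<bullet> x) / 2)"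
      by (simp add: exp_sum[symmetric] inner_vec_def power2_eq_square sum_subtractf sum_divide_distrib)
    also have "\<dots> = exp ((\<eta> \<bullet> \<eta>) / 2) * exp (- (x \<bullet> x) / 2)"
      by (simp add: exp_add[symmetric])
    finally show ?thesis .
  qed
  moreover have "0 \<le> (\<Prod>k\<in>UNIV. C k)" by (simp add: prod_nonneg C(1))
  ultimately show ?thesis by blast
qed

text \<open>The factor exp (|\<eta>|^2 / 2) is kept exact. At \<eta> = y - \<xi> the weight exp
  (-|\<xi>|^2 / 2) cancels its quadratic growth in \<xi> and leaves exp (-y.\<xi>); a larger
  coefficient in the exponent would leave quadratic growth behind.\<close>

lemma gau_decay:
  fixes \<alpha> :: "'n::finite \<Rightarrow> nat"
  shows "\<exists>C m. 0 \<le> C \<and> (\<forall>x \<eta>. (1 + norm x) ^ N * cmod (gau \<alpha> (complex_vec x \<eta>))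
    \<le> C * (1 + norm \<eta>) ^ m * exp ((\<eta> \<bullet> \<eta>) / 2))"
proof -
  obtain C m where C: "0 \<le> C" "\<And>x \<eta>. cmod (gau \<alpha> (complex_vec x \<eta>))
    \<le> C * ((1 + norm x) * (1 + norm \<eta>)) ^ m * (exp ((\<eta> \<bullet> \<eta>) / 2) * exp (- (x \<bullet> x) / 2))"
    using gau_bound[of \<alpha>] by blast
  obtain D where D: "0 \<le> D" "\<And>x::real^'n. (1 + norm x) ^ (N + m) * exp (- (x \<bullet> x) / 2) \<le> D"
    using gaussian_beats_power[where p="N + m"] by blast
  have "(1 + norm x) ^ N * cmod (gau \<alpha> (complex_vec x \<eta>)) \<le> (C * D) * (1 + norm \<eta>) ^ m * exp ((\<eta> \<bullet> \<eta>) / 2)" for x \<eta> :: "real^'n"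
  proof -
    have "(1 + norm x) ^ N * cmod (gau \<alpha> (complex_vec x \<eta>)) \<le>
      (1 + norm x) ^ N * (C * ((1 + norm x) * (1 + norm \<eta>)) ^ m * (exp ((\<eta> \<bullet> \<eta>) / 2) * exp (- (x \<bullet> x) / 2)))"
      by (intro mult_left_mono C(2)) simp
    also have "\<dots> = C * ((1 + norm x) ^ (N + m) * exp (- (x \<bullet> x) / 2)) * ((1 + norm \<eta>) ^ m * exp ((\<eta> \<bullet> \<eta>) / 2))"
      by (simp add: power_add power_mult_distrib mult_ac)
    also have "\<dots> \<le> C * D * ((1 + norm \<eta>) ^ m * exp ((\<eta> \<bullet> \<eta>) / 2))"
      by (intro mult_right_mono mult_left_mono C(1) D(2)) simp
    finally show ?thesis by (simp add: mult.assoc)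
  qed
  then show ?thesis using C(1) D(1) by (intro exI[of _ "C * D"] exI[of _ m]) auto
qed

text \<open>The Gaussian derivative on the real slice through z, read as a Schwartz function of s
  with parameter z.\<close>

definition gz :: "('n::finite \<Rightarrow> nat) \<Rightarrow> complex^'n \<Rightarrow> real^'n \<Rightarrow> complex" where
  "gz \<alpha> z s = gau \<alpha> (complex_vec s 0 + z)"

lemma gz_derivative: "(gz \<alpha> z has_derivative grad_form (\<lambda>i. gz (incr i \<alpha>) z s)) (at s)"
proof -
  have "((\<lambda>s. complex_vec s 0 + z) has_derivative (\<lambda>v. complex_vec v 0)) (at s)"
    using bounded_linear_imp_has_derivative[OF bounded_linear_complex_vec]
    by (auto intro!: derivative_eq_intros)
  from has_derivative_compose[OF this gau_derivative]
  show ?thesis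
    unfolding gz_def[abs_def]
    by (rule has_derivative_eq_rhs) (simp add: gform_def grad_form_def complex_vec_def fun_eq_iff complex_of_real_def)
qed

lemma smooth_gz: "smooth (gz \<alpha> z)" and partials_gz: "partials is (gz \<alpha> z) = gz (incrs is \<alpha>) z"
proof -
  let ?G = "\<lambda>is. gz (incrs is \<alpha>) z"
  have G: "(?G is has_derivative grad_form (\<lambda>i. ?G (i # is) x)) (at x)" for "is" x
    using gz_derivative[of "incrs is \<alpha>" z x] by simp
  show "smooth (gz \<alpha> z)" using smoothI[of ?G, OF G] by simp
  show "partials is (gz \<alpha> z) = gz (incrs is \<alpha>) z" using partials_eqI[of ?G, OF G] by simp
qed

lemma gz_decay_uniform:
  fixes \<alpha> :: "'n::finite \<Rightarrow> nat"
  shows "\<exists>C m. 0 \<le> C \<and> (\<forall>is x \<eta>. length is \<le> M \<longrightarrow> (1 + norm x) ^ N * cmod (gau (incrs is \<alpha>) (complex_vec x \<eta>))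
    \<le> C * (1 + norm \<eta>) ^ m * exp ((\<eta> \<bullet> \<eta>) / 2))"
proof -
  have "\<forall>is. \<exists>C m. 0 \<le> C \<and> (\<forall>x \<eta>. (1 + norm x) ^ N * cmod (gau (incrs is \<alpha>) (complex_vec x \<eta>))
    \<le> C * (1 + norm \<eta>) ^ m * exp ((\<eta> \<bullet> \<eta>) / 2))"
    using gau_decay by blast
  then obtain C m where C: "\<And>is. 0 \<le> C is" "\<And>is x \<eta>. (1 + norm x) ^ N * cmod (gau (incrs is \<alpha>) (complex_vec x \<eta>))
    \<le> C is * (1 + norm \<eta>) ^ m is * exp ((\<eta> \<bullet> \<eta>) / 2)" by metis
  let ?L = "{is::'n list. length is \<le> M}"
  have "(1 + norm x) ^ N * cmod (gau (incrs is \<alpha>) (complex_vec x \<eta>))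
     \<le> (\<Sum>is\<in>?L. C is) * (1 + norm \<eta>) ^ (\<Sum>is\<in>?L. m is) * exp ((\<eta> \<bullet> \<eta>) / 2)" if "length is \<le> M" for "is" x \<eta>
  proof -
    have "C is \<le> (\<Sum>is\<in>?L. C is)" "m is \<le> (\<Sum>is\<in>?L. m is)"
      using that by (auto intro!: member_le_sum simp: finite_short_lists C(1))
    then have "C is * (1 + norm \<eta>) ^ m is * exp ((\<eta> \<bullet> \<eta>) / 2) \<le> (\<Sum>is\<in>?L. C is) * (1 + norm \<eta>) ^ (\<Sum>is\<in>?L. m is) * exp ((\<eta> \<bullet> \<eta>) / 2)"
      using C(1) by (intro mult_right_mono mult_mono power_increasing) (auto intro: sum_nonneg)
    with C(2)[of x "is" \<eta>] show ?thesis by linarith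
  qed
  then show ?thesis
    using C(1) by (intro exI[of _ "\<Sum>is\<in>?L. C is"] exI[of _ "\<Sum>is\<in>?L. m is"]) (auto intro: sum_nonneg)
qed

text \<open>The real part of z acts as a translation and costs only a power, while the imaginary
  part carries the exponential growth. The reflection \<sigma> = -1 prepares
  \<open>transform\<close>, where the Gaussian is evaluated at z - t.\<close>

lemma gz_sbound:
  fixes \<alpha> :: "'n::finite \<Rightarrow> nat"
  shows "\<exists>C m. 0 \<le> C \<and> (\<forall>z \<sigma>. \<bar>\<sigma>\<bar> = 1 \<longrightarrow> sbound N (\<lambda>t. gz \<alpha> z (\<sigma> *\<^sub>R t))
     (C * (1 + norm (re_vec z)) ^ N * (1 + norm (im_vec z)) ^ m * exp ((im_vec z \<bullet> im_vec z) / 2)))"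
proof -
  obtain C m where C: "0 \<le> C" "\<And>is x \<eta>. length is \<le> N \<Longrightarrow> (1 + norm x) ^ N * cmod (gau (incrs is \<alpha>) (complex_vec x \<eta>))
    \<le> C * (1 + norm \<eta>) ^ m * exp ((\<eta> \<bullet> \<eta>) / 2)" using gz_decay_uniform[of N N \<alpha>] by blast
  have "sbound N (\<lambda>t. gz \<alpha> z (\<sigma> *\<^sub>R t)) (C * (1 + norm (re_vec z)) ^ N * (1 + norm (im_vec z)) ^ m * exp ((im_vec z \<bullet> im_vec z) / 2))"
    if \<sigma>: "\<bar>\<sigma>\<bar> = 1" for z and \<sigma> :: real
  proof -
    let ?z = "complex_vec 0 (im_vec z)"
    have "sbound N (gz \<alpha> ?z) (C * (1 + norm (im_vec z)) ^ m * exp ((im_vec z \<bullet> im_vec z) / 2))"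
      unfolding sbound_def partials_gz using C(2)[of _ _ "im_vec z"] by (simp add: gz_def complex_vec_add)
    from sbound_affine[OF smooth_gz this \<sigma>, of "re_vec z"]
    have "sbound N (\<lambda>x. gz \<alpha> ?z (re_vec z + \<sigma> *\<^sub>R x)) ((1 + norm (re_vec z)) ^ N * (C * (1 + norm (im_vec z)) ^ m * exp ((im_vec z \<bullet> im_vec z) / 2)))" .
    moreover have "gz \<alpha> ?z (re_vec z + \<sigma> *\<^sub>R x) = gz \<alpha> z (\<sigma> *\<^sub>R x)" for x
    proof -
      have "complex_vec (re_vec z + \<sigma> *\<^sub>R x) 0 + ?z = complex_vec (\<sigma> *\<^sub>R x) 0 + complex_vec (re_vec z) (im_vec z)"
        by (simp only: complex_vec_add add.commute add_0_left add_0_right)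
      then show ?thesis by (simp add: gz_def)
    qed
    ultimately show ?thesis by (simp add: mult_ac)
  qed
  then show ?thesis using C(1) by blast
qed

lemma schwartz_gz: "\<bar>\<sigma>\<bar> = 1 \<Longrightarrow> (\<lambda>t. gz \<alpha> z (\<sigma> *\<^sub>R t)) \<in> schwartz_space"
  using gz_sbound smooth_affine[OF smooth_gz, of \<alpha> z 0 \<sigma>] by (intro schwartzI) (auto, blast)

text \<open>The mean value inequality along the segment from s to s + iy, on which |\<eta>| \<le> 1
  caps the growth factor at 2^m exp (1 / 2). The linear rate in |y| makes the windows converge in
  every Schwartz seminorm.\<close>

lemma gz_imaginary_shift_bound:
  fixes \<alpha> :: "'n::finite \<Rightarrow> nat"
  shows "\<exists>C\<ge>0. \<forall>y. norm y \<le> 1 \<longrightarrow> sbound N (\<lambda>t. gz \<alpha> (complex_vec 0 y) t - gz \<alpha> 0 t) (C * norm y)"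
proof -
  obtain C m where C: "0 \<le> C" "\<And>is x \<eta>. length is \<le> Suc N \<Longrightarrow> (1 + norm x) ^ N * cmod (gau (incrs is \<alpha>) (complex_vec x \<eta>))
    \<le> C * (1 + norm \<eta>) ^ m * exp ((\<eta> \<bullet> \<eta>) / 2)" using gz_decay_uniform[of "Suc N" N \<alpha>] by blast
  let ?K = "C * 2 ^ m * exp (1 / 2)"
  have "sbound N (\<lambda>t. gz \<alpha> (complex_vec 0 y) t - gz \<alpha> 0 t) (real CARD('n) * ?K * norm y)" if y: "norm y \<le> 1" for y :: "real^'n"
  proof -
    have eq: "partials is (\<lambda>t. gz \<alpha> (complex_vec 0 y) t - gz \<alpha> 0 t) = (\<lambda>t. gz (incrs is \<alpha>) (complex_vec 0 y) t - gz (incrs is \<alpha>) 0 t)" for "is"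
      using partials_lincomb[OF smooth_gz smooth_gz, of "is" 1 \<alpha> "complex_vec 0 y" "-1" \<alpha> 0] by (simp add: partials_gz)
    show ?thesis
      unfolding sbound_def eq
    proof (intro allI impI)
      fix "is" :: "'n list" and x :: "real^'n" assume l: "length is \<le> N"
      have B: "cmod (gau (incr i (incrs is \<alpha>)) (complex_vec x \<eta>)) \<le> ?K / (1 + norm x) ^ N" if \<eta>: "norm \<eta> \<le> 1" for i \<eta>
      proof -
        have "\<eta> \<bullet> \<eta> \<le> 1" using \<eta> by (simp add: power2_norm_eq_inner[symmetric] power_le_one)
        then have "C * (1 + norm \<eta>) ^ m * exp ((\<eta> \<bullet> \<eta>) / 2) \<le> ?K"
          using \<eta> C(1) by (intro mult_mono mult_left_mono power_mono) auto
        with C(2)[of "i # is" x \<eta>] l show ?thesis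
          by (simp add: pos_le_divide_eq add_pos_nonneg mult.commute)
      qed
      have "cmod (gau (incrs is \<alpha>) (complex_vec x 0 + complex_vec 0 y) - gau (incrs is \<alpha>) (complex_vec x 0) - 0)
         \<le> real CARD('n) * (?K / (1 + norm x) ^ N) * norm y"
      proof (rule derivative_line_bound[where f' = "\<lambda>z. gform (\<lambda>k. gau (incr k (incrs is \<alpha>)) z)"])
        fix t :: real assume t: "0 \<le> t" "t \<le> 1"
        let ?z = "complex_vec x 0 + t *\<^sub>R complex_vec 0 y"
        show "(gau (incrs is \<alpha>) has_derivative gform (\<lambda>k. gau (incr k (incrs is \<alpha>)) ?z)) (at ?z)"
          by (rule gau_derivative)
        have z: "?z = complex_vec x (t *\<^sub>R y)" by (simp add: complex_vec_scaleR complex_vec_add)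
        have "norm (t *\<^sub>R y) \<le> 1" using t y by (simp add: mult_le_one)
        then have "cmod (gform (\<lambda>k. gau (incr k (incrs is \<alpha>)) ?z) (complex_vec 0 y)) \<le> real CARD('n) * (?K / (1 + norm x) ^ N) * norm (complex_vec 0 y)"
          unfolding z by (intro norm_gform_le B)
        also have "\<dots> \<le> real CARD('n) * (?K / (1 + norm x) ^ N) * norm y"
          using norm_complex_vec_le[of 0 y] C(1) by (intro mult_left_mono) auto
        finally show "cmod (gform (\<lambda>k. gau (incr k (incrs is \<alpha>)) ?z) (complex_vec 0 y) - 0) \<le> real CARD('n) * (?K / (1 + norm x) ^ N) * norm y"
          by simp
      qed
      then have "cmod (gz (incrs is \<alpha>) (complex_vec 0 y) x - gz (incrs is \<alpha>) 0 x) \<le> real CARD('n) * ?K * norm y / (1 + norm x) ^ N"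
        by (simp add: gz_def)
      then show "(1 + norm x) ^ N * cmod (gz (incrs is \<alpha>) (complex_vec 0 y) x - gz (incrs is \<alpha>) 0 x) \<le> real CARD('n) * ?K * norm y"
        by (simp add: pos_le_divide_eq add_pos_nonneg mult.commute)
    qed
  qed
  then show ?thesis
    using C(1) by (intro exI[of _ "real CARD('n) * ?K"]) auto
qed

text \<open>The bound is uniform over the unit ball around z, as a Taylor remainder at z requires:
  real and imaginary parts of z + v stay below |z| + 1, so the translation and growth factors of
  \<open>gz_decay_uniform\<close> are bounded.\<close>

lemma gau_local_bound:
  fixes \<alpha> :: "'n::finite \<Rightarrow> nat"
  shows "\<exists>B\<ge>0. \<forall>is s v. length is \<le> L \<longrightarrow> norm v \<le> 1 \<longrightarrow>
    (1 + norm s) ^ K * cmod (gau (incrs is \<alpha>) (complex_vec s 0 + z + v)) \<le> B"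
proof -
  obtain C m where C: "0 \<le> C" "\<And>is x \<eta>. length is \<le> L \<Longrightarrow> (1 + norm x) ^ K * cmod (gau (incrs is \<alpha>) (complex_vec x \<eta>))
    \<le> C * (1 + norm \<eta>) ^ m * exp ((\<eta> \<bullet> \<eta>) / 2)" using gz_decay_uniform[of L K \<alpha>] by blast
  let ?r = "norm z + 1"
  let ?B = "(1 + ?r) ^ K * (C * (1 + ?r) ^ m * exp (?r * ?r / 2))"
  have "(1 + norm s) ^ K * cmod (gau (incrs is \<alpha>) (complex_vec s 0 + z + v)) \<le> ?B"
    if l: "length is \<le> L" and v: "norm v \<le> 1" for "is" s v
  proof -
    let ?a = "re_vec (z + v)" and ?\<eta> = "im_vec (z + v)"
    have zv: "norm (z + v) \<le> ?r" using norm_triangle_ineq[of z v] v by linarith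
    have a: "norm ?a \<le> ?r" and \<eta>: "norm ?\<eta> \<le> ?r"
      using norm_re_im_le[of "z + v"] zv by linarith+
    have eq: "complex_vec s 0 + z + v = complex_vec (?a + s) ?\<eta>"
    proof -
      have "z + v = complex_vec ?a ?\<eta>" by (rule re_im_simps(7)[symmetric])
      then have "complex_vec s 0 + (z + v) = complex_vec s 0 + complex_vec ?a ?\<eta>" by (rule arg_cong)
      also have "\<dots> = complex_vec (?a + s) ?\<eta>" by (simp add: complex_vec_add add.commute)
      finally show ?thesis by (simp only: add.assoc)
    qed
    have "norm s = norm (- ?a + (?a + s))" by simp
    then have "1 + norm s \<le> (1 + norm ?a) * (1 + norm (?a + s))"
      using one_plus_norm_add[of "- ?a" "?a + s"] by (simp only: norm_minus_cancel minus_add_cancel)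
    also have "\<dots> \<le> (1 + ?r) * (1 + norm (?a + s))" using a by (intro mult_right_mono) auto
    finally have "(1 + norm s) ^ K \<le> (1 + ?r) ^ K * (1 + norm (?a + s)) ^ K"
      by (metis power_mono power_mult_distrib add_nonneg_nonneg norm_ge_zero zero_le_one)
    then have "(1 + norm s) ^ K * cmod (gau (incrs is \<alpha>) (complex_vec (?a + s) ?\<eta>))
       \<le> (1 + ?r) ^ K * (1 + norm (?a + s)) ^ K * cmod (gau (incrs is \<alpha>) (complex_vec (?a + s) ?\<eta>))"
      by (intro mult_right_mono) auto
    also have "\<dots> = (1 + ?r) ^ K * ((1 + norm (?a + s)) ^ K * cmod (gau (incrs is \<alpha>) (complex_vec (?a + s) ?\<eta>)))"
      by (rule mult.assoc)
    also have "\<dots> \<le> (1 + ?r) ^ K * (C * (1 + norm ?\<eta>) ^ m * exp ((?\<eta> \<bullet> ?\<eta>) / 2))"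
      by (intro mult_left_mono C(2) l) auto
    also have "\<dots> \<le> ?B"
    proof (intro mult_left_mono mult_mono power_mono)
      have "?\<eta> \<bullet> ?\<eta> = norm ?\<eta> * norm ?\<eta>" by (simp add: power2_norm_eq_inner[symmetric] power2_eq_square)
      also have "\<dots> \<le> ?r * ?r" using \<eta> by (intro mult_mono) auto
      finally show "exp ((?\<eta> \<bullet> ?\<eta>) / 2) \<le> exp (?r * ?r / 2)" by simp
    qed (use \<eta> C(1) in auto)
    finally show ?thesis unfolding eq .
  qed
  moreover have "0 \<le> ?B" using C(1) by simp
  ultimately show ?thesis by blast
qed

text \<open>The complex first order Taylor remainder in z. Differentiating it in s only raises
  \<alpha>, so a pointwise estimate available for every \<alpha> is already a Schwartz
  bound.\<close>

definition gz_remainder :: "('n::finite \<Rightarrow> nat) \<Rightarrow> complex^'n \<Rightarrow> complex^'n \<Rightarrow> real^'n \<Rightarrow> complex" where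
  "gz_remainder \<alpha> z w s = gz \<alpha> (z + w) s - gz \<alpha> z s - gform (\<lambda>k. gz (incr k \<alpha>) z s) w"

lemma smooth_gz_remainder: "smooth (gz_remainder \<alpha> z w)"
  and partials_gz_remainder: "partials is (gz_remainder \<alpha> z w) = gz_remainder (incrs is \<alpha>) z w"
proof -
  let ?G = "\<lambda>is. gz_remainder (incrs is \<alpha>) z w"
  have G: "(?G is has_derivative grad_form (\<lambda>i. ?G (i # is) x)) (at x)" for "is" x
  proof -
    let ?b = "incrs is \<alpha>"
    have D: "(?G is has_derivative (\<lambda>v. grad_form (\<lambda>i. gz (incr i ?b) (z + w) x) v - grad_form (\<lambda>i. gz (incr i ?b) z x) v
        - (\<Sum>k\<in>UNIV. w $ k * grad_form (\<lambda>i. gz (incr i (incr k ?b)) z x) v))) (at x)"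
      unfolding gz_remainder_def[abs_def] gform_def
      by (intro has_derivative_diff has_derivative_sum has_derivative_mult_right gz_derivative)
    have "(\<Sum>k\<in>UNIV. w $ k * grad_form (\<lambda>i. gz (incr i (incr k ?b)) z x) v)
      = grad_form (\<lambda>i. gform (\<lambda>k. gz (incr k (incr i ?b)) z x) w) v" for v
      unfolding grad_form_def gform_def sum_distrib_left
      by (subst sum.swap) (simp add: incr_commute mult_ac)
    then show ?thesis
      by (intro has_derivative_eq_rhs[OF D]) (simp add: gz_remainder_def grad_form_diff fun_eq_iff)
  qed
  show "smooth (gz_remainder \<alpha> z w)" using smoothI[of ?G, OF G] by simp
  show "partials is (gz_remainder \<alpha> z w) = gz_remainder (incrs is \<alpha>) z w" using partials_eqI[of ?G, OF G] by simp
qed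

text \<open>A remainder that is quadratic in a Schwartz seminorm stays quadratic under a functional
  of finite order; this is how complex differentiability reaches \<open>transform\<close>. The two
  factors \<open>CARD('n')\<close> come from two nested sums over coordinates.\<close>

lemma gz_remainder_bound:
  fixes \<alpha> :: "'n::finite \<Rightarrow> nat"
  shows "\<exists>K\<ge>0. \<forall>w. norm w \<le> 1 \<longrightarrow> sbound N (gz_remainder \<alpha> z w) (K * (norm w * norm w))"
proof -
  obtain B where B: "0 \<le> B" "\<And>is s v. length is \<le> N + 2 \<Longrightarrow> norm v \<le> 1 \<Longrightarrow>
    (1 + norm s) ^ N * cmod (gau (incrs is \<alpha>) (complex_vec s 0 + z + v)) \<le> B"
    using gau_local_bound[where L="N + 2" and K=N and \<alpha>=\<alpha> and z=z] by blast
  let ?n = "real CARD('n)"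
  have "sbound N (gz_remainder \<alpha> z w) (?n * ?n * B * (norm w * norm w))" if w: "norm w \<le> 1" for w
    unfolding sbound_def partials_gz_remainder
  proof (intro allI impI)
    fix "is" :: "'n list" and s :: "real^'n" assume l: "length is \<le> N"
    let ?b = "incrs is \<alpha>" and ?x = "complex_vec s 0 + z"
    let ?P = "(1 + norm s) ^ N"
    have P: "0 < ?P" by (simp add: add_pos_nonneg)
    have 2: "cmod (gau (incr j (incr k ?b)) (?x + v)) \<le> B / ?P" if "norm v \<le> 1" for j k v
      using B(2)[of "j # k # is" v s] l that P by (simp add: pos_le_divide_eq mult.commute)
    have 1: "cmod (gau (incr k ?b) (?x + t *\<^sub>R w) - gau (incr k ?b) ?x) \<le> ?n * (B / ?P) * norm w"
      if t: "0 \<le> t" "t \<le> 1" for t k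
    proof -
      have tw: "norm (t *\<^sub>R w) \<le> norm w" using t by (simp add: mult_left_le_one_le)
      have "cmod (gau (incr k ?b) (?x + t *\<^sub>R w) - gau (incr k ?b) ?x - 0) \<le> ?n * (B / ?P) * norm (t *\<^sub>R w)"
      proof (rule derivative_line_bound[where f' = "\<lambda>y. gform (\<lambda>j. gau (incr j (incr k ?b)) y)"])
        fix q :: real assume q: "0 \<le> q" "q \<le> 1"
        show "(gau (incr k ?b) has_derivative gform (\<lambda>j. gau (incr j (incr k ?b)) (?x + q *\<^sub>R t *\<^sub>R w))) (at (?x + q *\<^sub>R t *\<^sub>R w))"
          by (rule gau_derivative)
        have "norm (q *\<^sub>R t *\<^sub>R w) \<le> norm (t *\<^sub>R w)"
          unfolding norm_scaleR[of q "t *\<^sub>R w"] using q by (intro mult_left_le_one_le) auto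
        then have "norm (q *\<^sub>R t *\<^sub>R w) \<le> 1" using tw w by linarith
        then show "cmod (gform (\<lambda>j. gau (incr j (incr k ?b)) (?x + q *\<^sub>R t *\<^sub>R w)) (t *\<^sub>R w) - 0) \<le> ?n * (B / ?P) * norm (t *\<^sub>R w)"
          unfolding diff_zero by (intro norm_gform_le 2)
      qed
      also have "\<dots> \<le> ?n * (B / ?P) * norm w"
        using tw B(1) P by (intro mult_left_mono) auto
      finally show ?thesis by simp
    qed
    have "cmod (gau ?b (?x + w) - gau ?b ?x - gform (\<lambda>k. gau (incr k ?b) ?x) w) \<le> ?n * (?n * (B / ?P) * norm w) * norm w"
    proof (rule derivative_line_bound[where f' = "\<lambda>y. gform (\<lambda>k. gau (incr k ?b) y)"])
      fix t :: real assume t: "0 \<le> t" "t \<le> 1"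
      show "(gau ?b has_derivative gform (\<lambda>k. gau (incr k ?b) (?x + t *\<^sub>R w))) (at (?x + t *\<^sub>R w))"
        by (rule gau_derivative)
      show "cmod (gform (\<lambda>k. gau (incr k ?b) (?x + t *\<^sub>R w)) w - gform (\<lambda>k. gau (incr k ?b) ?x) w) \<le> ?n * (?n * (B / ?P) * norm w) * norm w"
        unfolding gform_diff[symmetric] by (intro norm_gform_le 1 t)
    qed
    then have "cmod (gz_remainder ?b z w s) \<le> ?n * ?n * B * (norm w * norm w) / ?P"
      by (simp add: gz_remainder_def gz_def mult_ac add.assoc)
    then show "?P * cmod (gz_remainder ?b z w s) \<le> ?n * ?n * B * (norm w * norm w)"
      using P by (simp add: pos_le_divide_eq mult.commute)
  qed
  then show ?thesis using B(1) by (intro exI[of _ "?n * ?n * B"]) auto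
qed

text \<open>Weak differentiability of the orbit, at a single test function. Translating the
  distribution by h translates the test function by -h, and this sign cancels that of
  \<open>dist_partial\<close>.\<close>

lemma tempered_translate_taylor:
  fixes \<phi> :: "real^'n::finite \<Rightarrow> complex"
  assumes u: "u \<in> tempered_distributions" and \<phi>: "\<phi> \<in> schwartz_space"
  shows "\<exists>K. \<forall>s h. \<bar>s\<bar> \<le> 1 \<longrightarrow> \<bar>h\<bar> \<le> 1 \<longrightarrow>
    cmod (dist_translate ((s + h) *\<^sub>R axis i 1) u \<phi> - dist_translate (s *\<^sub>R axis i 1) u \<phi>
      - complex_of_real h * dist_translate (s *\<^sub>R axis i 1) (dist_partial i u) \<phi>) \<le> K * (h * h)"
proof -
  let ?e = "axis i (1::real) :: real^'n"
  obtain N C where C: "0 \<le> C" "\<And>\<phi> c. \<phi> \<in> schwartz_space \<Longrightarrow> sbound N \<phi> c \<Longrightarrow> cmod (u \<phi>) \<le> C * c"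
    using tempered_bound[OF u] by blast
  note u' = u[unfolded tempered_distributions_def]
  obtain c where c: "sbound (Suc (Suc N)) \<phi> c" using schwartz_sbound[OF \<phi>] by blast
  \<comment> \<open>Translation by at most 1 multiplies a Schwartz bound by 2 to the power of its
    order.\<close>
  define c' where "c' = 2 ^ Suc (Suc N) * c"
  have "cmod (dist_translate ((s + h) *\<^sub>R ?e) u \<phi> - dist_translate (s *\<^sub>R ?e) u \<phi>
      - complex_of_real h * dist_translate (s *\<^sub>R ?e) (dist_partial i u) \<phi>)
      \<le> C * (2 ^ Suc N * real CARD('n) * c') * (h * h)" if s: "\<bar>s\<bar> \<le> 1" and h: "\<bar>h\<bar> \<le> 1" for s h
  proof -
    let ?\<psi> = "\<lambda>x. \<phi> (x + - (s *\<^sub>R ?e))"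
    have \<psi>: "?\<psi> \<in> schwartz_space" using \<phi> by (rule schwartz_translate)
    note \<psi>s = schwartz_smooth[OF \<psi>]
    have "sbound (Suc (Suc N)) (\<lambda>x. \<phi> (- (s *\<^sub>R ?e) + 1 *\<^sub>R x)) ((1 + norm (- (s *\<^sub>R ?e))) ^ Suc (Suc N) * c)"
      by (rule sbound_affine[OF schwartz_smooth[OF \<phi>] c]) simp
    moreover have "(1 + norm (- (s *\<^sub>R ?e))) ^ Suc (Suc N) * c \<le> c'"
      unfolding c'_def using s sbound_nonneg[OF c] by (intro mult_right_mono power_mono) auto
    ultimately have "sbound (Suc (Suc N)) (\<lambda>x. \<phi> (- (s *\<^sub>R ?e) + 1 *\<^sub>R x)) c'"
      by (rule sbound_mono[OF _ order_refl])
    then have c1: "sbound (Suc (Suc N)) ?\<psi> c'" by (simp add: add.commute)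
    let ?R = "\<lambda>x. ?\<psi> (x + (- h) *\<^sub>R ?e) - ?\<psi> x - complex_of_real (- h) * partial i ?\<psi> x"
    have "sbound N ?R (2 ^ Suc N * real CARD('n) * c' * ((- h) * (- h)))"
      by (rule sbound_translate_taylor[OF \<psi>s c1]) (use h in simp)
    moreover have R1: "(\<lambda>x. ?\<psi> (x + (- h) *\<^sub>R ?e)) \<in> schwartz_space"
      using schwartz_translate[OF \<psi>, of "(- h) *\<^sub>R ?e"] .
    have R2: "(\<lambda>x. ?\<psi> (x + (- h) *\<^sub>R ?e) - ?\<psi> x) \<in> schwartz_space"
      using R1 \<psi> by (rule schwartz_diff)
    have R3: "(\<lambda>x. complex_of_real (- h) * partial i ?\<psi> x) \<in> schwartz_space"
      using schwartz_partial[OF \<psi>] by (rule schwartz_scale)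
    have "?R \<in> schwartz_space" using R2 R3 by (rule schwartz_diff)
    ultimately have "cmod (u ?R) \<le> C * (2 ^ Suc N * real CARD('n) * c' * (h * h))"
      using C(2) by fastforce
    moreover have diff: "u (\<lambda>x. a x - b x) = u a - u b" if "a \<in> schwartz_space" "b \<in> schwartz_space" for a b
      using continuous_dual_add[OF u' that(1) schwartz_scale[OF that(2), of "-1"]] continuous_dual_scale[OF u' that(2), of "-1"]
      by simp
    have "u ?R = u (\<lambda>x. ?\<psi> (x + (- h) *\<^sub>R ?e)) - u ?\<psi> - complex_of_real (- h) * u (partial i ?\<psi>)"
      unfolding diff[OF R2 R3] diff[OF R1 \<psi>] continuous_dual_scale[OF u' schwartz_partial[OF \<psi>]] by (rule refl)
    moreover have "dist_translate (s *\<^sub>R ?e) (dist_partial i u) \<phi> = - u (partial i ?\<psi>)"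
      using \<psi> by (simp add: dist_translate_def dist_partial_def)
    moreover have "dist_translate ((s + h) *\<^sub>R ?e) u \<phi> = u (\<lambda>x. ?\<psi> (x + (- h) *\<^sub>R ?e))"
      by (simp add: dist_translate_def scaleR_add_left algebra_simps)
    moreover have "dist_translate (s *\<^sub>R ?e) u \<phi> = u ?\<psi>"
      by (simp add: dist_translate_def)
    ultimately show ?thesis by (simp add: mult.assoc)
  qed
  then show ?thesis by blast
qed

text \<open>Lets a Riemann sum be rewritten on a grid \<open>k\<close> times finer, each coarse node
  being repeated \<open>k\<close> times.\<close>

lemma sum_div_blocks:
  fixes g :: "nat \<Rightarrow> complex"
  shows "(\<Sum>j<m * k. g (j div k)) = of_nat k * (\<Sum>j<m. g j)"
proof -
  have "(\<Sum>j<m * k. g (j div k)) = (\<Sum>a<m. \<Sum>j\<in>{a*k..<a*k+k}. g (j div k))"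
    by (rule sum.nat_group[symmetric])
  also have "\<dots> = (\<Sum>a<m. \<Sum>j\<in>{a*k..<a*k+k}. g a)"
  proof (intro sum.cong refl)
    fix a j assume "j \<in> {a*k..<a*k+k}"
    then have "j div k = a"
      by (intro div_nat_eqI) (auto simp: mult.commute)
    then show "g (j div k) = g a" by simp
  qed
  finally show ?thesis by (simp add: sum_distrib_left)
qed

section \<open>Differentiability of translation in the norm\<close>

context translation_invariant_banach_space
begin

text \<open>
  The Riemann sums \<open>R p\<close> of the orbit \<open>s \<mapsto> T s\<close> of the derivative are Cauchy, hence convergent in \<open>E\<close>.
  Evaluation at rapidly decreasing functions identifies the limit with the difference on the left.
\<close>

lemma translate_derivative_bound:
  assumes u: "u \<in> E" and v: "dist_partial i u \<in> E" and r1: "\<bar>r\<bar> \<le> 1"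
    and \<eta>: "\<And>s. \<bar>s\<bar> \<le> \<bar>r\<bar> \<Longrightarrow>
      nE (\<lambda>\<phi>. dist_translate (s *\<^sub>R axis i 1) (dist_partial i u) \<phi> - dist_partial i u \<phi>) \<le> \<eta>"
  shows "nE (\<lambda>\<phi>. dist_translate (r *\<^sub>R axis i 1) u \<phi> - u \<phi> - complex_of_real r * dist_partial i u \<phi>) \<le> \<bar>r\<bar> * \<eta>"
proof -
  let ?e = "axis i (1::real) :: real^'n"
  define v where "v = dist_partial i u"
  define T where "T s = dist_translate (s *\<^sub>R ?e) v" for s
  have vE: "v \<in> E" using v by (simp add: v_def)
  have TE: "T s \<in> E" for s using vE by (simp add: T_def)
  \<comment> \<open>Dyadic grids refine one another, so two Riemann sums can be compared node by
    node.\<close>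
  define h where "h p = r / 2 ^ p" for p :: nat
  define R where "R p = (\<lambda>\<phi>. \<Sum>j<(2::nat) ^ p. complex_of_real (h p) * T (real j * h p) \<phi>)" for p
  have hp: "\<bar>h p\<bar> * 2 ^ p = \<bar>r\<bar>" for p by (simp add: h_def abs_divide)
  have RE: "R p \<in> E" for p
    unfolding R_def using norm_sum[of "{..<2^p}" "\<lambda>j \<phi>. complex_of_real (h p) * T (real j * h p) \<phi>"]
    by (simp add: subspace_scale[OF subspace TE])
  have jh: "\<bar>real j * h p\<bar> \<le> \<bar>r\<bar>" if "j < 2 ^ p" for j p
  proof -
    have "real j \<le> 2 ^ p" using that by (metis less_imp_le of_nat_le_iff of_nat_numeral of_nat_power)
    then have "real j * \<bar>h p\<bar> \<le> 2 ^ p * \<bar>h p\<bar>" by (intro mult_right_mono) auto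
    then show ?thesis using hp[of p] by (simp add: abs_mult mult.commute)
  qed
  have est: "nE (\<lambda>\<phi>. \<Sum>j<(2::nat) ^ p. complex_of_real (h p) * X j \<phi>) \<le> \<bar>r\<bar> * b"
    if "\<And>j. j < 2 ^ p \<Longrightarrow> X j \<in> E" "\<And>j. j < 2 ^ p \<Longrightarrow> nE (X j) \<le> b" for X p b
  proof -
    have "nE (\<lambda>\<phi>. \<Sum>j<(2::nat) ^ p. complex_of_real (h p) * X j \<phi>) \<le> (\<Sum>j<(2::nat) ^ p. nE (\<lambda>\<phi>. complex_of_real (h p) * X j \<phi>))"
      using norm_sum[of "{..<2^p}" "\<lambda>j \<phi>. complex_of_real (h p) * X j \<phi>"] that(1)
      by (simp add: subspace_scale[OF subspace])
    also have "\<dots> \<le> (\<Sum>j<(2::nat) ^ p. \<bar>h p\<bar> * b)"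
      using that by (intro sum_mono) (auto simp: norm_scale intro: mult_left_mono)
    also have "\<dots> = \<bar>r\<bar> * b" by (simp flip: hp[of p])
    finally show ?thesis .
  qed
  \<comment> \<open>All nodes lie within \<bar>r\<bar> of 0 and the steps add up to \<bar>r\<bar>;
    the bound does not depend on \<open>p\<close> and therefore survives the limit.\<close>
  have R_close: "nE (\<lambda>\<phi>. R p \<phi> - complex_of_real r * v \<phi>) \<le> \<bar>r\<bar> * \<eta>" for p
  proof -
    have eq: "(\<lambda>\<phi>. R p \<phi> - complex_of_real r * v \<phi>) = (\<lambda>\<phi>. \<Sum>j<(2::nat) ^ p. complex_of_real (h p) * (T (real j * h p) \<phi> - v \<phi>))"
      by (simp add: R_def right_diff_distrib sum_subtractf h_def fun_eq_iff)
    show ?thesis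
      unfolding eq
    proof (rule est)
      fix j :: nat assume j: "j < 2 ^ p"
      show "(\<lambda>\<phi>. T (real j * h p) \<phi> - v \<phi>) \<in> E" by (intro subspace_diff subspace TE vE)
      show "nE (\<lambda>\<phi>. T (real j * h p) \<phi> - v \<phi>) \<le> \<eta>"
        using \<eta>[OF jh[OF j]] by (simp add: T_def v_def)
    qed
  qed
  obtain M k where M: "0 < M" "\<And>h u. u \<in> E \<Longrightarrow> nE (dist_translate h u) \<le> M * (1 + norm h) ^ k * nE u"
    using translation_bound by blast
  have cauchy: "nE (\<lambda>\<phi>. R (p + q) \<phi> - R p \<phi>) \<le> \<bar>r\<bar> * (M * 2 ^ k * \<epsilon>)"
    if \<epsilon>: "\<And>s. \<bar>s\<bar> \<le> \<bar>h p\<bar> \<Longrightarrow> nE (\<lambda>\<phi>. T s \<phi> - v \<phi>) \<le> \<epsilon>" for p q \<epsilon>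
  proof -
    let ?k = "(2::nat) ^ q"
    let ?X = "\<lambda>j \<phi>. T (real j * h (p + q)) \<phi> - T (real (j div ?k) * h p) \<phi>"
    have hpq: "h p = real ?k * h (p + q)" by (simp add: h_def power_add)
    have "R p \<phi> = (\<Sum>j<2 ^ (p + q). complex_of_real (h (p + q)) * T (real (j div ?k) * h p) \<phi>)" for \<phi>
      using sum_div_blocks[of "\<lambda>j. complex_of_real (h (p + q)) * T (real j * h p) \<phi>" ?k "2 ^ p"]
      unfolding R_def sum_distrib_left
      by (simp add: hpq power_add mult_ac)
    then have eq: "(\<lambda>\<phi>. R (p + q) \<phi> - R p \<phi>) = (\<lambda>\<phi>. \<Sum>j<(2::nat) ^ (p + q). complex_of_real (h (p + q)) * ?X j \<phi>)"
      by (simp add: R_def[of "p + q"] right_diff_distrib sum_subtractf fun_eq_iff)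
    show ?thesis
      unfolding eq
    proof (rule est)
      fix j :: nat assume j: "j < 2 ^ (p + q)"
      show "?X j \<in> E" by (intro subspace_diff subspace TE)
      \<comment> \<open>A fine node is its coarse node \<open>?a\<close> plus an offset
        \<open>?b\<close> of at most one coarse step, so the difference at this node is the
        translate by \<open>?a\<close> of \<open>T ?b\<close> minus \<open>v\<close>.\<close>
      let ?a = "real (j div ?k) * h p" and ?b = "real (j mod ?k) * h (p + q)"
      have "real j = real (j div ?k) * real ?k + real (j mod ?k)"
        by (simp only: of_nat_mult[symmetric] of_nat_add[symmetric] div_mult_mod_eq)
      then have jeq: "real j * h (p + q) = ?b + ?a"
        unfolding hpq by (simp add: algebra_simps)
      have "T (real j * h (p + q)) = dist_translate (?a *\<^sub>R ?e) (T ?b)"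
        by (simp add: T_def dist_translate_add jeq scaleR_add_left)
      then have Xe: "?X j = dist_translate (?a *\<^sub>R ?e) (\<lambda>\<phi>. T ?b \<phi> - v \<phi>)"
        by (simp add: T_def dist_translate_def)
      have "nE (?X j) \<le> M * (1 + norm (?a *\<^sub>R ?e)) ^ k * nE (\<lambda>\<phi>. T ?b \<phi> - v \<phi>)"
        unfolding Xe by (rule M(2)[OF subspace_diff[OF subspace TE vE]])
      also have "\<dots> \<le> M * 2 ^ k * \<epsilon>"
      proof (intro mult_mono mult_left_mono power_mono)
        have "j div ?k < 2 ^ p" using j by (simp add: less_mult_imp_div_less power_add)
        then have "\<bar>?a\<bar> \<le> 1" using jh[of "j div ?k" p] r1 by linarith
        then show "1 + norm (?a *\<^sub>R ?e) \<le> 2" by simp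
        have "real (j mod ?k) \<le> real ?k" by (simp add: less_imp_le)
        then have "real (j mod ?k) * \<bar>h (p + q)\<bar> \<le> real ?k * \<bar>h (p + q)\<bar>" by (intro mult_right_mono) auto
        also have "\<dots> = \<bar>h p\<bar>" unfolding hpq by (simp add: abs_mult)
        finally have "\<bar>?b\<bar> \<le> \<bar>h p\<bar>" by (simp add: abs_mult)
        then show "nE (\<lambda>\<phi>. T ?b \<phi> - v \<phi>) \<le> \<epsilon>" by (rule \<epsilon>)
      qed (use M(1) norm_nonneg[OF subspace_diff[OF subspace TE vE]] in auto)
      finally show "nE (?X j) \<le> M * 2 ^ k * \<epsilon>" .
    qed
  qed
  have h0: "h \<longlonglongrightarrow> 0"
  proof -
    have "(\<lambda>p. r * (1 / 2) ^ p) \<longlonglongrightarrow> r * 0"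
      by (intro tendsto_intros LIMSEQ_power_zero) auto
    then show ?thesis by (simp add: h_def[abs_def] power_divide)
  qed
  have "\<exists>w\<in>E. (\<lambda>p. nE (\<lambda>\<phi>. R p \<phi> - w \<phi>)) \<longlonglongrightarrow> 0"
  proof (rule complete[OF RE])
    fix e :: real assume e: "0 < e"
    define \<epsilon> where "\<epsilon> = e / (2 * (M * 2 ^ k))"
    have \<epsilon>: "0 < \<epsilon>" using e M(1) by (simp add: \<epsilon>_def)
    obtain \<delta> where \<delta>: "0 < \<delta>" "\<And>h. norm h < \<delta> \<Longrightarrow> nE (\<lambda>\<phi>. dist_translate h v \<phi> - v \<phi>) < \<epsilon>"
      using translation_continuous[OF vE \<epsilon>] by blast
    have "\<forall>\<^sub>F p in sequentially. \<bar>h p\<bar> < \<delta>"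
      using order_tendstoD(2)[OF tendsto_rabs[OF h0], of \<delta>] \<delta>(1) by simp
    then obtain P where P: "\<And>p. P \<le> p \<Longrightarrow> \<bar>h p\<bar> < \<delta>"
      unfolding eventually_sequentially by blast
    have half: "nE (\<lambda>\<phi>. R (p + q) \<phi> - R p \<phi>) < e" if p: "P \<le> p" for p q
    proof -
      have "nE (\<lambda>\<phi>. R (p + q) \<phi> - R p \<phi>) \<le> \<bar>r\<bar> * (M * 2 ^ k * \<epsilon>)"
      proof (rule cauchy)
        fix s assume "\<bar>s\<bar> \<le> \<bar>h p\<bar>"
        then have "norm (s *\<^sub>R ?e) < \<delta>" using P[OF p] by simp
        then show "nE (\<lambda>\<phi>. T s \<phi> - v \<phi>) \<le> \<epsilon>" using \<delta>(2)[of "s *\<^sub>R ?e"] by (simp add: T_def)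
      qed
      also have "M * 2 ^ k * \<epsilon> = e / 2" using M(1) by (simp add: \<epsilon>_def)
      also have "\<bar>r\<bar> * (e / 2) \<le> 1 * (e / 2)" using r1 e by (intro mult_right_mono) auto
      finally show ?thesis using e by simp
    qed
    have "nE (\<lambda>\<phi>. R a \<phi> - R b \<phi>) < e" if ab: "P \<le> a" "P \<le> b" for a b
    proof (cases "a \<le> b")
      case True
      then show ?thesis using half[OF ab(1), of "b - a"] norm_minus_commute_E[OF RE[of a] RE[of b]] by simp
    next
      case False
      then show ?thesis using half[OF ab(2), of "a - b"] by simp
    qed
    then show "\<exists>N. \<forall>k\<ge>N. \<forall>l\<ge>N. nE (\<lambda>\<phi>. R k \<phi> - R l \<phi>) < e" by blast
  qed
  then obtain w where w: "w \<in> E" "(\<lambda>p. nE (\<lambda>\<phi>. R p \<phi> - w \<phi>)) \<longlonglongrightarrow> 0" by blast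
  have "w \<phi> = dist_translate (r *\<^sub>R ?e) u \<phi> - u \<phi>" for \<phi>
  proof (cases "\<phi> \<in> schwartz_space")
    case False
    have out: "x \<phi> = 0" if "x \<in> E" for x
      using that False subset_tempered continuous_dual_outside unfolding tempered_distributions_def by blast
    show ?thesis using out[OF w(1)] out[OF u] out[OF translate_in[OF u]] by simp
  next
    case True
    obtain C where C: "0 \<le> C" "\<And>u. u \<in> E \<Longrightarrow> cmod (u \<phi>) \<le> C * nE u"
      using evaluation_bound by blast
    have "(\<lambda>p. R p \<phi> - w \<phi>) \<longlonglongrightarrow> 0"
    proof (rule Lim_null_comparison)
      show "\<forall>\<^sub>F p in sequentially. norm (R p \<phi> - w \<phi>) \<le> C * nE (\<lambda>\<phi>. R p \<phi> - w \<phi>)"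
        using C(2)[OF subspace_diff[OF subspace RE w(1)]] by simp
      show "(\<lambda>p. C * nE (\<lambda>\<phi>. R p \<phi> - w \<phi>)) \<longlonglongrightarrow> 0"
        using tendsto_mult_right_zero[OF w(2)] by simp
    qed
    moreover have "(\<lambda>p. R p \<phi> - (dist_translate (r *\<^sub>R ?e) u \<phi> - u \<phi>)) \<longlonglongrightarrow> 0"
    proof -
      \<comment> \<open>The increments of \<open>G\<close> telescope to the expected limit, and each
        differs from its Riemann term by O(h^2); the 2^p errors add up to O(h).\<close>
      define G where "G s = dist_translate (s *\<^sub>R ?e) u \<phi>" for s
      obtain K where K: "\<And>s h. \<bar>s\<bar> \<le> 1 \<Longrightarrow> \<bar>h\<bar> \<le> 1 \<Longrightarrow> cmod (G (s + h) - G s - complex_of_real h * T s \<phi>) \<le> K * (h * h)"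
        using tempered_translate_taylor[of u \<phi> i] u True subset_tempered unfolding G_def T_def v_def by blast
      have "norm (R p \<phi> - (G r - G 0)) \<le> \<bar>K\<bar> * \<bar>h p\<bar>" for p
      proof -
        have "(\<Sum>j<(2::nat) ^ p. G (real (Suc j) * h p) - G (real j * h p)) = G (real (2 ^ p) * h p) - G (real 0 * h p)"
          by (rule sum_lessThan_telescope)
        also have "real (2 ^ p) * h p = r" by (simp add: h_def)
        finally have "R p \<phi> - (G r - G 0) = (\<Sum>j<(2::nat) ^ p. complex_of_real (h p) * T (real j * h p) \<phi> - (G (real (Suc j) * h p) - G (real j * h p)))"
          by (simp add: R_def sum_subtractf)
        also have "norm \<dots> \<le> (\<Sum>j<(2::nat) ^ p. \<bar>K\<bar> * (h p * h p))"
        proof (rule sum_norm_le)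
          fix j assume "j \<in> {..<(2::nat) ^ p}"
          then have "\<bar>real j * h p\<bar> \<le> 1" using jh[of j p] r1 by simp
          moreover have "\<bar>h p\<bar> \<le> 1"
          proof -
            have "\<bar>h p\<bar> * 1 \<le> \<bar>h p\<bar> * 2 ^ p" by (intro mult_left_mono) auto
            then show ?thesis using hp[of p] r1 by linarith
          qed
          ultimately have "cmod (G (real j * h p + h p) - G (real j * h p) - complex_of_real (h p) * T (real j * h p) \<phi>) \<le> K * (h p * h p)"
            by (rule K)
          also have "\<dots> \<le> \<bar>K\<bar> * (h p * h p)" by (intro mult_right_mono) auto
          also have "real j * h p + h p = real (Suc j) * h p" by (simp add: algebra_simps)
          finally show "norm (complex_of_real (h p) * T (real j * h p) \<phi> - (G (real (Suc j) * h p) - G (real j * h p))) \<le> \<bar>K\<bar> * (h p * h p)"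
            by (subst norm_minus_commute) (simp add: algebra_simps)
        qed
        also have "\<dots> = \<bar>K\<bar> * (2 ^ p * \<bar>h p\<bar>) * \<bar>h p\<bar>" by (simp add: mult_ac)
        also have "\<dots> = \<bar>K\<bar> * \<bar>r\<bar> * \<bar>h p\<bar>" using hp[of p] by (simp add: mult.commute)
        also have "\<dots> \<le> \<bar>K\<bar> * 1 * \<bar>h p\<bar>" using r1 by (intro mult_right_mono mult_left_mono) auto
        finally show ?thesis by simp
      qed
      then have ev: "\<forall>\<^sub>F p in sequentially. norm (R p \<phi> - (G r - G 0)) \<le> \<bar>K\<bar> * \<bar>h p\<bar>"
        by simp
      have "(\<lambda>p. R p \<phi> - (G r - G 0)) \<longlonglongrightarrow> 0"
        by (rule Lim_null_comparison[OF ev tendsto_mult_right_zero[OF tendsto_rabs_zero[OF h0]]])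
      then show ?thesis by (simp add: G_def)
    qed
    ultimately have "(\<lambda>p. (R p \<phi> - w \<phi>) - (R p \<phi> - (dist_translate (r *\<^sub>R ?e) u \<phi> - u \<phi>))) \<longlonglongrightarrow> 0 - 0"
      by (rule tendsto_diff)
    then show ?thesis by (simp add: LIMSEQ_const_iff)
  qed
  then have weq: "w = (\<lambda>\<phi>. dist_translate (r *\<^sub>R ?e) u \<phi> - u \<phi>)" by (rule ext)
  have rv: "(\<lambda>\<phi>. complex_of_real r * v \<phi>) \<in> E" by (rule subspace_scale[OF subspace vE])
  have "nE (\<lambda>\<phi>. w \<phi> - complex_of_real r * v \<phi>) \<le> nE (\<lambda>\<phi>. R p \<phi> - w \<phi>) + \<bar>r\<bar> * \<eta>" for p
    using norm_diff_le[OF w(1) RE[of p] rv] norm_minus_commute_E[OF w(1) RE[of p]] R_close[of p] by simp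
  moreover have "(\<lambda>p. nE (\<lambda>\<phi>. R p \<phi> - w \<phi>) + \<bar>r\<bar> * \<eta>) \<longlonglongrightarrow> 0 + \<bar>r\<bar> * \<eta>"
    by (intro tendsto_intros w(2))
  ultimately have "nE (\<lambda>\<phi>. w \<phi> - complex_of_real r * v \<phi>) \<le> 0 + \<bar>r\<bar> * \<eta>"
    by (intro LIMSEQ_le_const) auto
  then show ?thesis by (simp add: weq v_def)
qed

lemma translate_derivative:
  assumes u: "u \<in> E" and v: "dist_partial i u \<in> E" and \<epsilon>: "0 < \<epsilon>"
  shows "\<exists>\<delta>>0. \<forall>r. \<bar>r\<bar> < \<delta> \<longrightarrow>
    nE (\<lambda>\<phi>. dist_translate (r *\<^sub>R axis i 1) u \<phi> - u \<phi> - complex_of_real r * dist_partial i u \<phi>) \<le> \<bar>r\<bar> * \<epsilon>"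
proof -
  obtain \<delta> where \<delta>: "0 < \<delta>" "\<And>h. norm h < \<delta> \<Longrightarrow> nE (\<lambda>\<phi>. dist_translate h (dist_partial i u) \<phi> - dist_partial i u \<phi>) < \<epsilon>"
    using translation_continuous[OF v \<epsilon>] by blast
  have "nE (\<lambda>\<phi>. dist_translate (r *\<^sub>R axis i 1) u \<phi> - u \<phi> - complex_of_real r * dist_partial i u \<phi>) \<le> \<bar>r\<bar> * \<epsilon>"
    if r: "\<bar>r\<bar> < min \<delta> 1" for r
  proof (rule translate_derivative_bound[OF u v])
    show "\<bar>r\<bar> \<le> 1" using r by simp
    fix s :: real assume "\<bar>s\<bar> \<le> \<bar>r\<bar>"
    then have "norm (s *\<^sub>R axis i (1::real)) < \<delta>" using r by simp
    then show "nE (\<lambda>\<phi>. dist_translate (s *\<^sub>R axis i 1) (dist_partial i u) \<phi> - dist_partial i u \<phi>) \<le> \<epsilon>"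
      using \<delta>(2) by (intro less_imp_le)
  qed
  then show ?thesis using \<delta>(1) by (intro exI[of _ "min \<delta> 1"]) auto
qed

end

section \<open>The test function space\<close>

definition de_norm :: "(((real^'n::finite \<Rightarrow> complex) \<Rightarrow> complex) \<Rightarrow> real) \<Rightarrow> nat \<Rightarrow> ((real^'n \<Rightarrow> complex) \<Rightarrow> complex) \<Rightarrow> real" where
  "de_norm nE N u = (MAX is\<in>{is. length is \<le> N}. nE (dist_partials is u))"

lemma DE_seminorms_eq: "DE_seminorms nE = range (de_norm nE)"
  by (auto simp: DE_seminorms_def de_norm_def[abs_def])

lemma de_norm_ge: "length is \<le> N \<Longrightarrow> nE (dist_partials is u) \<le> de_norm nE N u"
  unfolding de_norm_def by (intro Max_ge finite_imageI finite_short_lists) auto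

lemma de_norm_le: "(\<And>is. length is \<le> N \<Longrightarrow> nE (dist_partials is u) \<le> c) \<Longrightarrow> de_norm nE N u \<le> c"
  unfolding de_norm_def
  by (subst Max_le_iff) (auto intro!: finite_imageI finite_short_lists exI[of _ "[]"])

lemma de_norm_mono: "M \<le> N \<Longrightarrow> de_norm nE M u \<le> de_norm nE N u"
  by (intro de_norm_le de_norm_ge) simp

context translation_invariant_banach_space
begin

lemma DE_iff: "u \<in> DE_space E \<longleftrightarrow> (\<forall>is. dist_partials is u \<in> E)"
  unfolding DE_space_def by (auto dest: spec[of _ "[]"])

lemma DE_lincomb:
  assumes "u \<in> DE_space E" "v \<in> DE_space E"
  shows "(\<lambda>\<phi>. a * u \<phi> + b * v \<phi>) \<in> DE_space E"
  using assms unfolding DE_iff dist_partials_lincomb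
  by (intro allI subspace_add[OF subspace] subspace_scale[OF subspace]) auto

lemma DE_subspace: "complex_subspace (DE_space E)"
  unfolding complex_subspace_def
proof (intro conjI ballI allI)
  show "(\<lambda>x. 0) \<in> DE_space E"
    unfolding DE_iff
  proof
    fix "is" :: "'n list"
    have "dist_partials is (\<lambda>x::real^'n \<Rightarrow> complex. 0) = (\<lambda>x. 0)"
      using dist_partials_lincomb[of "is" 0 "\<lambda>x. 0" 0 "\<lambda>x. 0"] by simp
    then show "dist_partials is (\<lambda>x::real^'n \<Rightarrow> complex. 0) \<in> E" using subspace_zero[OF subspace] by simp
  qed
  show "(\<lambda>x. u x + v x) \<in> DE_space E" if "u \<in> DE_space E" "v \<in> DE_space E" for u v
    using DE_lincomb[OF that, of 1 1] by simp
  show "(\<lambda>x. c * u x) \<in> DE_space E" if "u \<in> DE_space E" for c u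
    using DE_lincomb[OF that that, of c 0] by simp
qed

lemma de_norm_nonneg: "u \<in> DE_space E \<Longrightarrow> 0 \<le> de_norm nE N u"
  using order_trans[OF norm_nonneg de_norm_ge[of "[]"]] by (auto simp: DE_space_def)

lemma de_norm_scale: "u \<in> DE_space E \<Longrightarrow> de_norm nE N (\<lambda>\<phi>. c * u \<phi>) \<le> cmod c * de_norm nE N u"
proof (rule de_norm_le)
  fix "is" :: "'n list" assume u: "u \<in> DE_space E" and l: "length is \<le> N"
  have "dist_partials is (\<lambda>\<phi>. c * u \<phi>) = (\<lambda>\<phi>. c * dist_partials is u \<phi>)"
    using dist_partials_lincomb[of "is" c u 0 u] by simp
  then show "nE (dist_partials is (\<lambda>\<phi>. c * u \<phi>)) \<le> cmod c * de_norm nE N u"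
    using u de_norm_ge[OF l, of nE u] by (simp add: norm_scale DE_iff mult_left_mono)
qed

lemma DE_partial:
  assumes "u \<in> DE_space E"
  shows "dist_partial i u \<in> DE_space E" and "de_norm nE N (dist_partial i u) \<le> de_norm nE (Suc N) u"
proof -
  have eq: "dist_partials is (dist_partial i u) = dist_partials (is @ [i]) u" for "is"
    by (simp add: dist_partials_append)
  show "dist_partial i u \<in> DE_space E"
    using assms unfolding DE_iff eq by blast
  show "de_norm nE N (dist_partial i u) \<le> de_norm nE (Suc N) u"
    by (rule de_norm_le, unfold eq, rule de_norm_ge) simp
qed

lemma DE_translate: "u \<in> DE_space E \<Longrightarrow> dist_translate h u \<in> DE_space E"
  by (simp add: DE_iff dist_translate_partials)

lemma DE_regular: "\<phi> \<in> schwartz_space \<Longrightarrow> regular_distribution \<phi> \<in> DE_space E"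
  by (simp add: DE_iff dist_partials_regular regular_in schwartz_partials)

lemma DE_dual_bound:
  assumes f: "f \<in> DE_dual E nE"
  shows "\<exists>N C. 0 \<le> C \<and> (\<forall>u\<in>DE_space E. cmod (f u) \<le> C * de_norm nE N u)"
proof -
  note f' = f[unfolded DE_dual_def]
  let ?T = "seminorm_topology (DE_space E) (DE_seminorms nE)"
  let ?U = "{u \<in> DE_space E. f u \<in> ball 0 1}"
  have "openin ?T ?U"
    using openin_continuous_map_preimage[OF continuous_dual_continuous[OF f'], of "ball 0 1"] by simp
  then have "\<exists>Q C. finite Q \<and> Q \<subseteq> DE_seminorms nE \<and> 0 \<le> C \<and> (\<forall>u\<in>DE_space E. cmod (f u) \<le> C * (\<Sum>q\<in>Q. q u))"
  proof (rule seminorm_bound_of_open)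
    have "f (\<lambda>x. 0) = 0"
      using continuous_dual_scale[OF f' subspace_zero[OF DE_subspace], of 0] by simp
    then show "(\<lambda>x. 0) \<in> ?U" using subspace_zero[OF DE_subspace] by simp
    show "cmod (f (\<lambda>x. c * u x)) = cmod c * cmod (f u)" if "u \<in> DE_space E" for u c
      using continuous_dual_scale[OF f' that, of c] by (simp add: norm_mult)
  qed (auto simp: DE_seminorms_eq de_norm_scale de_norm_nonneg subspace_scale[OF DE_subspace])
  then obtain Q C where Q: "finite Q" "Q \<subseteq> DE_seminorms nE" "0 \<le> C"
    "\<And>u. u\<in>DE_space E \<Longrightarrow> cmod (f u) \<le> C * (\<Sum>q\<in>Q. q u)" by blast
  \<comment> \<open>The seminorms \<open>de_norm nE j\<close> increase with \<open>j\<close>, so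
    finitely many are controlled by one with a large index.\<close>
  obtain J where J: "finite J" "Q = de_norm nE ` J"
    using Q(1,2) finite_subset_image[of Q "de_norm nE" UNIV] unfolding DE_seminorms_eq by blast
  obtain N where N: "\<And>j. j \<in> J \<Longrightarrow> j \<le> N"
    using J(1) finite_nat_set_iff_bounded_le[of J] by auto
  have S: "(\<Sum>q\<in>Q. q u) \<le> real (card Q) * de_norm nE N u" for u
    by (rule sum_bounded_above) (use J N in \<open>auto intro!: de_norm_mono\<close>)
  then have "cmod (f u) \<le> (C * real (card Q)) * de_norm nE N u" if "u\<in>DE_space E" for u
    using order_trans[OF Q(4)[OF that] mult_left_mono[OF S Q(3)]] by (simp add: mult.assoc)
  then show ?thesis using Q(3) by (intro exI[of _ N] exI[of _ "C * real (card Q)"]) auto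
qed

end

section \<open>Orbits of a continuous functional\<close>

text \<open>\<open>M\<close> and \<kappa> record the growth of translations, \<open>C\<close> and
  \<open>N\<close> the size and order of the functional; fixing them once lets all later constants
  be explicit.\<close>

locale de_functional = translation_invariant_banach_space E nE
  for E :: "((real^'n::finite \<Rightarrow> complex) \<Rightarrow> complex) set" and nE +
  fixes f :: "((real^'n \<Rightarrow> complex) \<Rightarrow> complex) \<Rightarrow> complex"
    and M C :: real and \<kappa> N :: nat
  assumes f_dual: "f \<in> DE_dual E nE"
    and M_pos: "0 < M"
    and M_bound: "u \<in> E \<Longrightarrow> nE (dist_translate h u) \<le> M * (1 + norm h) ^ \<kappa> * nE u"
    and C_nonneg: "0 \<le> C"
    and f_bound: "u \<in> DE_space E \<Longrightarrow> cmod (f u) \<le> C * de_norm nE N u"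
begin

lemma f_add: "u \<in> DE_space E \<Longrightarrow> v \<in> DE_space E \<Longrightarrow> f (\<lambda>x. u x + v x) = f u + f v"
  by (rule continuous_dual_add[OF f_dual[unfolded DE_dual_def]])

lemma f_scale: "u \<in> DE_space E \<Longrightarrow> f (\<lambda>x. c * u x) = c * f u"
  by (rule continuous_dual_scale[OF f_dual[unfolded DE_dual_def]])

lemma f_diff: "u \<in> DE_space E \<Longrightarrow> v \<in> DE_space E \<Longrightarrow> f (\<lambda>x. u x - v x) = f u - f v"
  using f_add[OF _ subspace_scale[OF DE_subspace], of u v "-1"] f_scale[of v "-1"] by simp

definition orbit :: "((real^'n \<Rightarrow> complex) \<Rightarrow> complex) \<Rightarrow> real^'n \<Rightarrow> complex" where
  "orbit u s = f (dist_translate s u)"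

lemma orbit_add: "u \<in> DE_space E \<Longrightarrow> v \<in> DE_space E \<Longrightarrow> orbit (\<lambda>x. u x + v x) s = orbit u s + orbit v s"
  using f_add[OF DE_translate DE_translate, of u v s s] by (simp add: orbit_def dist_translate_def)

lemma orbit_scale: "u \<in> DE_space E \<Longrightarrow> orbit (\<lambda>x. c * u x) s = c * orbit u s"
  using f_scale[OF DE_translate, of u c s] by (simp add: orbit_def dist_translate_def)

lemma de_norm_translate:
  assumes "u \<in> DE_space E"
  shows "de_norm nE K (dist_translate h u) \<le> M * (1 + norm h) ^ \<kappa> * de_norm nE K u"
proof (rule de_norm_le)
  fix "is" :: "'n list" assume l: "length is \<le> K"
  have "nE (dist_partials is (dist_translate h u)) \<le> M * (1 + norm h) ^ \<kappa> * nE (dist_partials is u)"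
    using assms by (simp add: dist_translate_partials M_bound DE_iff)
  also have "\<dots> \<le> M * (1 + norm h) ^ \<kappa> * de_norm nE K u"
    using M_pos by (intro mult_left_mono de_norm_ge l) auto
  finally show "nE (dist_partials is (dist_translate h u)) \<le> M * (1 + norm h) ^ \<kappa> * de_norm nE K u" .
qed

lemma orbit_bound:
  assumes "u \<in> DE_space E"
  shows "cmod (orbit u s) \<le> C * M * de_norm nE N u * (1 + norm s) ^ \<kappa>"
proof -
  have "cmod (orbit u s) \<le> C * de_norm nE N (dist_translate s u)"
    unfolding orbit_def by (intro f_bound DE_translate assms)
  also have "\<dots> \<le> C * (M * (1 + norm s) ^ \<kappa> * de_norm nE N u)"
    by (intro mult_left_mono de_norm_translate assms C_nonneg)
  finally show ?thesis by (simp add: mult_ac)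
qed

text \<open>One transfer principle from \<open>E\<close> to orbits: \<open>g r = 1\<close> gives
  continuity and \<open>g r = \<bar>r\<bar>\<close> differentiability. The hypothesis concerns the
  derivatives of \<open>w r\<close> because \<open>f\<close> is bounded through those of order up to
  \<open>N\<close>.\<close>

lemma orbit_tendsto:
  assumes w: "\<And>r. w r \<in> DE_space E"
    and lim: "\<And>is. ((\<lambda>r. nE (dist_partials is (w r)) / g r) \<longlongrightarrow> 0) F"
    and g: "\<And>r. 0 \<le> g r"
  shows "((\<lambda>r. cmod (orbit (w r) s) / g r) \<longlongrightarrow> (0::real)) F"
proof (rule Lim_null_comparison)
  let ?L = "{is::'n list. length is \<le> N}"
  let ?K = "C * (M * (1 + norm s) ^ \<kappa>)"
  have K0: "0 \<le> ?K" using C_nonneg M_pos by simp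
  have "cmod (orbit (w r) s) \<le> ?K * (\<Sum>is\<in>?L. nE (dist_partials is (w r)))" for r
  proof -
    have "de_norm nE N (w r) \<le> (\<Sum>is\<in>?L. nE (dist_partials is (w r)))"
      using w[of r] by (intro de_norm_le member_le_sum) (auto simp: finite_short_lists DE_iff norm_nonneg)
    then have "?K * de_norm nE N (w r) \<le> ?K * (\<Sum>is\<in>?L. nE (dist_partials is (w r)))"
      using K0 by (rule mult_left_mono)
    with orbit_bound[OF w[of r], of s] show ?thesis by (simp add: mult_ac)
  qed
  then have "cmod (orbit (w r) s) / g r \<le> ?K * (\<Sum>is\<in>?L. nE (dist_partials is (w r))) / g r" for r
    using g by (intro divide_right_mono)
  then have "cmod (orbit (w r) s) / g r \<le> ?K * (\<Sum>is\<in>?L. nE (dist_partials is (w r)) / g r)" for r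
    unfolding sum_divide_distrib[symmetric] by (simp only: times_divide_eq_right)
  then show "\<forall>\<^sub>F r in F. norm (cmod (orbit (w r) s) / g r) \<le> ?K * (\<Sum>is\<in>?L. nE (dist_partials is (w r)) / g r)"
    using g by (intro always_eventually) simp
  show "((\<lambda>r. ?K * (\<Sum>is\<in>?L. nE (dist_partials is (w r)) / g r)) \<longlongrightarrow> 0) F"
    by (intro tendsto_mult_right_zero tendsto_null_sum lim)
qed

lemma orbit_continuous:
  assumes u: "u \<in> DE_space E"
  shows "continuous_on UNIV (orbit u)"
proof (intro continuous_at_imp_continuous_on ballI)
  fix s
  let ?w = "\<lambda>h \<phi>. dist_translate h u \<phi> - u \<phi>"
  have w: "?w h \<in> DE_space E" for h
    by (intro subspace_diff DE_subspace DE_translate u)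
  have "((\<lambda>h. cmod (orbit (?w h) s) / 1) \<longlongrightarrow> 0) (at 0)"
  proof (rule orbit_tendsto[OF w])
    fix "is" :: "'n list"
    let ?v = "dist_partials is u"
    have v: "?v \<in> E" using u by (simp add: DE_iff)
    have eq: "dist_partials is (?w h) = (\<lambda>\<phi>. dist_translate h ?v \<phi> - ?v \<phi>)" for h
      using dist_partials_lincomb[of "is" 1 "dist_translate h u" "-1" u] by (simp add: dist_translate_partials)
    have nn: "0 \<le> nE (\<lambda>\<phi>. dist_translate h ?v \<phi> - ?v \<phi>)" for h
      by (intro norm_nonneg subspace_diff subspace translate_in v)
    show "((\<lambda>h. nE (dist_partials is (?w h)) / 1) \<longlongrightarrow> 0) (at 0)"
      unfolding eq tendsto_iff eventually_at
    proof (intro allI impI)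
      fix e :: real assume e: "0 < e"
      obtain \<delta> where "0 < \<delta>" "\<And>h. norm h < \<delta> \<Longrightarrow> nE (\<lambda>\<phi>. dist_translate h ?v \<phi> - ?v \<phi>) < e"
        using translation_continuous[OF v e] by blast
      then show "\<exists>d>0. \<forall>h\<in>UNIV. h \<noteq> 0 \<and> dist h 0 < d \<longrightarrow> dist (nE (\<lambda>\<phi>. dist_translate h ?v \<phi> - ?v \<phi>) / 1) 0 < e"
        using nn by (intro exI[of _ \<delta>]) (auto simp: dist_norm)
    qed
  qed simp
  moreover have "orbit (?w h) s = orbit u (s + h) - orbit u s" for h
    using f_diff[OF DE_translate[OF DE_translate[OF u]] DE_translate[OF u], of s h s]
    by (simp add: orbit_def dist_translate_def algebra_simps)
  ultimately have "((\<lambda>h. cmod (orbit u (s + h) - orbit u s)) \<longlongrightarrow> 0) (at 0)" by simp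
  from LIM_zero_cancel[OF tendsto_norm_zero_cancel[OF this]]
  show "isCont (orbit u) s" by (simp add: isCont_iff)
qed

lemma orbit_measurable: "u \<in> DE_space E \<Longrightarrow> orbit u \<in> borel_measurable borel"
  by (rule borel_measurable_continuous_onI[OF orbit_continuous])

text \<open>Translation commutes with derivatives, so \<open>translate_derivative\<close> applies to
  each derivative of \<open>u\<close> separately; membership in \<open>DE_space E\<close> supplies
  the one further derivative in \<open>E\<close> that it requires.\<close>

lemma orbit_derivative:
  assumes u: "u \<in> DE_space E"
  shows "((\<lambda>r. orbit u (s + r *\<^sub>R axis i 1)) has_vector_derivative orbit (dist_partial i u) s) (at 0)"
proof -
  let ?e = "axis i (1::real) :: real^'n"
  let ?w = "\<lambda>r \<phi>. dist_translate (r *\<^sub>R ?e) u \<phi> - u \<phi> - complex_of_real r * dist_partial i u \<phi>"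
  note du = DE_partial(1)[OF u, of i]
  have w1: "(\<lambda>\<phi>. dist_translate (r *\<^sub>R ?e) u \<phi> - u \<phi>) \<in> DE_space E" for r
    by (intro subspace_diff DE_subspace DE_translate u)
  have w2: "(\<lambda>\<phi>. complex_of_real r * dist_partial i u \<phi>) \<in> DE_space E" for r
    by (rule subspace_scale[OF DE_subspace du])
  have w: "?w r \<in> DE_space E" for r by (rule subspace_diff[OF DE_subspace w1 w2])
  have "((\<lambda>r. cmod (orbit (?w r) s) / \<bar>r\<bar>) \<longlongrightarrow> 0) (at 0)"
  proof (rule orbit_tendsto[OF w])
    fix "is" :: "'n list"
    let ?v = "dist_partials is u"
    have v: "?v \<in> E" "dist_partial i ?v \<in> E"
      using u unfolding DE_iff by (metis dist_partials_simps(2))+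
    have eq1: "dist_partials is (\<lambda>\<phi>. dist_translate (r *\<^sub>R ?e) u \<phi> - u \<phi>) = (\<lambda>\<phi>. dist_translate (r *\<^sub>R ?e) ?v \<phi> - ?v \<phi>)" for r
      using dist_partials_lincomb[of "is" 1 "dist_translate (r *\<^sub>R ?e) u" "-1" u] by (simp add: dist_translate_partials)
    have eq: "dist_partials is (?w r) = (\<lambda>\<phi>. dist_translate (r *\<^sub>R ?e) ?v \<phi> - ?v \<phi> - complex_of_real r * dist_partial i ?v \<phi>)" for r
      using dist_partials_lincomb[of "is" 1 "\<lambda>\<phi>. dist_translate (r *\<^sub>R ?e) u \<phi> - u \<phi>" "- complex_of_real r" "dist_partial i u"]
      by (simp add: eq1 dist_partials_partial)
    have nn: "0 \<le> nE (dist_partials is (?w r))" for r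
      using w[of r] by (simp add: DE_iff norm_nonneg del: dist_partials_simps)
    show "((\<lambda>r. nE (dist_partials is (?w r)) / \<bar>r\<bar>) \<longlongrightarrow> 0) (at 0)"
      unfolding tendsto_iff eventually_at
    proof (intro allI impI)
      fix \<epsilon> :: real assume \<epsilon>: "0 < \<epsilon>"
      obtain \<delta> where \<delta>: "0 < \<delta>" "\<And>r. \<bar>r\<bar> < \<delta> \<Longrightarrow> nE (dist_partials is (?w r)) \<le> \<bar>r\<bar> * (\<epsilon> / 2)"
        using translate_derivative[OF v, of "\<epsilon> / 2"] \<epsilon> unfolding eq by auto
      have "nE (dist_partials is (?w r)) / \<bar>r\<bar> < \<epsilon>" if "r \<noteq> 0" "\<bar>r\<bar> < \<delta>" for r
      proof -
        have "nE (dist_partials is (?w r)) / \<bar>r\<bar> \<le> \<epsilon> / 2"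
          using \<delta>(2)[OF that(2)] that(1) by (simp add: pos_divide_le_eq mult.commute)
        also have "\<dots> < \<epsilon>" using \<epsilon> by simp
        finally show ?thesis .
      qed
      then show "\<exists>d>0. \<forall>r\<in>UNIV. r \<noteq> 0 \<and> dist r 0 < d \<longrightarrow> dist (nE (dist_partials is (?w r)) / \<bar>r\<bar>) 0 < \<epsilon>"
        using \<delta>(1) nn by (intro exI[of _ \<delta>]) (auto simp: dist_norm)
    qed
  qed simp
  moreover have "orbit (?w r) s = orbit u (s + r *\<^sub>R ?e) - orbit u s - r *\<^sub>R orbit (dist_partial i u) s" for r
  proof -
    have "orbit (?w r) s = f (\<lambda>\<phi>. dist_translate s (\<lambda>\<phi>. dist_translate (r *\<^sub>R ?e) u \<phi> - u \<phi>) \<phi> - dist_translate s (\<lambda>\<phi>. complex_of_real r * dist_partial i u \<phi>) \<phi>)"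
      by (simp add: orbit_def dist_translate_def)
    also have "\<dots> = f (dist_translate s (\<lambda>\<phi>. dist_translate (r *\<^sub>R ?e) u \<phi> - u \<phi>)) - orbit (\<lambda>\<phi>. complex_of_real r * dist_partial i u \<phi>) s"
      unfolding orbit_def by (intro f_diff DE_translate w1 w2)
    also have "f (dist_translate s (\<lambda>\<phi>. dist_translate (r *\<^sub>R ?e) u \<phi> - u \<phi>)) = f (\<lambda>\<phi>. dist_translate (s + r *\<^sub>R ?e) u \<phi> - dist_translate s u \<phi>)"
      by (simp add: dist_translate_def algebra_simps)
    also have "\<dots> = orbit u (s + r *\<^sub>R ?e) - orbit u s"
      unfolding orbit_def by (intro f_diff DE_translate u)
    finally show ?thesis by (simp add: orbit_scale[OF du] scaleR_conv_of_real)
  qed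
  ultimately have "((\<lambda>r. norm (orbit u (s + r *\<^sub>R ?e) - orbit u (s + 0 *\<^sub>R ?e) - (r - 0) *\<^sub>R orbit (dist_partial i u) s) / norm (r - 0)) \<longlongrightarrow> 0) (at 0)"
    by simp
  then show ?thesis
    unfolding has_vector_derivative_def has_derivative_iff_norm
    by (simp add: bounded_linear_scaleR_left)
qed

end

section \<open>The windowed Fourier transform of an orbit\<close>

context de_functional
begin

text \<open>The Fourier transform of the orbit cut down by the window \<open>a\<close>. The orbit
  may grow like a power, and decay of \<open>a\<close> provides the integrability.\<close>

definition pairing :: "(real^'n \<Rightarrow> complex) \<Rightarrow> ((real^'n \<Rightarrow> complex) \<Rightarrow> complex) \<Rightarrow> real^'n \<Rightarrow> complex" where
  "pairing a u \<xi> = (LINT s|lborel. cis (s \<bullet> \<xi>) * (a s * orbit u s))"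

lemma schwartz_orbit_bound:
  assumes c: "sbound (\<kappa> + 2 * CARD('n)) a c" and u: "u \<in> DE_space E"
  shows "cmod (a s * orbit u s) \<le> c * (C * M * de_norm nE N u) * weight s"
proof -
  let ?D = "C * M * de_norm nE N u"
  have D: "0 \<le> ?D" using C_nonneg M_pos de_norm_nonneg[OF u, of N] by simp
  have "cmod (a s * orbit u s) \<le> cmod (a s) * (?D * (1 + norm s) ^ \<kappa>)"
    unfolding norm_mult by (intro mult_left_mono orbit_bound u) auto
  also have "\<dots> = ?D * ((1 + norm s) ^ \<kappa> * cmod (a s))" by (simp add: mult_ac)
  also have "\<dots> \<le> ?D * (c * weight s)"
    using sbound_weight[OF c, of s] D by (rule mult_left_mono)
  finally show ?thesis by (simp add: mult_ac)
qed

lemma schwartz_orbit_integrable: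
  assumes a: "a \<in> schwartz_space" and u: "u \<in> DE_space E"
  shows "integrable lborel (\<lambda>s. a s * orbit u s)"
proof -
  obtain c where c: "sbound (\<kappa> + 2 * CARD('n)) a c" using schwartz_sbound[OF a] by blast
  have [measurable]: "a \<in> borel_measurable borel" "orbit u \<in> borel_measurable borel"
    using a u by (auto intro: schwartz_measurable orbit_measurable)
  show ?thesis
  proof (rule Bochner_Integration.integrable_bound)
    show "integrable lborel (\<lambda>s::real^'n. c * (C * M * de_norm nE N u) * weight s)"
      by (simp add: integrable_weight)
    show "AE s in lborel. norm (a s * orbit u s) \<le> norm (c * (C * M * de_norm nE N u) * weight s)"
      using order_trans[OF schwartz_orbit_bound[OF c u] abs_ge_self] by (intro AE_I2) simp
  qed measurable
qed

lemma pairing_integrable: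
  assumes a: "a \<in> schwartz_space" and u: "u \<in> DE_space E"
  shows "integrable lborel (\<lambda>s. cis (s \<bullet> \<xi>) * (a s * orbit u s))"
proof (rule Bochner_Integration.integrable_bound[OF schwartz_orbit_integrable[OF a u]])
  have [measurable]: "a \<in> borel_measurable borel" "orbit u \<in> borel_measurable borel"
    using a u by (auto intro: schwartz_measurable orbit_measurable)
  show "(\<lambda>s. cis (s \<bullet> \<xi>) * (a s * orbit u s)) \<in> borel_measurable lborel" by measurable
qed (simp add: norm_mult)

lemma pairing_bound:
  assumes a: "a \<in> schwartz_space" and c: "sbound (\<kappa> + 2 * CARD('n)) a c" and u: "u \<in> DE_space E"
  shows "cmod (pairing a u \<xi>) \<le> c * (C * M * de_norm nE N u) * (LINT s|lborel. weight (s::real^'n))"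
proof -
  have "cmod (pairing a u \<xi>) \<le> (LINT s|lborel. c * (C * M * de_norm nE N u) * weight (s::real^'n))"
    unfolding pairing_def
  proof (rule order_trans[OF integral_norm_bound integral_mono])
    show "integrable lborel (\<lambda>s. norm (cis (s \<bullet> \<xi>) * (a s * orbit u s)))"
      by (rule integrable_norm[OF pairing_integrable[OF a u]])
    show "integrable lborel (\<lambda>s::real^'n. c * (C * M * de_norm nE N u) * weight s)"
      by (simp add: integrable_weight)
    show "norm (cis (s \<bullet> \<xi>) * (a s * orbit u s)) \<le> c * (C * M * de_norm nE N u) * weight s" for s
      using schwartz_orbit_bound[OF c u, of s] by (simp add: norm_mult)
  qed
  then show ?thesis by simp
qed

text \<open>The directional derivative of character times window times orbit integrates to 0; the
  three summands are those of the product rule.\<close>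

lemma pairing_by_parts:
  assumes a: "a \<in> schwartz_space" and u: "u \<in> DE_space E"
  shows "\<i> * complex_of_real (\<xi> $ k) * pairing a u \<xi> + pairing (partial k a) u \<xi> + pairing a (dist_partial k u) \<xi> = 0"
proof -
  let ?e = "axis k (1::real) :: real^'n"
  note a' = schwartz_partial[OF a, of k] and u' = DE_partial(1)[OF u, of k]
  let ?h = "\<lambda>s. cis (s \<bullet> \<xi>) * (a s * orbit u s)"
  let ?h1 = "\<lambda>s. cis (s \<bullet> \<xi>) * (partial k a s * orbit u s)"
  let ?h2 = "\<lambda>s. cis (s \<bullet> \<xi>) * (a s * orbit (dist_partial k u) s)"
  let ?h' = "\<lambda>s. \<i> * complex_of_real (\<xi> $ k) * ?h s + ?h1 s + ?h2 s"
  obtain c where c: "sbound (\<kappa> + 2 * CARD('n)) a c" using schwartz_sbound[OF a] by blast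
  obtain c' where c': "sbound (\<kappa> + 2 * CARD('n)) (partial k a) c'" using schwartz_sbound[OF a'] by blast
  define D where "D = \<bar>\<xi> $ k\<bar> * (c * (C * M * de_norm nE N u)) + c' * (C * M * de_norm nE N u) + c * (C * M * de_norm nE N (dist_partial k u))"
  have D0: "0 \<le> D"
    using sbound_nonneg[OF c] sbound_nonneg[OF c'] C_nonneg M_pos de_norm_nonneg[OF u, of N] de_norm_nonneg[OF u', of N]
    by (simp add: D_def)
  have hb: "cmod (?h' s) \<le> D * weight s" for s
  proof -
    have "cmod (?h' s) \<le> cmod (\<i> * complex_of_real (\<xi> $ k) * ?h s) + cmod (?h1 s) + cmod (?h2 s)"
      by (intro order_trans[OF norm_triangle_ineq] add_right_mono norm_triangle_ineq)
    also have "\<dots> = \<bar>\<xi> $ k\<bar> * cmod (a s * orbit u s) + cmod (partial k a s * orbit u s) + cmod (a s * orbit (dist_partial k u) s)"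
      by (simp add: norm_mult)
    also have "\<dots> \<le> \<bar>\<xi> $ k\<bar> * (c * (C * M * de_norm nE N u) * weight s) + c' * (C * M * de_norm nE N u) * weight s
         + c * (C * M * de_norm nE N (dist_partial k u)) * weight s"
      by (intro add_mono mult_left_mono schwartz_orbit_bound c c' u u') auto
    finally show ?thesis by (simp add: D_def algebra_simps)
  qed
  have [measurable]: "a \<in> borel_measurable borel" "orbit u \<in> borel_measurable borel"
     "partial k a \<in> borel_measurable borel" "orbit (dist_partial k u) \<in> borel_measurable borel"
    using a a' u u' by (auto intro: schwartz_measurable orbit_measurable)
  have "(LINT s|lborel. ?h' s) = 0"
  proof (rule integral_directional_derivative_eq_0[where h="?h" and e="?e" and W="\<lambda>s. D * (2 ^ (2 * CARD('n)) * weight s)"])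
    show "integrable lborel ?h" by (rule pairing_integrable[OF a u])
    show "?h' \<in> borel_measurable borel" by measurable
    show "integrable lborel (\<lambda>s::real^'n. D * (2 ^ (2 * CARD('n)) * weight s))"
      by (simp add: integrable_weight)
    fix s :: "real^'n"
    have "((\<lambda>r. cis ((s + r *\<^sub>R ?e) \<bullet> \<xi>)) has_vector_derivative (\<xi> $ k) *\<^sub>R (\<i> * cis (s \<bullet> \<xi>))) (at 0)"
    proof -
      have "((\<lambda>r::real. s \<bullet> \<xi> + r * (\<xi> $ k)) has_vector_derivative \<xi> $ k) (at 0)"
        by (auto intro!: derivative_eq_intros)
      moreover have "(cis has_vector_derivative \<i> * cis (s \<bullet> \<xi>)) (at (s \<bullet> \<xi> + 0 * (\<xi> $ k)))"
        using has_derivative_cis[OF has_derivative_ident, of "s \<bullet> \<xi>" UNIV] by (simp add: has_vector_derivative_def)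
      ultimately have "((cis \<circ> (\<lambda>r::real. s \<bullet> \<xi> + r * (\<xi> $ k))) has_vector_derivative (\<xi> $ k) *\<^sub>R (\<i> * cis (s \<bullet> \<xi>))) (at 0)"
        by (rule vector_diff_chain_at)
      then show ?thesis by (simp add: o_def inner_add_left inner_axis' )
    qed
    from has_vector_derivative_mult[OF this has_vector_derivative_mult[OF partial_directional[OF schwartz_smooth[OF a], of s k] orbit_derivative[OF u, of s k]]]
    show "((\<lambda>r. ?h (s + r *\<^sub>R ?e)) has_vector_derivative ?h' s) (at 0)"
      by (rule has_vector_derivative_eq_rhs) (simp add: scaleR_conv_of_real algebra_simps)
    show "cmod (?h' (s + r *\<^sub>R ?e)) \<le> D * (2 ^ (2 * CARD('n)) * weight s)" if "\<bar>r\<bar> \<le> 1" for r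
      by (rule order_trans[OF hb mult_left_mono[OF weight_shift D0]]) (use that in simp)
  qed
  moreover have "(LINT s|lborel. ?h' s) = (LINT s|lborel. \<i> * complex_of_real (\<xi> $ k) * ?h s) + (LINT s|lborel. ?h1 s) + (LINT s|lborel. ?h2 s)"
    using pairing_integrable[OF a u] pairing_integrable[OF a' u] pairing_integrable[OF a u'] by simp
  moreover have "(LINT s|lborel. \<i> * complex_of_real (\<xi> $ k) * ?h s) = \<i> * complex_of_real (\<xi> $ k) * pairing a u \<xi>"
    unfolding pairing_def by (rule integral_mult_right_zero)
  ultimately show ?thesis by (simp add: pairing_def)
qed

text \<open>Induction by \<open>pairing_by_parts\<close>: one power of the coordinate of \<xi> is
  exchanged for one derivative, falling either on \<open>a\<close> or on \<open>u\<close>. Both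
  orders therefore grow by one, and the two terms double the constant.\<close>

lemma pairing_component_decay:
  "\<exists>K\<ge>0. \<forall>a\<in>schwartz_space. \<forall>c. \<forall>u\<in>DE_space E. \<forall>\<xi> k. sbound (\<kappa> + 2 * CARD('n) + p) a c \<longrightarrow>
     \<bar>\<xi> $ k\<bar> ^ p * cmod (pairing a u \<xi>) \<le> K * c * de_norm nE (N + p) u"
proof (induction p)
  case 0
  let ?W = "LINT s|lborel. weight (s::real^'n)"
  have W: "0 \<le> ?W" by (intro integral_nonneg_AE AE_I2 less_imp_le weight_pos)
  show ?case
  proof (intro exI[of _ "C * M * ?W"] conjI ballI allI impI)
    show "0 \<le> C * M * ?W" using W C_nonneg M_pos by simp
    fix a :: "real^'n \<Rightarrow> complex" and c u \<xi> and k :: 'n assume "a \<in> schwartz_space" "u \<in> DE_space E" "sbound (\<kappa> + 2 * CARD('n) + 0) a c"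
    then show "\<bar>\<xi> $ k\<bar> ^ 0 * cmod (pairing a u \<xi>) \<le> C * M * ?W * c * de_norm nE (N + 0) u"
      using pairing_bound[of a c u \<xi>] by (simp add: mult_ac)
  qed
next
  case (Suc p)
  then obtain K where K: "0 \<le> K"
    "\<And>a c u \<xi> k. a \<in> schwartz_space \<Longrightarrow> u \<in> DE_space E \<Longrightarrow> sbound (\<kappa> + 2 * CARD('n) + p) a c \<Longrightarrow>
     \<bar>\<xi> $ k\<bar> ^ p * cmod (pairing a u \<xi>) \<le> K * c * de_norm nE (N + p) u" by blast
  show ?case
  proof (intro exI[of _ "2 * K"] conjI ballI allI impI)
    show "0 \<le> 2 * K" using K(1) by simp
    fix a :: "real^'n \<Rightarrow> complex" and c u \<xi> and k :: 'n assume a: "a \<in> schwartz_space" and u: "u \<in> DE_space E" and c: "sbound (\<kappa> + 2 * CARD('n) + Suc p) a c"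
    note a' = schwartz_partial[OF a, of k] and u' = DE_partial(1)[OF u, of k]
    have c0: "0 \<le> c" by (rule sbound_nonneg[OF c])
    have c1: "sbound (\<kappa> + 2 * CARD('n) + p) (partial k a) c" using c by (intro sbound_partial) simp
    have c2: "sbound (\<kappa> + 2 * CARD('n) + p) a c" by (rule sbound_mono[OF c]) auto
    have "\<i> * complex_of_real (\<xi> $ k) * pairing a u \<xi> = - (pairing (partial k a) u \<xi> + pairing a (dist_partial k u) \<xi>)"
      using pairing_by_parts[OF a u, of \<xi> k]
      by (simp only: eq_neg_iff_add_eq_0 add.assoc)
    then have "cmod (\<i> * complex_of_real (\<xi> $ k) * pairing a u \<xi>) = cmod (pairing (partial k a) u \<xi> + pairing a (dist_partial k u) \<xi>)"
      by (simp only: norm_minus_cancel)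
    then have "\<bar>\<xi> $ k\<bar> * cmod (pairing a u \<xi>) \<le> cmod (pairing (partial k a) u \<xi>) + cmod (pairing a (dist_partial k u) \<xi>)"
      using norm_triangle_ineq[of "pairing (partial k a) u \<xi>" "pairing a (dist_partial k u) \<xi>"] by (simp add: norm_mult)
    then have "\<bar>\<xi> $ k\<bar> ^ p * (\<bar>\<xi> $ k\<bar> * cmod (pairing a u \<xi>)) \<le> \<bar>\<xi> $ k\<bar> ^ p * (cmod (pairing (partial k a) u \<xi>) + cmod (pairing a (dist_partial k u) \<xi>))"
      by (intro mult_left_mono) auto
    also have "\<dots> \<le> K * c * de_norm nE (N + p) u + K * c * de_norm nE (N + p) (dist_partial k u)"
      unfolding distrib_left by (intro add_mono K(2) a a' u u' c1 c2)
    also have "\<dots> \<le> K * c * de_norm nE (N + Suc p) u + K * c * de_norm nE (N + Suc p) u"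
      using DE_partial(2)[OF u, of "N + p" k] de_norm_mono[of "N + p" "N + Suc p" nE u] K(1) c0
      by (intro add_mono mult_left_mono) auto
    finally show "\<bar>\<xi> $ k\<bar> ^ Suc p * cmod (pairing a u \<xi>) \<le> 2 * K * c * de_norm nE (N + Suc p) u"
      by (simp add: mult_ac)
  qed
qed

text \<open>In the order \<kappa> + 4n of the window, with n the dimension, \<kappa> absorbs the
  growth of the orbit, 2n give integrability in s, and 2n are the derivatives traded for decay in
  \<xi>. The last 2n reappear as additional derivatives of \<open>u\<close>.\<close>

lemma pairing_decay:
  "\<exists>K\<ge>0. \<forall>a\<in>schwartz_space. \<forall>c. \<forall>u\<in>DE_space E. \<forall>\<xi>. sbound (\<kappa> + 4 * CARD('n)) a c \<longrightarrow>
     cmod (pairing a u \<xi>) \<le> K * c * de_norm nE (N + 2 * CARD('n)) u * weight \<xi>"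
proof -
  let ?n = "CARD('n)" and ?p = "2 * CARD('n)"
  obtain K0 where K0: "0 \<le> K0"
    "\<And>a c u \<xi> k. a \<in> schwartz_space \<Longrightarrow> u \<in> DE_space E \<Longrightarrow> sbound (\<kappa> + 2 * CARD('n) + 0) a c \<Longrightarrow>
     \<bar>\<xi> $ k\<bar> ^ 0 * cmod (pairing a u \<xi>) \<le> K0 * c * de_norm nE (N + 0) u"
    using pairing_component_decay[of 0] by blast
  obtain K1 where K1: "0 \<le> K1"
    "\<And>a c u \<xi> k. a \<in> schwartz_space \<Longrightarrow> u \<in> DE_space E \<Longrightarrow> sbound (\<kappa> + 2 * CARD('n) + ?p) a c \<Longrightarrow>
     \<bar>\<xi> $ k\<bar> ^ ?p * cmod (pairing a u \<xi>) \<le> K1 * c * de_norm nE (N + ?p) u"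
    using pairing_component_decay[of ?p] by blast
  \<comment> \<open>The first summand serves |\<xi>| \<le> 1, where 1 + |\<xi>| \<le> 2. The second
    serves |\<xi>| > 1, where 1 + |\<xi>| is at most 2n times the largest coordinate.\<close>
  define A where "A = 2 ^ ?p * K0 + (2 * real ?n) ^ ?p * K1"
  show ?thesis
  proof (intro exI[of _ A] conjI ballI allI impI)
    show "0 \<le> A" using K0(1) K1(1) by (simp add: A_def)
    fix a :: "real^'n \<Rightarrow> complex" and c u and \<xi> :: "real^'n" assume a: "a \<in> schwartz_space" and u: "u \<in> DE_space E" and c: "sbound (\<kappa> + 4 * CARD('n)) a c"
    let ?q = "de_norm nE (N + ?p) u" and ?P = "cmod (pairing a u \<xi>)"
    have cq: "0 \<le> c * ?q" using sbound_nonneg[OF c] de_norm_nonneg[OF u] by simp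
    \<comment> \<open>A coordinate of largest modulus controls the norm up to the dimension, so
      decay in this one direction suffices.\<close>
    obtain k where k: "\<And>j. \<bar>\<xi> $ j\<bar> \<le> \<bar>\<xi> $ k\<bar>"
    proof -
      have "Max (range (\<lambda>j. \<bar>\<xi> $ j\<bar>)) \<in> range (\<lambda>j. \<bar>\<xi> $ j\<bar>)" by (rule Max_in) auto
      then obtain k where "Max (range (\<lambda>j. \<bar>\<xi> $ j\<bar>)) = \<bar>\<xi> $ k\<bar>" by blast
      then have "\<bar>\<xi> $ j\<bar> \<le> \<bar>\<xi> $ k\<bar>" for j using Max_ge[of "range (\<lambda>j. \<bar>\<xi> $ j\<bar>)" "\<bar>\<xi> $ j\<bar>"] by simp
      then show ?thesis by (rule that)
    qed
    have n1: "norm \<xi> \<le> real ?n * \<bar>\<xi> $ k\<bar>"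
      using norm_le_l1_cart[of \<xi>] sum_bounded_above[of UNIV "\<lambda>i. \<bar>\<xi> $ i\<bar>" "\<bar>\<xi> $ k\<bar>"] k by simp
    have b0: "?P \<le> K0 * (c * ?q)"
    proof -
      have "?P \<le> K0 * c * de_norm nE N u"
        using K0(2)[OF a u sbound_mono[OF c], of c \<xi> k] by simp
      also have "\<dots> \<le> K0 * c * ?q"
        using K0(1) sbound_nonneg[OF c] by (intro mult_left_mono de_norm_mono) auto
      finally show ?thesis by (simp add: mult.assoc)
    qed
    have b1: "\<bar>\<xi> $ k\<bar> ^ ?p * ?P \<le> K1 * (c * ?q)"
      using K1(2)[OF a u sbound_mono[OF c], of c \<xi> k] by (simp add: mult.assoc)
    have "(1 + norm \<xi>) ^ ?p * ?P \<le> A * (c * ?q)"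
    proof (cases "norm \<xi> \<le> 1")
      \<comment> \<open>Near the origin a power of \<open>\<xi> $ k\<close> carries no information,
        and the estimate of order 0 takes over.\<close>
      case True
      have "(1 + norm \<xi>) ^ ?p * ?P \<le> 2 ^ ?p * (K0 * (c * ?q))"
        using True b0 by (intro mult_mono power_mono) auto
      also have "\<dots> \<le> A * (c * ?q)"
        unfolding A_def using K1(1) cq by (simp add: distrib_right mult.assoc)
      finally show ?thesis .
    next
      case False
      have "1 + norm \<xi> \<le> 2 * real ?n * \<bar>\<xi> $ k\<bar>" using False n1 by argo
      then have "(1 + norm \<xi>) ^ ?p \<le> (2 * real ?n) ^ ?p * \<bar>\<xi> $ k\<bar> ^ ?p"
        by (metis power_mono power_mult_distrib add_nonneg_nonneg norm_ge_zero zero_le_one)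
      then have "(1 + norm \<xi>) ^ ?p * ?P \<le> (2 * real ?n) ^ ?p * \<bar>\<xi> $ k\<bar> ^ ?p * ?P"
        by (intro mult_right_mono) auto
      also have "\<dots> \<le> (2 * real ?n) ^ ?p * (K1 * (c * ?q))"
        unfolding mult.assoc by (intro mult_left_mono b1) auto
      also have "\<dots> \<le> A * (c * ?q)"
        unfolding A_def using K0(1) cq by (simp add: distrib_right mult.assoc)
      finally show ?thesis .
    qed
    then have "(1 + norm \<xi>) ^ (0 + ?p) * ?P \<le> A * (c * ?q)" by simp
    from weight_power[OF this]
    show "?P \<le> A * c * ?q * weight \<xi>" by (simp add: mult.assoc)
  qed
qed

end

lemma has_derivative_quadratic:
  fixes f :: "'a::real_normed_vector \<Rightarrow> 'b::real_normed_vector"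
  assumes D: "bounded_linear D"
    and q: "\<And>v. norm v \<le> r \<Longrightarrow> norm (f (x + v) - f x - D v) \<le> K * (norm v * norm v)"
    and r: "0 < r"
  shows "(f has_derivative D) (at x)"
  unfolding has_derivative_at
proof (intro conjI D)
  show "((\<lambda>v. norm (f (x + v) - f x - D v) / norm v) \<longlongrightarrow> 0) (at 0)"
  proof (rule Lim_null_comparison)
    have "norm (norm (f (x + v) - f x - D v) / norm v) \<le> \<bar>K\<bar> * norm v" if "v \<noteq> 0" "norm v \<le> r" for v
    proof -
      have "norm (f (x + v) - f x - D v) \<le> \<bar>K\<bar> * (norm v * norm v)"
        using q[OF that(2)] by (rule order_trans) (intro mult_right_mono; simp)
      then show ?thesis using that(1) by (simp add: pos_divide_le_eq mult.assoc)
    qed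
    then show "\<forall>\<^sub>F v in at 0. norm (norm (f (x + v) - f x - D v) / norm v) \<le> \<bar>K\<bar> * norm v"
      unfolding eventually_at using r by (intro exI[of _ r]) auto
    show "((\<lambda>v. \<bar>K\<bar> * norm v) \<longlongrightarrow> 0) (at (0::'a))"
      by (intro tendsto_mult_right_zero tendsto_norm_zero) (rule tendsto_ident_at)
  qed
qed

lemma bounded_linear_grad_form: "bounded_linear (grad_form g)"
proof -
  have "bounded_linear (\<lambda>v. \<Sum>i\<in>UNIV. complex_of_real (v $ i) * g i)"
    by (intro bounded_linear_sum bounded_linear_compose[OF bounded_linear_mult_left]
        bounded_linear_compose[OF bounded_linear_of_real] bounded_linear_vec_nth)
  then show ?thesis by (simp add: grad_form_def[abs_def])
qed

lemma bounded_linear_gform: "bounded_linear (gform g)"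
proof -
  have "bounded_linear (\<lambda>v. \<Sum>i\<in>UNIV. v $ i * g i)"
    by (intro bounded_linear_sum bounded_linear_compose[OF bounded_linear_mult_left] bounded_linear_vec_nth)
  then show ?thesis by (simp add: gform_def[abs_def])
qed

lemma schwartz_taylor:
  fixes b :: "real^'n::finite \<Rightarrow> complex"
  assumes b: "b \<in> schwartz_space"
  shows "\<exists>K\<ge>0. \<forall>x v. cmod (b (x + v) - b x - grad_form (\<lambda>i. partial i b x) v) \<le> K * (norm v * norm v)"
proof -
  obtain c where c: "sbound 2 b c" using schwartz_sbound[OF b] by blast
  have c2: "cmod (partial j (partial i b) x) \<le> c" for i j x
    using sboundD'[OF c, of "[j, i]" 0 x] by simp
  note sm = schwartz_smooth[OF b]
  have d: "(b has_derivative grad_form (\<lambda>i. partial i b y)) (at y)" for y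
    using smooth_derivative[OF sm, of "[]"] by simp
  have d1: "(partial i b has_derivative grad_form (\<lambda>j. partial j (partial i b) y)) (at y)" for i y
    using smooth_derivative[OF sm, of "[i]"] by simp
  let ?n = "real CARD('n)"
  have "cmod (b (x + v) - b x - grad_form (\<lambda>i. partial i b x) v) \<le> ?n * (?n * c * norm v) * norm v" for x v
  proof (rule derivative_line_bound[OF d])
    fix t :: real assume t: "0 \<le> t" "t \<le> 1"
    have "cmod (partial i b (x + t *\<^sub>R v) - partial i b x) \<le> ?n * c * norm v" for i
    proof -
      have "cmod (partial i b (x + t *\<^sub>R v) - partial i b x - 0) \<le> ?n * c * norm (t *\<^sub>R v)"
        by (rule derivative_line_bound[OF d1]) (unfold diff_zero, rule norm_grad_form_le, rule c2)
      also have "\<dots> \<le> ?n * c * norm v"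
        using t sbound_nonneg[OF c] by (intro mult_left_mono) (auto intro: mult_left_le_one_le)
      finally show ?thesis by simp
    qed
    then show "cmod (grad_form (\<lambda>i. partial i b (x + t *\<^sub>R v)) v - grad_form (\<lambda>i. partial i b x) v) \<le> ?n * (?n * c * norm v) * norm v"
      unfolding grad_form_diff[symmetric] by (rule norm_grad_form_le)
  qed
  then show ?thesis
    using sbound_nonneg[OF c] by (intro exI[of _ "?n * ?n * c"]) (auto simp: mult_ac)
qed

section \<open>Superpositions of translates\<close>

definition superpose :: "(real^'n::finite \<Rightarrow> complex) \<Rightarrow> (real^'n \<Rightarrow> complex) \<Rightarrow> real^'n \<Rightarrow> complex" where
  "superpose a b t = (LINT s|lborel. a s * b (t + s))"

definition rapid :: "(real^'n::finite \<Rightarrow> complex) \<Rightarrow> bool" where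
  "rapid a \<longleftrightarrow> a \<in> borel_measurable borel \<and> (\<forall>k. \<exists>c. \<forall>s. (1 + norm s) ^ k * cmod (a s) \<le> c)"

lemma rapid_schwartz: "a \<in> schwartz_space \<Longrightarrow> rapid a"
  unfolding rapid_def
proof (intro conjI allI)
  fix k assume a: "a \<in> schwartz_space"
  obtain c where "sbound k a c" using schwartz_sbound[OF a] by blast
  then show "\<exists>c. \<forall>s. (1 + norm s) ^ k * cmod (a s) \<le> c"
    using sboundD[of k a c "[]"] by auto
qed (rule schwartz_measurable)

lemma rapid_dominated:
  assumes "rapid a" "a' \<in> borel_measurable borel" "\<And>s. cmod (a' s) \<le> cmod (a s)"
  shows "rapid a'"
  unfolding rapid_def
proof (intro conjI allI assms(2))
  fix k
  obtain c where c: "\<And>s. (1 + norm s) ^ k * cmod (a s) \<le> c" using assms(1) unfolding rapid_def by blast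
  have "(1 + norm s) ^ k * cmod (a' s) \<le> c" for s
    using mult_left_mono[OF assms(3)[of s], of "(1 + norm s) ^ k"] c[of s] by simp
  then show "\<exists>c. \<forall>s. (1 + norm s) ^ k * cmod (a' s) \<le> c" by blast
qed

lemma rapid_weight_bound:
  fixes a :: "real^'n::finite \<Rightarrow> complex"
  assumes "rapid a"
  shows "\<exists>c. \<forall>s. (1 + norm s) ^ k * cmod (a s) \<le> c * weight s"
proof -
  obtain c where "\<And>s. (1 + norm s) ^ (k + 2 * CARD('n)) * cmod (a s) \<le> c"
    using assms unfolding rapid_def by blast
  then show ?thesis by (intro exI[of _ c] allI weight_power) auto
qed

lemma rapid_integrable:
  fixes a :: "real^'n::finite \<Rightarrow> complex"
  assumes "rapid a"
  shows "integrable lborel (\<lambda>s. (1 + norm s) ^ k * cmod (a s))"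
proof -
  obtain c where c: "\<And>s. (1 + norm s) ^ k * cmod (a s) \<le> c * weight s"
    using rapid_weight_bound[OF assms] by blast
  have [measurable]: "a \<in> borel_measurable borel" using assms by (simp add: rapid_def)
  show ?thesis
    by (rule Bochner_Integration.integrable_bound[where f="\<lambda>s::real^'n. c * weight s"])
      (auto simp: integrable_weight intro: order_trans[OF c abs_ge_self])
qed

lemma superpose_integrable:
  fixes a b :: "real^'n::finite \<Rightarrow> complex"
  assumes a: "rapid a" and b: "b \<in> schwartz_space"
  shows "integrable lborel (\<lambda>s. a s * b (t + s))"
proof -
  obtain c where c: "sbound 0 b c" using schwartz_sbound[OF b] by blast
  have [measurable]: "a \<in> borel_measurable borel" "b \<in> borel_measurable borel"
    using a b by (auto simp: rapid_def schwartz_measurable)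
  have bc: "cmod (b y) \<le> c" for y using sboundD[OF c, of "[]" y] by simp
  show ?thesis
  proof (rule Bochner_Integration.integrable_bound)
    show "integrable lborel (\<lambda>s. c * ((1 + norm s) ^ 0 * cmod (a s)))"
      using rapid_integrable[OF a, of 0] by (rule integrable_mult_right)
    show "AE s in lborel. norm (a s * b (t + s)) \<le> norm (c * ((1 + norm s) ^ 0 * cmod (a s)))"
      using bc sbound_nonneg[OF c] by (intro AE_I2) (auto simp: norm_mult mult.commute[of c] intro: mult_left_mono)
  qed measurable
qed

text \<open>The Taylor remainder of \<open>b\<close> is bounded uniformly in the base point, so the
  error under the integral is at most |v|^2 times a multiple of the integral of |a|.\<close>

lemma superpose_derivative:
  fixes a b :: "real^'n::finite \<Rightarrow> complex"
  assumes a: "rapid a" and b: "b \<in> schwartz_space"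
  shows "(superpose a b has_derivative grad_form (\<lambda>i. superpose a (partial i b) t)) (at t)"
proof -
  obtain K where K: "0 \<le> K" "\<And>x v. cmod (b (x + v) - b x - grad_form (\<lambda>i. partial i b x) v) \<le> K * (norm v * norm v)"
    using schwartz_taylor[OF b] by blast
  have ia: "integrable lborel (\<lambda>s. cmod (a s))" using rapid_integrable[OF a, of 0] by simp
  show ?thesis
  proof (rule has_derivative_quadratic[where r=1 and K="K * (LINT s|lborel. cmod (a s))"])
    fix v :: "real^'n"
    let ?R = "\<lambda>s. b (t + s + v) - b (t + s) - grad_form (\<lambda>i. partial i b (t + s)) v"
    note I = superpose_integrable[OF a b]
    note I' = superpose_integrable[OF a schwartz_partial[OF b]]
    have gf: "a s * grad_form (\<lambda>i. partial i b (t + s)) v = (\<Sum>i\<in>UNIV. complex_of_real (v $ i) * (a s * partial i b (t + s)))" for s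
      by (simp add: grad_form_def sum_distrib_left mult_ac)
    have ig: "integrable lborel (\<lambda>s. a s * grad_form (\<lambda>i. partial i b (t + s)) v)"
      unfolding gf using I' by simp
    have eg: "(LINT s|lborel. a s * grad_form (\<lambda>i. partial i b (t + s)) v) = grad_form (\<lambda>i. superpose a (partial i b) t) v"
      unfolding gf using I' by (simp add: grad_form_def superpose_def)
    have ib: "integrable lborel (\<lambda>s. a s * b (t + s + v))"
      using I[of "t + v"] by (simp add: add_ac)
    have eq: "(\<lambda>s. a s * ?R s) = (\<lambda>s. a s * b (t + s + v) - a s * b (t + s) - a s * grad_form (\<lambda>i. partial i b (t + s)) v)"
      by (simp add: right_diff_distrib)
    have e1: "superpose a b (t + v) = (LINT s|lborel. a s * b (t + s + v))" by (simp add: superpose_def add_ac)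
    have e2: "superpose a b t = (LINT s|lborel. a s * b (t + s))" by (rule superpose_def)
    have "superpose a b (t + v) - superpose a b t - grad_form (\<lambda>i. superpose a (partial i b) t) v = (LINT s|lborel. a s * ?R s)"
      unfolding eq e1 e2 eg[symmetric] using ib ig I[of t] by simp
    also have "cmod \<dots> \<le> (LINT s|lborel. K * (norm v * norm v) * cmod (a s))"
    proof (rule order_trans[OF integral_norm_bound integral_mono])
      have "integrable lborel (\<lambda>s. a s * ?R s)"
        unfolding eq using ib ig I[of t] by simp
      then show "integrable lborel (\<lambda>s. norm (a s * ?R s))" by (rule integrable_norm)
      show "integrable lborel (\<lambda>s. K * (norm v * norm v) * cmod (a s))" using ia by simp
      show "norm (a s * ?R s) \<le> K * (norm v * norm v) * cmod (a s)" for s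
        using mult_left_mono[OF K(2)[of "t + s" v], of "cmod (a s)"] by (simp add: norm_mult mult_ac)
    qed
    also have "\<dots> = K * (LINT s|lborel. cmod (a s)) * (norm v * norm v)" by simp
    finally show "cmod (superpose a b (t + v) - superpose a b t - grad_form (\<lambda>i. superpose a (partial i b) t) v) \<le> K * (LINT s|lborel. cmod (a s)) * (norm v * norm v)" .
  qed (simp_all add: bounded_linear_grad_form)
qed

lemma
  fixes a b :: "real^'n::finite \<Rightarrow> complex"
  assumes a: "rapid a" and b: "b \<in> schwartz_space"
  shows smooth_superpose: "smooth (superpose a b)"
    and partials_superpose: "partials is (superpose a b) = superpose a (partials is b)"
proof -
  let ?G = "\<lambda>is. superpose a (partials is b)"
  have G: "(?G is has_derivative grad_form (\<lambda>i. ?G (i # is) x)) (at x)" for "is" x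
    using superpose_derivative[OF a schwartz_partials[OF b, of "is"], of x] by simp
  show "smooth (superpose a b)" using smoothI[of ?G, OF G] by simp
  show "partials is (superpose a b) = superpose a (partials is b)" using partials_eqI[of ?G, OF G] by simp
qed

text \<open>The weight at t is split by \<open>one_plus_norm_add\<close> between s and t + s:
  \<open>b\<close> pays for the second factor and the decay of \<open>a\<close> for the
  first.\<close>

lemma sbound_superpose:
  fixes a b :: "real^'n::finite \<Rightarrow> complex"
  assumes a: "rapid a" and b: "b \<in> schwartz_space" and c: "sbound N b c"
  shows "sbound N (superpose a b) (c * (LINT s|lborel. (1 + norm s) ^ N * cmod (a s)))"
  unfolding sbound_def partials_superpose[OF a b]
proof (intro allI impI)
  fix "is" :: "'n list" and t :: "real^'n" assume l: "length is \<le> N"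
  let ?b = "partials is b"
  note I = superpose_integrable[OF a schwartz_partials[OF b]]
  have P: "cmod (complex_of_real ((1 + norm t) ^ N)) = (1 + norm t) ^ N"
    by (subst norm_of_real) simp
  have "(1 + norm t) ^ N * cmod (superpose a ?b t) = cmod (complex_of_real ((1 + norm t) ^ N) * superpose a ?b t)"
    unfolding norm_mult P by (rule refl)
  also have "complex_of_real ((1 + norm t) ^ N) * superpose a ?b t = (LINT s|lborel. complex_of_real ((1 + norm t) ^ N) * (a s * ?b (t + s)))"
    unfolding superpose_def by (rule integral_mult_right_zero[symmetric])
  also have "cmod \<dots> \<le> (LINT s|lborel. c * ((1 + norm s) ^ N * cmod (a s)))"
  proof (rule order_trans[OF integral_norm_bound integral_mono])
    show "integrable lborel (\<lambda>s. norm (complex_of_real ((1 + norm t) ^ N) * (a s * ?b (t + s))))"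
      using I[of "is" t] by (intro integrable_norm integrable_mult_right)
    show "integrable lborel (\<lambda>s. c * ((1 + norm s) ^ N * cmod (a s)))"
      using rapid_integrable[OF a] by (rule integrable_mult_right)
    fix s
    have "1 + norm t \<le> (1 + norm s) * (1 + norm (t + s))"
      using one_plus_norm_add[of "- s" "t + s"] by simp
    then have "(1 + norm t) ^ N \<le> (1 + norm s) ^ N * (1 + norm (t + s)) ^ N"
      by (metis power_mono power_mult_distrib add_nonneg_nonneg norm_ge_zero zero_le_one)
    then have "(1 + norm t) ^ N * cmod (?b (t + s)) \<le> (1 + norm s) ^ N * (1 + norm (t + s)) ^ N * cmod (?b (t + s))"
      by (intro mult_right_mono) auto
    also have "\<dots> \<le> (1 + norm s) ^ N * c"
      using sboundD[OF c l, of "t + s"] by (simp add: mult.assoc mult_left_mono)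
    finally have "cmod (a s) * ((1 + norm t) ^ N * cmod (?b (t + s))) \<le> cmod (a s) * ((1 + norm s) ^ N * c)"
      by (intro mult_left_mono) auto
    then show "norm (complex_of_real ((1 + norm t) ^ N) * (a s * ?b (t + s))) \<le> c * ((1 + norm s) ^ N * cmod (a s))"
      unfolding norm_mult P by (simp add: mult_ac)
  qed
  also have "\<dots> = c * (LINT s|lborel. (1 + norm s) ^ N * cmod (a s))"
    by (rule integral_mult_right_zero)
  finally show "(1 + norm t) ^ N * cmod (superpose a ?b t) \<le> c * (LINT s|lborel. (1 + norm s) ^ N * cmod (a s))" .
qed

lemma schwartz_superpose:
  assumes "rapid a" "b \<in> schwartz_space"
  shows "superpose a b \<in> schwartz_space"
proof (rule schwartzI)
  show "smooth (superpose a b)" by (rule smooth_superpose[OF assms])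
  show "\<exists>c. sbound N (superpose a b) c" for N
    using schwartz_sbound[OF assms(2), of N] sbound_superpose[OF assms] by blast
qed

lemma
  assumes "finite I" "\<And>i. i \<in> I \<Longrightarrow> X i \<in> schwartz_space"
  shows schwartz_sum: "(\<lambda>x. \<Sum>i\<in>I. c i * X i x) \<in> schwartz_space"
    and partials_sum: "partials is (\<lambda>x. \<Sum>i\<in>I. c i * X i x) = (\<lambda>x. \<Sum>i\<in>I. c i * partials is (X i) x)"
proof -
  have "(\<lambda>x. \<Sum>i\<in>I. c i * X i x) \<in> schwartz_space \<and>
     partials is (\<lambda>x. \<Sum>i\<in>I. c i * X i x) = (\<lambda>x. \<Sum>i\<in>I. c i * partials is (X i) x)"
    using assms
  proof (induction I rule: finite_induct)
    case empty
    have "partials is (\<lambda>x. 0) = (\<lambda>x. 0)"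
      using partials_lincomb[of "\<lambda>x. 0" "\<lambda>x. 0" "is" 0 0] schwartz_smooth[OF schwartz_zero] by simp
    then show ?case by simp
  next
    case (insert i I)
    then have X: "X i \<in> schwartz_space" "(\<lambda>x. \<Sum>i\<in>I. c i * X i x) \<in> schwartz_space"
      and eq: "partials is (\<lambda>x. \<Sum>i\<in>I. c i * X i x) = (\<lambda>x. \<Sum>i\<in>I. c i * partials is (X i) x)" by auto
    show ?case
      using insert(1,2) schwartz_lincomb[OF X, of "c i" 1] partials_lincomb[OF X[THEN schwartz_smooth], of "is" "c i" 1]
      by (simp add: eq)
  qed
  then show "(\<lambda>x. \<Sum>i\<in>I. c i * X i x) \<in> schwartz_space"
     "partials is (\<lambda>x. \<Sum>i\<in>I. c i * X i x) = (\<lambda>x. \<Sum>i\<in>I. c i * partials is (X i) x)" by auto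
qed

lemma sbound_triangle:
  assumes "smooth \<phi>" "smooth \<theta>" "sbound N \<phi> c" "sbound N \<theta> d"
  shows "sbound N (\<lambda>x. \<phi> x + \<theta> x) (c + d)"
  unfolding sbound_def
proof (intro allI impI)
  fix "is" x assume l: "length (is :: 'a list) \<le> N"
  have "partials is (\<lambda>x. \<phi> x + \<theta> x) = (\<lambda>x. partials is \<phi> x + partials is \<theta> x)"
    using partials_lincomb[OF assms(1,2), of "is" 1 1] by simp
  moreover have "(1 + norm x) ^ N * cmod (partials is \<phi> x + partials is \<theta> x) \<le> (1 + norm x) ^ N * (cmod (partials is \<phi> x) + cmod (partials is \<theta> x))"
    by (intro mult_left_mono norm_triangle_ineq) auto
  ultimately show "(1 + norm x) ^ N * cmod (partials is (\<lambda>x. \<phi> x + \<theta> x) x) \<le> c + d"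
    using sboundD[OF assms(3) l, of x] sboundD[OF assms(4) l, of x] by (simp add: distrib_left)
qed

lemma sbound_scale:
  assumes "smooth \<phi>" "sbound N \<phi> c"
  shows "sbound N (\<lambda>x. a * \<phi> x) (cmod a * c)"
  unfolding sbound_def
proof (intro allI impI)
  fix "is" x assume l: "length (is :: 'a list) \<le> N"
  have "partials is (\<lambda>x. a * \<phi> x) = (\<lambda>x. a * partials is \<phi> x)"
    using partials_lincomb[OF assms(1,1), of "is" a 0] by simp
  then show "(1 + norm x) ^ N * cmod (partials is (\<lambda>x. a * \<phi> x) x) \<le> cmod a * c"
    using mult_left_mono[OF sboundD[OF assms(2) l, of x], of "cmod a"] by (simp add: norm_mult mult_ac)
qed

text \<open>The summands of the Riemann sums of a superposition depend on their node in a Lipschitz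
  manner, measured in a Schwartz norm; the bounded range of nodes makes the constant
  uniform.\<close>

lemma sbound_product_translate_diff:
  fixes a b :: "real^'n::finite \<Rightarrow> complex"
  assumes a: "a \<in> schwartz_space" and b: "b \<in> schwartz_space"
  shows "\<exists>Q\<ge>0. \<forall>x s. norm s \<le> r \<longrightarrow> norm x \<le> r \<longrightarrow> norm (x - s) \<le> 1 \<longrightarrow>
    sbound N (\<lambda>t. a x * b (t + x) - a s * b (t + s)) (Q * norm (x - s))"
proof -
  obtain ca where ca: "sbound 1 a ca" using schwartz_sbound[OF a] by blast
  obtain cb where cb: "sbound (Suc N) b cb" using schwartz_sbound[OF b] by blast
  note sa = schwartz_smooth[OF a] and sb = schwartz_smooth[OF b]
  have ca0: "0 \<le> ca" and cb0: "0 \<le> cb" using sbound_nonneg ca cb by auto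
  let ?n = "real CARD('n)" and ?R = "(1 + \<bar>r\<bar>) ^ N"
  let ?Q = "?n * ca * (?R * cb) + ca * (?R * (2 ^ N * ?n * cb))"
  have "sbound N (\<lambda>t. a x * b (t + x) - a s * b (t + s)) (?Q * norm (x - s))"
    if s: "norm s \<le> r" and x: "norm x \<le> r" and xs: "norm (x - s) \<le> 1" for x s
  proof -
    have R: "(1 + norm y) ^ N \<le> ?R" if "norm y \<le> r" for y :: "real^'n" using that by (intro power_mono) auto
    have T: "sbound N (\<lambda>t. \<phi> (t + y)) (?R * c)" if "smooth \<phi>" "sbound N \<phi> c" "norm y \<le> r" for \<phi> c and y :: "real^'n"
    proof -
      have "sbound N (\<lambda>x. \<phi> (y + 1 *\<^sub>R x)) ((1 + norm y) ^ N * c)"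
        by (rule sbound_affine[OF that(1,2)]) simp
      moreover have "(1 + norm y) ^ N * c \<le> ?R * c"
        using R[OF that(3)] sbound_nonneg[OF that(2)] by (intro mult_right_mono)
      ultimately have "sbound N (\<lambda>x. \<phi> (y + 1 *\<^sub>R x)) (?R * c)" by (rule sbound_mono[OF _ order_refl])
      then show ?thesis by (simp add: add.commute)
    qed
    have tr: "smooth (\<lambda>t. b (t + y))" for y
      using smooth_affine[OF sb, of y 1] by (simp add: add.commute)
    \<comment> \<open>The difference is split into two changes, first of the coefficient and then of
      the translate.\<close>
    have 1: "sbound N (\<lambda>t. (a x - a s) * b (t + x)) (cmod (a x - a s) * (?R * cb))"
      by (rule sbound_scale[OF tr T[OF sb sbound_mono[OF cb] x]]) auto
    let ?h = "x - s"
    let ?d = "\<lambda>t. b (t + ?h) - b t"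
    have sd: "smooth ?d" using smooth_lincomb[OF tr sb, of 1 ?h "-1"] by simp
    have "sbound N (\<lambda>t. ?d (t + s)) (?R * (2 ^ N * ?n * cb * norm ?h))"
      by (rule T[OF sd sbound_translate_diff[OF sb cb xs] s])
    moreover have "smooth (\<lambda>t. ?d (t + s))"
      using smooth_affine[OF sd, of s 1] by (simp add: add.commute)
    moreover note smooth_lincomb[OF calculation(2,2), of "a s" 0] sbound_scale[OF calculation(2,1), of "a s"]
    ultimately have 2: "sbound N (\<lambda>t. a s * ?d (t + s)) (cmod (a s) * (?R * (2 ^ N * ?n * cb * norm ?h)))"
      and s2: "smooth (\<lambda>t. a s * ?d (t + s))"
      by simp_all
    have s1: "smooth (\<lambda>t. (a x - a s) * b (t + x))"
      using smooth_lincomb[OF tr tr, of "a x - a s" x 0] by simp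
    have "sbound 0 (\<lambda>x. a (x + ?h) - a x) (2 ^ 0 * ?n * ca * norm ?h)"
      by (rule sbound_translate_diff[OF sa _ xs]) (use ca in simp)
    from sboundD[OF this, of "[]" s] have d1: "cmod (a x - a s) \<le> ?n * ca * norm ?h" by simp
    have d2: "cmod (a s) \<le> ca" using sboundD'[OF ca, of "[]" 0 s] by simp
    have A: "sbound N (\<lambda>t. (a x - a s) * b (t + x) + a s * ?d (t + s))
        (cmod (a x - a s) * (?R * cb) + cmod (a s) * (?R * (2 ^ N * ?n * cb * norm ?h)))"
      by (rule sbound_triangle[OF s1 s2 1 2])
    have "cmod (a x - a s) * (?R * cb) + cmod (a s) * (?R * (2 ^ N * ?n * cb * norm ?h))
       \<le> ?n * ca * norm ?h * (?R * cb) + ca * (?R * (2 ^ N * ?n * cb * norm ?h))"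
      using d1 d2 cb0 by (intro add_mono mult_right_mono) auto
    also have "\<dots> = ?Q * norm ?h"
      by (simp only: distrib_left distrib_right mult_ac)
    finally have le: "cmod (a x - a s) * (?R * cb) + cmod (a s) * (?R * (2 ^ N * ?n * cb * norm ?h)) \<le> ?Q * norm ?h" .
    have eq: "(\<lambda>t. (a x - a s) * b (t + x) + a s * ?d (t + s)) = (\<lambda>t. a x * b (t + x) - a s * b (t + s))"
    proof
      fix t
      have "t + s + (x - s) = t + x" by simp
      then show "(a x - a s) * b (t + x) + a s * ?d (t + s) = a x * b (t + x) - a s * b (t + s)"
        by (simp only:) (simp add: left_diff_distrib right_diff_distrib)
    qed
    show ?thesis using sbound_mono[OF A order_refl le] unfolding eq .
  qed
  moreover have "0 \<le> ?Q" using ca0 cb0 by simp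
  ultimately show ?thesis by blast
qed

section \<open>Tempered functionals commute with superpositions\<close>

text \<open>A tempered distribution reduced to linearity and a bound of finite order. It will be
  instantiated with \<open>f\<close> composed with \<open>regular_distribution\<close>, which frees
  the exchange of integrals from the norm of \<open>E\<close>.\<close>

locale schwartz_functional =
  fixes G :: "(real^'n::finite \<Rightarrow> complex) \<Rightarrow> complex" and L :: nat and K0 :: real
  assumes G_add: "\<phi> \<in> schwartz_space \<Longrightarrow> \<theta> \<in> schwartz_space \<Longrightarrow> G (\<lambda>x. \<phi> x + \<theta> x) = G \<phi> + G \<theta>"
    and G_scale: "\<phi> \<in> schwartz_space \<Longrightarrow> G (\<lambda>x. k * \<phi> x) = k * G \<phi>"
    and G_bound: "\<phi> \<in> schwartz_space \<Longrightarrow> sbound L \<phi> c \<Longrightarrow> cmod (G \<phi>) \<le> K0 * c"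
    and K0_nonneg: "0 \<le> K0"
begin

lemma G_diff: "\<phi> \<in> schwartz_space \<Longrightarrow> \<theta> \<in> schwartz_space \<Longrightarrow> G (\<lambda>x. \<phi> x - \<theta> x) = G \<phi> - G \<theta>"
  using G_add[OF _ schwartz_scale, of \<phi> \<theta> "-1"] G_scale[of \<theta> "-1"] by simp

lemma G_sum:
  assumes "finite I" "\<And>i. i \<in> I \<Longrightarrow> X i \<in> schwartz_space"
  shows "G (\<lambda>x. \<Sum>i\<in>I. c i * X i x) = (\<Sum>i\<in>I. c i * G (X i))"
  using assms
proof (induction I rule: finite_induct)
  case empty
  then show ?case using G_scale[OF schwartz_zero, of 0] by simp
next
  case (insert i I)
  then have "G (\<lambda>x. c i * X i x + (\<Sum>i\<in>I. c i * X i x)) = G (\<lambda>x. c i * X i x) + G (\<lambda>x. \<Sum>i\<in>I. c i * X i x)"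
    by (intro G_add schwartz_scale schwartz_sum) auto
  moreover have "G (\<lambda>x. c i * X i x) = c i * G (X i)"
    by (rule G_scale) (rule insert.prems[OF insertI1])
  ultimately show ?case using insert by simp
qed

lemma G_translate_bound:
  assumes b: "b \<in> schwartz_space" and c: "sbound L b c"
  shows "cmod (G (\<lambda>t. b (t + s))) \<le> K0 * c * (1 + norm s) ^ L"
proof -
  have "sbound L (\<lambda>t. b (s + 1 *\<^sub>R t)) ((1 + norm s) ^ L * c)"
    by (rule sbound_affine[OF schwartz_smooth[OF b] c]) simp
  then have "sbound L (\<lambda>t. b (t + s)) ((1 + norm s) ^ L * c)" by (simp add: add.commute)
  from G_bound[OF schwartz_translate[OF b] this] show ?thesis by (simp add: mult_ac)
qed

lemma G_translate_continuous:
  assumes b: "b \<in> schwartz_space"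
  shows "continuous_on UNIV (\<lambda>s. G (\<lambda>t. b (t + s)))"
proof (intro continuous_at_imp_continuous_on ballI)
  fix s :: "real^'n"
  let ?b = "\<lambda>t. b (t + s)"
  have bs: "?b \<in> schwartz_space" using b by (rule schwartz_translate)
  obtain c where c: "sbound (Suc L) ?b c" using schwartz_sbound[OF bs] by blast
  define D where "D = K0 * (2 ^ L * real CARD('n) * c)"
  have "((\<lambda>h. G (\<lambda>t. b (t + (s + h))) - G ?b) \<longlongrightarrow> 0) (at 0)"
  proof (rule Lim_null_comparison)
    have "norm (G (\<lambda>t. b (t + (s + h))) - G ?b) \<le> D * norm h" if h: "norm h \<le> 1" for h
    proof -
      have "G (\<lambda>t. ?b (t + h) - ?b t) = G (\<lambda>t. ?b (t + h)) - G ?b"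
        by (intro G_diff schwartz_translate bs)
      moreover have "(\<lambda>t. ?b (t + h)) = (\<lambda>t. b (t + (s + h)))" by (simp add: add_ac)
      moreover have "cmod (G (\<lambda>t. ?b (t + h) - ?b t)) \<le> K0 * (2 ^ L * real CARD('n) * c * norm h)"
        by (intro G_bound schwartz_diff schwartz_translate[OF bs] bs sbound_translate_diff[OF schwartz_smooth[OF bs] c h])
      ultimately show ?thesis by (simp add: D_def mult.assoc)
    qed
    then show "\<forall>\<^sub>F h in at 0. norm (G (\<lambda>t. b (t + (s + h))) - G ?b) \<le> D * norm h"
      unfolding eventually_at by (intro exI[of _ 1]) auto
    show "((\<lambda>h. D * norm h) \<longlongrightarrow> 0) (at (0::real^'n))"
      by (intro tendsto_mult_right_zero tendsto_norm_zero) (rule tendsto_ident_at)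
  qed
  then show "isCont (\<lambda>s. G (\<lambda>t. b (t + s))) s"
    unfolding isCont_iff by (rule LIM_zero_cancel)
qed

text \<open>
  The functional commutes with finite Riemann sums, and these approximate the integral with
  respect to the seminorm controlling the functional.
\<close>

lemma G_superpose_box:
  fixes a b :: "real^'n \<Rightarrow> complex" and l u :: "real^'n"
  assumes a: "a \<in> schwartz_space" and b: "b \<in> schwartz_space"
  defines "a' \<equiv> (\<lambda>s. if s \<in> cbox l u then a s else 0)"
  shows "((\<lambda>s. a s * G (\<lambda>t. b (t + s))) has_integral G (superpose a' b)) (cbox l u)"
proof -
  let ?B = "cbox l u"
  obtain r where r: "\<And>s. s \<in> ?B \<Longrightarrow> norm s \<le> r"
    using bounded_cbox[of l u] unfolding bounded_iff by blast
  obtain Q where Q: "0 \<le> Q" "\<And>x s. norm s \<le> r \<Longrightarrow> norm x \<le> r \<Longrightarrow> norm (x - s) \<le> 1 \<Longrightarrow>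
    sbound L (\<lambda>t. a x * b (t + x) - a s * b (t + s)) (Q * norm (x - s))"
    using sbound_product_translate_diff[OF a b, of r L] by blast
  have [measurable]: "a \<in> borel_measurable borel" by (rule schwartz_measurable[OF a])
  have ra: "rapid a'"
    by (rule rapid_dominated[OF rapid_schwartz[OF a]]) (auto simp: a'_def)
  have cont: "continuous_on S (\<lambda>s. a s * c (t + s))" if "c \<in> schwartz_space" for c t S
  proof -
    have "continuous_on S (\<lambda>s. c (s + t))" by (rule schwartz_continuous_on[OF schwartz_translate[OF that]])
    then show ?thesis by (intro continuous_intros schwartz_continuous_on[OF a]) (simp add: add.commute)
  qed
  have sup: "superpose a' c t = integral ?B (\<lambda>s. a s * c (t + s))" if c: "c \<in> schwartz_space" for c t
  proof -
    have "(\<lambda>s. indicator ?B s *\<^sub>R (a s * c (t + s))) = (\<lambda>s. a' s * c (t + s))"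
      by (auto simp: a'_def indicator_def)
    then have "set_integrable lborel ?B (\<lambda>s. a s * c (t + s))" "superpose a' c t = (LINT s:?B|lborel. a s * c (t + s))"
      using superpose_integrable[OF ra c, of t] by (simp_all add: set_integrable_def set_lebesgue_integral_def superpose_def)
    then show ?thesis by (simp add: set_borel_integral_eq_integral(2))
  qed
  show ?thesis
    unfolding has_integral
  proof (intro allI impI)
    fix e :: real assume e: "0 < e"
    define X where "X = K0 * Q * measure lborel ?B"
    have X: "0 \<le> X" using K0_nonneg Q(1) by (simp add: X_def)
    \<comment> \<open>The mesh must be at most 1 for the Lipschitz estimate and small against the
      total constant \<open>X\<close>; adding 1 avoids a division by 0.\<close>
    define \<delta> where "\<delta> = min 1 (e / (X + 1))"
    have \<delta>: "0 < \<delta>" "\<delta> \<le> 1" using e X by (auto simp: \<delta>_def)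
    have Xd: "X * \<delta> < e"
    proof -
      have "X * \<delta> \<le> X * (e / (X + 1))" using X by (intro mult_left_mono) (auto simp: \<delta>_def)
      also have "\<dots> < e" using X e by (simp add: field_simps)
      finally show ?thesis .
    qed
    have "norm ((\<Sum>(x, k)\<in>\<D>. measure lborel k *\<^sub>R (a x * G (\<lambda>t. b (t + x)))) - G (superpose a' b)) < e"
      if div: "\<D> tagged_division_of ?B" and fine: "(\<lambda>x. ball x \<delta>) fine \<D>" for \<D>
    proof -
      let ?c = "\<lambda>p. complex_of_real (measure lborel (snd p)) * a (fst p)"
      let ?X = "\<lambda>p t. b (t + fst p)"
      let ?S = "\<lambda>t. \<Sum>p\<in>\<D>. ?c p * ?X p t"
      have fin: "finite \<D>" using div by (rule tagged_division_ofD(1))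
      have XS: "?X p \<in> schwartz_space" for p :: "(real^'n) \<times> (real^'n) set" using b by (rule schwartz_translate)
      have SS: "?S \<in> schwartz_space" by (rule schwartz_sum[OF fin XS])
      have sS: "superpose a' b \<in> schwartz_space" by (rule schwartz_superpose[OF ra b])
      have "(\<Sum>(x, k)\<in>\<D>. measure lborel k *\<^sub>R (a x * G (\<lambda>t. b (t + x)))) = (\<Sum>p\<in>\<D>. ?c p * G (?X p))"
        by (intro sum.cong) (auto simp: scaleR_conv_of_real mult.assoc)
      also have "\<dots> = G ?S" by (rule G_sum[OF fin XS, symmetric])
      finally have "(\<Sum>(x, k)\<in>\<D>. measure lborel k *\<^sub>R (a x * G (\<lambda>t. b (t + x)))) - G (superpose a' b) = G (\<lambda>t. ?S t - superpose a' b t)"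
        by (simp add: G_diff[OF SS sS])
      moreover have "sbound L (\<lambda>t. ?S t - superpose a' b t) (Q * \<delta> * measure lborel ?B)"
        unfolding sbound_def
      proof (intro allI impI)
        fix "is" :: "'n list" and t :: "real^'n" assume len: "length is \<le> L"
        let ?b = "partials is b"
        let ?P = "(1 + norm t) ^ L"
        have P: "0 < ?P" by (simp add: add_pos_nonneg)
        have bS: "?b \<in> schwartz_space" using b by (rule schwartz_partials)
        let ?g = "\<lambda>s. a s * ?b (t + s)"
        have pX: "partials is (?X p) = (\<lambda>t. ?b (t + fst p))" for p :: "(real^'n) \<times> (real^'n) set"
          by (rule partials_translate[OF schwartz_smooth[OF b]])
        have "partials is (\<lambda>t. ?S t - superpose a' b t) = (\<lambda>t. partials is ?S t - superpose a' ?b t)"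
          using partials_lincomb[OF SS[THEN schwartz_smooth] sS[THEN schwartz_smooth], of "is" 1 "-1"]
          by (simp add: partials_superpose[OF ra b])
        also have "partials is ?S = (\<lambda>t. \<Sum>p\<in>\<D>. ?c p * ?b (t + fst p))"
          by (simp add: partials_sum[OF fin XS] pX)
        finally have "partials is (\<lambda>t. ?S t - superpose a' b t) t = (\<Sum>p\<in>\<D>. ?c p * ?b (t + fst p)) - integral ?B ?g"
          by (simp add: sup[OF bS])
        \<comment> \<open>The integral is distributed over the cells of the division; on each cell
          the integrand differs from its value at the tag by at most Q \<delta> divided by the
          weight at t.\<close>
        also have "integral ?B ?g = (\<Sum>(x, k)\<in>\<D>. integral k ?g)"
          by (rule integral_combine_tagged_division_topdown[OF integrable_continuous[OF cont[OF bS]] div])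
        also have "(\<Sum>p\<in>\<D>. ?c p * ?b (t + fst p)) - (\<Sum>(x, k)\<in>\<D>. integral k ?g)
            = (\<Sum>(x, k)\<in>\<D>. measure lborel k *\<^sub>R ?g x - integral k ?g)"
          unfolding sum_subtractf[symmetric]
          by (intro sum.cong) (auto simp: scaleR_conv_of_real mult.assoc)
        also have "cmod \<dots> \<le> (\<Sum>(x, k)\<in>\<D>. (Q * \<delta> / ?P) * measure lborel k)"
        proof (rule sum_norm_le, clarify)
          fix x k assume xk: "(x, k) \<in> \<D>"
          obtain p q where k: "k = cbox p q" using tagged_division_ofD(4)[OF div xk] by blast
          have kB: "k \<subseteq> ?B" and xk': "x \<in> k" using tagged_division_ofD(2,3)[OF div xk] by auto
          have kx: "k \<subseteq> ball x \<delta>" using fineD[OF fine xk] .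
          have "((\<lambda>s. ?g x - ?g s) has_integral (measure lborel (cbox p q) *\<^sub>R ?g x - integral (cbox p q) ?g)) (cbox p q)"
            by (intro has_integral_diff has_integral_const integrable_integral integrable_continuous cont[OF bS])
          moreover have "norm (?g x - ?g s) \<le> Q * \<delta> / ?P" if s: "s \<in> cbox p q" for s
          proof -
            have xs: "norm (x - s) < \<delta>" using kx s k by (auto simp: dist_norm)
            have "sbound L (\<lambda>t. a x * b (t + x) - a s * b (t + s)) (Q * norm (x - s))"
            proof (rule Q(2)[OF r r])
              show "s \<in> ?B" "x \<in> ?B" using kB xk' s k by auto
              show "norm (x - s) \<le> 1" using xs \<delta>(2) by linarith
            qed
            moreover have "partials is (\<lambda>t. a x * b (t + x) - a s * b (t + s)) = (\<lambda>t. a x * ?b (t + x) - a s * ?b (t + s))"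
              using partials_lincomb[OF schwartz_smooth[OF schwartz_translate[OF b]] schwartz_smooth[OF schwartz_translate[OF b]], of "is" "a x" x "- a s" s]
              by (simp add: partials_translate[OF schwartz_smooth[OF b]])
            ultimately have "?P * cmod (?g x - ?g s) \<le> Q * norm (x - s)"
              using sboundD[OF _ len, of "\<lambda>t. a x * b (t + x) - a s * b (t + s)" _ t] by fastforce
            also have "\<dots> \<le> Q * \<delta>" using xs Q(1) by (intro mult_left_mono) auto
            finally show ?thesis using P by (simp add: pos_le_divide_eq mult.commute)
          qed
          ultimately have "norm (measure lborel (cbox p q) *\<^sub>R ?g x - integral (cbox p q) ?g) \<le> (Q * \<delta> / ?P) * measure lborel (cbox p q)"
            using Q(1) \<delta>(1) P by (intro has_integral_bound[where f="\<lambda>s. ?g x - ?g s"]) auto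
          then show "cmod (measure lborel k *\<^sub>R ?g x - integral k ?g) \<le> (Q * \<delta> / ?P) * measure lborel k"
            unfolding k .
        qed
        also have "\<dots> = (Q * \<delta> / ?P) * (\<Sum>(x, k)\<in>\<D>. measure lborel k)"
          by (simp add: sum_distrib_left case_prod_beta)
        also have "(\<Sum>(x, k)\<in>\<D>. measure lborel k) = measure lborel ?B"
          by (rule additive_content_tagged_division[OF div])
        finally show "?P * cmod (partials is (\<lambda>t. ?S t - superpose a' b t) t) \<le> Q * \<delta> * measure lborel ?B"
          using P by (simp add: pos_le_divide_eq mult.commute)
      qed
      ultimately have "norm ((\<Sum>(x, k)\<in>\<D>. measure lborel k *\<^sub>R (a x * G (\<lambda>t. b (t + x)))) - G (superpose a' b)) \<le> K0 * (Q * \<delta> * measure lborel ?B)"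
        using G_bound[OF schwartz_diff[OF SS sS]] by simp
      also have "\<dots> = X * \<delta>" by (simp add: X_def)
      finally show ?thesis using Xd by linarith
    qed
    then show "\<exists>\<gamma>. gauge \<gamma> \<and> (\<forall>\<D>. \<D> tagged_division_of ?B \<and> \<gamma> fine \<D> \<longrightarrow>
       norm ((\<Sum>(x, k)\<in>\<D>. measure lborel k *\<^sub>R (a x * G (\<lambda>t. b (t + x)))) - G (superpose a' b)) < e)"
      using gauge_ball[OF \<delta>(1)] by blast
  qed
qed

text \<open>Boxes exhaust the space. The integrals converge by dominated convergence. On the other
  side the truncation error of \<open>a\<close> is still \<open>rapid\<close>, and its superposition
  with \<open>b\<close> tends to 0 in the Schwartz bound of order \<open>L\<close>.\<close>

lemma G_superpose:
  fixes a b :: "real^'n \<Rightarrow> complex"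
  assumes a: "a \<in> schwartz_space" and b: "b \<in> schwartz_space"
  shows "integrable lborel (\<lambda>s. a s * G (\<lambda>t. b (t + s)))"
    and "G (superpose a b) = (LINT s|lborel. a s * G (\<lambda>t. b (t + s)))"
proof -
  let ?h = "\<lambda>s. a s * G (\<lambda>t. b (t + s))"
  obtain c where c: "sbound L b c" using schwartz_sbound[OF b] by blast
  have Gm: "(\<lambda>s. G (\<lambda>t. b (t + s))) \<in> borel_measurable borel"
    by (rule borel_measurable_continuous_onI[OF G_translate_continuous[OF b]])
  show ih: "integrable lborel ?h"
    using integrable_poly_growth_schwartz[OF a Gm G_translate_bound[OF b c]] by (simp add: mult.commute)
  have [measurable]: "a \<in> borel_measurable borel" "?h \<in> borel_measurable borel"
    using schwartz_measurable[OF a] borel_measurable_integrable[OF ih] by auto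
  define B where "B j = cbox (- (real j *\<^sub>R One)) (real j *\<^sub>R One :: real^'n)" for j :: nat
  define a' where "a' j s = (if s \<in> B j then a s else 0)" for j s
  have inB: "\<forall>\<^sub>F j in sequentially. s \<in> B j" for s
  proof -
    obtain J :: nat where J: "norm s \<le> real J" using real_arch_simple by blast
    have "s \<in> B j" if "J \<le> j" for j
    proof -
      have "\<bar>s \<bullet> i\<bar> \<le> real j" if "i \<in> Basis" for i
        using Basis_le_norm[OF that, of s] J \<open>J \<le> j\<close> by (meson of_nat_le_iff order_trans)
      then show ?thesis by (auto simp: B_def mem_box abs_le_iff minus_le_iff)
    qed
    then show ?thesis unfolding eventually_sequentially by blast
  qed
  have [measurable]: "B j \<in> sets borel" for j by (simp add: B_def)
  have ra: "rapid (a' j)" "rapid (\<lambda>s. a s - a' j s)" for j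
    by (rule rapid_dominated[OF rapid_schwartz[OF a]]; auto simp: a'_def[abs_def])+
  have "(\<lambda>j. G (superpose (a' j) b)) \<longlonglongrightarrow> (LINT s|lborel. ?h s)"
  proof -
    have "G (superpose (a' j) b) = (LINT s|lborel. indicator (B j) s *\<^sub>R ?h s)" for j
    proof -
      have "set_integrable lborel (B j) ?h"
        unfolding set_integrable_def using ih by (intro integrable_mult_indicator) auto
      then have "(LINT s:B j|lborel. ?h s) = integral (B j) ?h"
        by (rule set_borel_integral_eq_integral(2))
      also have "\<dots> = G (superpose (a' j) b)"
        using G_superpose_box[OF a b, of "- (real j *\<^sub>R One)" "real j *\<^sub>R One"]
        by (simp add: B_def[symmetric] a'_def[abs_def] integral_unique)
      finally show ?thesis by (simp add: set_lebesgue_integral_def)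
    qed
    moreover have "(\<lambda>j. LINT s|lborel. indicator (B j) s *\<^sub>R ?h s) \<longlonglongrightarrow> (LINT s|lborel. ?h s)"
    proof (rule integral_dominated_convergence[where w="\<lambda>s. norm (?h s)"])
      show "AE s in lborel. (\<lambda>j. indicator (B j) s *\<^sub>R ?h s) \<longlonglongrightarrow> ?h s"
      proof (rule AE_I2)
        fix s
        show "(\<lambda>j. indicator (B j) s *\<^sub>R ?h s) \<longlonglongrightarrow> ?h s"
          using inB[of s] by (intro tendsto_eventually) (auto elim: eventually_mono)
      qed
      show "AE s in lborel. norm (indicator (B j) s *\<^sub>R ?h s) \<le> norm (?h s)" for j
        by (intro AE_I2) (auto simp: indicator_def)
    qed (use ih in auto)
    ultimately show ?thesis by simp
  qed
  moreover have "(\<lambda>j. G (superpose (a' j) b)) \<longlonglongrightarrow> G (superpose a b)"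
  proof -
    let ?i = "\<lambda>j. LINT s|lborel. (1 + norm s) ^ L * cmod (a s - a' j s)"
    have "?i \<longlonglongrightarrow> integral\<^sup>L lborel (\<lambda>s::real^'n. 0::real)"
    proof (rule integral_dominated_convergence[where w="\<lambda>s. (1 + norm s) ^ L * cmod (a s)"])
      show "integrable lborel (\<lambda>s. (1 + norm s) ^ L * cmod (a s))" by (rule rapid_integrable[OF rapid_schwartz[OF a]])
      show "AE s in lborel. (\<lambda>j. (1 + norm s) ^ L * cmod (a s - a' j s)) \<longlonglongrightarrow> 0"
      proof (rule AE_I2)
        fix s
        show "(\<lambda>j. (1 + norm s) ^ L * cmod (a s - a' j s)) \<longlonglongrightarrow> 0"
          by (rule tendsto_eventually, rule eventually_mono[OF inB[of s]]) (simp add: a'_def)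
      qed
      show "AE s in lborel. norm ((1 + norm s) ^ L * cmod (a s - a' j s)) \<le> (1 + norm s) ^ L * cmod (a s)" for j
        by (intro AE_I2) (auto simp: a'_def)
    qed (auto simp: a'_def[abs_def])
    then have i0: "(\<lambda>j. K0 * (c * ?i j)) \<longlonglongrightarrow> 0"
      using tendsto_mult_right_zero[OF tendsto_mult_right_zero, of ?i sequentially K0 c] by simp
    have "norm (G (superpose (a' j) b) - G (superpose a b)) \<le> K0 * (c * ?i j)" for j
    proof -
      have "superpose (\<lambda>s. a s - a' j s) b = (\<lambda>t. superpose a b t - superpose (a' j) b t)"
        using superpose_integrable[OF rapid_schwartz[OF a] b] superpose_integrable[OF ra(1) b]
        by (simp add: superpose_def fun_eq_iff left_diff_distrib)
      then have "G (superpose (\<lambda>s. a s - a' j s) b) = G (superpose a b) - G (superpose (a' j) b)"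
        by (simp add: G_diff schwartz_superpose rapid_schwartz a b ra)
      moreover have "cmod (G (superpose (\<lambda>s. a s - a' j s) b)) \<le> K0 * (c * ?i j)"
        by (intro G_bound schwartz_superpose sbound_superpose ra b c)
      ultimately show ?thesis by (simp add: norm_minus_commute)
    qed
    then have "\<forall>\<^sub>F j in sequentially. norm (G (superpose (a' j) b) - G (superpose a b)) \<le> K0 * (c * ?i j)" by simp
    from LIM_zero_cancel[OF Lim_null_comparison[OF this i0]] show ?thesis .
  qed
  ultimately show "G (superpose a b) = (LINT s|lborel. ?h s)"
    using LIMSEQ_unique by blast
qed

text \<open>Both sides are \<open>G\<close> of one function: after reflecting \<open>a\<close> and
  \<phi>, the substitution of -t - s for s turns their superposition, taken in the opposite order,
  into that of \<open>a\<close> and \<phi>.\<close>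

lemma G_convolution_exchange:
  fixes a \<phi> :: "real^'n \<Rightarrow> complex"
  assumes a: "a \<in> schwartz_space" and \<phi>: "\<phi> \<in> schwartz_space"
  shows "(LINT x|lborel. G (\<lambda>t. a (x - t)) * \<phi> x) = (LINT s|lborel. a s * G (\<lambda>t. \<phi> (t + s)))"
proof -
  let ?\<phi> = "\<lambda>s. \<phi> (0 + (- 1) *\<^sub>R s)" and ?a = "\<lambda>t. a (0 + (- 1) *\<^sub>R t)"
  have S: "?\<phi> \<in> schwartz_space" "?a \<in> schwartz_space"
    by (rule schwartz_affine, rule \<phi>, simp, rule schwartz_affine, rule a, simp)
  have [measurable]: "a \<in> borel_measurable borel" "\<phi> \<in> borel_measurable borel"
    using a \<phi> by (auto intro: schwartz_measurable)
  have "superpose ?\<phi> ?a t = superpose a \<phi> t" for t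
  proof -
    have "(LINT s|lborel. \<phi> (- s) * a (- (t + s))) = \<bar>- 1\<bar> ^ DIM(real^'n) *\<^sub>R (LINT s|lborel. \<phi> (- (- t + (- 1) *\<^sub>R s)) * a (- (t + (- t + (- 1) *\<^sub>R s))))"
      by (rule integral_lborel_affine) auto
    then show ?thesis by (simp add: superpose_def mult.commute add.commute)
  qed
  then have "G (superpose ?\<phi> ?a) = G (superpose a \<phi>)" by presburger
  then have "(LINT s|lborel. ?\<phi> s * G (\<lambda>t. ?a (t + s))) = (LINT s|lborel. a s * G (\<lambda>t. \<phi> (t + s)))"
    unfolding G_superpose(2)[OF S] G_superpose(2)[OF a \<phi>] .
  moreover have "(LINT s|lborel. ?\<phi> s * G (\<lambda>t. ?a (t + s))) = \<bar>- 1\<bar> ^ DIM(real^'n) *\<^sub>R (LINT x|lborel. ?\<phi> (0 + (- 1) *\<^sub>R x) * G (\<lambda>t. ?a (t + (0 + (- 1) *\<^sub>R x))))"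
    using borel_measurable_integrable[OF G_superpose(1)[OF S]] by (intro integral_lborel_affine) auto
  ultimately show ?thesis by (simp add: mult.commute)
qed

section \<open>The Gaussian transform\<close>

text \<open>For \<alpha> = 0 this is the Gaussian transform; the other \<alpha> give its complex
  derivatives, as \<open>transform_derivative\<close> shows.\<close>

definition transform :: "('n \<Rightarrow> nat) \<Rightarrow> complex^'n \<Rightarrow> complex" where
  "transform \<alpha> z = G (\<lambda>t. gz \<alpha> z ((- 1) *\<^sub>R t))"

lemma transform_bound:
  "\<exists>C m. 0 \<le> C \<and> (\<forall>z. cmod (transform \<alpha> z) \<le> C * (1 + norm (re_vec z)) ^ L * (1 + norm (im_vec z)) ^ m * exp ((im_vec z \<bullet> im_vec z) / 2))"
proof -
  obtain C m where C: "0 \<le> C" "\<And>z \<sigma>. \<bar>\<sigma>\<bar> = 1 \<Longrightarrow> sbound L (\<lambda>t. gz \<alpha> z (\<sigma> *\<^sub>R t))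
     (C * (1 + norm (re_vec z)) ^ L * (1 + norm (im_vec z)) ^ m * exp ((im_vec z \<bullet> im_vec z) / 2))"
    using gz_sbound[of L \<alpha>] by blast
  have "cmod (transform \<alpha> z) \<le> K0 * (C * (1 + norm (re_vec z)) ^ L * (1 + norm (im_vec z)) ^ m * exp ((im_vec z \<bullet> im_vec z) / 2))" for z
    unfolding transform_def by (intro G_bound schwartz_gz C(2)) auto
  then show ?thesis
    using C(1) K0_nonneg by (intro exI[of _ "K0 * C"] exI[of _ m]) (auto simp: mult_ac)
qed

text \<open>\<open>G\<close> is applied to the Taylor remainder of the Gaussian, whose Schwartz
  bound is quadratic in the increment.\<close>

lemma transform_derivative: "(transform \<alpha> has_derivative gform (\<lambda>k. transform (incr k \<alpha>) z)) (at z)"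
proof -
  obtain K where K: "0 \<le> K" "\<And>w. norm w \<le> 1 \<Longrightarrow> sbound L (gz_remainder \<alpha> z w) (K * (norm w * norm w))"
    using gz_remainder_bound[where N=L and \<alpha>=\<alpha> and z=z] by blast
  show ?thesis
  proof (rule has_derivative_quadratic[where r=1 and K="K0 * K"])
    fix w :: "complex^'n" assume w: "norm w \<le> 1"
    let ?\<rho> = "\<lambda>\<alpha> z t. gz \<alpha> z ((- 1) *\<^sub>R t)"
    have S: "?\<rho> \<alpha> z \<in> schwartz_space" for \<alpha> z by (rule schwartz_gz) simp
    have S1: "(\<lambda>t. ?\<rho> \<alpha> (z + w) t - ?\<rho> \<alpha> z t) \<in> schwartz_space" by (intro schwartz_diff S)
    have S2: "(\<lambda>t. \<Sum>k\<in>UNIV. w $ k * ?\<rho> (incr k \<alpha>) z t) \<in> schwartz_space"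
      by (rule schwartz_sum) (rule finite, rule S)
    let ?R = "\<lambda>t. gz_remainder \<alpha> z w (0 + (- 1) *\<^sub>R t)"
    have R: "?R = (\<lambda>t. (?\<rho> \<alpha> (z + w) t - ?\<rho> \<alpha> z t) - (\<Sum>k\<in>UNIV. w $ k * ?\<rho> (incr k \<alpha>) z t))"
      by (simp add: gz_remainder_def gform_def)
    have RS: "?R \<in> schwartz_space" unfolding R by (rule schwartz_diff[OF S1 S2])
    have "G ?R = transform \<alpha> (z + w) - transform \<alpha> z - gform (\<lambda>k. transform (incr k \<alpha>) z) w"
      unfolding R G_diff[OF S1 S2] G_diff[OF S S] G_sum[OF finite S] transform_def gform_def by (rule refl)
    moreover have "sbound L ?R ((1 + norm (0::real^'n)) ^ L * (K * (norm w * norm w)))"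
      by (rule sbound_affine[OF smooth_gz_remainder K(2)[OF w]]) simp
    then have "cmod (G ?R) \<le> K0 * (K * (norm w * norm w))"
      using G_bound[OF RS] by simp
    ultimately show "norm (transform \<alpha> (z + w) - transform \<alpha> z - gform (\<lambda>k. transform (incr k \<alpha>) z) w) \<le> K0 * K * (norm w * norm w)"
      by (simp add: mult.assoc)
  qed (simp_all add: bounded_linear_gform)
qed

lemma transform_exchange:
  assumes \<phi>: "\<phi> \<in> schwartz_space"
  shows "(LINT x|lborel. transform \<alpha> (complex_vec x \<eta>) * \<phi> x) = (LINT s|lborel. gz \<alpha> (complex_vec 0 \<eta>) s * G (\<lambda>t. \<phi> (t + s)))"
proof -
  have "gz \<alpha> (complex_vec 0 \<eta>) (x - t) = gz \<alpha> (complex_vec x \<eta>) ((- 1) *\<^sub>R t)" for x t :: "real^'n"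
    by (simp add: gz_def complex_vec_add)
  then have "transform \<alpha> (complex_vec x \<eta>) = G (\<lambda>t. gz \<alpha> (complex_vec 0 \<eta>) (x - t))" for x
    by (simp add: transform_def)
  moreover have "gz \<alpha> (complex_vec 0 \<eta>) \<in> schwartz_space"
    using schwartz_gz[of 1 \<alpha> "complex_vec 0 \<eta>"] by simp
  ultimately show ?thesis using G_convolution_exchange[OF _ \<phi>] by presburger
qed

end

section \<open>Boundary values\<close>

lemma weighted_integral:
  fixes g :: "real^'n::finite \<Rightarrow> complex"
  assumes A [measurable]: "A \<in> sets borel" and g [measurable]: "g \<in> borel_measurable borel" and B: "0 \<le> B"
    and b: "\<And>\<xi>. \<xi> \<in> A \<Longrightarrow> cmod (g \<xi>) \<le> B * weight \<xi>"
  shows "integrable lborel (\<lambda>\<xi>. indicator A \<xi> *\<^sub>R g \<xi>)"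
    and "cmod (LINT \<xi>|lborel. indicator A \<xi> *\<^sub>R g \<xi>) \<le> B * (LINT \<xi>|lborel. weight (\<xi>::real^'n))"
proof -
  have le: "cmod (indicator A \<xi> *\<^sub>R g \<xi>) \<le> B * weight \<xi>" for \<xi>
    using b[of \<xi>] B weight_pos[of \<xi>] by (auto simp: indicator_def)
  have iw: "integrable lborel (\<lambda>\<xi>::real^'n. B * weight \<xi>)" by (simp add: integrable_weight)
  show i: "integrable lborel (\<lambda>\<xi>. indicator A \<xi> *\<^sub>R g \<xi>)"
  proof (rule Bochner_Integration.integrable_bound[OF iw])
    show "AE \<xi> in lborel. norm (indicator A \<xi> *\<^sub>R g \<xi>) \<le> norm (B * weight \<xi>)"
      unfolding real_norm_def by (intro AE_I2 order_trans[OF le abs_ge_self])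
  qed measurable
  have "cmod (LINT \<xi>|lborel. indicator A \<xi> *\<^sub>R g \<xi>) \<le> (LINT \<xi>|lborel. B * weight (\<xi>::real^'n))"
    by (rule order_trans[OF integral_norm_bound integral_mono[OF integrable_norm[OF i] iw le]])
  then show "cmod (LINT \<xi>|lborel. indicator A \<xi> *\<^sub>R g \<xi>) \<le> B * (LINT \<xi>|lborel. weight (\<xi>::real^'n))" by simp
qed

lemma exp_beats_power:
  assumes r: "0 < r"
  shows "\<exists>c\<ge>0. \<forall>x::real^'n::finite. (1 + norm x) ^ p * exp (- (r * norm x)) \<le> c"
\<comment> \<open>The constant stays open here and is fixed by the last inequality as (q / r)^q exp
  r with q = p + 1.\<close>
proof (intro exI conjI allI)
  let ?q = "real (Suc p)"
  fix x :: "real^'n"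
  let ?t = "norm x"
  have "r * (1 + ?t) / ?q \<le> exp (r * (1 + ?t) / ?q)"
    using exp_ge_add_one_self[of "r * (1 + ?t) / ?q"] by linarith
  then have "(r * (1 + ?t) / ?q) ^ Suc p \<le> exp (r * (1 + ?t) / ?q) ^ Suc p"
    using r by (intro power_mono) auto
  also have "\<dots> = exp (r * (1 + ?t))"
    by (subst exp_of_nat_mult[symmetric]) simp
  finally have "r ^ Suc p * (1 + ?t) ^ Suc p \<le> ?q ^ Suc p * exp (r * (1 + ?t))"
    by (simp only: power_divide power_mult_distrib pos_divide_le_eq zero_less_power of_nat_0_less_iff zero_less_Suc mult.commute)
  then have "(1 + ?t) ^ Suc p \<le> (?q / r) ^ Suc p * exp (r * (1 + ?t))"
    using r by (simp only: power_divide) (simp add: field_simps)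
  moreover have "(1 + ?t) ^ p \<le> (1 + ?t) ^ Suc p" by (intro power_increasing) auto
  ultimately have "(1 + ?t) ^ p \<le> (?q / r) ^ Suc p * exp (r * (1 + ?t))" by linarith
  then have "(1 + ?t) ^ p * exp (- (r * ?t)) \<le> (?q / r) ^ Suc p * exp (r * (1 + ?t)) * exp (- (r * ?t))"
    by (intro mult_right_mono) auto
  also have "\<dots> = (?q / r) ^ Suc p * (exp (r * (1 + ?t)) * exp (- (r * ?t)))" by (rule mult.assoc)
  also have "exp (r * (1 + ?t)) * exp (- (r * ?t)) = exp r"
    unfolding exp_add[symmetric] by (simp add: distrib_left)
  finally show "(1 + ?t) ^ p * exp (- (r * ?t)) \<le> (?q / r) ^ Suc p * exp r" .
qed (use r in simp)

abbreviation \<alpha>0 :: "'n \<Rightarrow> nat" where "\<alpha>0 \<equiv> \<lambda>_. 0"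

lemma gau_zero: "gau \<alpha>0 z = exp (- (\<Sum>k\<in>UNIV. (z $ k)\<^sup>2) / 2)"
  by (simp add: gau_def gauss_deriv_def exp_sum[symmetric] sum_negf sum_divide_distrib)

text \<open>
  The Gaussian weight in \<open>\<xi>\<close> compensates the growth of the Gaussian at the imaginary point \<open>y - \<xi>\<close>;
  what remains is a Fourier character damped by \<open>exp (- (y \<bullet> \<xi>))\<close>.
\<close>

lemma gaussian_modulation:
  fixes s y \<xi> :: "real^'n::finite"
  shows "complex_of_real (exp (- (\<xi> \<bullet> \<xi>) / 2)) * gz \<alpha>0 (complex_vec 0 (y - \<xi>)) s
    = complex_of_real (exp (- (y \<bullet> \<xi>))) * (cis (s \<bullet> \<xi>) * gz \<alpha>0 (complex_vec 0 y) s)"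
proof -
  have sq: "(Complex a b)\<^sup>2 = complex_of_real (a * a) - complex_of_real (b * b) + 2 * \<i> * complex_of_real (a * b)" for a b
    by (simp add: power2_eq_square complex_eq_iff)
  have g: "gz \<alpha>0 (complex_vec 0 \<eta>) s = exp (- (complex_of_real (s \<bullet> s) - complex_of_real (\<eta> \<bullet> \<eta>) + 2 * \<i> * complex_of_real (s \<bullet> \<eta>)) / 2)" for \<eta> :: "real^'n"
  proof -
    have "(\<Sum>k\<in>UNIV. (complex_vec s \<eta> $ k)\<^sup>2) = complex_of_real (s \<bullet> s) - complex_of_real (\<eta> \<bullet> \<eta>) + 2 * \<i> * complex_of_real (s \<bullet> \<eta>)"
      by (simp add: complex_vec_def sq inner_vec_def sum.distrib sum_subtractf sum_distrib_left)
    then show ?thesis by (simp add: gz_def gau_zero complex_vec_add)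
  qed
  show ?thesis
    unfolding g cis_conv_exp exp_of_real[symmetric] exp_add[symmetric]
    by (rule arg_cong[of _ _ exp])
      (simp add: inner_diff_left inner_diff_right inner_commute[of \<xi> y] field_simps)
qed

lemma sbound_partials:
  fixes \<phi> :: "real^'n::finite \<Rightarrow> complex"
  assumes c: "sbound (K + J) \<phi> c" and js: "length js \<le> J"
  shows "sbound K (partials js \<phi>) c"
  unfolding sbound_def partials_append[symmetric]
  using js by (auto intro!: sboundD'[OF c])

context de_functional
begin

lemma regular_functional: "\<exists>L K0. schwartz_functional (\<lambda>\<phi>. f (regular_distribution \<phi>)) L K0"
proof -
  obtain N1 C1 where C1: "0 \<le> C1" "\<And>\<phi> c. \<phi> \<in> schwartz_space \<Longrightarrow> sbound N1 \<phi> c \<Longrightarrow> nE (regular_distribution \<phi>) \<le> C1 * c"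
    using regular_bound by blast
  \<comment> \<open>The functional looks at \<open>N\<close> derivatives, and each of them is
    measured by the order \<open>N1\<close> of the embedding into \<open>E\<close>.\<close>
  have "schwartz_functional (\<lambda>\<phi>. f (regular_distribution \<phi>)) (N1 + N) (C * C1)"
  proof
    show "f (regular_distribution (\<lambda>x. \<phi> x + \<theta> x)) = f (regular_distribution \<phi>) + f (regular_distribution \<theta>)"
      if "\<phi> \<in> schwartz_space" "\<theta> \<in> schwartz_space" for \<phi> \<theta>
      using regular_distribution_lincomb[OF that, of 1 1] f_add[OF DE_regular[OF that(1)] DE_regular[OF that(2)]] by simp
    show "f (regular_distribution (\<lambda>x. c * \<phi> x)) = c * f (regular_distribution \<phi>)" if "\<phi> \<in> schwartz_space" for \<phi> c
      using regular_distribution_scale[OF that, of c] f_scale[OF DE_regular[OF that], of c] by simp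
    show "0 \<le> C * C1" using C1(1) C_nonneg by simp
    show "cmod (f (regular_distribution \<phi>)) \<le> C * C1 * c" if \<phi>: "\<phi> \<in> schwartz_space" and c: "sbound (N1 + N) \<phi> c" for \<phi> c
    proof -
      have "de_norm nE N (regular_distribution \<phi>) \<le> C1 * c"
      proof (rule de_norm_le)
        fix "is" :: "'n list" assume "length is \<le> N"
        then show "nE (dist_partials is (regular_distribution \<phi>)) \<le> C1 * c"
          unfolding dist_partials_regular[OF \<phi>] by (intro C1(2) schwartz_partials \<phi> sbound_partials[OF c])
      qed
      then show ?thesis
        using f_bound[OF DE_regular[OF \<phi>]] mult_left_mono[OF _ C_nonneg] by (metis order_trans mult.assoc)
    qed
  qed
  then show ?thesis by blast
qed

lemma pairing_add:
  assumes "a \<in> schwartz_space" "u \<in> DE_space E" "v \<in> DE_space E"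
  shows "pairing a (\<lambda>x. u x + v x) \<xi> = pairing a u \<xi> + pairing a v \<xi>"
  using pairing_integrable[OF assms(1,2)] pairing_integrable[OF assms(1,3)]
  by (simp add: pairing_def orbit_add[OF assms(2,3)] distrib_left)

lemma pairing_scale:
  assumes "u \<in> DE_space E"
  shows "pairing a (\<lambda>x. c * u x) \<xi> = c * pairing a u \<xi>"
proof -
  have "pairing a (\<lambda>x. c * u x) \<xi> = (LINT s|lborel. c * (cis (s \<bullet> \<xi>) * (a s * orbit u s)))"
    by (simp add: pairing_def orbit_scale[OF assms] mult_ac)
  then show ?thesis by (simp add: pairing_def)
qed

lemma pairing_diff:
  assumes "a \<in> schwartz_space" "b \<in> schwartz_space" "u \<in> DE_space E"
  shows "pairing (\<lambda>s. a s - b s) u \<xi> = pairing a u \<xi> - pairing b u \<xi>"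
  using pairing_integrable[OF assms(1,3)] pairing_integrable[OF assms(2,3)]
  by (simp add: pairing_def left_diff_distrib right_diff_distrib)

lemma pairing_measurable:
  assumes "a \<in> schwartz_space" "u \<in> DE_space E"
  shows "pairing a u \<in> borel_measurable borel"
proof -
  have [measurable]: "a \<in> borel_measurable borel" "orbit u \<in> borel_measurable borel"
    using assms by (auto intro: schwartz_measurable orbit_measurable)
  show ?thesis unfolding pairing_def[abs_def] by measurable
qed

lemma pairing_inversion:
  assumes a: "a \<in> schwartz_space" and u: "u \<in> DE_space E"
  shows "(LINT \<xi>|lborel. pairing a u \<xi>) = complex_of_real ((2 * pi) ^ CARD('n)) * (a 0 * f u)"
proof -
  obtain c where c: "sbound (\<kappa> + 4 * CARD('n)) a c" using schwartz_sbound[OF a] by blast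
  have c1: "sbound (\<kappa> + 2 * CARD('n)) a c" by (rule sbound_mono[OF c]) auto
  obtain K where K: "0 \<le> K" "\<And>\<xi>. cmod (pairing a u \<xi>) \<le> K * c * de_norm nE (N + 2 * CARD('n)) u * weight \<xi>"
    using pairing_decay a u c by blast
  let ?D = "c * (C * M * de_norm nE N u)"
  have D0: "0 \<le> ?D" using sbound_nonneg[OF c] C_nonneg M_pos de_norm_nonneg[OF u, of N] by simp
  have "(LINT \<xi>|lborel. LINT s|lborel. cis (s \<bullet> \<xi>) * (a s * orbit u s)) = complex_of_real ((2 * pi) ^ CARD('n)) * (a 0 * orbit u 0)"
  proof (rule fourier_inversion_at_0)
    show "continuous_on UNIV (\<lambda>s. a s * orbit u s)"
      by (intro continuous_on_mult schwartz_continuous_on a orbit_continuous u)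
    show "cmod (a s * orbit u s) \<le> ?D" for s
    proof -
      have "weight s \<le> 1" unfolding weight_def by (intro inverse_le_1_iff[THEN iffD2] disjI2 one_le_power) simp
      then have "?D * weight s \<le> ?D" using D0 by (intro mult_left_le) auto
      with schwartz_orbit_bound[OF c1 u, of s] show ?thesis by linarith
    qed
    show "integrable lborel (\<lambda>s. a s * orbit u s)" by (rule schwartz_orbit_integrable[OF a u])
    have "integrable lborel (pairing a u)"
    proof (rule Bochner_Integration.integrable_bound)
      show "integrable lborel (\<lambda>\<xi>::real^'n. K * c * de_norm nE (N + 2 * CARD('n)) u * weight \<xi>)" by (simp add: integrable_weight)
      show "pairing a u \<in> borel_measurable lborel" using pairing_measurable[OF a u] by simp
    qed (auto intro: order_trans[OF K(2) abs_ge_self])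
    then show "integrable lborel (\<lambda>\<xi>. LINT s|lborel. cis (s \<bullet> \<xi>) * (a s * orbit u s))"
      by (simp add: pairing_def[abs_def])
  qed
  then show ?thesis by (simp add: pairing_def orbit_def)
qed

end

section \<open>Boundary functionals and their strong limits\<close>

locale boundary_setup = de_functional E nE f M C \<kappa> N + sf: schwartz_functional "\<lambda>\<phi>. f (regular_distribution \<phi>)" L K0
  for E :: "((real^'n::finite \<Rightarrow> complex) \<Rightarrow> complex) set" and nE f M C \<kappa> N L K0
begin

definition window :: "real^'n \<Rightarrow> real^'n \<Rightarrow> complex" where
  "window y = gz \<alpha>0 (complex_vec 0 y)"

lemma window_schwartz: "window y \<in> schwartz_space"
  using schwartz_gz[of 1 \<alpha>0 "complex_vec 0 y"] by (simp add: window_def)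

definition inversion_const :: complex where "inversion_const = complex_of_real (1 / (2 * pi) ^ CARD('n))"

text \<open>The functional to be matched with F_j(. + iy). It acts on every distribution in
  \<open>DE_space E\<close>, including those that are not given by a Schwartz function, and it makes
  sense at y = 0, so the boundary value belongs to the same family.\<close>

definition boundary_functional :: "(real^'n) set \<Rightarrow> real^'n \<Rightarrow> ((real^'n \<Rightarrow> complex) \<Rightarrow> complex) \<Rightarrow> complex" where
  "boundary_functional A y u = (if u \<in> DE_space E then
     inversion_const * (LINT \<xi>|lborel. indicator A \<xi> *\<^sub>R (complex_of_real (exp (- (y \<bullet> \<xi>))) * pairing (window y) u \<xi>)) else 0)"

text \<open>The integrand of F_j; the other \<alpha> serve its derivatives in z.\<close>

definition kernel :: "('n \<Rightarrow> nat) \<Rightarrow> complex^'n \<Rightarrow> real^'n \<Rightarrow> complex" where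
  "kernel \<alpha> z \<xi> = complex_of_real (exp (- (\<xi> \<bullet> \<xi>) / 2)) * sf.transform \<alpha> (z + complex_vec 0 (- \<xi>))"

definition cone_part :: "(real^'n) set \<Rightarrow> complex^'n \<Rightarrow> complex" where
  "cone_part A z = inversion_const * (LINT \<xi>|lborel. indicator A \<xi> *\<^sub>R kernel \<alpha>0 z \<xi>)"

text \<open>On \<open>A\<close> the damping factor is at most 1, so the decay of the pairing bounds
  the integral, up to and including y = 0.\<close>

lemma boundary_functional_integrand:
  assumes A: "A \<in> sets borel" and y: "\<And>\<xi>. \<xi> \<in> A \<Longrightarrow> 0 \<le> y \<bullet> \<xi>"
  shows "\<exists>B\<ge>0. \<forall>u\<in>DE_space E.
     integrable lborel (\<lambda>\<xi>. indicator A \<xi> *\<^sub>R (complex_of_real (exp (- (y \<bullet> \<xi>))) * pairing (window y) u \<xi>)) \<and>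
     cmod (LINT \<xi>|lborel. indicator A \<xi> *\<^sub>R (complex_of_real (exp (- (y \<bullet> \<xi>))) * pairing (window y) u \<xi>)) \<le> B * de_norm nE (N + 2 * CARD('n)) u"
proof -
  let ?N = "N + 2 * CARD('n)"
  obtain c where c: "sbound (\<kappa> + 4 * CARD('n)) (window y) c" using schwartz_sbound[OF window_schwartz] by blast
  obtain K where K: "0 \<le> K" "\<And>u \<xi>. u \<in> DE_space E \<Longrightarrow> cmod (pairing (window y) u \<xi>) \<le> K * c * de_norm nE ?N u * weight \<xi>"
    using pairing_decay window_schwartz c by blast
  have c0: "0 \<le> c" by (rule sbound_nonneg[OF c])
  let ?W = "LINT \<xi>|lborel. weight (\<xi>::real^'n)"
  have W: "0 \<le> ?W" by (intro integral_nonneg_AE AE_I2 less_imp_le weight_pos)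
  show ?thesis
  proof (intro exI[of _ "K * c * ?W"] conjI ballI)
    show "0 \<le> K * c * ?W" using K(1) c0 W by simp
    fix u assume u: "u \<in> DE_space E"
    have [measurable]: "pairing (window y) u \<in> borel_measurable borel" by (rule pairing_measurable[OF window_schwartz u])
    have m: "(\<lambda>\<xi>. complex_of_real (exp (- (y \<bullet> \<xi>))) * pairing (window y) u \<xi>) \<in> borel_measurable borel" by measurable
    have B: "0 \<le> K * c * de_norm nE ?N u" using K(1) c0 de_norm_nonneg[OF u] by simp
    have b: "cmod (complex_of_real (exp (- (y \<bullet> \<xi>))) * pairing (window y) u \<xi>) \<le> K * c * de_norm nE ?N u * weight \<xi>" if "\<xi> \<in> A" for \<xi>
    proof -
      have "cmod (complex_of_real (exp (- (y \<bullet> \<xi>))) * pairing (window y) u \<xi>) \<le> 1 * cmod (pairing (window y) u \<xi>)"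
        unfolding norm_mult using y[OF that] by (intro mult_right_mono) auto
      with K(2)[OF u, of \<xi>] show ?thesis by simp
    qed
    show "integrable lborel (\<lambda>\<xi>. indicator A \<xi> *\<^sub>R (complex_of_real (exp (- (y \<bullet> \<xi>))) * pairing (window y) u \<xi>))"
      by (rule weighted_integral(1)[OF A m B b])
    show "cmod (LINT \<xi>|lborel. indicator A \<xi> *\<^sub>R (complex_of_real (exp (- (y \<bullet> \<xi>))) * pairing (window y) u \<xi>)) \<le> K * c * ?W * de_norm nE ?N u"
      using weighted_integral(2)[OF A m B b] by (simp add: mult_ac)
  qed
qed

lemma boundary_functional_in_dual:
  assumes A: "A \<in> sets borel" and y: "\<And>\<xi>. \<xi> \<in> A \<Longrightarrow> 0 \<le> y \<bullet> \<xi>"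
  shows "boundary_functional A y \<in> DE_dual E nE"
  unfolding DE_dual_def
proof -
  let ?N = "N + 2 * CARD('n)"
  let ?g = "\<lambda>u \<xi>. indicator A \<xi> *\<^sub>R (complex_of_real (exp (- (y \<bullet> \<xi>))) * pairing (window y) u \<xi>)"
  obtain B where B: "0 \<le> B" "\<And>u. u \<in> DE_space E \<Longrightarrow> integrable lborel (?g u)"
     "\<And>u. u \<in> DE_space E \<Longrightarrow> cmod (LINT \<xi>|lborel. ?g u \<xi>) \<le> B * de_norm nE ?N u"
    using boundary_functional_integrand[OF A y] by blast
  show "boundary_functional A y \<in> continuous_dual (DE_space E) (DE_seminorms nE)"
  proof (rule continuous_dualI[OF DE_subspace, where p="de_norm nE ?N" and C="cmod inversion_const * B"])
    show "de_norm nE ?N \<in> DE_seminorms nE" by (simp add: DE_seminorms_eq)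
    show "cmod (boundary_functional A y u) \<le> cmod inversion_const * B * de_norm nE ?N u" if "u \<in> DE_space E" for u
      using mult_left_mono[OF B(3)[OF that], of "cmod inversion_const"] that by (simp add: boundary_functional_def norm_mult mult.assoc)
    show "boundary_functional A y (\<lambda>x. u x + v x) = boundary_functional A y u + boundary_functional A y v" if uv: "u \<in> DE_space E" "v \<in> DE_space E" for u v
    proof -
      have "?g (\<lambda>x. u x + v x) = (\<lambda>\<xi>. ?g u \<xi> + ?g v \<xi>)"
        by (simp add: pairing_add[OF window_schwartz uv] distrib_left scaleR_add_right)
      then show ?thesis
        using B(2)[OF uv(1)] B(2)[OF uv(2)] uv by (simp add: boundary_functional_def subspace_add[OF DE_subspace] distrib_left)
    qed
    show "boundary_functional A y (\<lambda>x. c * u x) = c * boundary_functional A y u" if u: "u \<in> DE_space E" for c u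
    proof -
      have "?g (\<lambda>x. c * u x) = (\<lambda>\<xi>. c * ?g u \<xi>)"
        by (simp add: pairing_scale[OF u] scaleR_conv_of_real mult_ac)
      then have "(LINT \<xi>|lborel. ?g (\<lambda>x. c * u x) \<xi>) = c * (LINT \<xi>|lborel. ?g u \<xi>)"
        by (simp only: integral_mult_right_zero)
      then show ?thesis using u by (simp add: boundary_functional_def subspace_scale[OF DE_subspace])
    qed
  qed (simp_all add: boundary_functional_def de_norm_nonneg)
qed

text \<open>The error has two sources: the window changes by O(|y|), and the damping factor moves
  away from 1. Both are bounded by one seminorm of u, which is the form asked for by
  \<open>limitin_strong_dual\<close>.\<close>

lemma boundary_functional_limit:
  assumes A [measurable]: "A \<in> sets borel" and y: "\<And>y \<xi>. y \<in> S \<Longrightarrow> \<xi> \<in> A \<Longrightarrow> 0 \<le> y \<bullet> \<xi>"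
  shows "limitin (DE_dual_topology E nE) (boundary_functional A) (boundary_functional A 0) (at 0 within S)"
  unfolding DE_dual_topology_def
proof -
  let ?N = "N + 2 * CARD('n)"
  let ?W = "LINT \<xi>|lborel. weight (\<xi>::real^'n)"
  obtain c where c: "sbound (\<kappa> + 4 * CARD('n)) (window 0) c" using schwartz_sbound[OF window_schwartz] by blast
  obtain Q where Q: "0 \<le> Q" "\<And>y. norm y \<le> 1 \<Longrightarrow> sbound (\<kappa> + 4 * CARD('n)) (\<lambda>t. window y t - window 0 t) (Q * norm y)"
    using gz_imaginary_shift_bound[where N="\<kappa> + 4 * CARD('n)" and \<alpha>="\<alpha>0 :: 'n \<Rightarrow> nat"] by (auto simp: window_def)
  obtain K where K: "0 \<le> K" "\<And>a c u \<xi>. a \<in> schwartz_space \<Longrightarrow> u \<in> DE_space E \<Longrightarrow> sbound (\<kappa> + 4 * CARD('n)) a c \<Longrightarrow>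
     cmod (pairing a u \<xi>) \<le> K * c * de_norm nE ?N u * weight \<xi>"
    using pairing_decay by blast
  have c0: "0 \<le> c" by (rule sbound_nonneg[OF c])
  \<comment> \<open>For the damping error dominated convergence gives a limit without a rate;
    keeping \<open>u\<close> out of \<open>J\<close> is what makes it uniform in
    \<open>u\<close>.\<close>
  define J where "J y = (LINT \<xi>|lborel. indicator A \<xi> *\<^sub>R (\<bar>exp (- (y \<bullet> \<xi>)) - 1\<bar> * weight \<xi>))" for y
  define e where "e y = cmod inversion_const * (K * Q * norm y * ?W + K * c * J y)" for y
  have ex1: "\<bar>exp (- (y \<bullet> \<xi>)) - 1\<bar> \<le> 1" if "y \<in> insert 0 S" "\<xi> \<in> A" for y \<xi>
    using y[OF _ that(2), of y] that(1) by (auto simp: abs_if)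
  have hw: "norm (indicator A \<xi> *\<^sub>R (\<bar>exp (- (y \<bullet> \<xi>)) - 1\<bar> * weight \<xi>)) \<le> weight \<xi>" if "y \<in> insert 0 S" for y \<xi>
    using mult_right_mono[OF ex1[OF that, of \<xi>] less_imp_le[OF weight_pos[of \<xi>]]] weight_pos[of \<xi>]
    by (cases "\<xi> \<in> A") (simp_all add: abs_mult)
  have iJ: "integrable lborel (\<lambda>\<xi>. indicator A \<xi> *\<^sub>R (\<bar>exp (- (y \<bullet> \<xi>)) - 1\<bar> * weight \<xi>))" if "y \<in> insert 0 S" for y
  proof (rule Bochner_Integration.integrable_bound[OF integrable_weight])
    show "AE \<xi> in lborel. norm (indicator A \<xi> *\<^sub>R (\<bar>exp (- (y \<bullet> \<xi>)) - 1\<bar> * weight \<xi>)) \<le> norm (weight \<xi>)"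
      unfolding real_norm_def[of "weight _"] by (intro AE_I2 order_trans[OF hw[OF that] abs_ge_self])
  qed measurable
  have J0: "(J \<longlongrightarrow> 0) (at 0 within S)"
    unfolding tendsto_at_iff_sequentially
  proof (intro allI impI)
    fix Y assume Y: "\<forall>i. Y i \<in> S - {0}" "Y \<longlonglongrightarrow> 0"
    have "(\<lambda>i. J (Y i)) \<longlonglongrightarrow> integral\<^sup>L lborel (\<lambda>\<xi>::real^'n. 0::real)"
      unfolding J_def
    proof (rule integral_dominated_convergence[where w=weight])
      show "AE \<xi> in lborel. (\<lambda>i. indicator A \<xi> *\<^sub>R (\<bar>exp (- (Y i \<bullet> \<xi>)) - 1\<bar> * weight \<xi>)) \<longlonglongrightarrow> 0"
      proof (rule AE_I2)
        fix \<xi>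
        have "(\<lambda>i. indicator A \<xi> *\<^sub>R (\<bar>exp (- (Y i \<bullet> \<xi>)) - 1\<bar> * weight \<xi>)) \<longlonglongrightarrow> indicator A \<xi> *\<^sub>R (\<bar>exp (- (0 \<bullet> \<xi>)) - 1\<bar> * weight \<xi>)"
          by (intro tendsto_intros Y(2))
        then show "(\<lambda>i. indicator A \<xi> *\<^sub>R (\<bar>exp (- (Y i \<bullet> \<xi>)) - 1\<bar> * weight \<xi>)) \<longlonglongrightarrow> 0" by simp
      qed
      show "AE \<xi> in lborel. norm (indicator A \<xi> *\<^sub>R (\<bar>exp (- (Y i \<bullet> \<xi>)) - 1\<bar> * weight \<xi>)) \<le> weight \<xi>" for i
        using Y(1) by (intro AE_I2 hw) auto
    qed (auto intro: integrable_weight)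
    then show "(J \<circ> Y) \<longlonglongrightarrow> 0" by (simp add: o_def)
  qed
  have e0: "(e \<longlongrightarrow> 0) (at 0 within S)"
  proof -
    have "((\<lambda>y. norm y) \<longlongrightarrow> norm (0::real^'n)) (at 0 within S)"
      by (intro tendsto_norm tendsto_ident_at)
    then have "((\<lambda>y. cmod inversion_const * (K * Q * norm y * ?W + K * c * J y)) \<longlongrightarrow> cmod inversion_const * (K * Q * norm (0::real^'n) * ?W + K * c * 0)) (at 0 within S)"
      by (intro tendsto_intros J0)
    then show ?thesis by (simp add: e_def[abs_def])
  qed
  have est: "cmod (boundary_functional A y u - boundary_functional A 0 u) \<le> e y * de_norm nE ?N u" if yS: "y \<in> S" and y1: "norm y \<le> 1" and u: "u \<in> DE_space E" for y u
  proof -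
    let ?q = "de_norm nE ?N u"
    let ?g = "\<lambda>y \<xi>. indicator A \<xi> *\<^sub>R (complex_of_real (exp (- (y \<bullet> \<xi>))) * pairing (window y) u \<xi>)"
    let ?b = "\<lambda>\<xi>. K * (Q * norm y) * ?q * weight \<xi> + K * c * ?q * (indicator A \<xi> *\<^sub>R (\<bar>exp (- (y \<bullet> \<xi>)) - 1\<bar> * weight \<xi>))"
    have q0: "0 \<le> ?q" by (rule de_norm_nonneg[OF u])
    have ig: "integrable lborel (?g y)" "integrable lborel (?g 0)"
      using boundary_functional_integrand[OF A y[OF yS]] boundary_functional_integrand[OF A, of 0] u by auto
    have ib: "integrable lborel ?b"
      using iJ[of y] yS integrable_weight by (intro Bochner_Integration.integrable_add integrable_mult_right) auto
    have "cmod (?g y \<xi> - ?g 0 \<xi>) \<le> ?b \<xi>" for \<xi>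
    proof (cases "\<xi> \<in> A")
      case False
      then show ?thesis using K(1) Q(1) q0 weight_pos[of \<xi>] by simp
    next
      case True
      let ?x = "exp (- (y \<bullet> \<xi>))"
      have "?g y \<xi> - ?g 0 \<xi> = complex_of_real ?x * pairing (\<lambda>t. window y t - window 0 t) u \<xi> + complex_of_real (?x - 1) * pairing (window 0) u \<xi>"
        using True by (simp add: pairing_diff[OF window_schwartz window_schwartz u] algebra_simps)
      also have "cmod \<dots> \<le> ?x * cmod (pairing (\<lambda>t. window y t - window 0 t) u \<xi>) + \<bar>?x - 1\<bar> * cmod (pairing (window 0) u \<xi>)"
        by (rule order_trans[OF norm_triangle_ineq]) (simp only: norm_mult norm_of_real abs_exp_cancel order_refl)
      also have "\<dots> \<le> 1 * (K * (Q * norm y) * ?q * weight \<xi>) + \<bar>?x - 1\<bar> * (K * c * ?q * weight \<xi>)"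
      proof (intro add_mono mult_mono mult_left_mono)
        show "?x \<le> 1" using y[OF yS True] by simp
        show "cmod (pairing (\<lambda>t. window y t - window 0 t) u \<xi>) \<le> K * (Q * norm y) * ?q * weight \<xi>"
          by (intro K(2) schwartz_diff window_schwartz u Q(2) y1)
        show "cmod (pairing (window 0) u \<xi>) \<le> K * c * ?q * weight \<xi>"
          by (intro K(2) window_schwartz u c)
      qed auto
      also have "\<dots> = ?b \<xi>" using True by simp
      finally show ?thesis .
    qed
    then have "cmod (LINT \<xi>|lborel. ?g y \<xi> - ?g 0 \<xi>) \<le> (LINT \<xi>|lborel. ?b \<xi>)"
      using ig ib by (intro order_trans[OF integral_norm_bound integral_mono]) (auto intro: integrable_norm)
    also have "\<dots> = K * (Q * norm y) * ?q * ?W + K * c * ?q * J y"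
    proof -
      have i1: "integrable lborel (\<lambda>\<xi>::real^'n. K * (Q * norm y) * ?q * weight \<xi>)"
        by (rule integrable_mult_right[OF integrable_weight])
      have i2: "integrable lborel (\<lambda>\<xi>. K * c * ?q * (indicator A \<xi> *\<^sub>R (\<bar>exp (- (y \<bullet> \<xi>)) - 1\<bar> * weight \<xi>)))"
        by (rule integrable_mult_right[OF iJ]) (use yS in simp)
      show ?thesis
        unfolding J_def Bochner_Integration.integral_add[OF i1 i2] integral_mult_right_zero by (rule refl)
    qed
    also have "\<dots> = (K * Q * norm y * ?W + K * c * J y) * ?q"
      by (simp only: distrib_left distrib_right mult_ac)
    finally have "cmod inversion_const * cmod (LINT \<xi>|lborel. ?g y \<xi> - ?g 0 \<xi>) \<le> cmod inversion_const * ((K * Q * norm y * ?W + K * c * J y) * ?q)"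
      by (intro mult_left_mono) auto
    moreover have "boundary_functional A y u - boundary_functional A 0 u = inversion_const * (LINT \<xi>|lborel. ?g y \<xi> - ?g 0 \<xi>)"
      using u ig by (simp only: boundary_functional_def if_True Bochner_Integration.integral_diff right_diff_distrib)
    ultimately show ?thesis by (simp add: e_def norm_mult mult.assoc)
  qed
  have ev: "\<forall>\<^sub>F y in at 0 within S. y \<in> S \<and> norm y \<le> 1"
    unfolding eventually_at by (intro exI[of _ 1]) auto
  show "limitin (strong_dual_topology (DE_space E) (DE_seminorms nE)) (boundary_functional A) (boundary_functional A 0) (at 0 within S)"
  proof (rule limitin_strong_dual[where p="de_norm nE ?N" and e=e])
    show "boundary_functional A 0 \<in> continuous_dual (DE_space E) (DE_seminorms nE)"
      using boundary_functional_in_dual[OF A, of 0] by (simp add: DE_dual_def)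
    show "\<forall>\<^sub>F y in at 0 within S. boundary_functional A y \<in> continuous_dual (DE_space E) (DE_seminorms nE)"
      using ev by eventually_elim (use boundary_functional_in_dual[OF A y] in \<open>auto simp: DE_dual_def\<close>)
    show "de_norm nE ?N \<in> DE_seminorms nE" by (simp add: DE_seminorms_eq)
    show "\<forall>\<^sub>F y in at 0 within S. \<forall>u\<in>DE_space E. cmod (boundary_functional A y u - boundary_functional A 0 u) \<le> e y * de_norm nE ?N u"
      using ev by eventually_elim (use est in auto)
  qed (auto intro: e0 de_norm_nonneg)
qed

end

lemma continuous_on_complex_vec:
  assumes "continuous_on S g" "continuous_on S h"
  shows "continuous_on S (\<lambda>x. complex_vec (g x) (h x))"
  unfolding complex_vec_def Complex_eq
  by (intro continuous_intros assms)

section \<open>The holomorphic functions in the tubes\<close>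

context boundary_setup
begin

text \<open>An interior point leaves room for exponential damping in \<xi>, uniformly for imaginary
  parts near y, and this beats the powers from the Gaussian transform. A single \<rho> serves all
  \<alpha>, so that all derivatives are dominated on one neighbourhood.\<close>

lemma kernel_decay:
  assumes S: "open S" "y \<in> S" and A: "\<And>y \<xi>. y \<in> S \<Longrightarrow> \<xi> \<in> A \<Longrightarrow> 0 \<le> y \<bullet> \<xi>"
  shows "\<exists>\<rho>>0. \<rho> \<le> 1 \<and> (\<forall>\<alpha>. \<exists>c\<ge>0. \<forall>\<xi>\<in>A. \<forall>z. norm (im_vec z - y) \<le> \<rho> \<longrightarrow>
    cmod (kernel \<alpha> z \<xi>) \<le> c * (1 + norm (re_vec z)) ^ L * weight \<xi>)"
proof -
  obtain e where e: "0 < e" "cball y e \<subseteq> S" using S open_contains_cball by blast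
  define \<rho> where "\<rho> = min 1 (e / 2)"
  have \<rho>: "0 < \<rho>" "\<rho> \<le> 1" "2 * \<rho> \<le> e" using e(1) by (auto simp: \<rho>_def)
  \<comment> \<open>Moving \<open>y'\<close> by \<rho> against the direction of \<xi> stays in
    \<open>S\<close>, because 2 \<rho> \<le> e; nonnegativity at the moved point says exactly that
    \<open>y'\<close> pairs with \<xi> to at least \<rho> |\<xi>|.\<close>
  have dot: "\<rho> * norm \<xi> \<le> y' \<bullet> \<xi>" if y': "norm (y' - y) \<le> \<rho>" and \<xi>: "\<xi> \<in> A" for y' \<xi>
  proof (cases "\<xi> = 0")
    case False
    let ?v = "(\<rho> / norm \<xi>) *\<^sub>R \<xi>"
    have nv: "norm ?v = \<rho>" using False \<rho>(1) by simp
    have "norm (y' - ?v - y) \<le> norm (y' - y) + norm ?v"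
      using norm_triangle_ineq4[of "y' - y" ?v] by (simp add: algebra_simps)
    then have "norm (y' - ?v - y) \<le> e" using y' nv \<rho>(3) by linarith
    then have "y' - ?v \<in> S" using e(2) by (auto simp: dist_norm norm_minus_commute)
    then have "0 \<le> (y' - ?v) \<bullet> \<xi>" using \<xi> by (rule A)
    also have "(y' - ?v) \<bullet> \<xi> = y' \<bullet> \<xi> - \<rho> * norm \<xi>"
      using False by (simp add: inner_diff_left power2_norm_eq_inner[symmetric] power2_eq_square)
    finally show ?thesis by simp
  qed simp
  have "\<exists>c\<ge>0. \<forall>\<xi>\<in>A. \<forall>z. norm (im_vec z - y) \<le> \<rho> \<longrightarrow> cmod (kernel \<alpha> z \<xi>) \<le> c * (1 + norm (re_vec z)) ^ L * weight \<xi>" for \<alpha>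
  proof -
    obtain B m where B: "0 \<le> B" "\<And>z. cmod (sf.transform \<alpha> z) \<le> B * (1 + norm (re_vec z)) ^ L * (1 + norm (im_vec z)) ^ m * exp ((im_vec z \<bullet> im_vec z) / 2)"
      using sf.transform_bound[of \<alpha>] by blast
    obtain c1 where c1: "0 \<le> c1" "\<And>\<xi>::real^'n. (1 + norm \<xi>) ^ (m + 2 * CARD('n)) * exp (- (\<rho> * norm \<xi>)) \<le> c1"
      using exp_beats_power[OF \<rho>(1), where p="m + 2 * CARD('n)"] by blast
    define R where "R = norm y + 1"
    let ?c = "B * (1 + R) ^ m * exp (R * R / 2) * c1"
    have "cmod (kernel \<alpha> z \<xi>) \<le> ?c * (1 + norm (re_vec z)) ^ L * weight \<xi>"
      if \<xi>: "\<xi> \<in> A" and z: "norm (im_vec z - y) \<le> \<rho>" for \<xi> z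
    proof -
      let ?y = "im_vec z" and ?x = "re_vec z" and ?z = "z + complex_vec 0 (- \<xi>)"
      have yR: "norm ?y \<le> R" using norm_triangle_ineq[of "?y - y" y] z \<rho>(2) by (simp add: R_def)
      have re: "re_vec ?z = ?x" and im: "im_vec ?z = ?y - \<xi>" by simp_all
      have "1 + norm (?y - \<xi>) \<le> (1 + norm ?y) * (1 + norm \<xi>)"
        using one_plus_norm_add[of ?y "- \<xi>"] by simp
      also have "\<dots> \<le> (1 + R) * (1 + norm \<xi>)" using yR by (intro mult_right_mono) auto
      finally have p: "(1 + norm (?y - \<xi>)) ^ m \<le> (1 + R) ^ m * (1 + norm \<xi>) ^ m"
        by (metis power_mono power_mult_distrib add_nonneg_nonneg norm_ge_zero zero_le_one)
      have "?y \<bullet> ?y = norm ?y * norm ?y" by (simp add: power2_norm_eq_inner[symmetric] power2_eq_square)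
      also have "\<dots> \<le> R * R" using yR by (intro mult_mono) (auto simp: R_def)
      finally have yy: "?y \<bullet> ?y \<le> R * R" .
      have "exp (- (\<xi> \<bullet> \<xi>) / 2) * exp (((?y - \<xi>) \<bullet> (?y - \<xi>)) / 2) = exp ((?y \<bullet> ?y) / 2 - ?y \<bullet> \<xi>)"
        unfolding exp_add[symmetric] by (simp add: inner_diff_left inner_diff_right inner_commute[of \<xi> ?y] field_simps)
      also have "\<dots> \<le> exp (R * R / 2 - \<rho> * norm \<xi>)" using yy dot[OF z \<xi>] by simp
      also have "\<dots> = exp (R * R / 2) * exp (- (\<rho> * norm \<xi>))" by (simp add: exp_add[symmetric])
      finally have ex: "exp (- (\<xi> \<bullet> \<xi>) / 2) * exp (((?y - \<xi>) \<bullet> (?y - \<xi>)) / 2) \<le> exp (R * R / 2) * exp (- (\<rho> * norm \<xi>))" .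
      have w: "(1 + norm \<xi>) ^ m * exp (- (\<rho> * norm \<xi>)) \<le> c1 * weight \<xi>"
        by (rule weight_power[OF c1(2)])
      have "cmod (kernel \<alpha> z \<xi>) = exp (- (\<xi> \<bullet> \<xi>) / 2) * cmod (sf.transform \<alpha> ?z)"
        by (simp add: kernel_def norm_mult)
      also have "\<dots> \<le> exp (- (\<xi> \<bullet> \<xi>) / 2) * (B * (1 + norm ?x) ^ L * (1 + norm (?y - \<xi>)) ^ m * exp (((?y - \<xi>) \<bullet> (?y - \<xi>)) / 2))"
        using B(2)[of ?z] unfolding re im by (intro mult_left_mono) auto
      also have "\<dots> = B * (1 + norm ?x) ^ L * ((1 + norm (?y - \<xi>)) ^ m * (exp (- (\<xi> \<bullet> \<xi>) / 2) * exp (((?y - \<xi>) \<bullet> (?y - \<xi>)) / 2)))"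
        by (simp only: mult_ac)
      also have "\<dots> \<le> B * (1 + norm ?x) ^ L * (((1 + R) ^ m * (1 + norm \<xi>) ^ m) * (exp (R * R / 2) * exp (- (\<rho> * norm \<xi>))))"
        by (intro mult_left_mono mult_mono[OF p ex]) (use B(1) in \<open>auto simp: R_def\<close>)
      also have "\<dots> = B * (1 + norm ?x) ^ L * ((1 + R) ^ m * exp (R * R / 2)) * ((1 + norm \<xi>) ^ m * exp (- (\<rho> * norm \<xi>)))"
        by (simp only: mult_ac)
      also have "\<dots> \<le> B * (1 + norm ?x) ^ L * ((1 + R) ^ m * exp (R * R / 2)) * (c1 * weight \<xi>)"
        using w B(1) by (intro mult_left_mono) (auto simp: R_def)
      finally show ?thesis by (simp only: mult_ac)
    qed
    moreover have "0 \<le> ?c" using B(1) c1(1) by (simp add: R_def)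
    ultimately show ?thesis by blast
  qed
  with \<rho> show ?thesis by blast
qed

lemma continuous_on_transform: "continuous_on S g \<Longrightarrow> continuous_on S (\<lambda>x. sf.transform \<alpha> (g x))"
  by (rule continuous_on_compose2[of UNIV "sf.transform \<alpha>"])
    (auto intro!: continuous_at_imp_continuous_on has_derivative_continuous[OF sf.transform_derivative])

lemma kernel_measurable: "kernel \<alpha> z \<in> borel_measurable borel"
  unfolding kernel_def[abs_def]
  by (intro borel_measurable_continuous_onI continuous_intros continuous_on_transform continuous_on_complex_vec)
    simp_all

lemma kernel_measurable_pair:
  "(\<lambda>(\<xi>, x). kernel \<alpha> (complex_vec x y) \<xi>) \<in> borel_measurable (lborel \<Otimes>\<^sub>M lborel)"
proof -
  have "continuous_on UNIV (\<lambda>p. kernel \<alpha> (complex_vec (snd p) y) (fst p))"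
    unfolding kernel_def
    by (intro continuous_intros continuous_on_transform continuous_on_complex_vec) simp_all
  then have "(\<lambda>p. kernel \<alpha> (complex_vec (snd p) y) (fst p)) \<in> borel_measurable (borel \<Otimes>\<^sub>M borel)"
    unfolding borel_prod by (rule borel_measurable_continuous_onI)
  then show ?thesis
    by (simp add: case_prod_beta measurable_cong_sets[OF sets_pair_measure_cong[OF sets_lborel sets_lborel] refl])
qed

text \<open>Here function and functional meet: \<open>transform_exchange\<close> moves the integral
  against \<phi> onto the orbit, and \<open>gaussian_modulation\<close> rewrites the shifted
  Gaussian as damping, character and window.\<close>

lemma kernel_pairing:
  assumes \<phi>: "\<phi> \<in> schwartz_space"
  shows "(LINT x|lborel. kernel \<alpha>0 (complex_vec x y) \<xi> * \<phi> x)
    = complex_of_real (exp (- (y \<bullet> \<xi>))) * pairing (window y) (regular_distribution \<phi>) \<xi>"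
proof -
  let ?c = "complex_of_real (exp (- (\<xi> \<bullet> \<xi>) / 2))"
  have "(LINT x|lborel. kernel \<alpha>0 (complex_vec x y) \<xi> * \<phi> x) = (LINT x|lborel. ?c * (sf.transform \<alpha>0 (complex_vec x (y - \<xi>)) * \<phi> x))"
    by (simp add: kernel_def complex_vec_add mult.assoc)
  also have "\<dots> = ?c * (LINT s|lborel. gz \<alpha>0 (complex_vec 0 (y - \<xi>)) s * f (regular_distribution (\<lambda>t. \<phi> (t + s))))"
    by (simp add: sf.transform_exchange[OF \<phi>])
  also have "\<dots> = (LINT s|lborel. ?c * gz \<alpha>0 (complex_vec 0 (y - \<xi>)) s * orbit (regular_distribution \<phi>) s)"
    by (simp add: orbit_def dist_translate_regular[OF \<phi>] mult.assoc)
  also have "\<dots> = (LINT s|lborel. complex_of_real (exp (- (y \<bullet> \<xi>))) * (cis (s \<bullet> \<xi>) * (window y s * orbit (regular_distribution \<phi>) s)))"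
    unfolding gaussian_modulation by (simp add: window_def mult.assoc)
  finally show ?thesis by (simp add: pairing_def)
qed

text \<open>Fubini in x and \<xi>: the polynomial growth of the kernel in x is absorbed by \<phi>,
  and on \<open>A\<close> it decays like \<open>weight\<close> in \<xi>.\<close>

lemma cone_part_represents:
  assumes A [measurable]: "A \<in> sets borel" and S: "open S" "y \<in> S"
    and AS: "\<And>y \<xi>. y \<in> S \<Longrightarrow> \<xi> \<in> A \<Longrightarrow> 0 \<le> y \<bullet> \<xi>"
  shows "represents (\<lambda>x. cone_part A (complex_vec x y)) (boundary_functional A y)"
  unfolding represents_def
proof
  fix \<phi> :: "real^'n \<Rightarrow> complex" assume \<phi>: "\<phi> \<in> schwartz_space"
  have [measurable]: "\<phi> \<in> borel_measurable borel" by (rule schwartz_measurable[OF \<phi>])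
  obtain \<rho> where \<rho>: "0 < \<rho>" and dec: "\<exists>c\<ge>0. \<forall>\<xi>\<in>A. \<forall>z. norm (im_vec z - y) \<le> \<rho> \<longrightarrow>
      cmod (kernel \<alpha>0 z \<xi>) \<le> c * (1 + norm (re_vec z)) ^ L * weight \<xi>"
    using kernel_decay[OF S AS] by blast
  then obtain c where c: "0 \<le> c" "\<And>\<xi> z. \<xi> \<in> A \<Longrightarrow> norm (im_vec z - y) \<le> \<rho> \<Longrightarrow>
      cmod (kernel \<alpha>0 z \<xi>) \<le> c * (1 + norm (re_vec z)) ^ L * weight \<xi>" by blast
  let ?P = "\<lambda>\<xi> x. indicator A \<xi> *\<^sub>R (kernel \<alpha>0 (complex_vec x y) \<xi> * \<phi> x)"
  have [measurable]: "(\<lambda>(\<xi>, x). kernel \<alpha>0 (complex_vec x y) \<xi>) \<in> borel_measurable (lborel \<Otimes>\<^sub>M lborel)"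
    by (rule kernel_measurable_pair)
  have Pm: "case_prod ?P \<in> borel_measurable (lborel \<Otimes>\<^sub>M lborel)"
    by measurable
  have iw: "integrable (lborel \<Otimes>\<^sub>M lborel) (\<lambda>(\<xi>::real^'n, x). (c * weight \<xi>) * ((1 + norm x) ^ L * cmod (\<phi> x)))"
  proof (rule lborel_pair.Fubini_integrable)
    have i: "integrable lborel (\<lambda>x. (1 + norm x) ^ L * cmod (\<phi> x))" by (rule rapid_integrable[OF rapid_schwartz[OF \<phi>]])
    show "AE \<xi>::real^'n in lborel. integrable lborel (\<lambda>x. case (\<xi>, x) of (\<xi>, x) \<Rightarrow> (c * weight \<xi>) * ((1 + norm x) ^ L * cmod (\<phi> x)))"
      using i by simp
    have n: "(LINT x|lborel. norm (case (\<xi>, x) of (\<xi>, x) \<Rightarrow> (c * weight \<xi>) * ((1 + norm x) ^ L * cmod (\<phi> x))))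
        = (c * weight \<xi>) * (LINT x|lborel. (1 + norm x) ^ L * cmod (\<phi> x))" for \<xi> :: "real^'n"
    proof -
      have "norm (case (\<xi>, x) of (\<xi>, x) \<Rightarrow> (c * weight \<xi>) * ((1 + norm x) ^ L * cmod (\<phi> x)))
          = (c * weight \<xi>) * ((1 + norm x) ^ L * cmod (\<phi> x))" for x
        using c(1) weight_pos[of \<xi>] by simp
      then show ?thesis by (simp only: integral_mult_right_zero)
    qed
    show "integrable lborel (\<lambda>\<xi>::real^'n. LINT x|lborel. norm (case (\<xi>, x) of (\<xi>, x) \<Rightarrow> (c * weight \<xi>) * ((1 + norm x) ^ L * cmod (\<phi> x))))"
      unfolding n by (intro integrable_mult_left integrable_mult_right integrable_weight)
  qed measurable
  have P: "integrable (lborel \<Otimes>\<^sub>M lborel) (case_prod ?P)"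
  proof (rule Bochner_Integration.integrable_bound[OF iw Pm])
    have "norm (?P \<xi> x) \<le> norm ((c * weight \<xi>) * ((1 + norm x) ^ L * cmod (\<phi> x)))" for \<xi> x
    proof (cases "\<xi> \<in> A")
      case True
      have "cmod (kernel \<alpha>0 (complex_vec x y) \<xi>) * cmod (\<phi> x) \<le> (c * (1 + norm x) ^ L * weight \<xi>) * cmod (\<phi> x)"
        using c(2)[OF True, of "complex_vec x y"] \<rho> by (intro mult_right_mono) auto
      also have "\<dots> = (c * weight \<xi>) * ((1 + norm x) ^ L * cmod (\<phi> x))"
        by (simp only: mult_ac)
      also have "\<dots> \<le> norm ((c * weight \<xi>) * ((1 + norm x) ^ L * cmod (\<phi> x)))"
        unfolding real_norm_def by (rule abs_ge_self)
      finally show ?thesis using True by (simp add: norm_mult)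
    qed simp
    then show "AE p in lborel \<Otimes>\<^sub>M lborel. norm (case_prod ?P p) \<le> norm (case p of (\<xi>, x) \<Rightarrow> (c * weight \<xi>) * ((1 + norm x) ^ L * cmod (\<phi> x)))"
      by (auto simp: case_prod_beta)
  qed
  have inner: "(LINT \<xi>|lborel. ?P \<xi> x) = (LINT \<xi>|lborel. indicator A \<xi> *\<^sub>R kernel \<alpha>0 (complex_vec x y) \<xi>) * \<phi> x" for x
  proof -
    have "(\<lambda>\<xi>. ?P \<xi> x) = (\<lambda>\<xi>. (indicator A \<xi> *\<^sub>R kernel \<alpha>0 (complex_vec x y) \<xi>) * \<phi> x)"
      by (simp only: mult_scaleR_left)
    then show ?thesis by (simp only: integral_mult_left_zero)
  qed
  have h: "cone_part A (complex_vec x y) * \<phi> x = inversion_const * (LINT \<xi>|lborel. ?P \<xi> x)" for x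
    unfolding inner cone_part_def by (rule mult.assoc)
  have "integrable lborel (\<lambda>x. LINT \<xi>|lborel. ?P \<xi> x)"
    by (rule lborel_pair.integrable_snd[OF P])
  then have i: "integrable lborel (\<lambda>x. cone_part A (complex_vec x y) * \<phi> x)"
    unfolding h by (rule integrable_mult_right)
  have "(LINT x|lborel. cone_part A (complex_vec x y) * \<phi> x) = inversion_const * (LINT x|lborel. LINT \<xi>|lborel. ?P \<xi> x)"
    unfolding h by (rule integral_mult_right_zero)
  also have "(LINT x|lborel. LINT \<xi>|lborel. ?P \<xi> x) = (LINT \<xi>|lborel. LINT x|lborel. ?P \<xi> x)"
    by (rule lborel_pair.Fubini_integral[OF P])
  also have "\<dots> = (LINT \<xi>|lborel. indicator A \<xi> *\<^sub>R (complex_of_real (exp (- (y \<bullet> \<xi>))) * pairing (window y) (regular_distribution \<phi>) \<xi>))"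
    by (simp add: kernel_pairing[OF \<phi>])
  finally have "boundary_functional A y (regular_distribution \<phi>) = (LINT x|lborel. cone_part A (complex_vec x y) * \<phi> x)"
    using DE_regular[OF \<phi>] by (simp add: boundary_functional_def)
  with i show "integrable lborel (\<lambda>x. cone_part A (complex_vec x y) * \<phi> x) \<and>
      boundary_functional A y (regular_distribution \<phi>) = (LINT x|lborel. cone_part A (complex_vec x y) * \<phi> x)" by blast
qed

lemma kernel_derivative:
  "((\<lambda>z. kernel \<alpha> z \<xi>) has_derivative gform (\<lambda>k. kernel (incr k \<alpha>) z \<xi>)) (at z)"
proof -
  let ?c = "complex_of_real (exp (- (\<xi> \<bullet> \<xi>) / 2))"
  have "((\<lambda>z. z + complex_vec 0 (- \<xi>)) has_derivative (\<lambda>v. v)) (at z)"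
    by (auto intro!: derivative_eq_intros)
  from has_derivative_mult_right[OF has_derivative_compose[OF this sf.transform_derivative], of ?c \<alpha>]
  show ?thesis
    unfolding kernel_def by (rule has_derivative_eq_rhs) (simp add: gform_def fun_eq_iff sum_distrib_left mult_ac)
qed

text \<open>Differentiation under the integral: on a ball around z the second derivatives of the
  kernel are dominated by a multiple of \<open>weight\<close>, so the integrated Taylor remainder is
  quadratic.\<close>

lemma cone_part_holomorphic:
  assumes A [measurable]: "A \<in> sets borel" and S: "open S"
    and AS: "\<And>y \<xi>. y \<in> S \<Longrightarrow> \<xi> \<in> A \<Longrightarrow> 0 \<le> y \<bullet> \<xi>"
  shows "holomorphic_in (cone_part A) (tube S)"
  unfolding holomorphic_in_def
proof
  fix z assume "z \<in> tube S"
  then obtain x y where z: "z = complex_vec x y" and y: "y \<in> S" by (auto simp: tube_def)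
  let ?n = "real CARD('n)" and ?W = "LINT \<xi>|lborel. weight (\<xi>::real^'n)"
  obtain \<rho> where \<rho>: "0 < \<rho>" "\<rho> \<le> 1" and dec: "\<And>\<alpha>. \<exists>c\<ge>0. \<forall>\<xi>\<in>A. \<forall>z. norm (im_vec z - y) \<le> \<rho> \<longrightarrow>
      cmod (kernel \<alpha> z \<xi>) \<le> c * (1 + norm (re_vec z)) ^ L * weight \<xi>"
    using kernel_decay[OF S y AS] by blast
  have dec2: "\<exists>b\<ge>0. \<forall>\<xi>\<in>A. \<forall>w. norm w \<le> \<rho> \<longrightarrow> cmod (kernel \<alpha> (z + w) \<xi>) \<le> b * weight \<xi>" for \<alpha>
  proof -
    obtain c where c: "0 \<le> c" "\<And>\<xi> z. \<xi> \<in> A \<Longrightarrow> norm (im_vec z - y) \<le> \<rho> \<Longrightarrow>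
      cmod (kernel \<alpha> z \<xi>) \<le> c * (1 + norm (re_vec z)) ^ L * weight \<xi>" using dec by blast
    have "cmod (kernel \<alpha> (z + w) \<xi>) \<le> (c * (2 + norm x) ^ L) * weight \<xi>" if "\<xi> \<in> A" "norm w \<le> \<rho>" for \<xi> w
    proof -
      have "norm (im_vec (z + w) - y) \<le> \<rho>" using norm_re_im_le(2)[of w] that(2) by (simp add: z)
      then have "cmod (kernel \<alpha> (z + w) \<xi>) \<le> c * (1 + norm (re_vec (z + w))) ^ L * weight \<xi>" using that(1) by (intro c(2))
      moreover have "norm (re_vec (z + w)) \<le> norm x + 1"
        using norm_triangle_ineq[of x "re_vec w"] norm_re_im_le(1)[of w] that(2) \<rho>(2) by (simp add: z)
      then have "c * (1 + norm (re_vec (z + w))) ^ L * weight \<xi> \<le> c * (2 + norm x) ^ L * weight \<xi>"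
        using c(1) weight_pos[of \<xi>] by (intro mult_right_mono mult_left_mono power_mono) auto
      ultimately show ?thesis by linarith
    qed
    then show ?thesis using c(1) by (intro exI[of _ "c * (2 + norm x) ^ L"]) auto
  qed
  have "\<forall>k l. \<exists>b\<ge>0. \<forall>\<xi>\<in>A. \<forall>w. norm w \<le> \<rho> \<longrightarrow> cmod (kernel (incr l (incr k \<alpha>0)) (z + w) \<xi>) \<le> b * weight \<xi>"
    using dec2 by blast
  then obtain b where b: "\<And>k l. 0 \<le> b k l" "\<And>k l \<xi> w. \<xi> \<in> A \<Longrightarrow> norm w \<le> \<rho> \<Longrightarrow> cmod (kernel (incr l (incr k \<alpha>0)) (z + w) \<xi>) \<le> b k l * weight \<xi>"
    by metis
  define B where "B = (\<Sum>k\<in>UNIV. \<Sum>l\<in>UNIV. b k l)"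
  have bB: "b k l \<le> B" for k l
  proof -
    have "b k l \<le> (\<Sum>l\<in>UNIV. b k l)" by (rule member_le_sum) (auto simp: b(1))
    also have "\<dots> \<le> B" unfolding B_def by (rule member_le_sum) (auto simp: b(1) sum_nonneg)
    finally show ?thesis .
  qed
  have B0: "0 \<le> B" unfolding B_def by (intro sum_nonneg b(1))
  have int: "integrable lborel (\<lambda>\<xi>. indicator A \<xi> *\<^sub>R kernel \<alpha> (z + w) \<xi>)" if "norm w \<le> \<rho>" for \<alpha> w
  proof -
    obtain b' where b': "0 \<le> b'" "\<forall>\<xi>\<in>A. \<forall>w. norm w \<le> \<rho> \<longrightarrow> cmod (kernel \<alpha> (z + w) \<xi>) \<le> b' * weight \<xi>"
      using dec2[of \<alpha>] by (elim exE conjE)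
    show ?thesis
      by (rule weighted_integral(1)[OF A kernel_measurable b'(1)]) (use b'(2) that in simp)
  qed
  have int0: "integrable lborel (\<lambda>\<xi>. indicator A \<xi> *\<^sub>R kernel \<alpha> z \<xi>)" for \<alpha>
    using int[of 0 \<alpha>] \<rho>(1) by simp
  let ?I = "\<lambda>k. LINT \<xi>|lborel. indicator A \<xi> *\<^sub>R kernel (incr k \<alpha>0) z \<xi>"
  let ?D = "gform (\<lambda>k. inversion_const * ?I k)"
  have rem: "cmod (kernel \<alpha>0 (z + w) \<xi> - kernel \<alpha>0 z \<xi> - gform (\<lambda>k. kernel (incr k \<alpha>0) z \<xi>) w) \<le> (?n * ?n * B * (norm w * norm w)) * weight \<xi>"
    if \<xi>: "\<xi> \<in> A" and w: "norm w \<le> \<rho>" for \<xi> w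
  proof -
    have sw: "norm (t *\<^sub>R w) \<le> norm w" if "0 \<le> t" "t \<le> 1" for t
      using that by (simp add: mult_left_le_one_le)
    have 1: "cmod (kernel (incr k \<alpha>0) (z + t *\<^sub>R w) \<xi> - kernel (incr k \<alpha>0) z \<xi>) \<le> ?n * (B * weight \<xi>) * norm w"
      if t: "0 \<le> t" "t \<le> 1" for t k
    proof -
      have "cmod (kernel (incr k \<alpha>0) (z + t *\<^sub>R w) \<xi> - kernel (incr k \<alpha>0) z \<xi> - 0) \<le> ?n * (B * weight \<xi>) * norm (t *\<^sub>R w)"
      proof (rule derivative_line_bound[OF kernel_derivative])
        fix q :: real assume q: "0 \<le> q" "q \<le> 1"
        have "norm (q *\<^sub>R t *\<^sub>R w) \<le> norm (t *\<^sub>R w)"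
          unfolding norm_scaleR[of q "t *\<^sub>R w"] using q by (intro mult_left_le_one_le) auto
        then have "norm (q *\<^sub>R t *\<^sub>R w) \<le> \<rho>" using sw[OF t] w by linarith
        then have "cmod (kernel (incr l (incr k \<alpha>0)) (z + q *\<^sub>R t *\<^sub>R w) \<xi>) \<le> B * weight \<xi>" for l
          by (rule order_trans[OF b(2)[OF \<xi>] mult_right_mono[OF bB less_imp_le[OF weight_pos]]])
        then show "cmod (gform (\<lambda>l. kernel (incr l (incr k \<alpha>0)) (z + q *\<^sub>R t *\<^sub>R w) \<xi>) (t *\<^sub>R w) - 0) \<le> ?n * (B * weight \<xi>) * norm (t *\<^sub>R w)"
          unfolding diff_zero by (rule norm_gform_le)
      qed
      also have "\<dots> \<le> ?n * (B * weight \<xi>) * norm w"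
        using sw[OF t] B0 weight_pos[of \<xi>] by (intro mult_left_mono) auto
      finally show ?thesis by simp
    qed
    have "cmod (kernel \<alpha>0 (z + w) \<xi> - kernel \<alpha>0 z \<xi> - gform (\<lambda>k. kernel (incr k \<alpha>0) z \<xi>) w) \<le> ?n * (?n * (B * weight \<xi>) * norm w) * norm w"
      by (rule derivative_line_bound[OF kernel_derivative]) (unfold gform_diff[symmetric], intro norm_gform_le 1)
    then show ?thesis by (simp only: mult_ac)
  qed
  have "(cone_part A has_derivative ?D) (at z)"
  proof (rule has_derivative_quadratic[where r=\<rho> and K="cmod inversion_const * (?n * ?n * B * ?W)"])
    fix w :: "complex^'n" assume w: "norm w \<le> \<rho>"
    let ?r = "\<lambda>\<xi>. kernel \<alpha>0 (z + w) \<xi> - kernel \<alpha>0 z \<xi> - gform (\<lambda>k. kernel (incr k \<alpha>0) z \<xi>) w"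
    have gs: "indicator A \<xi> *\<^sub>R gform (\<lambda>k. kernel (incr k \<alpha>0) z \<xi>) w = (\<Sum>k\<in>UNIV. w $ k * (indicator A \<xi> *\<^sub>R kernel (incr k \<alpha>0) z \<xi>))" for \<xi>
      by (simp add: gform_def scaleR_sum_right)
    have ig: "integrable lborel (\<lambda>\<xi>. indicator A \<xi> *\<^sub>R gform (\<lambda>k. kernel (incr k \<alpha>0) z \<xi>) w)"
      unfolding gs by (intro Bochner_Integration.integrable_sum integrable_mult_right int0)
    have eg: "(LINT \<xi>|lborel. indicator A \<xi> *\<^sub>R gform (\<lambda>k. kernel (incr k \<alpha>0) z \<xi>) w) = gform ?I w"
    proof -
      have "(LINT \<xi>|lborel. (\<Sum>k\<in>UNIV. w $ k * (indicator A \<xi> *\<^sub>R kernel (incr k \<alpha>0) z \<xi>)))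
          = (\<Sum>k\<in>UNIV. (LINT \<xi>|lborel. w $ k * (indicator A \<xi> *\<^sub>R kernel (incr k \<alpha>0) z \<xi>)))"
        by (intro Bochner_Integration.integral_sum integrable_mult_right int0)
      then show ?thesis unfolding gs unfolding gform_def integral_mult_right_zero .
    qed
    have rm: "?r \<in> borel_measurable borel"
      using kernel_measurable unfolding gform_def by (intro borel_measurable_diff borel_measurable_sum borel_measurable_times) auto
    have "(LINT \<xi>|lborel. indicator A \<xi> *\<^sub>R ?r \<xi>) = (LINT \<xi>|lborel. indicator A \<xi> *\<^sub>R kernel \<alpha>0 (z + w) \<xi>)
        - (LINT \<xi>|lborel. indicator A \<xi> *\<^sub>R kernel \<alpha>0 z \<xi>) - gform ?I w"
      unfolding scaleR_diff_right eg[symmetric] using int[OF w] int0 ig by simp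
    then have "cone_part A (z + w) - cone_part A z - ?D w = inversion_const * (LINT \<xi>|lborel. indicator A \<xi> *\<^sub>R ?r \<xi>)"
      by (simp add: cone_part_def gform_def right_diff_distrib sum_distrib_left mult_ac)
    moreover have le: "cmod (LINT \<xi>|lborel. indicator A \<xi> *\<^sub>R ?r \<xi>) \<le> (?n * ?n * B * (norm w * norm w)) * ?W"
      by (rule weighted_integral(2)[OF A rm]) (use B0 rem w in auto)
    ultimately show "cmod (cone_part A (z + w) - cone_part A z - ?D w) \<le> cmod inversion_const * (?n * ?n * B * ?W) * (norm w * norm w)"
      using mult_left_mono[OF le norm_ge_zero[of inversion_const]] by (simp add: norm_mult mult_ac)
  qed (use \<rho> in \<open>simp_all add: bounded_linear_gform\<close>)
  moreover have "?D (c *s v) = c * ?D v" for c v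
    by (simp add: gform_def sum_distrib_left mult.assoc)
  \<comment> \<open>The form \<open>gform\<close> is linear over the complex numbers, and this is
    what separates holomorphy from real differentiability.\<close>
  ultimately show "\<exists>D. (cone_part A has_derivative D) (at z) \<and> (\<forall>c v. D (c *s v) = c * D v)" by blast
qed

lemma boundary_functional_sum:
  assumes J: "finite J" and A: "\<And>j. j \<in> J \<Longrightarrow> A j \<in> sets borel"
    and partition: "\<And>\<xi>. (\<Sum>j\<in>J. indicator (A j) \<xi>) = (1::real)"
  shows "f = (\<lambda>u. \<Sum>j\<in>J. boundary_functional (A j) 0 u)"
proof
  fix u
  show "f u = (\<Sum>j\<in>J. boundary_functional (A j) 0 u)"
  proof (cases "u \<in> DE_space E")
    \<comment> \<open>Outside \<open>DE_space E\<close> both sides are 0 by convention.\<close>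
    case False
    then show ?thesis
      using continuous_dual_outside[OF f_dual[unfolded DE_dual_def]] by (simp add: boundary_functional_def)
  next
    case True
    let ?g = "\<lambda>j \<xi>. indicator (A j) \<xi> *\<^sub>R pairing (window 0) u \<xi>"
    have i: "integrable lborel (?g j)" if "j \<in> J" for j
      using boundary_functional_integrand[OF A[OF that], of 0] True by auto
    have "(\<Sum>j\<in>J. boundary_functional (A j) 0 u) = inversion_const * (\<Sum>j\<in>J. (LINT \<xi>|lborel. ?g j \<xi>))"
      using True by (simp add: boundary_functional_def sum_distrib_left)
    also have "(\<Sum>j\<in>J. (LINT \<xi>|lborel. ?g j \<xi>)) = (LINT \<xi>|lborel. (\<Sum>j\<in>J. ?g j \<xi>))"
      by (rule Bochner_Integration.integral_sum[symmetric]) (rule i)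
    also have "\<dots> = (LINT \<xi>|lborel. pairing (window 0) u \<xi>)"
      by (simp add: partition flip: scaleR_sum_left)
    also have "\<dots> = complex_of_real ((2 * pi) ^ CARD('n)) * (window 0 0 * f u)"
      by (rule pairing_inversion[OF window_schwartz True])
    also have "window 0 0 = 1"
      by (simp add: window_def gz_def gau_zero)
    finally show ?thesis by (simp add: inversion_const_def flip: of_real_mult)
  qed
qed

end

text \<open>An intersection of closed half spaces; closedness makes the pieces of the partition
  Borel sets.\<close>

lemma closed_dual_cone: "closed (dual_cone C)"
proof -
  have "dual_cone C = (\<Inter>y\<in>C. {\<xi>. 0 \<le> y \<bullet> \<xi>})" by (auto simp: dual_cone_def)
  then show ?thesis by (simp add: closed_INT closed_halfspace_ge)
qed

theorem theorem4p2:
  fixes E :: "((real^'n::finite \<Rightarrow> complex) \<Rightarrow> complex) set"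
    and nE :: "((real^'n \<Rightarrow> complex) \<Rightarrow> complex) \<Rightarrow> real"
    and m :: nat
    and C :: "nat \<Rightarrow> (real^'n) set"
    and f :: "((real^'n \<Rightarrow> complex) \<Rightarrow> complex) \<Rightarrow> complex"
  assumes "translation_invariant_banach_space E nE"
    and "\<And>j. j \<in> {1..m} \<Longrightarrow> open_convex_cone (C j)"
    and "(\<Union>j\<in>{1..m}. dual_cone (C j)) = UNIV"
    and "f \<in> DE_dual E nE"
  shows "\<exists>F L. (\<forall>j\<in>{1..m}. holomorphic_in (F j) (tube (C j)) \<and>
                            boundary_value E nE (C j) (F j) (L j)) \<and>
               f = (\<lambda>u. \<Sum>j=1..m. L j u)"
proof -
  interpret translation_invariant_banach_space E nE by (rule assms(1))
  obtain M \<kappa> where M: "0 < M" "\<And>h u. u \<in> E \<Longrightarrow> nE (dist_translate h u) \<le> M * (1 + norm h) ^ \<kappa> * nE u"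
    using translation_bound by blast
  obtain N B where B: "0 \<le> B" "\<And>u. u \<in> DE_space E \<Longrightarrow> cmod (f u) \<le> B * de_norm nE N u"
    using DE_dual_bound[OF assms(4)] by blast
  interpret de_functional E nE f M B \<kappa> N
    by standard (use assms(4) M B in auto)
  obtain L K0 where "schwartz_functional (\<lambda>\<phi>. f (regular_distribution \<phi>)) L K0"
    using regular_functional by blast
  then interpret boundary_setup E nE f M B \<kappa> N L K0
    by (intro boundary_setup.intro de_functional_axioms)
  \<comment> \<open>Removing the earlier dual cones makes the cover disjoint and keeps each piece
    inside its own dual cone, where the damping exponent has the right sign.\<close>
  define A where "A j = dual_cone (C j) - (\<Union>i\<in>{1..<j}. dual_cone (C i))" for j
  have A: "A j \<in> sets borel" for j
    unfolding A_def by (intro sets.Diff sets.finite_UN borel_closed closed_dual_cone) simp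
  have AC: "0 \<le> y \<bullet> \<xi>" if "y \<in> C j" "\<xi> \<in> A j" for j y \<xi>
    using that by (simp add: A_def dual_cone_def)
  have partition: "(\<Sum>j\<in>{1..m}. indicator (A j) \<xi>) = (1::real)" for \<xi>
  proof -
    \<comment> \<open>The one piece containing \<xi> belongs to the first dual cone that contains
      \<xi>.\<close>
    define j0 where "j0 = (LEAST j. j \<in> {1..m} \<and> \<xi> \<in> dual_cone (C j))"
    have ex: "\<exists>j. j \<in> {1..m} \<and> \<xi> \<in> dual_cone (C j)" using assms(3) by blast
    have j0: "j0 \<in> {1..m}" "\<xi> \<in> dual_cone (C j0)"
      using LeastI_ex[OF ex] by (auto simp: j0_def)
    have min: "j0 \<le> i" if "i \<in> {1..m}" "\<xi> \<in> dual_cone (C i)" for i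
      unfolding j0_def using that by (intro Least_le) auto
    have "\<xi> \<in> A j \<longleftrightarrow> j = j0" if "j \<in> {1..m}" for j
    proof
      assume "\<xi> \<in> A j"
      then have d: "\<xi> \<in> dual_cone (C j)" and n: "\<And>i. 1 \<le> i \<Longrightarrow> i < j \<Longrightarrow> \<xi> \<notin> dual_cone (C i)"
        by (auto simp: A_def)
      have "\<not> j0 < j" using n[of j0] j0 by auto
      then show "j = j0" using min[OF that d] by simp
    next
      assume "j = j0"
      then show "\<xi> \<in> A j"
        using j0 min that by (fastforce simp: A_def)
    qed
    then have "(\<Sum>j\<in>{1..m}. indicator (A j) \<xi>) = (\<Sum>j\<in>{1..m}. if j = j0 then 1 else (0::real))"
      by (intro sum.cong) (auto simp: indicator_def)
    then show ?thesis using j0(1) by simp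
  qed
  show ?thesis
  proof (intro exI conjI ballI)
    fix j assume j: "j \<in> {1..m}"
    have op: "open (C j)" using assms(2)[OF j] by (simp add: open_convex_cone_def)
    show "holomorphic_in (cone_part (A j)) (tube (C j))"
      by (rule cone_part_holomorphic[OF A op AC])
    show "boundary_value E nE (C j) (cone_part (A j)) (boundary_functional (A j) 0)"
      unfolding boundary_value_def
    proof (intro exI[of _ "boundary_functional (A j)"] conjI ballI)
      fix y assume y: "y \<in> C j"
      show "boundary_functional (A j) y \<in> DE_dual E nE" by (rule boundary_functional_in_dual[OF A AC[OF y]])
      show "represents (\<lambda>x. cone_part (A j) (complex_vec x y)) (boundary_functional (A j) y)"
        by (rule cone_part_represents[OF A op y AC])
    next
      show "limitin (DE_dual_topology E nE) (boundary_functional (A j)) (boundary_functional (A j) 0) (at 0 within C j)"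
        by (rule boundary_functional_limit[OF A AC])
    qed
  next
    show "f = (\<lambda>u. \<Sum>j=1..m. boundary_functional (A j) 0 u)"
      by (rule boundary_functional_sum[OF _ A partition]) simp
  qed
qed

end
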